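(* The quantum enveloping algebra $U_q(L)$ of a complex semisimple Lie algebra $L$ is isomorphic, as a Hopf algebra, to a quotient (by a Hopf ideal) of a semi-path Hopf algebra over $\mathbb C$.
   Context: Let $k=\mathbb C$, $0\neq q\in\mathbb C$ not a root of unity, and let $L$ be a complex semisimple Lie algebra with Cartan matrix $A=(a_{ij})_{n\times n}$ and $d_i\in\{1,2,3\}$ such that $d_ia_{ij}=d_ja_{ji}$. $U_q(L)$ is the algebra generated by $K_i^{\pm1},E_i,F_i$ ($1\le i\le n$) with relations $K_iK_i^{-1}=K_i^{-1}K_i=1$, $K_iK_j=K_jK_i$, $K_iE_jK_i^{-1}=q^{d_ia_{ij}}E_j$, $K_iF_jK_i^{-1}=q^{-d_ia_{ij}}F_j$, $E_iF_j-F_jE_i=\delta_{ij}\frac{K_i^2-K_i^{-2}}{q^{2d_i}-q^{-2d_i}}$, and for $i\ne j$ $$\sum_{m=0}^{1-a_{ij}}(-1)^m\left[\begin{array}{c} 1-a_{ij} \\ m \end{array}\right]_{q^{2d_i}}E_i^{1-a_{ij}-m}E_jE_i^m=0,$$ and the same with $F$ in place of $E$; here $[n]_p=\frac{p^n-p^{-n}}{p-p^{-1}}$, $[n]_p!=\prod_{i=1}^n[i]_p$, $\left[\begin{array}{c} n \\ m \end{array}\right]_p=\frac{[n]_p!}{[m]_p![n-m]_p!}$. Its Hopf structure is $\Delta(K_i)=K_i\otimes K_i$, $\Delta(E_i)=E_i\otimes K_i^{-1}+K_i\otimes E_i$, $\Delta(F_i)=F_i\otimes K_i^{-1}+K_i\otimes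 F_i$, $\varepsilon(K_i)=1$, $\varepsilon(E_i)=\varepsilon(F_i)=0$, $S(K_i)=K_i^{-1}$, $S(E_i)=-q^{-2d_i}E_i$, $S(F_i)=-q^{2d_i}F_i$. Semi-path Hopf algebra: let $G$ be a group and $r=\sum_Cr_CC$ a formal sum of conjugacy classes of $G$ with cardinal coefficients. The Hopf quiver $(Q,G,r)$ has vertex set $G$ and exactly $r_C$ arrows from $x$ to $y$ whenever $x^{-1}y\in C$. The arrow comodule $kQ_1^c$ is the span $kQ_1$ of the arrows with coactions $\delta^-(a)=t(a)\otimes a$, $\delta^+(a)=a\otimes s(a)$ ($s,t$ start and end vertex). Given left and right $kG$-actions making $kQ_1^c$ a $kG$-Hopf bimodule (coactions are bimodule maps), the semi-path Hopf algebra $kQ^s$ is the tensor algebra $T_{kG}(kQ_1^c)$ with the graded Hopf algebra structure whose comultiplication extends $\Delta_{kG}$ on $kG$ and $\delta^-+\delta^+$ on $kQ_1$. *)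

theory Defs
  imports
    "HOL-Library.Poly_Mapping"
    "HOL-Algebra.Algebra"
    "HOL-Algebra.Algebraic_Closure_Type"
    "Graph_Theory.Digraph"
begin

section \<open>Complex vector spaces and algebras with carriers\<close>

text \<open>
  Vector spaces and algebras over the complex numbers are \<open>(complex, 'a) module\<close> records. For a
  mere vector space the ring fields \<open>mult\<close> and \<open>one\<close> are irrelevant.
\<close>

abbreviation CC :: "complex ring" where
  "CC \<equiv> ring_of_type_algebra"

definition complex_space :: "(complex, complex) module" where
  "complex_space = ring.extend CC (module.fields (*))"

definition complex_algebra :: "(complex, 'a, 'm) module_scheme \<Rightarrow> bool" where
  "complex_algebra A \<longleftrightarrow> ring A \<and> module CC A \<and>
     (\<forall>c. \<forall>x\<in>carrier A. \<forall>y\<in>carrier A.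
        (c \<odot>\<^bsub>A\<^esub> x) \<otimes>\<^bsub>A\<^esub> y = c \<odot>\<^bsub>A\<^esub> (x \<otimes>\<^bsub>A\<^esub> y) \<and>
        x \<otimes>\<^bsub>A\<^esub> (c \<odot>\<^bsub>A\<^esub> y) = c \<odot>\<^bsub>A\<^esub> (x \<otimes>\<^bsub>A\<^esub> y))"

definition linear_map ::
  "(complex, 'a, 'm) module_scheme \<Rightarrow> (complex, 'b, 'n) module_scheme \<Rightarrow> ('a \<Rightarrow> 'b) \<Rightarrow> bool" where
  "linear_map V W f \<longleftrightarrow> f ` carrier V \<subseteq> carrier W \<and>
     (\<forall>x\<in>carrier V. \<forall>y\<in>carrier V. f (x \<oplus>\<^bsub>V\<^esub> y) = f x \<oplus>\<^bsub>W\<^esub> f y) \<and>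
     (\<forall>c. \<forall>x\<in>carrier V. f (c \<odot>\<^bsub>V\<^esub> x) = c \<odot>\<^bsub>W\<^esub> f x)"

definition bilinear_map ::
  "(complex, 'a, 'm) module_scheme \<Rightarrow> (complex, 'b, 'n) module_scheme \<Rightarrow>
   (complex, 'c, 'p) module_scheme \<Rightarrow> ('a \<Rightarrow> 'b \<Rightarrow> 'c) \<Rightarrow> bool" where
  "bilinear_map V W Z f \<longleftrightarrow>
     (\<forall>v\<in>carrier V. linear_map W Z (f v)) \<and> (\<forall>w\<in>carrier W. linear_map V Z (\<lambda>v. f v w))"

definition algebra_map ::
  "(complex, 'a, 'm) module_scheme \<Rightarrow> (complex, 'b, 'n) module_scheme \<Rightarrow> ('a \<Rightarrow> 'b) \<Rightarrow> bool" where
  "algebra_map A B f \<longleftrightarrow> linear_map A B f \<and> f \<in> ring_hom A B"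

definition linear_span :: "(complex, 'a, 'm) module_scheme \<Rightarrow> 'a set \<Rightarrow> 'a set" where
  "linear_span V S = \<Inter> {W. submodule W CC V \<and> S \<subseteq> W}"

text \<open>
  The quotient by a subspace \<open>W\<close>; it is an algebra if \<open>V\<close> is one and \<open>W\<close> is a two-sided ideal.
\<close>

definition quotient_space ::
  "(complex, 'a, 'm) module_scheme \<Rightarrow> 'a set \<Rightarrow> (complex, 'a set) module" where
  "quotient_space V W =
     ring.extend (V Quot W) (module.fields (\<lambda>c C. \<Union>x\<in>C. W +>\<^bsub>V\<^esub> (c \<odot>\<^bsub>V\<^esub> x)))"

definition free_space :: "'x set \<Rightarrow> (complex, 'x \<Rightarrow>\<^sub>0 complex) module" where
  "free_space S =
     \<lparr>carrier = {p. Poly_Mapping.keys p \<subseteq> S}, monoid.mult = (\<lambda>_ _. undefined), one = undefined,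
      ring.zero = 0, ring.add = (+), module.smult = (\<lambda>c. Poly_Mapping.map (\<lambda>z. c * z))\<rparr>"

definition monoid_algebra :: "('x, 'm) monoid_scheme \<Rightarrow> (complex, 'x \<Rightarrow>\<^sub>0 complex) module" where
  "monoid_algebra M = (free_space (carrier M))
     \<lparr>monoid.mult := (\<lambda>p q. \<Sum>x\<in>Poly_Mapping.keys p. \<Sum>y\<in>Poly_Mapping.keys q.
        Poly_Mapping.single (x \<otimes>\<^bsub>M\<^esub> y) (Poly_Mapping.lookup p x * Poly_Mapping.lookup q y)),
      one := Poly_Mapping.single \<one>\<^bsub>M\<^esub> 1\<rparr>"

abbreviation basis_vector :: "'x \<Rightarrow> 'x \<Rightarrow>\<^sub>0 complex" where
  "basis_vector x \<equiv> Poly_Mapping.single x 1"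

definition linear_extension ::
  "(complex, 'b, 'm) module_scheme \<Rightarrow> ('x \<Rightarrow> 'b) \<Rightarrow> ('x \<Rightarrow>\<^sub>0 complex) \<Rightarrow> 'b" where
  "linear_extension V f p = (\<Oplus>\<^bsub>V\<^esub>x\<in>Poly_Mapping.keys p. Poly_Mapping.lookup p x \<odot>\<^bsub>V\<^esub> f x)"


section \<open>Tensor products over the complex numbers\<close>

definition tensor_relations ::
  "(complex, 'a, 'm) module_scheme \<Rightarrow> (complex, 'b, 'n) module_scheme \<Rightarrow>
   ('a \<times> 'b \<Rightarrow>\<^sub>0 complex) set" where
  "tensor_relations V W =
     {basis_vector (v \<oplus>\<^bsub>V\<^esub> v', w) - basis_vector (v, w) - basis_vector (v', w) | v v' w.
        v \<in> carrier V \<and> v' \<in> carrier V \<and> w \<in> carrier W} \<union>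
     {basis_vector (v, w \<oplus>\<^bsub>W\<^esub> w') - basis_vector (v, w) - basis_vector (v, w') | v w w'.
        v \<in> carrier V \<and> w \<in> carrier W \<and> w' \<in> carrier W} \<union>
     {basis_vector (c \<odot>\<^bsub>V\<^esub> v, w) - Poly_Mapping.single (v, w) c | c v w.
        v \<in> carrier V \<and> w \<in> carrier W} \<union>
     {basis_vector (v, c \<odot>\<^bsub>W\<^esub> w) - Poly_Mapping.single (v, w) c | c v w.
        v \<in> carrier V \<and> w \<in> carrier W}"

text \<open>
  The free vector space on \<open>carrier V \<times> carrier W\<close> modulo the bilinearity relations. Using the monoid
  algebra of the product monoid gives, when \<open>V\<close> and \<open>W\<close> are algebras, the tensor product algebra
  with \<open>(v \<otimes> w) (v' \<otimes> w') = v v' \<otimes> w w'\<close>.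
\<close>

abbreviation tensor_kernel ::
  "(complex, 'a, 'm) module_scheme \<Rightarrow> (complex, 'b, 'n) module_scheme \<Rightarrow>
   ('a \<times> 'b \<Rightarrow>\<^sub>0 complex) set" where
  "tensor_kernel V W \<equiv> linear_span (monoid_algebra (V \<times>\<times> W)) (tensor_relations V W)"

definition tensor ::
  "(complex, 'a, 'm) module_scheme \<Rightarrow> (complex, 'b, 'n) module_scheme \<Rightarrow>
   (complex, ('a \<times> 'b \<Rightarrow>\<^sub>0 complex) set) module" where
  "tensor V W = quotient_space (monoid_algebra (V \<times>\<times> W)) (tensor_kernel V W)"

definition pure_tensor ::
  "(complex, 'a, 'm) module_scheme \<Rightarrow> (complex, 'b, 'n) module_scheme \<Rightarrow> 'a \<Rightarrow> 'b \<Rightarrow>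
   ('a \<times> 'b \<Rightarrow>\<^sub>0 complex) set" where
  "pure_tensor V W v w = tensor_kernel V W +>\<^bsub>monoid_algebra (V \<times>\<times> W)\<^esub> basis_vector (v, w)"

text \<open>
  The linear map \<open>V \<otimes> W \<rightarrow> Z\<close> induced by a bilinear map \<open>f\<close>. Tensors are cosets, and the value does
  not depend on the chosen representative.
\<close>

definition tensor_lift ::
  "(complex, 'c, 'p) module_scheme \<Rightarrow> ('a \<Rightarrow> 'b \<Rightarrow> 'c) \<Rightarrow> ('a \<times> 'b \<Rightarrow>\<^sub>0 complex) set \<Rightarrow> 'c" where
  "tensor_lift Z f t = linear_extension Z (\<lambda>(v, w). f v w) (SOME p. p \<in> t)"

text \<open>The map \<open>f \<otimes> g\<close> with values in \<open>V' \<otimes> W'\<close>.\<close>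

definition tensor_map ::
  "(complex, 'c, 'm) module_scheme \<Rightarrow> (complex, 'd, 'n) module_scheme \<Rightarrow>
   ('a \<Rightarrow> 'c) \<Rightarrow> ('b \<Rightarrow> 'd) \<Rightarrow>
   ('a \<times> 'b \<Rightarrow>\<^sub>0 complex) set \<Rightarrow> ('c \<times> 'd \<Rightarrow>\<^sub>0 complex) set" where
  "tensor_map V' W' f g =
     tensor_lift (tensor V' W') (\<lambda>v w. pure_tensor V' W' (f v) (g w))"

text \<open>The canonical map \<open>(U \<otimes> V) \<otimes> W \<rightarrow> U \<otimes> (V \<otimes> W)\<close>.\<close>

definition tensor_assoc ::
  "(complex, 'a, 'm) module_scheme \<Rightarrow> (complex, 'b, 'n) module_scheme \<Rightarrow>
   (complex, 'c, 'p) module_scheme \<Rightarrow>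
   (('a \<times> 'b \<Rightarrow>\<^sub>0 complex) set \<times> 'c \<Rightarrow>\<^sub>0 complex) set \<Rightarrow>
   ('a \<times> ('b \<times> 'c \<Rightarrow>\<^sub>0 complex) set \<Rightarrow>\<^sub>0 complex) set" where
  "tensor_assoc U V W =
     tensor_lift (tensor U (tensor V W))
       (\<lambda>t w. tensor_lift (tensor U (tensor V W))
          (\<lambda>u v. pure_tensor U (tensor V W) u (pure_tensor V W v w)) t)"

text \<open>The product \<open>(b \<otimes> c) \<cdot> (x \<otimes> y) = f b x \<otimes> g c y\<close> in \<open>V \<otimes> W\<close> for bilinear \<open>f\<close> and \<open>g\<close>.\<close>

definition tensor_product_action ::
  "(complex, 'v, 'm) module_scheme \<Rightarrow> (complex, 'w, 'n) module_scheme \<Rightarrow>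
   ('b \<Rightarrow> 'x \<Rightarrow> 'v) \<Rightarrow> ('c \<Rightarrow> 'y \<Rightarrow> 'w) \<Rightarrow>
   ('b \<times> 'c \<Rightarrow>\<^sub>0 complex) set \<Rightarrow> ('x \<times> 'y \<Rightarrow>\<^sub>0 complex) set \<Rightarrow>
   ('v \<times> 'w \<Rightarrow>\<^sub>0 complex) set" where
  "tensor_product_action V W f g s t =
     tensor_lift (tensor V W) (\<lambda>b c. tensor_map V W (f b) (g c) t) s"


section \<open>Hopf algebras\<close>

record 'a hopf = "(complex, 'a) module" +
  comult :: "'a \<Rightarrow> ('a \<times> 'a \<Rightarrow>\<^sub>0 complex) set"
  counit :: "'a \<Rightarrow> complex"
  antipode :: "'a \<Rightarrow> 'a"

definition hopf_algebra :: "('a, 'm) hopf_scheme \<Rightarrow> bool" where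
  "hopf_algebra H \<longleftrightarrow>
     complex_algebra H \<and>
     algebra_map H (tensor H H) (comult H) \<and>
     algebra_map H complex_space (counit H) \<and>
     linear_map H H (antipode H) \<and>
     (\<forall>x\<in>carrier H.
        tensor_assoc H H H (tensor_map (tensor H H) H (comult H) (\<lambda>y. y) (comult H x)) =
        tensor_map H (tensor H H) (\<lambda>y. y) (comult H) (comult H x)) \<and>
     (\<forall>x\<in>carrier H.
        tensor_lift H (\<lambda>a b. counit H a \<odot>\<^bsub>H\<^esub> b) (comult H x) = x \<and>
        tensor_lift H (\<lambda>a b. counit H b \<odot>\<^bsub>H\<^esub> a) (comult H x) = x) \<and>
     (\<forall>x\<in>carrier H.
        tensor_lift H (\<lambda>a b. antipode H a \<otimes>\<^bsub>H\<^esub> b) (comult H x) = counit H x \<odot>\<^bsub>H\<^esub> \<one>\<^bsub>H\<^esub> \<and>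
        tensor_lift H (\<lambda>a b. a \<otimes>\<^bsub>H\<^esub> antipode H b) (comult H x) = counit H x \<odot>\<^bsub>H\<^esub> \<one>\<^bsub>H\<^esub>)"

text \<open>The span occurring here is \<open>I \<otimes> H + H \<otimes> I\<close>.\<close>

definition hopf_ideal :: "'a set \<Rightarrow> ('a, 'm) hopf_scheme \<Rightarrow> bool" where
  "hopf_ideal I H \<longleftrightarrow>
     ideal I H \<and>
     (\<forall>x\<in>I. comult H x \<in> linear_span (tensor H H)
        {pure_tensor H H a b | a b. a \<in> carrier H \<and> b \<in> carrier H \<and> (a \<in> I \<or> b \<in> I)}) \<and>
     (\<forall>x\<in>I. counit H x = 0) \<and>
     (\<forall>x\<in>I. antipode H x \<in> I)"

text \<open>For a Hopf ideal the structure maps do not depend on the chosen representatives.\<close>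

definition hopf_quotient :: "('a, 'm) hopf_scheme \<Rightarrow> 'a set \<Rightarrow> 'a set hopf" where
  "hopf_quotient H I = module.extend (quotient_space H I)
     (hopf.fields
       (\<lambda>C. tensor_map (quotient_space H I) (quotient_space H I)
              (\<lambda>x. I +>\<^bsub>H\<^esub> x) (\<lambda>x. I +>\<^bsub>H\<^esub> x) (comult H (SOME x. x \<in> C)))
       (\<lambda>C. counit H (SOME x. x \<in> C))
       (\<lambda>C. I +>\<^bsub>H\<^esub> antipode H (SOME x. x \<in> C)))"

definition hopf_isomorphism ::
  "('a, 'm) hopf_scheme \<Rightarrow> ('b, 'n) hopf_scheme \<Rightarrow> ('a \<Rightarrow> 'b) \<Rightarrow> bool" where
  "hopf_isomorphism H K f \<longleftrightarrow>
     hopf_algebra H \<and> hopf_algebra K \<and>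
     algebra_map H K f \<and> bij_betw f (carrier H) (carrier K) \<and>
     (\<forall>x\<in>carrier H.
        comult K (f x) = tensor_map K K f f (comult H x) \<and>
        counit K (f x) = counit H x \<and>
        antipode K (f x) = f (antipode H x))"


section \<open>Semi-path Hopf algebras\<close>

definition conjugacy_classes :: "('g, 'm) monoid_scheme \<Rightarrow> 'g set set" where
  "conjugacy_classes G =
     (\<lambda>g. (\<lambda>x. inv\<^bsub>G\<^esub> x \<otimes>\<^bsub>G\<^esub> g \<otimes>\<^bsub>G\<^esub> x) ` carrier G) ` carrier G"

text \<open>
  The ramification data \<open>\<rho>\<close> assign to each conjugacy class a cardinal number, which in HOL is a
  minimal well-order (\<open>Card_order\<close>).
\<close>

definition hopf_quiver ::
  "('g, 'm) monoid_scheme \<Rightarrow> ('g set \<Rightarrow> 'c rel) \<Rightarrow> ('g, 'e) pre_digraph \<Rightarrow> bool" where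
  "hopf_quiver G \<rho> Q \<longleftrightarrow>
     group G \<and> (\<forall>C\<in>conjugacy_classes G. Card_order (\<rho> C)) \<and>
     wf_digraph Q \<and> verts Q = carrier G \<and>
     (\<forall>x\<in>carrier G. \<forall>y\<in>carrier G. \<forall>C\<in>conjugacy_classes G.
        inv\<^bsub>G\<^esub> x \<otimes>\<^bsub>G\<^esub> y \<in> C \<longrightarrow>
        (card_of {a \<in> arcs Q. tail Q a = x \<and> head Q a = y}, \<rho> C) \<in> ordIso)"

abbreviation arrow_space :: "('g, 'e) pre_digraph \<Rightarrow> (complex, 'e \<Rightarrow>\<^sub>0 complex) module" where
  "arrow_space Q \<equiv> free_space (arcs Q)"

definition group_comult ::
  "('g, 'm) monoid_scheme \<Rightarrow> ('g \<Rightarrow>\<^sub>0 complex) \<Rightarrow>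
   (('g \<Rightarrow>\<^sub>0 complex) \<times> ('g \<Rightarrow>\<^sub>0 complex) \<Rightarrow>\<^sub>0 complex) set" where
  "group_comult G = linear_extension (tensor (monoid_algebra G) (monoid_algebra G))
     (\<lambda>g. pure_tensor (monoid_algebra G) (monoid_algebra G) (basis_vector g) (basis_vector g))"

definition left_coaction ::
  "('g, 'm) monoid_scheme \<Rightarrow> ('g, 'e) pre_digraph \<Rightarrow> ('e \<Rightarrow>\<^sub>0 complex) \<Rightarrow>
   (('g \<Rightarrow>\<^sub>0 complex) \<times> ('e \<Rightarrow>\<^sub>0 complex) \<Rightarrow>\<^sub>0 complex) set" where
  "left_coaction G Q = linear_extension (tensor (monoid_algebra G) (arrow_space Q))
     (\<lambda>a. pure_tensor (monoid_algebra G) (arrow_space Q)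
        (basis_vector (head Q a)) (basis_vector a))"

definition right_coaction ::
  "('g, 'm) monoid_scheme \<Rightarrow> ('g, 'e) pre_digraph \<Rightarrow> ('e \<Rightarrow>\<^sub>0 complex) \<Rightarrow>
   (('e \<Rightarrow>\<^sub>0 complex) \<times> ('g \<Rightarrow>\<^sub>0 complex) \<Rightarrow>\<^sub>0 complex) set" where
  "right_coaction G Q = linear_extension (tensor (arrow_space Q) (monoid_algebra G))
     (\<lambda>a. pure_tensor (arrow_space Q) (monoid_algebra G)
        (basis_vector a) (basis_vector (tail Q a)))"

text \<open>In \<open>r m x\<close> the algebra element \<open>x\<close> acts on the right of \<open>m\<close>.\<close>

definition bimodule ::
  "(complex, 'a, 'm) module_scheme \<Rightarrow> (complex, 'b, 'n) module_scheme \<Rightarrow>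
   ('a \<Rightarrow> 'b \<Rightarrow> 'b) \<Rightarrow> ('b \<Rightarrow> 'a \<Rightarrow> 'b) \<Rightarrow> bool" where
  "bimodule R M l r \<longleftrightarrow>
     bilinear_map R M M l \<and> bilinear_map M R M r \<and>
     (\<forall>m\<in>carrier M. l \<one>\<^bsub>R\<^esub> m = m \<and> r m \<one>\<^bsub>R\<^esub> = m) \<and>
     (\<forall>a\<in>carrier R. \<forall>b\<in>carrier R. \<forall>m\<in>carrier M.
        l (a \<otimes>\<^bsub>R\<^esub> b) m = l a (l b m) \<and>
        r m (a \<otimes>\<^bsub>R\<^esub> b) = r (r m a) b \<and>
        l a (r m b) = r (l a m) b)"

text \<open>
  The coactions always turn the arrow space into a bicomodule over the group algebra. The following
  says that the actions make this bicomodule a Hopf bimodule over the group algebra: both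
  coactions are bimodule maps, where the group algebra acts on the tensor products through its
  comultiplication.
\<close>

definition arrow_hopf_bimodule ::
  "('g, 'm) monoid_scheme \<Rightarrow> ('g, 'e) pre_digraph \<Rightarrow>
   (('g \<Rightarrow>\<^sub>0 complex) \<Rightarrow> ('e \<Rightarrow>\<^sub>0 complex) \<Rightarrow> ('e \<Rightarrow>\<^sub>0 complex)) \<Rightarrow>
   (('e \<Rightarrow>\<^sub>0 complex) \<Rightarrow> ('g \<Rightarrow>\<^sub>0 complex) \<Rightarrow> ('e \<Rightarrow>\<^sub>0 complex)) \<Rightarrow> bool" where
  "arrow_hopf_bimodule G Q l r \<longleftrightarrow>
     (let kG = monoid_algebra G; M = arrow_space Q;
          \<Delta> = group_comult G; \<delta>l = left_coaction G Q; \<delta>r = right_coaction G Q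
      in bimodule kG M l r \<and>
         (\<forall>x\<in>carrier kG. \<forall>m\<in>carrier M.
            \<delta>l (l x m) = tensor_product_action kG M (monoid.mult kG) l (\<Delta> x) (\<delta>l m) \<and>
            \<delta>l (r m x) = tensor_product_action kG M (monoid.mult kG) r (\<delta>l m) (\<Delta> x) \<and>
            \<delta>r (l x m) = tensor_product_action M kG l (monoid.mult kG) (\<Delta> x) (\<delta>r m) \<and>
            \<delta>r (r m x) = tensor_product_action M kG r (monoid.mult kG) (\<delta>r m) (\<Delta> x)))"

text \<open>
  The tensor algebra of an \<open>R\<close>-bimodule \<open>M\<close> is the direct sum over \<open>n\<close> of the spaces
  \<open>R \<otimes>\<^sub>R M \<otimes>\<^sub>R \<dots> \<otimes>\<^sub>R M\<close> with \<open>n\<close> factors \<open>M\<close>, that is, of \<open>R\<close> itself for \<open>n = 0\<close> and of the \<open>n\<close>-fold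
  tensor power of \<open>M\<close> over \<open>R\<close> for \<open>n > 0\<close>. The word \<open>(a, [m\<^sub>1, \<dots>, m\<^sub>n])\<close> stands for
  \<open>a \<otimes> m\<^sub>1 \<otimes> \<dots> \<otimes> m\<^sub>n\<close>, and the relations express multilinearity and balancedness over \<open>R\<close>.
  Words multiply by concatenation, the coefficient of the second word acting on the last letter
  of the first one.
\<close>

definition tensor_words ::
  "(complex, 'a, 'm) module_scheme \<Rightarrow> (complex, 'b, 'n) module_scheme \<Rightarrow>
   ('b \<Rightarrow> 'a \<Rightarrow> 'b) \<Rightarrow> ('a \<times> 'b list) monoid" where
  "tensor_words R M r =
     \<lparr>carrier = carrier R \<times> lists (carrier M),
      monoid.mult = (\<lambda>(a, us) (b, vs).
        if us = [] then (a \<otimes>\<^bsub>R\<^esub> b, vs) else (a, butlast us @ [r (last us) b] @ vs)),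
      one = (\<one>\<^bsub>R\<^esub>, [])\<rparr>"

definition tensor_algebra_relations ::
  "(complex, 'a, 'm) module_scheme \<Rightarrow> (complex, 'b, 'n) module_scheme \<Rightarrow>
   ('a \<Rightarrow> 'b \<Rightarrow> 'b) \<Rightarrow> ('b \<Rightarrow> 'a \<Rightarrow> 'b) \<Rightarrow> ('a \<times> 'b list \<Rightarrow>\<^sub>0 complex) set" where
  "tensor_algebra_relations R M l r =
     {basis_vector (a \<oplus>\<^bsub>R\<^esub> b, us) - basis_vector (a, us) - basis_vector (b, us) | a b us.
        a \<in> carrier R \<and> b \<in> carrier R \<and> us \<in> lists (carrier M)} \<union>
     {basis_vector (c \<odot>\<^bsub>R\<^esub> a, us) - Poly_Mapping.single (a, us) c | c a us.
        a \<in> carrier R \<and> us \<in> lists (carrier M)} \<union>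
     {basis_vector (a, us @ [m \<oplus>\<^bsub>M\<^esub> m'] @ vs)
        - basis_vector (a, us @ [m] @ vs) - basis_vector (a, us @ [m'] @ vs) | a us m m' vs.
        a \<in> carrier R \<and> us \<in> lists (carrier M) \<and> m \<in> carrier M \<and> m' \<in> carrier M \<and>
        vs \<in> lists (carrier M)} \<union>
     {basis_vector (a, us @ [c \<odot>\<^bsub>M\<^esub> m] @ vs) - Poly_Mapping.single (a, us @ [m] @ vs) c
        | c a us m vs.
        a \<in> carrier R \<and> us \<in> lists (carrier M) \<and> m \<in> carrier M \<and> vs \<in> lists (carrier M)} \<union>
     {basis_vector (a \<otimes>\<^bsub>R\<^esub> b, m # us) - basis_vector (a, l b m # us) | a b m us.
        a \<in> carrier R \<and> b \<in> carrier R \<and> m \<in> carrier M \<and> us \<in> lists (carrier M)} \<union>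
     {basis_vector (a, us @ [r m b, m'] @ vs) - basis_vector (a, us @ [m, l b m'] @ vs)
        | a b us m m' vs.
        a \<in> carrier R \<and> b \<in> carrier R \<and> us \<in> lists (carrier M) \<and> m \<in> carrier M \<and>
        m' \<in> carrier M \<and> vs \<in> lists (carrier M)}"

abbreviation tensor_algebra_kernel where
  "tensor_algebra_kernel R M l r \<equiv>
     linear_span (monoid_algebra (tensor_words R M r)) (tensor_algebra_relations R M l r)"

definition tensor_algebra ::
  "(complex, 'a, 'm) module_scheme \<Rightarrow> (complex, 'b, 'n) module_scheme \<Rightarrow>
   ('a \<Rightarrow> 'b \<Rightarrow> 'b) \<Rightarrow> ('b \<Rightarrow> 'a \<Rightarrow> 'b) \<Rightarrow> (complex, ('a \<times> 'b list \<Rightarrow>\<^sub>0 complex) set) module" where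
  "tensor_algebra R M l r =
     quotient_space (monoid_algebra (tensor_words R M r)) (tensor_algebra_kernel R M l r)"

definition tensor_word ::
  "(complex, 'a, 'm) module_scheme \<Rightarrow> (complex, 'b, 'n) module_scheme \<Rightarrow>
   ('a \<Rightarrow> 'b \<Rightarrow> 'b) \<Rightarrow> ('b \<Rightarrow> 'a \<Rightarrow> 'b) \<Rightarrow> 'a \<Rightarrow> 'b list \<Rightarrow> ('a \<times> 'b list \<Rightarrow>\<^sub>0 complex) set" where
  "tensor_word R M l r a us =
     tensor_algebra_kernel R M l r +>\<^bsub>monoid_algebra (tensor_words R M r)\<^esub> basis_vector (a, us)"

definition tensor_algebra_degree ::
  "(complex, 'a, 'm) module_scheme \<Rightarrow> (complex, 'b, 'n) module_scheme \<Rightarrow>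
   ('a \<Rightarrow> 'b \<Rightarrow> 'b) \<Rightarrow> ('b \<Rightarrow> 'a \<Rightarrow> 'b) \<Rightarrow> nat \<Rightarrow> ('a \<times> 'b list \<Rightarrow>\<^sub>0 complex) set set" where
  "tensor_algebra_degree R M l r n = linear_span (tensor_algebra R M l r)
     {tensor_word R M l r a us | a us.
        a \<in> carrier R \<and> us \<in> lists (carrier M) \<and> length us = n}"

text \<open>\<open>D n\<close> is the homogeneous component of degree \<open>n\<close>.\<close>

definition graded_hopf_algebra :: "('a, 'm) hopf_scheme \<Rightarrow> (nat \<Rightarrow> 'a set) \<Rightarrow> bool" where
  "graded_hopf_algebra H D \<longleftrightarrow> hopf_algebra H \<and>
     (\<forall>n. \<forall>x\<in>D n.
        comult H x \<in> linear_span (tensor H H)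
          {pure_tensor H H y z | y z i j. i + j = n \<and> y \<in> D i \<and> z \<in> D j} \<and>
        (n > 0 \<longrightarrow> counit H x = 0) \<and>
        antipode H x \<in> D n)"

definition semi_path_hopf_algebra ::
  "('g, 'm) monoid_scheme \<Rightarrow> ('g, 'e) pre_digraph \<Rightarrow>
   (('g \<Rightarrow>\<^sub>0 complex) \<Rightarrow> ('e \<Rightarrow>\<^sub>0 complex) \<Rightarrow> ('e \<Rightarrow>\<^sub>0 complex)) \<Rightarrow>
   (('e \<Rightarrow>\<^sub>0 complex) \<Rightarrow> ('g \<Rightarrow>\<^sub>0 complex) \<Rightarrow> ('e \<Rightarrow>\<^sub>0 complex)) \<Rightarrow>
   (('g \<Rightarrow>\<^sub>0 complex) \<times> ('e \<Rightarrow>\<^sub>0 complex) list \<Rightarrow>\<^sub>0 complex) set hopf \<Rightarrow> bool" where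
  "semi_path_hopf_algebra G Q l r H \<longleftrightarrow>
     (let kG = monoid_algebra G; M = arrow_space Q;
          \<iota>0 = (\<lambda>x. tensor_word kG M l r x []); \<iota>1 = (\<lambda>m. tensor_word kG M l r \<one>\<^bsub>kG\<^esub> [m])
      in module.truncate H = tensor_algebra kG M l r \<and>
         graded_hopf_algebra H (tensor_algebra_degree kG M l r) \<and>
         (\<forall>x\<in>carrier kG. comult H (\<iota>0 x) = tensor_map H H \<iota>0 \<iota>0 (group_comult G x)) \<and>
         (\<forall>m\<in>carrier M. comult H (\<iota>1 m) =
            tensor_map H H \<iota>0 \<iota>1 (left_coaction G Q m) \<oplus>\<^bsub>tensor H H\<^esub>
            tensor_map H H \<iota>1 \<iota>0 (right_coaction G Q m)))"


section \<open>Complex semisimple Lie algebras and their Cartan matrices\<close>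

locale complex_lie_algebra = vector_space scale
  for scale :: "complex \<Rightarrow> 'l::ab_group_add \<Rightarrow> 'l" +
  fixes bracket :: "'l \<Rightarrow> 'l \<Rightarrow> 'l"
  assumes bracket_add_left: "bracket (x + y) z = bracket x z + bracket y z"
    and bracket_add_right: "bracket x (y + z) = bracket x y + bracket x z"
    and bracket_scale_left: "bracket (scale c x) y = scale c (bracket x y)"
    and bracket_scale_right: "bracket x (scale c y) = scale c (bracket x y)"
    and bracket_self: "bracket x x = 0"
    and jacobi: "bracket x (bracket y z) + bracket y (bracket z x) + bracket z (bracket x y) = 0"
    and finite_dimensional: "\<exists>B. finite B \<and> span B = UNIV"
begin

definition commutator :: "'l set \<Rightarrow> 'l set \<Rightarrow> 'l set" where
  "commutator U V = span {bracket x y | x y. x \<in> U \<and> y \<in> V}"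

definition lie_subalgebra :: "'l set \<Rightarrow> bool" where
  "lie_subalgebra U \<longleftrightarrow> subspace U \<and> (\<forall>x\<in>U. \<forall>y\<in>U. bracket x y \<in> U)"

definition lie_ideal :: "'l set \<Rightarrow> bool" where
  "lie_ideal U \<longleftrightarrow> subspace U \<and> (\<forall>x. \<forall>y\<in>U. bracket x y \<in> U)"

definition lie_solvable :: "'l set \<Rightarrow> bool" where
  "lie_solvable U \<longleftrightarrow> (\<exists>n. ((\<lambda>V. commutator V V) ^^ n) U = {0})"

definition lie_nilpotent :: "'l set \<Rightarrow> bool" where
  "lie_nilpotent U \<longleftrightarrow> (\<exists>n. (commutator U ^^ n) U = {0})"

definition cartan_subalgebra :: "'l set \<Rightarrow> bool" where
  "cartan_subalgebra H \<longleftrightarrow> lie_subalgebra H \<and> lie_nilpotent H \<and>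
     (\<forall>x. (\<forall>h\<in>H. bracket x h \<in> H) \<longrightarrow> x \<in> H)"

text \<open>
  Only the restriction of \<open>\<alpha>\<close> to \<open>H\<close> matters; it is linear as soon as the root space is nonzero.
\<close>

definition root_space :: "'l set \<Rightarrow> ('l \<Rightarrow> complex) \<Rightarrow> 'l set" where
  "root_space H \<alpha> = {x. \<forall>h\<in>H. bracket h x = scale (\<alpha> h) x}"

definition is_root :: "'l set \<Rightarrow> ('l \<Rightarrow> complex) \<Rightarrow> bool" where
  "is_root H \<alpha> \<longleftrightarrow> (\<exists>h\<in>H. \<alpha> h \<noteq> 0) \<and> root_space H \<alpha> \<noteq> {0}"

definition simple_roots :: "'l set \<Rightarrow> ('n::finite \<Rightarrow> 'l \<Rightarrow> complex) \<Rightarrow> bool" where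
  "simple_roots H \<alpha> \<longleftrightarrow>
     (\<forall>i. is_root H (\<alpha> i)) \<and>
     (\<forall>c. (\<forall>h\<in>H. (\<Sum>i\<in>UNIV. c i * \<alpha> i h) = 0) \<longrightarrow> (\<forall>i. c i = 0)) \<and>
     (\<forall>\<beta>. is_root H \<beta> \<longrightarrow> (\<exists>m :: 'n \<Rightarrow> nat.
        (\<forall>h\<in>H. \<beta> h = (\<Sum>i\<in>UNIV. of_nat (m i) * \<alpha> i h)) \<or>
        (\<forall>h\<in>H. \<beta> h = - (\<Sum>i\<in>UNIV. of_nat (m i) * \<alpha> i h))))"

text \<open>
  The coroot of a root \<open>\<alpha>\<close> is the element \<open>t\<close> of \<open>[L\<^sub>\<alpha>, L\<^sub>-\<^sub>\<alpha>]\<close> with \<open>\<alpha>(t) = 2\<close>. Root spaces of a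
  semisimple Lie algebra are one-dimensional, so no span of brackets is needed.
\<close>

definition is_coroot :: "'l set \<Rightarrow> ('l \<Rightarrow> complex) \<Rightarrow> 'l \<Rightarrow> bool" where
  "is_coroot H \<alpha> t \<longleftrightarrow> t \<in> H \<and> \<alpha> t = 2 \<and>
     (\<exists>x\<in>root_space H \<alpha>. \<exists>y\<in>root_space H (\<lambda>h. - \<alpha> h). t = bracket x y)"

text \<open>
  \<open>a\<^sub>i\<^sub>j = \<alpha>\<^sub>j(t\<^sub>i) = 2(\<alpha>\<^sub>i, \<alpha>\<^sub>j) / (\<alpha>\<^sub>i, \<alpha>\<^sub>i)\<close>; with this index convention the numbers \<open>d\<^sub>i\<close> with
  \<open>d\<^sub>i a\<^sub>i\<^sub>j = d\<^sub>j a\<^sub>j\<^sub>i\<close> are proportional to the squared root lengths on each simple component.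
\<close>

definition is_cartan_matrix :: "('n::finite \<Rightarrow> 'n \<Rightarrow> int) \<Rightarrow> bool" where
  "is_cartan_matrix A \<longleftrightarrow>
     (\<exists>H \<alpha> t. cartan_subalgebra H \<and> simple_roots H \<alpha> \<and> (\<forall>i. is_coroot H (\<alpha> i) (t i)) \<and>
        (\<forall>i j. of_int (A i j) = \<alpha> j (t i)))"

end

locale complex_semisimple_lie_algebra = complex_lie_algebra +
  assumes semisimple: "lie_ideal U \<Longrightarrow> lie_solvable U \<Longrightarrow> U = {0}"


section \<open>Quantum enveloping algebras\<close>

definition q_number :: "complex \<Rightarrow> nat \<Rightarrow> complex" where
  "q_number p n = (p powi int n - p powi (- int n)) / (p - inverse p)"

definition q_factorial :: "complex \<Rightarrow> nat \<Rightarrow> complex" where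
  "q_factorial p n = (\<Prod>i=1..n. q_number p i)"

definition q_binomial :: "complex \<Rightarrow> nat \<Rightarrow> nat \<Rightarrow> complex" where
  "q_binomial p n m = q_factorial p n / (q_factorial p m * q_factorial p (n - m))"

text \<open>The generator \<open>Kinv i\<close> is the inverse of \<open>K i\<close>.\<close>

datatype 'n generator = K 'n | Kinv 'n | E 'n | F 'n

definition free_algebra :: "(complex, 'x list \<Rightarrow>\<^sub>0 complex) module" where
  "free_algebra = monoid_algebra \<lparr>carrier = UNIV, monoid.mult = (@), one = []\<rparr>"

text \<open>Each element of the free algebra below is the difference of the two sides of a relation.\<close>

definition Uq_serre ::
  "complex \<Rightarrow> ('n \<Rightarrow> 'n \<Rightarrow> int) \<Rightarrow> ('n \<Rightarrow> nat) \<Rightarrow> ('n \<Rightarrow> 'n generator) \<Rightarrow> 'n \<Rightarrow> 'n \<Rightarrow>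
   ('n generator list \<Rightarrow>\<^sub>0 complex)" where
  "Uq_serre q A d g i j =
     (let N = nat (1 - A i j) in
      \<Sum>m=0..N. Poly_Mapping.single (replicate (N - m) (g i) @ [g j] @ replicate m (g i))
        ((-1) ^ m * q_binomial (q ^ (2 * d i)) N m))"

definition Uq_relations ::
  "complex \<Rightarrow> ('n \<Rightarrow> 'n \<Rightarrow> int) \<Rightarrow> ('n \<Rightarrow> nat) \<Rightarrow> ('n generator list \<Rightarrow>\<^sub>0 complex) set" where
  "Uq_relations q A d =
     {basis_vector [K i, Kinv i] - basis_vector [] | i. True} \<union>
     {basis_vector [Kinv i, K i] - basis_vector [] | i. True} \<union>
     {basis_vector [K i, K j] - basis_vector [K j, K i] | i j. True} \<union>
     {basis_vector [K i, E j, Kinv i]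
        - Poly_Mapping.single [E j] (q powi (int (d i) * A i j)) | i j. True} \<union>
     {basis_vector [K i, F j, Kinv i]
        - Poly_Mapping.single [F j] (q powi (- (int (d i) * A i j))) | i j. True} \<union>
     {basis_vector [E i, F j] - basis_vector [F j, E i] | i j. i \<noteq> j} \<union>
     {basis_vector [E i, F i] - basis_vector [F i, E i]
        - (let c = 1 / (q powi (2 * int (d i)) - q powi (- (2 * int (d i))))
           in Poly_Mapping.single [K i, K i] c - Poly_Mapping.single [Kinv i, Kinv i] c)
        | i. True} \<union>
     {Uq_serre q A d E i j | i j. i \<noteq> j} \<union>
     {Uq_serre q A d F i j | i j. i \<noteq> j}"

abbreviation Uq_ideal where
  "Uq_ideal q A d \<equiv> genideal free_algebra (Uq_relations q A d)"

definition Uq_algebra ::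
  "complex \<Rightarrow> ('n \<Rightarrow> 'n \<Rightarrow> int) \<Rightarrow> ('n \<Rightarrow> nat) \<Rightarrow>
   (complex, ('n generator list \<Rightarrow>\<^sub>0 complex) set) module" where
  "Uq_algebra q A d = quotient_space free_algebra (Uq_ideal q A d)"

definition Uq_gen ::
  "complex \<Rightarrow> ('n \<Rightarrow> 'n \<Rightarrow> int) \<Rightarrow> ('n \<Rightarrow> nat) \<Rightarrow> 'n generator \<Rightarrow>
   ('n generator list \<Rightarrow>\<^sub>0 complex) set" where
  "Uq_gen q A d g = Uq_ideal q A d +>\<^bsub>free_algebra\<^esub> basis_vector [g]"

definition Uq_gen_comult ::
  "complex \<Rightarrow> ('n \<Rightarrow> 'n \<Rightarrow> int) \<Rightarrow> ('n \<Rightarrow> nat) \<Rightarrow> 'n generator \<Rightarrow>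
   (('n generator list \<Rightarrow>\<^sub>0 complex) set \<times> ('n generator list \<Rightarrow>\<^sub>0 complex) set \<Rightarrow>\<^sub>0 complex) set" where
  "Uq_gen_comult q A d g =
     (let U = Uq_algebra q A d; u = Uq_gen q A d; UU = tensor U U; T = pure_tensor U U in
      case g of
        K i \<Rightarrow> T (u (K i)) (u (K i))
      | Kinv i \<Rightarrow> T (u (Kinv i)) (u (Kinv i))
      | E i \<Rightarrow> T (u (E i)) (u (Kinv i)) \<oplus>\<^bsub>UU\<^esub> T (u (K i)) (u (E i))
      | F i \<Rightarrow> T (u (F i)) (u (Kinv i)) \<oplus>\<^bsub>UU\<^esub> T (u (K i)) (u (F i)))"

definition Uq_gen_counit :: "'n generator \<Rightarrow> complex" where
  "Uq_gen_counit g = (case g of K i \<Rightarrow> 1 | Kinv i \<Rightarrow> 1 | E i \<Rightarrow> 0 | F i \<Rightarrow> 0)"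

definition Uq_gen_antipode ::
  "complex \<Rightarrow> ('n \<Rightarrow> 'n \<Rightarrow> int) \<Rightarrow> ('n \<Rightarrow> nat) \<Rightarrow> 'n generator \<Rightarrow>
   ('n generator list \<Rightarrow>\<^sub>0 complex) set" where
  "Uq_gen_antipode q A d g =
     (let U = Uq_algebra q A d; u = Uq_gen q A d in
      case g of
        K i \<Rightarrow> u (Kinv i)
      | Kinv i \<Rightarrow> u (K i)
      | E i \<Rightarrow> (- (q powi (- (2 * int (d i))))) \<odot>\<^bsub>U\<^esub> u (E i)
      | F i \<Rightarrow> (- (q powi (2 * int (d i)))) \<odot>\<^bsub>U\<^esub> u (F i))"

text \<open>
  The homomorphism and the antihomomorphism of the free algebra into \<open>B\<close> given on generators by \<open>f\<close>.
\<close>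

definition free_algebra_lift ::
  "(complex, 'b, 'm) module_scheme \<Rightarrow> ('x \<Rightarrow> 'b) \<Rightarrow> ('x list \<Rightarrow>\<^sub>0 complex) \<Rightarrow> 'b" where
  "free_algebra_lift B f =
     linear_extension B (\<lambda>w. foldr (\<lambda>g y. f g \<otimes>\<^bsub>B\<^esub> y) w \<one>\<^bsub>B\<^esub>)"

definition free_algebra_antilift ::
  "(complex, 'b, 'm) module_scheme \<Rightarrow> ('x \<Rightarrow> 'b) \<Rightarrow> ('x list \<Rightarrow>\<^sub>0 complex) \<Rightarrow> 'b" where
  "free_algebra_antilift B f =
     linear_extension B (\<lambda>w. foldr (\<lambda>g y. y \<otimes>\<^bsub>B\<^esub> f g) w \<one>\<^bsub>B\<^esub>)"

text \<open>
  The structure maps are computed on representatives in the free algebra; that they respect the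
  relations is part of the assertion \<open>hopf_algebra (Uq q A d)\<close>.
\<close>

definition Uq ::
  "complex \<Rightarrow> ('n \<Rightarrow> 'n \<Rightarrow> int) \<Rightarrow> ('n \<Rightarrow> nat) \<Rightarrow> ('n generator list \<Rightarrow>\<^sub>0 complex) set hopf" where
  "Uq q A d =
     (let U = Uq_algebra q A d in
      module.extend U
       (hopf.fields
         (\<lambda>C. free_algebra_lift (tensor U U) (Uq_gen_comult q A d) (SOME p. p \<in> C))
         (\<lambda>C. free_algebra_lift complex_space Uq_gen_counit (SOME p. p \<in> C))
         (\<lambda>C. free_algebra_antilift U (Uq_gen_antipode q A d) (SOME p. p \<in> C))))"

end

theory Submission
  imports Defs "HOL-Library.Function_Algebras"
begin

text \<open>
  In \<open>U = U\<^sub>q(L)\<close> the elements \<open>K\<^sub>i\<close> are grouplike, commute and are invertible, and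
  \<open>\<Delta>(E\<^sub>i) = E\<^sub>i \<otimes> K\<^sub>i\<^sup>-\<^sup>1 + K\<^sub>i \<otimes> E\<^sub>i\<close>, likewise for \<open>F\<^sub>i\<close>. Thus \<open>E\<^sub>i\<close> and \<open>F\<^sub>i\<close> behave as
  arrows of a quiver from the vertex \<open>K\<^sub>i\<^sup>-\<^sup>1\<close> to the vertex \<open>K\<^sub>i\<close>. Take the lattice \<open>G = \<int>\<^sup>n\<close>, with
  \<open>g\<close> standing for the product \<open>K^g\<close> of the \<open>K\<^sub>i^(g i)\<close>, and the Hopf quiver with two arrows
  from \<open>x\<close> to \<open>x + 2 e\<^sub>i\<close> for every \<open>x\<close> and \<open>i\<close>, standing for \<open>K^(x + e\<^sub>i) E\<^sub>i\<close> and \<open>K^(x + e\<^sub>i) F\<^sub>i\<close>.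
  This prescribes the Hopf bimodule structure: the group acts from the left by translation and from
  the right by translation times a character, because \<open>K^g E\<^sub>j\<close> and \<open>E\<^sub>j K^g\<close> differ by a power of \<open>q\<close>
  (\<open>arrow_hopf_bimodule\<close>). By the universal property of the tensor algebra
  (\<open>semi_path_universal\<close>) homomorphisms out of the semi-path algebra \<open>T\<close> may be prescribed on group
  elements and arrows. This yields its Hopf structure (\<open>semi_path_hopf_algebra_exists\<close>) and also a
  homomorphism \<open>\<phi>\<close> from \<open>T\<close> onto \<open>U\<close> (\<open>projection_exists\<close>). The map \<open>\<phi>\<close> commutes with the structure
  maps, since this can be checked on generators, and the first isomorphism theorem
  (\<open>hopf_first_isomorphism\<close>) identifies \<open>U\<close> with the quotient of \<open>T\<close> by the kernel of \<open>\<phi>\<close>.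

  The Hopf axioms for \<open>U\<close> are inherited along \<open>\<phi>\<close>, but its structure maps are prescribed on the free
  algebra and have to be shown to respect the defining relations. The essential case is that of the
  quantum Serre relations under \<open>\<Delta>\<close>. The Serre sum is an iterated q-commutator
  \<open>z\<^sub>n\<^sub>+\<^sub>1 = x z\<^sub>n - p^(2n) s z\<^sub>n x\<close> starting from \<open>z\<^sub>0 = y\<close> (\<open>serre_element_q_commutator\<close>). If
  \<open>x = a + b\<close> with \<open>b a = p^2 a b\<close> and \<open>b y = s y b\<close>, then \<open>b z\<^sub>n = p^(2n) s z\<^sub>n b\<close>, so that \<open>b\<close> cancels at
  each step. For \<open>\<Delta>(E\<^sub>i)\<close> and \<open>\<Delta>(E\<^sub>j)\<close>, which are sums of two such terms, the Serre sum therefore splits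
  into two parts (\<open>serre_q_commutator_add\<close>), each with the Serre sum of \<open>E\<^sub>i\<close> and \<open>E\<^sub>j\<close> as a tensor
  factor. The exponents match because \<open>a\<^sub>i\<^sub>i = 2\<close> and \<open>d\<^sub>i a\<^sub>i\<^sub>j = d\<^sub>j a\<^sub>j\<^sub>i\<close>.
\<close>

section \<open>Linear maps and spans\<close>

lemma CC_simps [simp]:
  "carrier CC = UNIV" "\<one>\<^bsub>CC\<^esub> = 1" "\<zero>\<^bsub>CC\<^esub> = 0" "x \<oplus>\<^bsub>CC\<^esub> y = x + y" "x \<otimes>\<^bsub>CC\<^esub> y = x * y"
  by (simp_all add: ring_of_type_algebra_def)

lemma vector_spaceI:
  assumes add: "\<And>x y. x \<in> carrier V \<Longrightarrow> y \<in> carrier V \<Longrightarrow> x \<oplus>\<^bsub>V\<^esub> y \<in> carrier V"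
    and zero: "\<zero>\<^bsub>V\<^esub> \<in> carrier V"
    and assoc: "\<And>x y z. x \<in> carrier V \<Longrightarrow> y \<in> carrier V \<Longrightarrow> z \<in> carrier V \<Longrightarrow>
      (x \<oplus>\<^bsub>V\<^esub> y) \<oplus>\<^bsub>V\<^esub> z = x \<oplus>\<^bsub>V\<^esub> (y \<oplus>\<^bsub>V\<^esub> z)"
    and comm: "\<And>x y. x \<in> carrier V \<Longrightarrow> y \<in> carrier V \<Longrightarrow> x \<oplus>\<^bsub>V\<^esub> y = y \<oplus>\<^bsub>V\<^esub> x"
    and l_zero: "\<And>x. x \<in> carrier V \<Longrightarrow> \<zero>\<^bsub>V\<^esub> \<oplus>\<^bsub>V\<^esub> x = x"
    and smult: "\<And>c x. x \<in> carrier V \<Longrightarrow> c \<odot>\<^bsub>V\<^esub> x \<in> carrier V"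
    and l_distr: "\<And>a b x. x \<in> carrier V \<Longrightarrow> (a + b) \<odot>\<^bsub>V\<^esub> x = a \<odot>\<^bsub>V\<^esub> x \<oplus>\<^bsub>V\<^esub> b \<odot>\<^bsub>V\<^esub> x"
    and r_distr: "\<And>a x y. x \<in> carrier V \<Longrightarrow> y \<in> carrier V \<Longrightarrow>
      a \<odot>\<^bsub>V\<^esub> (x \<oplus>\<^bsub>V\<^esub> y) = a \<odot>\<^bsub>V\<^esub> x \<oplus>\<^bsub>V\<^esub> a \<odot>\<^bsub>V\<^esub> y"
    and sassoc: "\<And>a b x. x \<in> carrier V \<Longrightarrow> (a * b) \<odot>\<^bsub>V\<^esub> x = a \<odot>\<^bsub>V\<^esub> (b \<odot>\<^bsub>V\<^esub> x)"
    and one: "\<And>x. x \<in> carrier V \<Longrightarrow> 1 \<odot>\<^bsub>V\<^esub> x = x"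
    and zero_smult: "\<And>x. x \<in> carrier V \<Longrightarrow> 0 \<odot>\<^bsub>V\<^esub> x = \<zero>\<^bsub>V\<^esub>"
  shows "module CC V"
proof (rule moduleI)
  show "cring CC" by (rule cring_from_type_algebra)
  show "abelian_group V"
  proof (rule abelian_groupI)
    fix x assume x: "x \<in> carrier V"
    have "(- 1) \<odot>\<^bsub>V\<^esub> x \<oplus>\<^bsub>V\<^esub> x = ((- 1) + 1) \<odot>\<^bsub>V\<^esub> x"
      unfolding l_distr[OF x] by (simp add: one x)
    then show "\<exists>y\<in>carrier V. y \<oplus>\<^bsub>V\<^esub> x = \<zero>\<^bsub>V\<^esub>"
      using x smult[OF x, of "- 1"] zero_smult by auto
  qed (use assms in auto)
qed (use assms in auto)

text \<open>
  The axioms of a vector space pass to any image under a map that respects the operations.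
  Quotients and records with changed fields are treated in this way.
\<close>

lemma vector_space_image:
  assumes V: "module CC V" and im: "carrier Q = h ` carrier V"
    and add: "\<And>x y. x \<in> carrier V \<Longrightarrow> y \<in> carrier V \<Longrightarrow> h x \<oplus>\<^bsub>Q\<^esub> h y = h (x \<oplus>\<^bsub>V\<^esub> y)"
    and smult: "\<And>c x. x \<in> carrier V \<Longrightarrow> c \<odot>\<^bsub>Q\<^esub> h x = h (c \<odot>\<^bsub>V\<^esub> x)"
    and zero: "\<zero>\<^bsub>Q\<^esub> = h \<zero>\<^bsub>V\<^esub>"
  shows "module CC Q"
proof -
  interpret V: module CC V by fact
  show ?thesis
    by (rule vector_spaceI)
      (auto simp: im add smult zero V.a_ac V.smult_r_distr
        V.smult_l_distr[simplified] V.smult_assoc1[simplified] V.smult_one[simplified]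
        V.smult_l_null[simplified])
qed

lemma linear_mapI:
  assumes "\<And>x. x \<in> carrier V \<Longrightarrow> f x \<in> carrier W"
    and "\<And>x y. x \<in> carrier V \<Longrightarrow> y \<in> carrier V \<Longrightarrow> f (x \<oplus>\<^bsub>V\<^esub> y) = f x \<oplus>\<^bsub>W\<^esub> f y"
    and "\<And>c x. x \<in> carrier V \<Longrightarrow> f (c \<odot>\<^bsub>V\<^esub> x) = c \<odot>\<^bsub>W\<^esub> f x"
  shows "linear_map V W f"
  using assms by (auto simp: linear_map_def)

lemma linear_mapD:
  assumes "linear_map V W f"
  shows "x \<in> carrier V \<Longrightarrow> f x \<in> carrier W"
    and "x \<in> carrier V \<Longrightarrow> y \<in> carrier V \<Longrightarrow> f (x \<oplus>\<^bsub>V\<^esub> y) = f x \<oplus>\<^bsub>W\<^esub> f y"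
    and "x \<in> carrier V \<Longrightarrow> f (c \<odot>\<^bsub>V\<^esub> x) = c \<odot>\<^bsub>W\<^esub> f x"
  using assms by (auto simp: linear_map_def)

lemma linear_map_zero:
  assumes "module CC V" "module CC W" "linear_map V W f"
  shows "f \<zero>\<^bsub>V\<^esub> = \<zero>\<^bsub>W\<^esub>"
proof -
  interpret V: module CC V by fact
  interpret W: module CC W by fact
  show ?thesis
    using linear_mapD(3)[OF assms(3), of "\<zero>\<^bsub>V\<^esub>" 0] linear_mapD(1)[OF assms(3), of "\<zero>\<^bsub>V\<^esub>"]
      V.smult_l_null[of "\<zero>\<^bsub>V\<^esub>"] W.smult_l_null
    by simp
qed

lemma neg_eq_smult:
  assumes "module CC V" "x \<in> carrier V"
  shows "\<ominus>\<^bsub>V\<^esub> x = (- 1) \<odot>\<^bsub>V\<^esub> x"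
proof -
  interpret V: module CC V by fact
  have "(- 1) \<odot>\<^bsub>V\<^esub> x \<oplus>\<^bsub>V\<^esub> x = \<zero>\<^bsub>V\<^esub>"
    using V.smult_l_distr[of "- 1" 1 x] assms V.smult_one[of x] V.smult_l_null[of x] by simp
  then show ?thesis using assms V.minus_equality V.smult_closed by auto
qed

lemma linear_map_neg:
  assumes "module CC V" "module CC W" "linear_map V W f" "x \<in> carrier V"
  shows "f (\<ominus>\<^bsub>V\<^esub> x) = \<ominus>\<^bsub>W\<^esub> f x"
  using assms by (simp add: neg_eq_smult linear_mapD)

lemma linear_map_minus:
  assumes "module CC V" "module CC W" "linear_map V W f" "x \<in> carrier V" "y \<in> carrier V"
  shows "f (x \<ominus>\<^bsub>V\<^esub> y) = f x \<ominus>\<^bsub>W\<^esub> f y"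
proof -
  interpret V: module CC V by fact
  show ?thesis using assms by (simp add: a_minus_def linear_map_neg linear_mapD)
qed

lemma linear_map_comp:
  assumes "linear_map U V f" "linear_map V W g"
  shows "linear_map U W (\<lambda>x. g (f x))"
  using assms by (auto intro!: linear_mapI simp: linear_mapD)

lemma linear_map_id: "linear_map V V (\<lambda>x. x)"
  by (auto intro!: linear_mapI)

lemma linear_map_add:
  assumes "module CC W" "linear_map V W f" "linear_map V W g"
  shows "linear_map V W (\<lambda>x. f x \<oplus>\<^bsub>W\<^esub> g x)"
proof -
  interpret W: module CC W by fact
  show ?thesis
    by (rule linear_mapI) (simp_all add: linear_mapD[OF assms(2)] linear_mapD[OF assms(3)]
      W.a_ac W.smult_r_distr)
qed

lemma linear_map_scale:
  assumes "module CC W" "linear_map V W f"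
  shows "linear_map V W (\<lambda>x. c \<odot>\<^bsub>W\<^esub> f x)"
proof -
  interpret W: module CC W by fact
  show ?thesis
  proof (rule linear_mapI)
    fix b x assume "x \<in> carrier V"
    then show "c \<odot>\<^bsub>W\<^esub> f (b \<odot>\<^bsub>V\<^esub> x) = b \<odot>\<^bsub>W\<^esub> (c \<odot>\<^bsub>W\<^esub> f x)"
      using W.smult_assoc1[of b c "f x"] W.smult_assoc1[of c b "f x"] linear_mapD[OF assms(2)]
      by (simp add: mult.commute)
  qed (simp_all add: linear_mapD[OF assms(2)] W.smult_r_distr)
qed

lemma bilinear_mapI:
  assumes "\<And>v w. v \<in> carrier V \<Longrightarrow> w \<in> carrier W \<Longrightarrow> f v w \<in> carrier Z"
    and "\<And>v w w'. v \<in> carrier V \<Longrightarrow> w \<in> carrier W \<Longrightarrow> w' \<in> carrier W \<Longrightarrow>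
      f v (w \<oplus>\<^bsub>W\<^esub> w') = f v w \<oplus>\<^bsub>Z\<^esub> f v w'"
    and "\<And>v w c. v \<in> carrier V \<Longrightarrow> w \<in> carrier W \<Longrightarrow> f v (c \<odot>\<^bsub>W\<^esub> w) = c \<odot>\<^bsub>Z\<^esub> f v w"
    and "\<And>v v' w. v \<in> carrier V \<Longrightarrow> v' \<in> carrier V \<Longrightarrow> w \<in> carrier W \<Longrightarrow>
      f (v \<oplus>\<^bsub>V\<^esub> v') w = f v w \<oplus>\<^bsub>Z\<^esub> f v' w"
    and "\<And>v w c. v \<in> carrier V \<Longrightarrow> w \<in> carrier W \<Longrightarrow> f (c \<odot>\<^bsub>V\<^esub> v) w = c \<odot>\<^bsub>Z\<^esub> f v w"
  shows "bilinear_map V W Z f"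
  using assms by (auto simp: bilinear_map_def intro!: linear_mapI)

lemma bilinear_mapI2:
  assumes "\<And>v. v \<in> carrier V \<Longrightarrow> linear_map W Z (f v)"
    and "\<And>w. w \<in> carrier W \<Longrightarrow> linear_map V Z (\<lambda>v. f v w)"
  shows "bilinear_map V W Z f"
  using assms by (auto simp: bilinear_map_def)

lemma bilinear_mapD:
  assumes "bilinear_map V W Z f"
  shows "v \<in> carrier V \<Longrightarrow> linear_map W Z (f v)"
    and "w \<in> carrier W \<Longrightarrow> linear_map V Z (\<lambda>v. f v w)"
  using assms by (auto simp: bilinear_map_def)

lemma bilinear_simps:
  assumes "bilinear_map V W Z f"
  shows "v \<in> carrier V \<Longrightarrow> w \<in> carrier W \<Longrightarrow> f v w \<in> carrier Z"
    and "v \<in> carrier V \<Longrightarrow> w \<in> carrier W \<Longrightarrow> w' \<in> carrier W \<Longrightarrow>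
      f v (w \<oplus>\<^bsub>W\<^esub> w') = f v w \<oplus>\<^bsub>Z\<^esub> f v w'"
    and "v \<in> carrier V \<Longrightarrow> w \<in> carrier W \<Longrightarrow> f v (c \<odot>\<^bsub>W\<^esub> w) = c \<odot>\<^bsub>Z\<^esub> f v w"
    and "v \<in> carrier V \<Longrightarrow> v' \<in> carrier V \<Longrightarrow> w \<in> carrier W \<Longrightarrow>
      f (v \<oplus>\<^bsub>V\<^esub> v') w = f v w \<oplus>\<^bsub>Z\<^esub> f v' w"
    and "v \<in> carrier V \<Longrightarrow> w \<in> carrier W \<Longrightarrow> f (c \<odot>\<^bsub>V\<^esub> v) w = c \<odot>\<^bsub>Z\<^esub> f v w"
  using linear_mapD[OF bilinear_mapD(1)[OF assms]] linear_mapD[OF bilinear_mapD(2)[OF assms]]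
  by simp_all

lemma subspaceI:
  assumes "module CC V" "H \<subseteq> carrier V" "\<zero>\<^bsub>V\<^esub> \<in> H"
    and "\<And>x y. x \<in> H \<Longrightarrow> y \<in> H \<Longrightarrow> x \<oplus>\<^bsub>V\<^esub> y \<in> H" "\<And>c x. x \<in> H \<Longrightarrow> c \<odot>\<^bsub>V\<^esub> x \<in> H"
  shows "submodule H CC V"
proof -
  interpret V: module CC V by fact
  have "\<ominus>\<^bsub>V\<^esub> x \<in> H" if "x \<in> H" for x
    using that assms(2,5) by (subst neg_eq_smult[OF assms(1)]) auto
  then show ?thesis using assms by (intro V.submoduleI) auto
qed

lemma subspaceD:
  assumes "module CC V" "submodule H CC V"
  shows "H \<subseteq> carrier V" "\<zero>\<^bsub>V\<^esub> \<in> H" "x \<in> H \<Longrightarrow> y \<in> H \<Longrightarrow> x \<oplus>\<^bsub>V\<^esub> y \<in> H" "x \<in> H \<Longrightarrow> c \<odot>\<^bsub>V\<^esub> x \<in> H"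
    "x \<in> H \<Longrightarrow> \<ominus>\<^bsub>V\<^esub> x \<in> H" "x \<in> H \<Longrightarrow> y \<in> H \<Longrightarrow> x \<ominus>\<^bsub>V\<^esub> y \<in> H"
proof -
  interpret V: module CC V by fact
  note E = V.submoduleE[OF assms(2)]
  show "H \<subseteq> carrier V" "x \<in> H \<Longrightarrow> y \<in> H \<Longrightarrow> x \<oplus>\<^bsub>V\<^esub> y \<in> H" "x \<in> H \<Longrightarrow> c \<odot>\<^bsub>V\<^esub> x \<in> H" "x \<in> H \<Longrightarrow> \<ominus>\<^bsub>V\<^esub> x \<in> H"
     "x \<in> H \<Longrightarrow> y \<in> H \<Longrightarrow> x \<ominus>\<^bsub>V\<^esub> y \<in> H"
    using E by (auto simp: a_minus_def)
  obtain x where "x \<in> H" using E by auto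
  then have "x \<oplus>\<^bsub>V\<^esub> \<ominus>\<^bsub>V\<^esub> x \<in> H" "x \<in> carrier V" using E by auto
  then show "\<zero>\<^bsub>V\<^esub> \<in> H" by (simp add: V.r_neg)
qed

lemma linear_span_superset: "S \<subseteq> linear_span V S"
  by (auto simp: linear_span_def)

lemma linear_span_least: "submodule W CC V \<Longrightarrow> S \<subseteq> W \<Longrightarrow> linear_span V S \<subseteq> W"
  by (auto simp: linear_span_def)

lemma linear_span_subspace:
  assumes V: "module CC V" and S: "S \<subseteq> carrier V"
  shows "submodule (linear_span V S) CC V"
proof -
  interpret V: module CC V by fact
  note c = V.carrier_is_submodule
  show ?thesis
  proof (rule subspaceI[OF V])
    show "linear_span V S \<subseteq> carrier V" using c S by (auto simp: linear_span_def)
  qed (auto simp: linear_span_def subspaceD[OF V])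
qed

lemma subspace_vimage:
  assumes "module CC V" "module CC W" "linear_map V W f" "submodule H CC W"
  shows "submodule {x \<in> carrier V. f x \<in> H} CC V"
proof -
  interpret V: module CC V by fact
  show ?thesis
    by (rule subspaceI[OF assms(1)])
       (auto simp: subspaceD[OF assms(2,4)] linear_mapD[OF assms(3)] linear_map_zero[OF assms(1-3)])
qed

text \<open>
  The preimage of a subspace is a subspace, so membership of the image can be tested on a spanning
  set.
\<close>

lemma linear_map_span:
  assumes "module CC V" "module CC W" "linear_map V W f" "submodule H CC W"
    and "S \<subseteq> carrier V" "\<And>x. x \<in> S \<Longrightarrow> f x \<in> H" "x \<in> linear_span V S"
  shows "f x \<in> H"
  using linear_span_least[OF subspace_vimage[OF assms(1-4)], of S] assms(5-) by auto

lemma linear_map_eq_on_span: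
  assumes "module CC V" "module CC W" "linear_map V W f" "linear_map V W g"
    and "S \<subseteq> carrier V" "\<And>x. x \<in> S \<Longrightarrow> f x = g x" "x \<in> linear_span V S"
  shows "f x = g x"
proof -
  interpret V: module CC V by fact
  have "submodule {x \<in> carrier V. f x = g x} CC V"
    by (rule subspaceI[OF assms(1)])
       (auto simp: linear_mapD[OF assms(3)] linear_mapD[OF assms(4)] linear_map_zero[OF assms(1,2,3)]
         linear_map_zero[OF assms(1,2,4)])
  from linear_span_least[OF this, of S] show ?thesis using assms(5-) by auto
qed

lemma trivial_subspace: "module CC V \<Longrightarrow> submodule {\<zero>\<^bsub>V\<^esub>} CC V"
proof -
  assume V: "module CC V"
  interpret V: module CC V by fact
  show ?thesis by (rule subspaceI[OF V]) auto
qed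

section \<open>Free vector spaces\<close>

lemma free_space_simps [simp]:
  "carrier (free_space S) = {p. Poly_Mapping.keys p \<subseteq> S}" "\<zero>\<^bsub>free_space S\<^esub> = 0"
  "p \<oplus>\<^bsub>free_space S\<^esub> p' = p + p'" "c \<odot>\<^bsub>free_space S\<^esub> p = Poly_Mapping.map (\<lambda>z. c * z) p"
  by (simp_all add: free_space_def)

lemma monoid_algebra_simps [simp]:
  "carrier (monoid_algebra M) = {p. Poly_Mapping.keys p \<subseteq> carrier M}" "\<zero>\<^bsub>monoid_algebra M\<^esub> = 0"
  "p \<oplus>\<^bsub>monoid_algebra M\<^esub> p' = p + p'" "c \<odot>\<^bsub>monoid_algebra M\<^esub> p = Poly_Mapping.map (\<lambda>z. c * z) p"
  "\<one>\<^bsub>monoid_algebra M\<^esub> = basis_vector \<one>\<^bsub>M\<^esub>"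
  by (simp_all add: monoid_algebra_def free_space_def)

lemma lookup_map_strict [simp]:
  "f 0 = 0 \<Longrightarrow> Poly_Mapping.lookup (Poly_Mapping.map f p) k = f (Poly_Mapping.lookup p k)"
  by (simp add: Poly_Mapping.map.rep_eq when_def)

lemma keys_scale:
  fixes c :: complex
  shows "Poly_Mapping.keys (Poly_Mapping.map (\<lambda>z. c * z) p) \<subseteq> Poly_Mapping.keys p"
  by (auto simp: in_keys_iff)

lemma scale_single [simp]:
  fixes c :: complex
  shows "Poly_Mapping.map (\<lambda>z. c * z) (Poly_Mapping.single x b) = Poly_Mapping.single x (c * b)"
  by (rule poly_mapping_eqI) (simp add: lookup_single when_def)

lemma free_space_vector_space: "module CC (free_space S)"
proof (rule vector_spaceI)
  fix p p' :: "'a \<Rightarrow>\<^sub>0 complex" and c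
  assume a: "p \<in> carrier (free_space S)"
  show "c \<odot>\<^bsub>free_space S\<^esub> p \<in> carrier (free_space S)" using a keys_scale[of c p] by auto
  assume "p' \<in> carrier (free_space S)"
  then show "p \<oplus>\<^bsub>free_space S\<^esub> p' \<in> carrier (free_space S)" using a keys_add[of p p'] by auto
qed (auto intro!: poly_mapping_eqI simp: lookup_add algebra_simps)

lemma monoid_algebra_vector_space: "module CC (monoid_algebra M)"
  by (rule vector_space_image[where h = id, OF free_space_vector_space[of "carrier M"]]) auto

lemma linear_map_monoid_algebra:
  "linear_map (monoid_algebra M) V f \<longleftrightarrow> linear_map (free_space (carrier M)) V f"
  "linear_map V (monoid_algebra M) g \<longleftrightarrow> linear_map V (free_space (carrier M)) g"
  by (simp_all add: linear_map_def)

lemma in_span_basis_vectors: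
  assumes W: "submodule W CC (free_space S)" and b: "\<And>x. x \<in> S \<Longrightarrow> basis_vector x \<in> W"
    and p: "p \<in> carrier (free_space S)"
  shows "p \<in> W"
proof -
  note D = subspaceD[OF free_space_vector_space W]
  have s: "Poly_Mapping.single x c \<in> W" if "x \<in> S" for x c
    using D(4)[OF b[OF that], of c] by simp
  have sm: "(\<Sum>x\<in>T. Poly_Mapping.single x (c x)) \<in> W" if "finite T" "T \<subseteq> S" for T c
    using that
  proof (induction T rule: finite_induct)
    case (insert x T)
    then show ?case using D(3)[OF s[of x "c x"]] by simp
  qed (use D(2) in simp)
  have "p = (\<Sum>x\<in>Poly_Mapping.keys p. Poly_Mapping.single x (Poly_Mapping.lookup p x))"
  proof (rule poly_mapping_eqI)
    fix k
    show "Poly_Mapping.lookup p k =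
      Poly_Mapping.lookup (\<Sum>x\<in>Poly_Mapping.keys p. Poly_Mapping.single x (Poly_Mapping.lookup p x)) k"
      by (simp add: lookup_sum lookup_single when_def in_keys_iff)
  qed
  then show ?thesis using sm[of "Poly_Mapping.keys p" "Poly_Mapping.lookup p"] p by simp
qed

lemma free_space_linear_eq:
  assumes V: "module CC V" and f: "linear_map (free_space S) V f" and g: "linear_map (free_space S) V g"
    and eq: "\<And>x. x \<in> S \<Longrightarrow> f (basis_vector x) = g (basis_vector x)" and p: "p \<in> carrier (free_space S)"
  shows "f p = g p"
proof -
  note F = free_space_vector_space[of S]
  have "p \<in> linear_span (free_space S) (basis_vector ` S)"
    by (rule in_span_basis_vectors[OF linear_span_subspace[OF F] _ p])
       (use linear_span_superset[of "basis_vector ` S" "free_space S"] in auto)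
  then show ?thesis by (rule linear_map_eq_on_span[OF F V f g, rotated 2]) (auto simp: eq)
qed

lemma free_space_linear_into:
  assumes V: "module CC V" and f: "linear_map (free_space S) V f" and W: "submodule W CC V"
    and eq: "\<And>x. x \<in> S \<Longrightarrow> f (basis_vector x) \<in> W" and p: "p \<in> carrier (free_space S)"
  shows "f p \<in> W"
  using in_span_basis_vectors[OF subspace_vimage[OF free_space_vector_space V f W] _ p] eq by auto

text \<open>
  Padding the support with zero coefficients gives sums over a common index set, which can be
  added termwise.
\<close>

lemma linear_extension_over:
  assumes V: "module CC V" and f: "\<And>x. x \<in> S \<Longrightarrow> f x \<in> carrier V"
    and T: "finite T" "Poly_Mapping.keys p \<subseteq> T" "T \<subseteq> S"
  shows "linear_extension V f p = (\<Oplus>\<^bsub>V\<^esub>x\<in>T. Poly_Mapping.lookup p x \<odot>\<^bsub>V\<^esub> f x)"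
proof -
  interpret V: module CC V by fact
  show ?thesis unfolding linear_extension_def
    by (rule V.add.finprod_mono_neutral_cong_left)
       (use T f in \<open>auto simp: in_keys_iff subset_eq intro!: V.smult_closed V.smult_l_null[simplified]\<close>)
qed

lemma linear_extension_basis:
  assumes V: "module CC V" and f: "f x \<in> carrier V"
  shows "linear_extension V f (Poly_Mapping.single x c) = c \<odot>\<^bsub>V\<^esub> f x"
proof -
  interpret V: module CC V by fact
  show ?thesis
    by (subst linear_extension_over[OF V, of "{x}" f "{x}"]) (use f in auto)
qed

lemma linear_extension_basis_vector:
  assumes V: "module CC V" and f: "f x \<in> carrier V"
  shows "linear_extension V f (basis_vector x) = f x"
  using linear_extension_basis[of V f x 1, OF assms] module.smult_one[OF V f] by simp

lemma linear_extension_linear: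
  assumes V: "module CC V" and f: "\<And>x. x \<in> S \<Longrightarrow> f x \<in> carrier V"
  shows "linear_map (free_space S) V (linear_extension V f)"
proof -
  interpret V: module CC V by fact
  note over = linear_extension_over[OF V, of S f, OF f]
  have cl: "c \<odot>\<^bsub>V\<^esub> f x \<in> carrier V" if "x \<in> S" for x c using f[OF that] by simp
  show ?thesis
  proof (rule linear_mapI)
    fix p assume p: "p \<in> carrier (free_space S)"
    show "linear_extension V f p \<in> carrier V"
      unfolding linear_extension_def by (rule V.finsum_closed) (use p cl in auto)
    fix c
    show "linear_extension V f (c \<odot>\<^bsub>free_space S\<^esub> p) = c \<odot>\<^bsub>V\<^esub> linear_extension V f p"
    proof -
      let ?T = "Poly_Mapping.keys p"
      have "linear_extension V f (c \<odot>\<^bsub>free_space S\<^esub> p) = (\<Oplus>\<^bsub>V\<^esub>x\<in>?T. (c * Poly_Mapping.lookup p x) \<odot>\<^bsub>V\<^esub> f x)"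
        using over[of ?T "c \<odot>\<^bsub>free_space S\<^esub> p"] keys_scale[of c p] p by simp
      also have "\<dots> = (\<Oplus>\<^bsub>V\<^esub>x\<in>?T. c \<odot>\<^bsub>V\<^esub> (Poly_Mapping.lookup p x \<odot>\<^bsub>V\<^esub> f x))"
        by (rule V.finsum_cong') (use p f cl in \<open>auto simp: V.smult_assoc1[simplified] subset_eq\<close>)
      also have "\<dots> = c \<odot>\<^bsub>V\<^esub> (\<Oplus>\<^bsub>V\<^esub>x\<in>?T. Poly_Mapping.lookup p x \<odot>\<^bsub>V\<^esub> f x)"
        by (rule V.finsum_smult_ldistr[symmetric]) (use p cl in \<open>auto simp: subset_eq\<close>)
      finally show ?thesis by (simp add: linear_extension_def)
    qed
  next
    fix p p' assume p: "p \<in> carrier (free_space S)" "p' \<in> carrier (free_space S)"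
    let ?T = "Poly_Mapping.keys p \<union> Poly_Mapping.keys p'"
    have T: "finite ?T" "?T \<subseteq> S" "Poly_Mapping.keys (p + p') \<subseteq> ?T" using p keys_add[of p p'] by auto
    have "linear_extension V f (p + p') = (\<Oplus>\<^bsub>V\<^esub>x\<in>?T. Poly_Mapping.lookup (p + p') x \<odot>\<^bsub>V\<^esub> f x)"
      by (rule over) (use T in auto)
    also have "\<dots> = (\<Oplus>\<^bsub>V\<^esub>x\<in>?T. Poly_Mapping.lookup p x \<odot>\<^bsub>V\<^esub> f x \<oplus>\<^bsub>V\<^esub> Poly_Mapping.lookup p' x \<odot>\<^bsub>V\<^esub> f x)"
      by (rule V.finsum_cong') (use T cl f in \<open>auto simp: lookup_add V.smult_l_distr[simplified] subset_eq\<close>)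
    also have "\<dots> = (\<Oplus>\<^bsub>V\<^esub>x\<in>?T. Poly_Mapping.lookup p x \<odot>\<^bsub>V\<^esub> f x) \<oplus>\<^bsub>V\<^esub> (\<Oplus>\<^bsub>V\<^esub>x\<in>?T. Poly_Mapping.lookup p' x \<odot>\<^bsub>V\<^esub> f x)"
      by (rule V.finsum_addf) (use T cl in \<open>auto simp: subset_eq\<close>)
    also have "\<dots> = linear_extension V f p \<oplus>\<^bsub>V\<^esub> linear_extension V f p'"
      by (subst over[of ?T p, symmetric], use T in simp_all) (subst over[of ?T p', symmetric], use T in simp_all)
    finally show "linear_extension V f (p \<oplus>\<^bsub>free_space S\<^esub> p') = linear_extension V f p \<oplus>\<^bsub>V\<^esub> linear_extension V f p'"
      by simp
  qed
qed

section \<open>Quotients\<close>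

text \<open>
  The coset map as a function in its own right, so that it can be used as a linear map.
\<close>

definition quotient_class :: "(complex, 'a, 'm) module_scheme \<Rightarrow> 'a set \<Rightarrow> 'a \<Rightarrow> 'a set" where
  "quotient_class V W x = W +>\<^bsub>V\<^esub> x"

lemma quotient_space_simps:
  "carrier (quotient_space V W) = quotient_class V W ` carrier V"
  "\<zero>\<^bsub>quotient_space V W\<^esub> = W"
  "\<one>\<^bsub>quotient_space V W\<^esub> = quotient_class V W \<one>\<^bsub>V\<^esub>"
  "(\<oplus>\<^bsub>quotient_space V W\<^esub>) = set_add V"
  "(\<otimes>\<^bsub>quotient_space V W\<^esub>) = rcoset_mult V W"
  "(\<odot>\<^bsub>quotient_space V W\<^esub>) = (\<lambda>c C. \<Union>x\<in>C. quotient_class V W (c \<odot>\<^bsub>V\<^esub> x))"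
  by (auto simp: quotient_space_def ring.defs module.defs FactRing_def A_RCOSETS_def' quotient_class_def)

context
  fixes V :: "(complex, 'a, 'm) module_scheme" and W :: "'a set"
  assumes V: "module CC V" and W: "submodule W CC V"
begin

interpretation V: module CC V by (rule V)
interpretation W: subgroup W "add_monoid V" using W by (simp add: submodule_def)

lemma quotient_class_normal: "W \<lhd> add_monoid V"
  using V.add.subgroup_imp_normal[OF W.subgroup_axioms] .

lemma quotient_class_eq_iff:
  assumes "x \<in> carrier V" "y \<in> carrier V"
  shows "quotient_class V W x = quotient_class V W y \<longleftrightarrow> x \<ominus>\<^bsub>V\<^esub> y \<in> W"
proof -
  have ag: "abelian_subgroup W V"
    using quotient_class_normal V.abelian_group_axioms by (auto intro!: abelian_subgroupI simp: V.a_comm)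
  have "quotient_class V W x = quotient_class V W y \<longleftrightarrow> x \<in> W +>\<^bsub>V\<^esub> y"
    unfolding quotient_class_def
    using abelian_subgroup.a_repr_independence'[OF ag, of x y] abelian_subgroup.a_rcos_self[OF ag, of x] assms
    by auto
  also have "\<dots> \<longleftrightarrow> x \<ominus>\<^bsub>V\<^esub> y \<in> W"
    using abelian_subgroup.a_rcos_module[OF ag] assms
    by (simp add: a_minus_def)
  finally show ?thesis .
qed

lemma quotient_class_mem:
  assumes "x \<in> carrier V"
  shows "y \<in> quotient_class V W x \<longleftrightarrow> y \<in> carrier V \<and> quotient_class V W y = quotient_class V W x"
proof -
  have ag: "abelian_subgroup W V"
    using quotient_class_normal V.abelian_group_axioms by (auto intro!: abelian_subgroupI simp: V.a_comm)
  show ?thesis unfolding quotient_class_def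
    using abelian_subgroup.a_repr_independence'[OF ag, of y x] abelian_subgroup.a_rcos_self[OF ag, of y]
      abelian_subgroup.a_elemrcos_carrier[OF ag, of x y] assms by auto
qed

lemma quotient_class_eq_zero_iff:
  assumes "x \<in> carrier V"
  shows "quotient_class V W x = W \<longleftrightarrow> x \<in> W"
proof -
  have "quotient_class V W \<zero>\<^bsub>V\<^esub> = W"
    using W.subset unfolding quotient_class_def by (simp add: a_r_coset_def V.add.coset_mult_one)
  then show ?thesis using quotient_class_eq_iff[OF assms, of "\<zero>\<^bsub>V\<^esub>"] assms by (simp add: a_minus_def V.add.inv_one[folded a_inv_def])
qed

lemma quotient_class_zero: "quotient_class V W \<zero>\<^bsub>V\<^esub> = W"
  using quotient_class_eq_zero_iff[of "\<zero>\<^bsub>V\<^esub>"] subspaceD(2)[OF V W] by simp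

lemma quotient_class_add:
  assumes "x \<in> carrier V" "y \<in> carrier V"
  shows "quotient_class V W x \<oplus>\<^bsub>quotient_space V W\<^esub> quotient_class V W y = quotient_class V W (x \<oplus>\<^bsub>V\<^esub> y)"
  using normal.rcos_sum[OF quotient_class_normal] assms
  by (simp add: quotient_space_simps quotient_class_def set_add_def a_r_coset_def)

lemma quotient_class_smult:
  assumes x: "x \<in> carrier V"
  shows "c \<odot>\<^bsub>quotient_space V W\<^esub> quotient_class V W x = quotient_class V W (c \<odot>\<^bsub>V\<^esub> x)"
proof -
  have "quotient_class V W (c \<odot>\<^bsub>V\<^esub> y) = quotient_class V W (c \<odot>\<^bsub>V\<^esub> x)" if "y \<in> quotient_class V W x" for y
  proof -
    have y: "y \<in> carrier V" "y \<ominus>\<^bsub>V\<^esub> x \<in> W"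
      using that quotient_class_mem[OF x, of y] quotient_class_eq_iff[of y x] x by simp_all
    have "c \<odot>\<^bsub>V\<^esub> (y \<ominus>\<^bsub>V\<^esub> x) \<in> W" using subspaceD(4)[OF V W] y by auto
    also have "c \<odot>\<^bsub>V\<^esub> (y \<ominus>\<^bsub>V\<^esub> x) = c \<odot>\<^bsub>V\<^esub> y \<ominus>\<^bsub>V\<^esub> c \<odot>\<^bsub>V\<^esub> x"
      using linear_map_minus[OF V V linear_map_scale[OF V linear_map_id, of c] y(1) x] .
    finally show ?thesis using x y by (subst quotient_class_eq_iff) auto
  qed
  moreover have "x \<in> quotient_class V W x" using x by (simp add: quotient_class_mem)
  ultimately show ?thesis unfolding quotient_space_simps by (intro SUP_eq_const) blast+
qed

lemma quotient_vector_space: "module CC (quotient_space V W)"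
  by (rule vector_space_image[where h = "quotient_class V W", OF V])
     (simp_all add: quotient_space_simps(1,2) quotient_class_add quotient_class_smult quotient_class_zero)

lemma quotient_class_linear: "linear_map V (quotient_space V W) (quotient_class V W)"
  by (rule linear_mapI) (simp_all add: quotient_space_simps(1) quotient_class_add quotient_class_smult)

text \<open>
  Maps out of a quotient are evaluated at a representative picked by the choice operator. Two
  representatives differ by an element of \<open>W\<close>, on which \<open>f\<close> vanishes.
\<close>

lemma quotient_value:
  assumes Z: "module CC Z" and f: "linear_map V Z f" and z: "\<And>x. x \<in> W \<Longrightarrow> f x = \<zero>\<^bsub>Z\<^esub>" and x: "x \<in> carrier V"
  shows "f (SOME y. y \<in> quotient_class V W x) = f x"
proof -
  interpret Z: module CC Z by fact
  define y where "y = (SOME y. y \<in> quotient_class V W x)"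
  have "y \<in> quotient_class V W x"
    unfolding y_def by (rule someI[of _ x]) (use x in \<open>simp add: quotient_class_mem\<close>)
  then have y: "y \<in> carrier V" "y \<ominus>\<^bsub>V\<^esub> x \<in> W"
    using quotient_class_mem[OF x, of y] quotient_class_eq_iff[of y x] x by simp_all
  have fx: "f x \<in> carrier Z" and fy: "f y \<in> carrier Z" using linear_mapD(1)[OF f] x y by blast+
  have "f y \<ominus>\<^bsub>Z\<^esub> f x = \<zero>\<^bsub>Z\<^esub>"
    unfolding linear_map_minus[OF V Z f y(1) x, symmetric] by (rule z[OF y(2)])
  then have "f y = \<ominus>\<^bsub>Z\<^esub> (\<ominus>\<^bsub>Z\<^esub> f x)"
    unfolding a_minus_def using Z.minus_equality[of "f y" "\<ominus>\<^bsub>Z\<^esub> f x"] fx fy Z.a_inv_closed by metis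
  then have "f y = f x" using Z.minus_minus[OF fx] by (rule trans)
  then show ?thesis by (simp add: y_def)
qed

lemma quotient_lift_linear:
  assumes Z: "module CC Z" and f: "linear_map V Z f" and z: "\<And>x. x \<in> W \<Longrightarrow> f x = \<zero>\<^bsub>Z\<^esub>"
  shows "linear_map (quotient_space V W) Z (\<lambda>C. f (SOME y. y \<in> C))"
proof -
  note val = quotient_value[OF Z f z]
  show ?thesis
  proof (rule linear_mapI)
    fix C assume "C \<in> carrier (quotient_space V W)"
    then obtain x where x: "x \<in> carrier V" "C = quotient_class V W x" by (auto simp: quotient_space_simps(1))
    show "f (SOME y. y \<in> C) \<in> carrier Z" using x by (simp add: val linear_mapD[OF f])
    show "f (SOME y. y \<in> c \<odot>\<^bsub>quotient_space V W\<^esub> C) = c \<odot>\<^bsub>Z\<^esub> f (SOME y. y \<in> C)" for c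
      using x by (simp add: val linear_mapD[OF f] quotient_class_smult)
    fix C' assume "C' \<in> carrier (quotient_space V W)"
    then obtain x' where x': "x' \<in> carrier V" "C' = quotient_class V W x'" by (auto simp: quotient_space_simps(1))
    show "f (SOME y. y \<in> C \<oplus>\<^bsub>quotient_space V W\<^esub> C') = f (SOME y. y \<in> C) \<oplus>\<^bsub>Z\<^esub> f (SOME y. y \<in> C')"
      using x x' by (simp add: val linear_mapD[OF f] quotient_class_add)
  qed
qed

end

section \<open>Complex algebras\<close>

lemma complex_algebraI:
  assumes V: "module CC A"
    and "\<And>x y. x \<in> carrier A \<Longrightarrow> y \<in> carrier A \<Longrightarrow> x \<otimes>\<^bsub>A\<^esub> y \<in> carrier A" "\<one>\<^bsub>A\<^esub> \<in> carrier A"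
    and "\<And>x y z. x \<in> carrier A \<Longrightarrow> y \<in> carrier A \<Longrightarrow> z \<in> carrier A \<Longrightarrow>
      (x \<otimes>\<^bsub>A\<^esub> y) \<otimes>\<^bsub>A\<^esub> z = x \<otimes>\<^bsub>A\<^esub> (y \<otimes>\<^bsub>A\<^esub> z)"
    and "\<And>x. x \<in> carrier A \<Longrightarrow> \<one>\<^bsub>A\<^esub> \<otimes>\<^bsub>A\<^esub> x = x" "\<And>x. x \<in> carrier A \<Longrightarrow> x \<otimes>\<^bsub>A\<^esub> \<one>\<^bsub>A\<^esub> = x"
    and "\<And>x y z. x \<in> carrier A \<Longrightarrow> y \<in> carrier A \<Longrightarrow> z \<in> carrier A \<Longrightarrow>
      (x \<oplus>\<^bsub>A\<^esub> y) \<otimes>\<^bsub>A\<^esub> z = x \<otimes>\<^bsub>A\<^esub> z \<oplus>\<^bsub>A\<^esub> y \<otimes>\<^bsub>A\<^esub> z"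
    and "\<And>x y z. x \<in> carrier A \<Longrightarrow> y \<in> carrier A \<Longrightarrow> z \<in> carrier A \<Longrightarrow>
      z \<otimes>\<^bsub>A\<^esub> (x \<oplus>\<^bsub>A\<^esub> y) = z \<otimes>\<^bsub>A\<^esub> x \<oplus>\<^bsub>A\<^esub> z \<otimes>\<^bsub>A\<^esub> y"
    and "\<And>c x y. x \<in> carrier A \<Longrightarrow> y \<in> carrier A \<Longrightarrow> (c \<odot>\<^bsub>A\<^esub> x) \<otimes>\<^bsub>A\<^esub> y = c \<odot>\<^bsub>A\<^esub> (x \<otimes>\<^bsub>A\<^esub> y)"
    and "\<And>c x y. x \<in> carrier A \<Longrightarrow> y \<in> carrier A \<Longrightarrow> x \<otimes>\<^bsub>A\<^esub> (c \<odot>\<^bsub>A\<^esub> y) = c \<odot>\<^bsub>A\<^esub> (x \<otimes>\<^bsub>A\<^esub> y)"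
  shows "complex_algebra A"
proof -
  interpret V: module CC A by fact
  have "ring A" by (rule ringI) (use assms in \<open>auto intro!: monoidI V.abelian_group_axioms\<close>)
  then show ?thesis using assms by (auto simp: complex_algebra_def)
qed

lemma complex_algebraD:
  assumes "complex_algebra A"
  shows "ring A" "module CC A"
    "x \<in> carrier A \<Longrightarrow> y \<in> carrier A \<Longrightarrow> (c \<odot>\<^bsub>A\<^esub> x) \<otimes>\<^bsub>A\<^esub> y = c \<odot>\<^bsub>A\<^esub> (x \<otimes>\<^bsub>A\<^esub> y)"
    "x \<in> carrier A \<Longrightarrow> y \<in> carrier A \<Longrightarrow> x \<otimes>\<^bsub>A\<^esub> (c \<odot>\<^bsub>A\<^esub> y) = c \<odot>\<^bsub>A\<^esub> (x \<otimes>\<^bsub>A\<^esub> y)"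
  using assms by (auto simp: complex_algebra_def)

lemma complex_algebra_simps:
  assumes "complex_algebra A"
  shows "x \<in> carrier A \<Longrightarrow> y \<in> carrier A \<Longrightarrow> x \<otimes>\<^bsub>A\<^esub> y \<in> carrier A"
    "x \<in> carrier A \<Longrightarrow> y \<in> carrier A \<Longrightarrow> x \<oplus>\<^bsub>A\<^esub> y \<in> carrier A"
    "x \<in> carrier A \<Longrightarrow> c \<odot>\<^bsub>A\<^esub> x \<in> carrier A"
    "x \<in> carrier A \<Longrightarrow> \<ominus>\<^bsub>A\<^esub> x \<in> carrier A"
    "x \<in> carrier A \<Longrightarrow> y \<in> carrier A \<Longrightarrow> x \<ominus>\<^bsub>A\<^esub> y \<in> carrier A"
    "\<one>\<^bsub>A\<^esub> \<in> carrier A" "\<zero>\<^bsub>A\<^esub> \<in> carrier A"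
    "x \<in> carrier A \<Longrightarrow> \<one>\<^bsub>A\<^esub> \<otimes>\<^bsub>A\<^esub> x = x" "x \<in> carrier A \<Longrightarrow> x \<otimes>\<^bsub>A\<^esub> \<one>\<^bsub>A\<^esub> = x"
    "x \<in> carrier A \<Longrightarrow> 1 \<odot>\<^bsub>A\<^esub> x = x"
    "x \<in> carrier A \<Longrightarrow> 0 \<odot>\<^bsub>A\<^esub> x = \<zero>\<^bsub>A\<^esub>"
    "x \<in> carrier A \<Longrightarrow> b \<odot>\<^bsub>A\<^esub> (c \<odot>\<^bsub>A\<^esub> x) = (b * c) \<odot>\<^bsub>A\<^esub> x"
    "x \<in> carrier A \<Longrightarrow> y \<in> carrier A \<Longrightarrow> (c \<odot>\<^bsub>A\<^esub> x) \<otimes>\<^bsub>A\<^esub> y = c \<odot>\<^bsub>A\<^esub> (x \<otimes>\<^bsub>A\<^esub> y)"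
    "x \<in> carrier A \<Longrightarrow> y \<in> carrier A \<Longrightarrow> x \<otimes>\<^bsub>A\<^esub> (c \<odot>\<^bsub>A\<^esub> y) = c \<odot>\<^bsub>A\<^esub> (x \<otimes>\<^bsub>A\<^esub> y)"
    "x \<in> carrier A \<Longrightarrow> y \<in> carrier A \<Longrightarrow> z \<in> carrier A \<Longrightarrow>
      (x \<otimes>\<^bsub>A\<^esub> y) \<otimes>\<^bsub>A\<^esub> z = x \<otimes>\<^bsub>A\<^esub> (y \<otimes>\<^bsub>A\<^esub> z)"
    "x \<in> carrier A \<Longrightarrow> y \<in> carrier A \<Longrightarrow> z \<in> carrier A \<Longrightarrow>
      (x \<oplus>\<^bsub>A\<^esub> y) \<otimes>\<^bsub>A\<^esub> z = x \<otimes>\<^bsub>A\<^esub> z \<oplus>\<^bsub>A\<^esub> y \<otimes>\<^bsub>A\<^esub> z"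
    "x \<in> carrier A \<Longrightarrow> y \<in> carrier A \<Longrightarrow> z \<in> carrier A \<Longrightarrow>
      z \<otimes>\<^bsub>A\<^esub> (x \<oplus>\<^bsub>A\<^esub> y) = z \<otimes>\<^bsub>A\<^esub> x \<oplus>\<^bsub>A\<^esub> z \<otimes>\<^bsub>A\<^esub> y"
    "x \<in> carrier A \<Longrightarrow> y \<in> carrier A \<Longrightarrow> c \<odot>\<^bsub>A\<^esub> (x \<oplus>\<^bsub>A\<^esub> y) = c \<odot>\<^bsub>A\<^esub> x \<oplus>\<^bsub>A\<^esub> c \<odot>\<^bsub>A\<^esub> y"
proof -
  interpret ring A using assms by (rule complex_algebraD)
  interpret V: module CC A using assms by (rule complex_algebraD)
  show "x \<in> carrier A \<Longrightarrow> b \<odot>\<^bsub>A\<^esub> (c \<odot>\<^bsub>A\<^esub> x) = (b * c) \<odot>\<^bsub>A\<^esub> x"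
    using V.smult_assoc1[of b c x] by simp
  show "x \<in> carrier A \<Longrightarrow> 0 \<odot>\<^bsub>A\<^esub> x = \<zero>\<^bsub>A\<^esub>" "x \<in> carrier A \<Longrightarrow> 1 \<odot>\<^bsub>A\<^esub> x = x"
    using V.smult_l_null[of x] V.smult_one[of x] by auto
qed (use complex_algebraD[OF assms] in
  \<open>auto intro: module.smult_closed ring.ring_simprules simp: ring.ring_simprules module.smult_r_distr monoid.r_one ring.is_monoid\<close>)

lemma complex_algebra_mult_linear:
  assumes "complex_algebra A" "x \<in> carrier A"
  shows "linear_map A A (\<lambda>y. x \<otimes>\<^bsub>A\<^esub> y)" "linear_map A A (\<lambda>y. y \<otimes>\<^bsub>A\<^esub> x)"
  using assms(2) by (auto intro!: linear_mapI simp: complex_algebra_simps[OF assms(1)])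

lemma complex_algebra_mult_bilinear: "complex_algebra A \<Longrightarrow> bilinear_map A A A (monoid.mult A)"
  by (intro bilinear_mapI2 complex_algebra_mult_linear)

lemma complex_algebra_image:
  assumes A: "complex_algebra A" and im: "carrier Q = h ` carrier A"
    and add: "\<And>x y. x \<in> carrier A \<Longrightarrow> y \<in> carrier A \<Longrightarrow> h x \<oplus>\<^bsub>Q\<^esub> h y = h (x \<oplus>\<^bsub>A\<^esub> y)"
    and smult: "\<And>c x. x \<in> carrier A \<Longrightarrow> c \<odot>\<^bsub>Q\<^esub> h x = h (c \<odot>\<^bsub>A\<^esub> x)"
    and zero: "\<zero>\<^bsub>Q\<^esub> = h \<zero>\<^bsub>A\<^esub>"
    and mult: "\<And>x y. x \<in> carrier A \<Longrightarrow> y \<in> carrier A \<Longrightarrow> h x \<otimes>\<^bsub>Q\<^esub> h y = h (x \<otimes>\<^bsub>A\<^esub> y)"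
    and one: "\<one>\<^bsub>Q\<^esub> = h \<one>\<^bsub>A\<^esub>"
  shows "complex_algebra Q"
proof (rule complex_algebraI)
  show "module CC Q" by (rule vector_space_image[OF complex_algebraD(2)[OF A]]) (use assms in auto)
qed (auto simp: im add smult mult one complex_algebra_simps[OF A])

lemma algebra_mapI:
  assumes "linear_map A B f"
    and "\<And>x y. x \<in> carrier A \<Longrightarrow> y \<in> carrier A \<Longrightarrow> f (x \<otimes>\<^bsub>A\<^esub> y) = f x \<otimes>\<^bsub>B\<^esub> f y"
    and "f \<one>\<^bsub>A\<^esub> = \<one>\<^bsub>B\<^esub>"
  shows "algebra_map A B f"
  using assms linear_mapD[OF assms(1)] by (auto simp: algebra_map_def ring_hom_def)

lemma algebra_mapD:
  assumes "algebra_map A B f"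
  shows "linear_map A B f"
    "x \<in> carrier A \<Longrightarrow> y \<in> carrier A \<Longrightarrow> f (x \<otimes>\<^bsub>A\<^esub> y) = f x \<otimes>\<^bsub>B\<^esub> f y"
    "f \<one>\<^bsub>A\<^esub> = \<one>\<^bsub>B\<^esub>"
  using assms by (auto simp: algebra_map_def ring_hom_def)

lemmas algebra_map_simps = linear_mapD[OF algebra_mapD(1)] algebra_mapD(2,3)

lemma algebra_map_comp:
  "algebra_map A B f \<Longrightarrow> algebra_map B C g \<Longrightarrow> algebra_map A C (\<lambda>x. g (f x))"
  by (rule algebra_mapI) (auto intro: linear_map_comp dest: algebra_mapD simp: algebra_map_simps)

lemma algebra_map_id: "algebra_map A A (\<lambda>x. x)"
  by (rule algebra_mapI) (auto intro: linear_map_id)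

text \<open>Multiplicativity is a bilinear condition, so that it suffices to verify it on a spanning set.\<close>

lemma algebra_map_on_span:
  assumes A: "complex_algebra A" and B: "complex_algebra B" and f: "linear_map A B f"
    and S: "S \<subseteq> carrier A" "carrier A \<subseteq> linear_span A S"
    and m: "\<And>x y. x \<in> S \<Longrightarrow> y \<in> S \<Longrightarrow> f (x \<otimes>\<^bsub>A\<^esub> y) = f x \<otimes>\<^bsub>B\<^esub> f y"
    and one: "f \<one>\<^bsub>A\<^esub> = \<one>\<^bsub>B\<^esub>"
  shows "algebra_map A B f"
proof (rule algebra_mapI[OF f _ one])
  note mA = complex_algebra_mult_linear[OF A] and mB = complex_algebra_mult_linear[OF B]
  note VA = complex_algebraD(2)[OF A] and VB = complex_algebraD(2)[OF B]
  have *: "f (x \<otimes>\<^bsub>A\<^esub> y) = f x \<otimes>\<^bsub>B\<^esub> f y" if x: "x \<in> S" and y: "y \<in> carrier A" for x y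
  proof (rule linear_map_eq_on_span[OF VA VB _ _ S(1) m[OF x]])
    have x': "x \<in> carrier A" using x S by auto
    show "linear_map A B (\<lambda>y. f (x \<otimes>\<^bsub>A\<^esub> y))" by (rule linear_map_comp[OF mA(1)[OF x'] f])
    show "linear_map A B (\<lambda>y. f x \<otimes>\<^bsub>B\<^esub> f y)"
      by (rule linear_map_comp[OF f mB(1)[OF linear_mapD(1)[OF f x']]])
    show "y \<in> linear_span A S" using y S by auto
  qed
  show "f (x \<otimes>\<^bsub>A\<^esub> y) = f x \<otimes>\<^bsub>B\<^esub> f y" if x: "x \<in> carrier A" and y: "y \<in> carrier A" for x y
  proof (rule linear_map_eq_on_span[OF VA VB _ _ S(1) *[OF _ y]])
    show "linear_map A B (\<lambda>x. f (x \<otimes>\<^bsub>A\<^esub> y))" by (rule linear_map_comp[OF mA(2)[OF y] f])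
    show "linear_map A B (\<lambda>x. f x \<otimes>\<^bsub>B\<^esub> f y)"
      by (rule linear_map_comp[OF f mB(2)[OF linear_mapD(1)[OF f y]]])
    show "x \<in> linear_span A S" using x S by auto
  qed
qed

lemma complex_space_simps [simp]:
  "carrier complex_space = UNIV" "\<one>\<^bsub>complex_space\<^esub> = 1" "\<zero>\<^bsub>complex_space\<^esub> = 0"
  "x \<oplus>\<^bsub>complex_space\<^esub> y = x + y" "x \<otimes>\<^bsub>complex_space\<^esub> y = x * y" "c \<odot>\<^bsub>complex_space\<^esub> y = c * y"
  by (simp_all add: complex_space_def ring.defs module.defs ring_of_type_algebra_def)

lemma complex_space_algebra: "complex_algebra complex_space"
  by (rule complex_algebraI, rule vector_spaceI) (auto simp: algebra_simps)

text \<open>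
  Antihomomorphisms into \<open>A\<close>, such as antipodes, are homomorphisms into the opposite
  algebra, so that results on homomorphisms apply to them.
\<close>

definition opposite_algebra :: "(complex, 'a, 'm) module_scheme \<Rightarrow> (complex, 'a, 'm) module_scheme" where
  "opposite_algebra A = A\<lparr>monoid.mult := (\<lambda>x y. y \<otimes>\<^bsub>A\<^esub> x)\<rparr>"

lemma opposite_algebra_simps [simp]:
  "carrier (opposite_algebra A) = carrier A" "\<one>\<^bsub>opposite_algebra A\<^esub> = \<one>\<^bsub>A\<^esub>"
  "\<zero>\<^bsub>opposite_algebra A\<^esub> = \<zero>\<^bsub>A\<^esub>" "ring.add (opposite_algebra A) = ring.add A"
  "module.smult (opposite_algebra A) = module.smult A" "x \<otimes>\<^bsub>opposite_algebra A\<^esub> y = y \<otimes>\<^bsub>A\<^esub> x"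
  by (simp_all add: opposite_algebra_def)

lemma opposite_algebra: "complex_algebra A \<Longrightarrow> complex_algebra (opposite_algebra A)"
  by (rule complex_algebraI)
     (auto simp: complex_algebra_simps
       intro: vector_space_image[where h = id, OF complex_algebraD(2)])

lemma linear_map_opposite [simp]: "linear_map A (opposite_algebra B) f \<longleftrightarrow> linear_map A B f"
  by (simp add: linear_map_def)

section \<open>Monoid algebras and their quotients\<close>

text \<open>
  The product may be summed over any finite sets that contain the supports; with common index sets
  bilinearity becomes a computation with sums.
\<close>

lemma monoid_algebra_mult_over:
  assumes "finite S" "Poly_Mapping.keys p \<subseteq> S" "finite T" "Poly_Mapping.keys p' \<subseteq> T"
  shows "p \<otimes>\<^bsub>monoid_algebra M\<^esub> p' = (\<Sum>x\<in>S. \<Sum>y\<in>T. Poly_Mapping.single (x \<otimes>\<^bsub>M\<^esub> y)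
    (Poly_Mapping.lookup p x * Poly_Mapping.lookup p' y))"
proof -
  have "p \<otimes>\<^bsub>monoid_algebra M\<^esub> p' = (\<Sum>x\<in>Poly_Mapping.keys p. \<Sum>y\<in>Poly_Mapping.keys p'.
      Poly_Mapping.single (x \<otimes>\<^bsub>M\<^esub> y) (Poly_Mapping.lookup p x * Poly_Mapping.lookup p' y))"
    by (simp add: monoid_algebra_def free_space_def)
  also have "\<dots> = (\<Sum>x\<in>Poly_Mapping.keys p. \<Sum>y\<in>T.
      Poly_Mapping.single (x \<otimes>\<^bsub>M\<^esub> y) (Poly_Mapping.lookup p x * Poly_Mapping.lookup p' y))"
    by (intro sum.cong refl sum.mono_neutral_left) (use assms in \<open>auto simp: in_keys_iff\<close>)
  also have "\<dots> = (\<Sum>x\<in>S. \<Sum>y\<in>T.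
      Poly_Mapping.single (x \<otimes>\<^bsub>M\<^esub> y) (Poly_Mapping.lookup p x * Poly_Mapping.lookup p' y))"
    by (rule sum.mono_neutral_left) (use assms in \<open>auto simp: in_keys_iff\<close>)
  finally show ?thesis .
qed

lemma monoid_algebra_mult_single [simp]:
  "Poly_Mapping.single x a \<otimes>\<^bsub>monoid_algebra M\<^esub> Poly_Mapping.single y b
   = Poly_Mapping.single (x \<otimes>\<^bsub>M\<^esub> y) (a * b)"
  by (subst monoid_algebra_mult_over[of "{x}" _ "{y}"]) auto

lemma scale_sum:
  fixes c :: complex
  shows "Poly_Mapping.map (\<lambda>z. c * z) (\<Sum>x\<in>S. f x) = (\<Sum>x\<in>S. Poly_Mapping.map (\<lambda>z. c * z) (f x))"
  by (rule poly_mapping_eqI) (simp add: lookup_sum sum_distrib_left)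

lemma monoid_algebra_mult_bilinear:
  assumes "monoid M"
  shows "bilinear_map (monoid_algebra M) (monoid_algebra M) (monoid_algebra M) (monoid.mult (monoid_algebra M))"
proof (rule bilinear_mapI)
  interpret monoid M by fact
  let ?k = "Poly_Mapping.keys"
  fix v w w' v' :: "'a \<Rightarrow>\<^sub>0 complex" and c
  assume vw: "v \<in> carrier (monoid_algebra M)" "w \<in> carrier (monoid_algebra M)"
  have "?k (\<Sum>x\<in>?k v. \<Sum>y\<in>?k w. Poly_Mapping.single (x \<otimes>\<^bsub>M\<^esub> y)
      (Poly_Mapping.lookup v x * Poly_Mapping.lookup w y)) \<subseteq> carrier M"
  proof -
    have s: "x \<in> carrier M \<Longrightarrow> y \<in> carrier M \<Longrightarrow> ?k (Poly_Mapping.single (x \<otimes>\<^bsub>M\<^esub> y) b) \<subseteq> carrier M"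
      for x y and b :: complex by auto
    have sm: "(\<And>i. i \<in> I \<Longrightarrow> ?k (g i) \<subseteq> carrier M) \<Longrightarrow> ?k (sum g I) \<subseteq> carrier M"
      for g :: "'a \<Rightarrow> 'a \<Rightarrow>\<^sub>0 complex" and I
    proof (induction I rule: infinite_finite_induct)
      case (insert x F)
      then show ?case using keys_add[of "g x" "sum g F"] by auto
    qed auto
    show ?thesis by (intro sm s) (use vw in auto)
  qed
  then show "v \<otimes>\<^bsub>monoid_algebra M\<^esub> w \<in> carrier (monoid_algebra M)"
    by (simp add: monoid_algebra_mult_over[of "?k v" _ "?k w"])
  show "v \<otimes>\<^bsub>monoid_algebra M\<^esub> (w \<oplus>\<^bsub>monoid_algebra M\<^esub> w') =
      v \<otimes>\<^bsub>monoid_algebra M\<^esub> w \<oplus>\<^bsub>monoid_algebra M\<^esub> v \<otimes>\<^bsub>monoid_algebra M\<^esub> w'"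
    by (simp add: monoid_algebra_mult_over[of "?k v" _ "?k w \<union> ?k w'"] keys_add
      lookup_add single_add[symmetric] sum.distrib[symmetric] distrib_left)
  show "v \<otimes>\<^bsub>monoid_algebra M\<^esub> (c \<odot>\<^bsub>monoid_algebra M\<^esub> w) = c \<odot>\<^bsub>monoid_algebra M\<^esub> (v \<otimes>\<^bsub>monoid_algebra M\<^esub> w)"
    by (simp add: monoid_algebra_mult_over[of "?k v" _ "?k w"] keys_scale scale_sum mult.assoc mult.left_commute)
  show "(c \<odot>\<^bsub>monoid_algebra M\<^esub> v) \<otimes>\<^bsub>monoid_algebra M\<^esub> w = c \<odot>\<^bsub>monoid_algebra M\<^esub> (v \<otimes>\<^bsub>monoid_algebra M\<^esub> w)"
    by (simp add: monoid_algebra_mult_over[of "?k v" _ "?k w"] keys_scale scale_sum mult.assoc mult.left_commute)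
  show "(v \<oplus>\<^bsub>monoid_algebra M\<^esub> v') \<otimes>\<^bsub>monoid_algebra M\<^esub> w =
      v \<otimes>\<^bsub>monoid_algebra M\<^esub> w \<oplus>\<^bsub>monoid_algebra M\<^esub> v' \<otimes>\<^bsub>monoid_algebra M\<^esub> w"
    by (simp add: monoid_algebra_mult_over[of "?k v \<union> ?k v'" _ "?k w"] keys_add
      lookup_add single_add[symmetric] sum.distrib[symmetric] distrib_right)
qed

lemma monoid_algebra_linear_eq:
  assumes "module CC V" "linear_map (monoid_algebra M) V f" "linear_map (monoid_algebra M) V g"
    "\<And>x. x \<in> carrier M \<Longrightarrow> f (basis_vector x) = g (basis_vector x)" "p \<in> carrier (monoid_algebra M)"
  shows "f p = g p"
  using assms free_space_linear_eq[of V "carrier M" f g p] by (simp add: linear_map_monoid_algebra)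

lemma monoid_algebra_linear_into:
  assumes V: "module CC V" and f: "linear_map (monoid_algebra M) V f" and W: "submodule W CC V"
    and eq: "\<And>x. x \<in> carrier M \<Longrightarrow> f (basis_vector x) \<in> W" and p: "p \<in> carrier (monoid_algebra M)"
  shows "f p \<in> W"
  using free_space_linear_into[of V "carrier M" f W p] assms by (simp add: linear_map_monoid_algebra)

lemma monoid_algebra_spanned:
  "carrier (monoid_algebra M) \<subseteq> linear_span (monoid_algebra M) (basis_vector ` carrier M)"
proof
  fix p assume p: "p \<in> carrier (monoid_algebra M)"
  let ?S = "basis_vector ` carrier M :: ('a \<Rightarrow>\<^sub>0 complex) set"
  have "submodule (linear_span (monoid_algebra M) ?S) CC (monoid_algebra M)"
    by (rule linear_span_subspace[OF monoid_algebra_vector_space]) auto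
  from monoid_algebra_linear_into[OF monoid_algebra_vector_space linear_map_id this _ p]
  show "p \<in> linear_span (monoid_algebra M) ?S"
    using linear_span_superset[of ?S "monoid_algebra M"] by blast
qed

lemma monoid_algebra_algebra:
  assumes M: "monoid M"
  shows "complex_algebra (monoid_algebra M)"
proof -
  interpret monoid M by fact
  note V = monoid_algebra_vector_space[of M]
  note B = monoid_algebra_mult_bilinear[OF M]
  note b = bilinear_simps[OF B] and L = bilinear_mapD(1)[OF B] and R = bilinear_mapD(2)[OF B]
  let ?A = "monoid_algebra M"
  have bv: "basis_vector x \<in> carrier ?A" if "x \<in> carrier M" for x using that by simp
  show ?thesis
  proof (rule complex_algebraI[OF V])
    fix x assume x: "x \<in> carrier ?A"
    show "\<one>\<^bsub>?A\<^esub> \<otimes>\<^bsub>?A\<^esub> x = x"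
      by (rule monoid_algebra_linear_eq[OF V L linear_map_id _ x]) auto
    show "x \<otimes>\<^bsub>?A\<^esub> \<one>\<^bsub>?A\<^esub> = x"
      by (rule monoid_algebra_linear_eq[OF V R linear_map_id _ x]) auto
    fix y z assume y: "y \<in> carrier ?A" and z: "z \<in> carrier ?A"
    have 1: "(basis_vector u \<otimes>\<^bsub>?A\<^esub> basis_vector v) \<otimes>\<^bsub>?A\<^esub> z = basis_vector u \<otimes>\<^bsub>?A\<^esub> (basis_vector v \<otimes>\<^bsub>?A\<^esub> z)"
      if "u \<in> carrier M" "v \<in> carrier M" for u v
      by (rule monoid_algebra_linear_eq[OF V L linear_map_comp[OF L L] _ z])
         (use that in \<open>auto simp: m_assoc\<close>)
    have 2: "(basis_vector u \<otimes>\<^bsub>?A\<^esub> y) \<otimes>\<^bsub>?A\<^esub> z = basis_vector u \<otimes>\<^bsub>?A\<^esub> (y \<otimes>\<^bsub>?A\<^esub> z)" if u: "u \<in> carrier M" for u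
      by (rule monoid_algebra_linear_eq[OF V linear_map_comp[OF L[OF bv[OF u]] R[OF z]]
             linear_map_comp[OF R[OF z] L[OF bv[OF u]]] 1 y]) (use u in auto)
    show "(x \<otimes>\<^bsub>?A\<^esub> y) \<otimes>\<^bsub>?A\<^esub> z = x \<otimes>\<^bsub>?A\<^esub> (y \<otimes>\<^bsub>?A\<^esub> z)"
      by (rule monoid_algebra_linear_eq[OF V linear_map_comp[OF R[OF y] R[OF z]] R[OF b(1)[OF y z]] 2 x])
  qed (use b in auto)
qed

lemma ideal_subspace:
  assumes A: "complex_algebra A" and I: "ideal I A"
  shows "submodule I CC A"
proof (rule subspaceI[OF complex_algebraD(2)[OF A]])
  interpret ideal I A by fact
  show s: "I \<subseteq> carrier A" by (rule a_subset)
  show "c \<odot>\<^bsub>A\<^esub> x \<in> I" if "x \<in> I" for c x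
  proof -
    have "(c \<odot>\<^bsub>A\<^esub> \<one>\<^bsub>A\<^esub>) \<otimes>\<^bsub>A\<^esub> x \<in> I" by (rule I_l_closed[OF that]) (simp add: complex_algebra_simps[OF A])
    then show ?thesis using that s by (auto simp: complex_algebra_simps[OF A] subset_eq)
  qed
qed (auto simp: additive_subgroup.zero_closed[OF ideal.axioms(1)[OF I]] additive_subgroup.a_closed[OF ideal.axioms(1)[OF I]])

lemma quotient_algebra:
  assumes A: "complex_algebra A" and I: "ideal I A"
  shows "complex_algebra (quotient_space A I)" "algebra_map A (quotient_space A I) (quotient_class A I)"
proof -
  interpret ideal I A by fact
  note V = complex_algebraD(2)[OF A] and W = ideal_subspace[OF A I]
  have mult: "quotient_class A I x \<otimes>\<^bsub>quotient_space A I\<^esub> quotient_class A I y = quotient_class A I (x \<otimes>\<^bsub>A\<^esub> y)"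
    if "x \<in> carrier A" "y \<in> carrier A" for x y
    using rcoset_mult_add[OF that] by (simp add: quotient_space_simps quotient_class_def)
  show "complex_algebra (quotient_space A I)"
    by (rule complex_algebra_image[where h = "quotient_class A I", OF A])
       (simp_all add: quotient_space_simps(1-3) quotient_class_add[OF V W] quotient_class_smult[OF V W]
         quotient_class_zero[OF V W] mult)
  show "algebra_map A (quotient_space A I) (quotient_class A I)"
    by (rule algebra_mapI[OF quotient_class_linear[OF V W]]) (simp_all add: mult quotient_space_simps(3))
qed

lemma quotient_algebra_lift:
  assumes A: "complex_algebra A" and I: "ideal I A" and B: "complex_algebra B"
    and f: "algebra_map A B f" and z: "\<And>x. x \<in> I \<Longrightarrow> f x = \<zero>\<^bsub>B\<^esub>"
  shows "algebra_map (quotient_space A I) B (\<lambda>C. f (SOME x. x \<in> C))"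
proof (rule algebra_mapI)
  note V = complex_algebraD(2)[OF A] and W = ideal_subspace[OF A I] and VB = complex_algebraD(2)[OF B]
  note Q = quotient_algebra[OF A I]
  note val = quotient_value[OF V W VB algebra_mapD(1)[OF f] z]
  show "linear_map (quotient_space A I) B (\<lambda>C. f (SOME x. x \<in> C))"
    by (rule quotient_lift_linear[OF V W VB algebra_mapD(1)[OF f] z])
  show "f (SOME x. x \<in> \<one>\<^bsub>quotient_space A I\<^esub>) = \<one>\<^bsub>B\<^esub>"
    using val complex_algebra_simps(6)[OF A] algebra_mapD(3)[OF f] by (simp add: quotient_space_simps(3))
  fix C D assume "C \<in> carrier (quotient_space A I)" "D \<in> carrier (quotient_space A I)"
  then obtain x y where xy: "x \<in> carrier A" "y \<in> carrier A"
    and CD: "C = quotient_class A I x" "D = quotient_class A I y"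
    by (auto simp: quotient_space_simps(1))
  have CD': "C \<otimes>\<^bsub>quotient_space A I\<^esub> D = quotient_class A I (x \<otimes>\<^bsub>A\<^esub> y)"
    using algebra_mapD(2)[OF Q(2)] xy CD by simp
  show "f (SOME x. x \<in> C \<otimes>\<^bsub>quotient_space A I\<^esub> D) = f (SOME x. x \<in> C) \<otimes>\<^bsub>B\<^esub> f (SOME x. x \<in> D)"
    unfolding CD' unfolding CD using xy by (simp add: val complex_algebra_simps[OF A] algebra_mapD(2)[OF f])
qed

text \<open>
  Monoid elements span the algebra, so that absorption of the elements of \<open>R\<close> by them
  carries over to the whole algebra by bilinearity.
\<close>

lemma span_ideal:
  assumes M: "monoid M" and R: "R \<subseteq> carrier (monoid_algebra M)"
    and l: "\<And>x r. x \<in> carrier M \<Longrightarrow> r \<in> R \<Longrightarrow>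
      basis_vector x \<otimes>\<^bsub>monoid_algebra M\<^esub> r \<in> linear_span (monoid_algebra M) R"
    and r: "\<And>x r. x \<in> carrier M \<Longrightarrow> r \<in> R \<Longrightarrow>
      r \<otimes>\<^bsub>monoid_algebra M\<^esub> basis_vector x \<in> linear_span (monoid_algebra M) R"
  shows "ideal (linear_span (monoid_algebra M) R) (monoid_algebra M)"
proof -
  let ?A = "monoid_algebra M"
  let ?I = "linear_span ?A R"
  note A = monoid_algebra_algebra[OF M]
  note V = complex_algebraD(2)[OF A]
  note W = linear_span_subspace[OF V R]
  note mult = complex_algebra_mult_linear[OF A]
  show ?thesis
  proof (rule idealI)
    show "ring ?A" by (rule complex_algebraD(1)[OF A])
    show "subgroup ?I (add_monoid ?A)" using W by (simp add: submodule_def)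
    fix a p assume a: "a \<in> ?I" and p: "p \<in> carrier ?A"
    have a': "a \<in> carrier ?A" using a subspaceD(1)[OF V W] by auto
    show "p \<otimes>\<^bsub>?A\<^esub> a \<in> ?I"
    proof (rule monoid_algebra_linear_into[OF V mult(2)[OF a'] W _ p])
      fix x assume x: "x \<in> carrier M"
      show "basis_vector x \<otimes>\<^bsub>?A\<^esub> a \<in> ?I"
        by (rule linear_map_span[OF V V mult(1) W R l[OF x] a]) (use x in simp)
    qed
    show "a \<otimes>\<^bsub>?A\<^esub> p \<in> ?I"
    proof (rule monoid_algebra_linear_into[OF V mult(1)[OF a'] W _ p])
      fix x assume x: "x \<in> carrier M"
      show "a \<otimes>\<^bsub>?A\<^esub> basis_vector x \<in> ?I"
        by (rule linear_map_span[OF V V mult(2) W R r[OF x] a]) (use x in simp)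
    qed
  qed
qed

lemma monoid_algebra_lift:
  assumes M: "monoid M" and B: "complex_algebra B" and f: "\<And>x. x \<in> carrier M \<Longrightarrow> f x \<in> carrier B"
    and m: "\<And>x y. x \<in> carrier M \<Longrightarrow> y \<in> carrier M \<Longrightarrow> f (x \<otimes>\<^bsub>M\<^esub> y) = f x \<otimes>\<^bsub>B\<^esub> f y"
    and one: "f \<one>\<^bsub>M\<^esub> = \<one>\<^bsub>B\<^esub>"
  shows "algebra_map (monoid_algebra M) B (linear_extension B f)"
proof -
  interpret monoid M by fact
  note VB = complex_algebraD(2)[OF B]
  have lb: "linear_extension B f (basis_vector x) = f x" if "x \<in> carrier M" for x
    by (rule linear_extension_basis_vector[of B f x, OF VB f[OF that]])
  show ?thesis
  proof (rule algebra_map_on_span[OF monoid_algebra_algebra[OF M] B _ _ monoid_algebra_spanned])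
    show "linear_map (monoid_algebra M) B (linear_extension B f)"
      using linear_extension_linear[OF VB f] by (simp add: linear_map_monoid_algebra)
    show "linear_extension B f \<one>\<^bsub>monoid_algebra M\<^esub> = \<one>\<^bsub>B\<^esub>" using lb one by simp
  qed (auto simp: lb m)
qed

section \<open>Tensor products\<close>

lemma DirProd_simps [simp]:
  "carrier (V \<times>\<times> W) = carrier V \<times> carrier W" "\<one>\<^bsub>V \<times>\<times> W\<^esub> = (\<one>\<^bsub>V\<^esub>, \<one>\<^bsub>W\<^esub>)"
  "(a, b) \<otimes>\<^bsub>V \<times>\<times> W\<^esub> (a', b') = (a \<otimes>\<^bsub>V\<^esub> a', b \<otimes>\<^bsub>W\<^esub> b')"
  by (simp_all add: DirProd_def)

lemma monoid_algebra_minus: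
  assumes "p \<in> carrier (monoid_algebra M)" "p' \<in> carrier (monoid_algebra M)"
  shows "p \<ominus>\<^bsub>monoid_algebra M\<^esub> p' = p - p'"
  unfolding a_minus_def neg_eq_smult[OF monoid_algebra_vector_space assms(2)]
  by (rule poly_mapping_eqI) (simp add: lookup_add lookup_minus)

lemma keys_minus_subset:
  fixes p p' :: "'a \<Rightarrow>\<^sub>0 complex"
  assumes "Poly_Mapping.keys p \<subseteq> S" "Poly_Mapping.keys p' \<subseteq> S"
  shows "Poly_Mapping.keys (p - p') \<subseteq> S"
  using assms by (auto simp: in_keys_iff lookup_minus) (metis diff_zero in_keys_iff subsetD)

lemma linear_map_diff_basis:
  assumes Z: "module CC Z" and E: "linear_map (monoid_algebra M) Z f"
    and p: "p \<in> carrier (monoid_algebra M)" "p' \<in> carrier (monoid_algebra M)"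
  shows "f (p - p') = f p \<ominus>\<^bsub>Z\<^esub> f p'" "p - p' \<in> carrier (monoid_algebra M)"
  using linear_map_minus[OF monoid_algebra_vector_space Z E p] monoid_algebra_minus[OF p]
    keys_minus_subset[of p _ p'] p by auto

lemma minus_minus_cancel:
  assumes "module CC Z" "a \<in> carrier Z"
  shows "b \<in> carrier Z \<Longrightarrow> a \<oplus>\<^bsub>Z\<^esub> b \<ominus>\<^bsub>Z\<^esub> a \<ominus>\<^bsub>Z\<^esub> b = \<zero>\<^bsub>Z\<^esub>" "a \<ominus>\<^bsub>Z\<^esub> a = \<zero>\<^bsub>Z\<^esub>"
proof -
  interpret Z: module CC Z by fact
  have "a \<oplus>\<^bsub>Z\<^esub> b \<ominus>\<^bsub>Z\<^esub> a = b" if "b \<in> carrier Z" using that assms by (simp add: a_minus_def Z.a_comm[of a b] Z.a_assoc Z.r_neg)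
  then show "b \<in> carrier Z \<Longrightarrow> a \<oplus>\<^bsub>Z\<^esub> b \<ominus>\<^bsub>Z\<^esub> a \<ominus>\<^bsub>Z\<^esub> b = \<zero>\<^bsub>Z\<^esub>" "a \<ominus>\<^bsub>Z\<^esub> a = \<zero>\<^bsub>Z\<^esub>"
    using assms by (simp_all add: a_minus_def Z.r_neg)
qed

lemma tensor_relations_subset:
  assumes "module CC V" "module CC W"
  shows "tensor_relations V W \<subseteq> carrier (monoid_algebra (V \<times>\<times> W))"
proof -
  interpret V: module CC V by fact
  interpret W: module CC W by fact
  show ?thesis unfolding tensor_relations_def
    by (intro Un_least subsetI; elim CollectE exE conjE) (simp_all add: keys_minus_subset)
qed

lemma tensor_relations_members:
  "v \<in> carrier V \<Longrightarrow> v' \<in> carrier V \<Longrightarrow> w \<in> carrier W \<Longrightarrow>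
    basis_vector (v \<oplus>\<^bsub>V\<^esub> v', w) - basis_vector (v, w) - basis_vector (v', w) \<in> tensor_relations V W"
  "v \<in> carrier V \<Longrightarrow> w \<in> carrier W \<Longrightarrow> w' \<in> carrier W \<Longrightarrow>
    basis_vector (v, w \<oplus>\<^bsub>W\<^esub> w') - basis_vector (v, w) - basis_vector (v, w') \<in> tensor_relations V W"
  "v \<in> carrier V \<Longrightarrow> w \<in> carrier W \<Longrightarrow>
    basis_vector (c \<odot>\<^bsub>V\<^esub> v, w) - Poly_Mapping.single (v, w) c \<in> tensor_relations V W"
  "v \<in> carrier V \<Longrightarrow> w \<in> carrier W \<Longrightarrow>
    basis_vector (v, c \<odot>\<^bsub>W\<^esub> w) - Poly_Mapping.single (v, w) c \<in> tensor_relations V W"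
  unfolding tensor_relations_def by blast+

lemma pure_tensor_class:
  "pure_tensor V W v w = quotient_class (monoid_algebra (V \<times>\<times> W)) (tensor_kernel V W) (basis_vector (v, w))"
  by (simp add: pure_tensor_def quotient_class_def)

context
  fixes V :: "(complex, 'a, 'm) module_scheme" and W :: "(complex, 'b, 'n) module_scheme"
  assumes V: "module CC V" and W: "module CC W"
begin

interpretation V: module CC V by (rule V)
interpretation W: module CC W by (rule W)

lemma tensor_kernel_subspace: "submodule (tensor_kernel V W) CC (monoid_algebra (V \<times>\<times> W))"
  by (rule linear_span_subspace[OF monoid_algebra_vector_space tensor_relations_subset[OF V W]])

lemma tensor_vector_space: "module CC (tensor V W)"
  unfolding tensor_def by (rule quotient_vector_space[OF monoid_algebra_vector_space tensor_kernel_subspace])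

lemma tensor_class_linear:
  "linear_map (monoid_algebra (V \<times>\<times> W)) (tensor V W) (quotient_class (monoid_algebra (V \<times>\<times> W)) (tensor_kernel V W))"
  unfolding tensor_def by (rule quotient_class_linear[OF monoid_algebra_vector_space tensor_kernel_subspace])

lemma tensor_class_eqI:
  assumes r: "p - p' \<in> tensor_relations V W"
    and p: "p \<in> carrier (monoid_algebra (V \<times>\<times> W))" "p' \<in> carrier (monoid_algebra (V \<times>\<times> W))"
  shows "quotient_class (monoid_algebra (V \<times>\<times> W)) (tensor_kernel V W) p
    = quotient_class (monoid_algebra (V \<times>\<times> W)) (tensor_kernel V W) p'"
  unfolding quotient_class_eq_iff[OF monoid_algebra_vector_space tensor_kernel_subspace p] monoid_algebra_minus[OF p]
  by (rule subsetD[OF linear_span_superset r])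

lemma pure_tensor_bilinear: "bilinear_map V W (tensor V W) (pure_tensor V W)"
proof (rule bilinear_mapI)
  let ?M = "monoid_algebra (V \<times>\<times> W)"
  let ?c = "quotient_class ?M (tensor_kernel V W)"
  note L = linear_mapD[OF tensor_class_linear]
  have s: "Poly_Mapping.single (v, w) c \<in> carrier ?M" if "v \<in> carrier V" "w \<in> carrier W" for v w c
    using that by auto
  have cs: "?c (Poly_Mapping.single (v, w) c) = c \<odot>\<^bsub>tensor V W\<^esub> pure_tensor V W v w"
    if "v \<in> carrier V" "w \<in> carrier W" for v w c
    using L(3)[OF s[OF that, of 1], of c] by (simp add: pure_tensor_class)
  have ca: "?c (basis_vector (v, w) + basis_vector (v', w')) = pure_tensor V W v w \<oplus>\<^bsub>tensor V W\<^esub> pure_tensor V W v' w'"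
    if "v \<in> carrier V" "w \<in> carrier W" "v' \<in> carrier V" "w' \<in> carrier W" for v w v' w'
    using L(2)[OF s[OF that(1,2), of 1] s[OF that(3,4), of 1]] by (simp add: pure_tensor_class)
  have sa: "p \<in> carrier ?M \<Longrightarrow> p' \<in> carrier ?M \<Longrightarrow> p + p' \<in> carrier ?M" for p p'
    using keys_add[of p p'] by auto
  fix v v' w w' c assume vw: "v \<in> carrier V" "w \<in> carrier W"
  show "pure_tensor V W v w \<in> carrier (tensor V W)"
    using L(1)[OF s[OF vw, of 1]] by (simp add: pure_tensor_class)
  show "pure_tensor V W v (c \<odot>\<^bsub>W\<^esub> w) = c \<odot>\<^bsub>tensor V W\<^esub> pure_tensor V W v w"
    unfolding cs[OF vw, symmetric] unfolding pure_tensor_class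
  proof (rule tensor_class_eqI)
    show "basis_vector (v, c \<odot>\<^bsub>W\<^esub> w) - Poly_Mapping.single (v, w) c \<in> tensor_relations V W"
      by (intro tensor_relations_members vw)
  qed (intro s vw W.smult_closed, simp, intro s vw)
  show "pure_tensor V W (c \<odot>\<^bsub>V\<^esub> v) w = c \<odot>\<^bsub>tensor V W\<^esub> pure_tensor V W v w"
    unfolding cs[OF vw, symmetric] unfolding pure_tensor_class
  proof (rule tensor_class_eqI)
    show "basis_vector (c \<odot>\<^bsub>V\<^esub> v, w) - Poly_Mapping.single (v, w) c \<in> tensor_relations V W"
      by (intro tensor_relations_members vw)
  qed (intro s vw V.smult_closed, simp, intro s vw)
  show "pure_tensor V W v (w \<oplus>\<^bsub>W\<^esub> w') = pure_tensor V W v w \<oplus>\<^bsub>tensor V W\<^esub> pure_tensor V W v w'"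
    if w': "w' \<in> carrier W"
    unfolding ca[OF vw vw(1) w', symmetric] unfolding pure_tensor_class
  proof (rule tensor_class_eqI)
    show "basis_vector (v, w \<oplus>\<^bsub>W\<^esub> w') - (basis_vector (v, w) + basis_vector (v, w')) \<in> tensor_relations V W"
      unfolding diff_diff_eq[symmetric] by (intro tensor_relations_members vw w')
  qed (intro sa s vw w' W.a_closed)+
  show "pure_tensor V W (v \<oplus>\<^bsub>V\<^esub> v') w = pure_tensor V W v w \<oplus>\<^bsub>tensor V W\<^esub> pure_tensor V W v' w"
    if v': "v' \<in> carrier V"
    unfolding ca[OF vw v' vw(2), symmetric] unfolding pure_tensor_class
  proof (rule tensor_class_eqI)
    show "basis_vector (v \<oplus>\<^bsub>V\<^esub> v', w) - (basis_vector (v, w) + basis_vector (v', w)) \<in> tensor_relations V W"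
      unfolding diff_diff_eq[symmetric] by (intro tensor_relations_members vw v')
  qed (intro sa s vw v' V.a_closed)+
qed

lemmas pure_tensor_simps = bilinear_simps[OF pure_tensor_bilinear]

lemma tensor_linear_into:
  assumes Z: "module CC Z" and f: "linear_map (tensor V W) Z f" and H: "submodule H CC Z"
    and p: "\<And>v w. v \<in> carrier V \<Longrightarrow> w \<in> carrier W \<Longrightarrow> f (pure_tensor V W v w) \<in> H"
    and t: "t \<in> carrier (tensor V W)"
  shows "f t \<in> H"
proof -
  let ?M = "monoid_algebra (V \<times>\<times> W)"
  let ?c = "quotient_class ?M (tensor_kernel V W)"
  obtain x where x: "x \<in> carrier ?M" "t = ?c x"
    using t unfolding tensor_def quotient_space_simps(1) by auto
  show ?thesis unfolding x(2)
    by (rule monoid_algebra_linear_into[OF Z linear_map_comp[OF tensor_class_linear f] H _ x(1)])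
       (use p in \<open>auto simp: pure_tensor_class\<close>)
qed

lemma tensor_spanned:
  "carrier (tensor V W) \<subseteq> linear_span (tensor V W) {pure_tensor V W v w | v w. v \<in> carrier V \<and> w \<in> carrier W}"
    (is "_ \<subseteq> linear_span _ ?P")
proof
  fix t assume t: "t \<in> carrier (tensor V W)"
  have "submodule (linear_span (tensor V W) ?P) CC (tensor V W)"
    by (rule linear_span_subspace[OF tensor_vector_space]) (auto simp: pure_tensor_simps)
  then show "t \<in> linear_span (tensor V W) ?P"
    by (rule tensor_linear_into[OF tensor_vector_space linear_map_id _ _ t])
       (use linear_span_superset[of ?P "tensor V W"] in blast)
qed

text \<open>
  Pure tensors span, so that a linear map on a tensor product is determined by its values on them.
\<close>

lemma tensor_linear_eq:
  assumes Z: "module CC Z" and f: "linear_map (tensor V W) Z f" and g: "linear_map (tensor V W) Z g"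
    and p: "\<And>v w. v \<in> carrier V \<Longrightarrow> w \<in> carrier W \<Longrightarrow> f (pure_tensor V W v w) = g (pure_tensor V W v w)"
    and t: "t \<in> carrier (tensor V W)"
  shows "f t = g t"
  by (rule linear_map_eq_on_span[OF tensor_vector_space Z f g, rotated 2])
     (use tensor_spanned t p in \<open>auto simp: pure_tensor_simps\<close>)

text \<open>
  The two facts behind the universal property: the linear extension of a bilinear map kills the
  bilinearity relations, hence their span.
\<close>

lemma tensor_lift_aux:
  assumes Z: "module CC Z" and f: "bilinear_map V W Z f"
  shows "linear_map (monoid_algebra (V \<times>\<times> W)) Z (linear_extension Z (\<lambda>(v, w). f v w))"
    and "x \<in> tensor_kernel V W \<Longrightarrow> linear_extension Z (\<lambda>(v, w). f v w) x = \<zero>\<^bsub>Z\<^esub>"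
proof -
  interpret Z: module CC Z by fact
  note b = bilinear_simps[OF f]
  let ?M = "monoid_algebra (V \<times>\<times> W)"
  let ?E = "linear_extension Z (\<lambda>(v, w). f v w)"
  have E: "linear_map ?M Z ?E"
    using linear_extension_linear[OF Z, of "carrier V \<times> carrier W" "\<lambda>(v, w). f v w"] b(1)
    by (auto simp: linear_map_monoid_algebra)
  then show "linear_map ?M Z ?E" .
  have s: "?E (Poly_Mapping.single (v, w) c) = c \<odot>\<^bsub>Z\<^esub> f v w" if "v \<in> carrier V" "w \<in> carrier W" for v w c
    using linear_extension_basis[OF Z, of "\<lambda>(v, w). f v w" "(v, w)" c] b(1)[OF that] by simp
  have s1: "?E (basis_vector (v, w)) = f v w" if "v \<in> carrier V" "w \<in> carrier W" for v w
    using linear_extension_basis_vector[OF Z, of "\<lambda>(v, w). f v w" "(v, w)"] b(1)[OF that] by simp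
  note d = linear_map_diff_basis[OF Z E]
  have sc: "Poly_Mapping.single (v, w) c \<in> carrier ?M" if "v \<in> carrier V" "w \<in> carrier W" for v w c
    using that by auto
  note z = minus_minus_cancel[OF Z]
  assume "x \<in> tensor_kernel V W"
  then have "?E x \<in> {\<zero>\<^bsub>Z\<^esub>}"
  proof (rule linear_map_span[OF monoid_algebra_vector_space Z E trivial_subspace[OF Z]
        tensor_relations_subset[OF V W], rotated])
    fix r assume "r \<in> tensor_relations V W"
    then show "?E r \<in> {\<zero>\<^bsub>Z\<^esub>}"
      unfolding tensor_relations_def
      by (auto simp del: monoid_algebra_simps(1) simp add: d sc s s1 b z Z.smult_one[simplified])
  qed
  then show "?E x = \<zero>\<^bsub>Z\<^esub>" by simp
qed

lemma tensor_lift_linear: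
  assumes Z: "module CC Z" and f: "bilinear_map V W Z f"
  shows "linear_map (tensor V W) Z (tensor_lift Z f)"
  using quotient_lift_linear[OF monoid_algebra_vector_space tensor_kernel_subspace Z tensor_lift_aux[OF Z f]]
  by (simp add: tensor_def tensor_lift_def[abs_def])

lemma tensor_lift_pure:
  assumes Z: "module CC Z" and f: "bilinear_map V W Z f" and vw: "v \<in> carrier V" "w \<in> carrier W"
  shows "tensor_lift Z f (pure_tensor V W v w) = f v w"
proof -
  have b: "basis_vector (v, w) \<in> carrier (monoid_algebra (V \<times>\<times> W))" using vw by simp
  have "linear_extension Z (\<lambda>(v, w). f v w)
      (SOME p. p \<in> quotient_class (monoid_algebra (V \<times>\<times> W)) (tensor_kernel V W) (basis_vector (v, w)))
    = linear_extension Z (\<lambda>(v, w). f v w) (basis_vector (v, w))"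
    by (rule quotient_value[OF monoid_algebra_vector_space tensor_kernel_subspace Z tensor_lift_aux[OF Z f] b])
  then show ?thesis
    using linear_extension_basis_vector[OF Z, of "\<lambda>(v, w). f v w" "(v, w)"] bilinear_simps(1)[OF f vw]
    by (simp add: tensor_lift_def pure_tensor_class)
qed

end

lemma tensor_map_bilinear:
  assumes "module CC V'" "module CC W'" "linear_map V V' f" "linear_map W W' g"
  shows "bilinear_map V W (tensor V' W') (\<lambda>v w. pure_tensor V' W' (f v) (g w))"
  by (rule bilinear_mapI)
     (simp_all add: linear_mapD[OF assms(3)] linear_mapD[OF assms(4)] pure_tensor_simps[OF assms(1,2)])

lemma tensor_map_linear:
  assumes "module CC V" "module CC W" "module CC V'" "module CC W'" "linear_map V V' f" "linear_map W W' g"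
  shows "linear_map (tensor V W) (tensor V' W') (tensor_map V' W' f g)"
  unfolding tensor_map_def
  by (intro tensor_lift_linear tensor_map_bilinear tensor_vector_space assms)

lemma tensor_map_pure:
  assumes "module CC V" "module CC W" "module CC V'" "module CC W'" "linear_map V V' f" "linear_map W W' g"
    and "v \<in> carrier V" "w \<in> carrier W"
  shows "tensor_map V' W' f g (pure_tensor V W v w) = pure_tensor V' W' (f v) (g w)"
  unfolding tensor_map_def
  by (intro tensor_lift_pure tensor_map_bilinear tensor_vector_space assms)

text \<open>
  The associator is obtained by lifting twice. With the last factor held fixed the inner map is
  bilinear in the first two, and the lifted map depends linearly on the last factor.
\<close>

lemma tensor_assoc_inner:
  assumes U: "module CC U" and V: "module CC V" and W: "module CC W" and w: "w \<in> carrier W"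
  shows "bilinear_map U V (tensor U (tensor V W)) (\<lambda>u v. pure_tensor U (tensor V W) u (pure_tensor V W v w))"
proof -
  note VW = tensor_vector_space[OF V W]
  show ?thesis
    by (rule bilinear_mapI) (simp_all add: pure_tensor_simps[OF U VW] pure_tensor_simps[OF V W] w)
qed

lemma tensor_assoc_bilinear:
  assumes U: "module CC U" and V: "module CC V" and W: "module CC W"
  shows "bilinear_map (tensor U V) W (tensor U (tensor V W))
    (\<lambda>t w. tensor_lift (tensor U (tensor V W))
       (\<lambda>u v. pure_tensor U (tensor V W) u (pure_tensor V W v w)) t)"
proof -
  interpret V: module CC V by fact
  interpret W: module CC W by fact
  note VW = tensor_vector_space[OF V W] and UV = tensor_vector_space[OF U V]
  note Z = tensor_vector_space[OF U VW]
  note p = pure_tensor_simps[OF U VW] pure_tensor_simps[OF V W]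
  note inner = tensor_assoc_inner[OF U V W]
  note L = tensor_lift_linear[OF U V Z inner] and P = tensor_lift_pure[OF U V Z inner]
  show ?thesis
  proof (rule bilinear_mapI2)
    fix w assume w: "w \<in> carrier W"
    show "linear_map (tensor U V) (tensor U (tensor V W))
      (\<lambda>t. tensor_lift (tensor U (tensor V W)) (\<lambda>u v. pure_tensor U (tensor V W) u (pure_tensor V W v w)) t)"
      by (rule L[OF w])
  next
    fix t assume t: "t \<in> carrier (tensor U V)"
    show "linear_map W (tensor U (tensor V W))
      (\<lambda>w. tensor_lift (tensor U (tensor V W)) (\<lambda>u v. pure_tensor U (tensor V W) u (pure_tensor V W v w)) t)"
    proof (rule linear_mapI)
      fix w c assume w: "w \<in> carrier W"
      show "tensor_lift (tensor U (tensor V W)) (\<lambda>u v. pure_tensor U (tensor V W) u (pure_tensor V W v w)) t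
        \<in> carrier (tensor U (tensor V W))" by (rule linear_mapD(1)[OF L[OF w] t])
      show "tensor_lift (tensor U (tensor V W)) (\<lambda>u v. pure_tensor U (tensor V W) u (pure_tensor V W v (c \<odot>\<^bsub>W\<^esub> w))) t
        = c \<odot>\<^bsub>tensor U (tensor V W)\<^esub> tensor_lift (tensor U (tensor V W)) (\<lambda>u v. pure_tensor U (tensor V W) u (pure_tensor V W v w)) t"
        by (rule tensor_linear_eq[OF U V Z L linear_map_scale[OF Z L[OF w]] _ t])
           (simp_all add: w P p)
      fix w' assume w': "w' \<in> carrier W"
      show "tensor_lift (tensor U (tensor V W)) (\<lambda>u v. pure_tensor U (tensor V W) u (pure_tensor V W v (w \<oplus>\<^bsub>W\<^esub> w'))) t
        = tensor_lift (tensor U (tensor V W)) (\<lambda>u v. pure_tensor U (tensor V W) u (pure_tensor V W v w)) t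
        \<oplus>\<^bsub>tensor U (tensor V W)\<^esub> tensor_lift (tensor U (tensor V W)) (\<lambda>u v. pure_tensor U (tensor V W) u (pure_tensor V W v w')) t"
        by (rule tensor_linear_eq[OF U V Z L linear_map_add[OF Z L[OF w] L[OF w']] _ t])
           (simp_all add: w w' P p)
    qed
  qed
qed

lemma tensor_assoc_linear:
  assumes U: "module CC U" and V: "module CC V" and W: "module CC W"
  shows "linear_map (tensor (tensor U V) W) (tensor U (tensor V W)) (tensor_assoc U V W)"
  unfolding tensor_assoc_def
  by (intro tensor_lift_linear tensor_assoc_bilinear tensor_vector_space assms)

lemma tensor_assoc_pure:
  assumes U: "module CC U" and V: "module CC V" and W: "module CC W"
    and u: "u \<in> carrier U" "v \<in> carrier V" "w \<in> carrier W"
  shows "tensor_assoc U V W (pure_tensor (tensor U V) W (pure_tensor U V u v) w)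
    = pure_tensor U (tensor V W) u (pure_tensor V W v w)"
proof -
  note VW = tensor_vector_space[OF V W] and UV = tensor_vector_space[OF U V]
  note Z = tensor_vector_space[OF U VW]
  show ?thesis
    unfolding tensor_assoc_def
    using tensor_lift_pure[OF UV W Z tensor_assoc_bilinear[OF U V W] pure_tensor_simps(1)[OF U V u(1,2)] u(3)]
      tensor_lift_pure[OF U V Z tensor_assoc_inner[OF U V W u(3)] u(1,2)] by simp
qed

section \<open>Tensor products of algebras\<close>

context
  fixes A :: "(complex, 'a, 'm) module_scheme" and B :: "(complex, 'b, 'n) module_scheme"
  assumes A: "complex_algebra A" and B: "complex_algebra B"
begin

interpretation A: ring A using A by (rule complex_algebraD)
interpretation B: ring B using B by (rule complex_algebraD)

lemma tensor_monoid: "monoid (A \<times>\<times> B)"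
  by (rule monoidI) (auto simp: A.m_assoc B.m_assoc)

text \<open>
  Multiplying a bilinearity relation by a pair \<open>(a, b)\<close> gives a relation of the same
  kind, because multiplication is bilinear in each of the two algebras.
\<close>

lemma tensor_kernel_ideal: "ideal (tensor_kernel A B) (monoid_algebra (A \<times>\<times> B))"
proof -
  note VA = complex_algebraD(2)[OF A] and VB = complex_algebraD(2)[OF B]
  let ?M = "monoid_algebra (A \<times>\<times> B)"
  note S = complex_algebra_simps[OF A] complex_algebra_simps[OF B]
  note K = monoid_algebra_algebra[OF tensor_monoid]
  interpret K: ring ?M using K by (rule complex_algebraD)
  note mult = complex_algebra_mult_linear[OF K]
  note VK = monoid_algebra_vector_space[of "A \<times>\<times> B"]
  have sc: "Poly_Mapping.single (v, w) c \<in> carrier ?M" if "v \<in> carrier A" "w \<in> carrier B" for v w c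
    using that by auto
  note mc = linear_map_diff_basis(2)[OF VK linear_map_id]
  have l: "z \<otimes>\<^bsub>?M\<^esub> (p - p') = z \<otimes>\<^bsub>?M\<^esub> p - z \<otimes>\<^bsub>?M\<^esub> p'"
    and r: "(p - p') \<otimes>\<^bsub>?M\<^esub> z = p \<otimes>\<^bsub>?M\<^esub> z - p' \<otimes>\<^bsub>?M\<^esub> z"
    if "p \<in> carrier ?M" "p' \<in> carrier ?M" "z \<in> carrier ?M" for p p' z
    using linear_map_minus[OF VK VK mult(1)[OF that(3)] that(1,2)]
      linear_map_minus[OF VK VK mult(2)[OF that(3)] that(1,2)] that
    by (simp_all del: monoid_algebra_simps(1) add: monoid_algebra_minus)
  have in_rel: "basis_vector x \<otimes>\<^bsub>?M\<^esub> r \<in> tensor_relations A B \<and> r \<otimes>\<^bsub>?M\<^esub> basis_vector x \<in> tensor_relations A B"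
    if x: "x \<in> carrier (A \<times>\<times> B)" and rr: "r \<in> tensor_relations A B" for x r
  proof -
    obtain a b where ab: "x = (a, b)" "a \<in> carrier A" "b \<in> carrier B" using x by auto
    note sm = l r mc sc ab S
    from rr consider
      v v' w where "r = basis_vector (v \<oplus>\<^bsub>A\<^esub> v', w) - basis_vector (v, w) - basis_vector (v', w)"
        "v \<in> carrier A" "v' \<in> carrier A" "w \<in> carrier B"
    | v w w' where "r = basis_vector (v, w \<oplus>\<^bsub>B\<^esub> w') - basis_vector (v, w) - basis_vector (v, w')"
        "v \<in> carrier A" "w \<in> carrier B" "w' \<in> carrier B"
    | c v w where "r = basis_vector (c \<odot>\<^bsub>A\<^esub> v, w) - Poly_Mapping.single (v, w) c"
        "v \<in> carrier A" "w \<in> carrier B"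
    | c v w where "r = basis_vector (v, c \<odot>\<^bsub>B\<^esub> w) - Poly_Mapping.single (v, w) c"
        "v \<in> carrier A" "w \<in> carrier B"
      unfolding tensor_relations_def by blast
    then show ?thesis
      by cases (simp_all del: monoid_algebra_simps(1) add: sm tensor_relations_members)
  qed
  show ?thesis
    by (rule span_ideal[OF tensor_monoid tensor_relations_subset[OF VA VB]])
       (use in_rel linear_span_superset[of "tensor_relations A B" ?M] in blast)+
qed

lemma tensor_algebra_structure: "complex_algebra (tensor A B)"
  unfolding tensor_def by (rule quotient_algebra[OF monoid_algebra_algebra[OF tensor_monoid] tensor_kernel_ideal])

lemma pure_tensor_mult:
  assumes "a \<in> carrier A" "b \<in> carrier B" "a' \<in> carrier A" "b' \<in> carrier B"
  shows "pure_tensor A B a b \<otimes>\<^bsub>tensor A B\<^esub> pure_tensor A B a' b' = pure_tensor A B (a \<otimes>\<^bsub>A\<^esub> a') (b \<otimes>\<^bsub>B\<^esub> b')"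
  using algebra_mapD(2)[OF quotient_algebra(2)[OF monoid_algebra_algebra[OF tensor_monoid] tensor_kernel_ideal],
      of "basis_vector (a, b)" "basis_vector (a', b')"] assms
  by (simp add: pure_tensor_class tensor_def)

lemma pure_tensor_one: "\<one>\<^bsub>tensor A B\<^esub> = pure_tensor A B \<one>\<^bsub>A\<^esub> \<one>\<^bsub>B\<^esub>"
  by (simp add: pure_tensor_class tensor_def quotient_space_simps)

lemma tensor_algebra_mapI:
  assumes C: "complex_algebra C" and f: "linear_map (tensor A B) C f"
    and m: "\<And>a b a' b'. a \<in> carrier A \<Longrightarrow> b \<in> carrier B \<Longrightarrow> a' \<in> carrier A \<Longrightarrow> b' \<in> carrier B \<Longrightarrow>
      f (pure_tensor A B (a \<otimes>\<^bsub>A\<^esub> a') (b \<otimes>\<^bsub>B\<^esub> b')) = f (pure_tensor A B a b) \<otimes>\<^bsub>C\<^esub> f (pure_tensor A B a' b')"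
    and one: "f (pure_tensor A B \<one>\<^bsub>A\<^esub> \<one>\<^bsub>B\<^esub>) = \<one>\<^bsub>C\<^esub>"
  shows "algebra_map (tensor A B) C f"
proof (rule algebra_map_on_span[OF tensor_algebra_structure C f _ tensor_spanned])
  note VA = complex_algebraD(2)[OF A] and VB = complex_algebraD(2)[OF B]
  show "module CC A" "module CC B" by fact+
  show "{pure_tensor A B v w |v w. v \<in> carrier A \<and> w \<in> carrier B} \<subseteq> carrier (tensor A B)"
    by (auto simp: pure_tensor_simps[OF VA VB])
  show "f \<one>\<^bsub>tensor A B\<^esub> = \<one>\<^bsub>C\<^esub>" by (simp add: pure_tensor_one one)
qed (auto simp: pure_tensor_mult m)

end

lemma tensor_map_algebra_map:
  assumes A: "complex_algebra A" and B: "complex_algebra B" and C: "complex_algebra C" and D: "complex_algebra D"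
    and f: "algebra_map A C f" and g: "algebra_map B D g"
  shows "algebra_map (tensor A B) (tensor C D) (tensor_map C D f g)"
proof (rule tensor_algebra_mapI[OF A B tensor_algebra_structure[OF C D]])
  note V = complex_algebraD(2)[OF A] complex_algebraD(2)[OF B] complex_algebraD(2)[OF C] complex_algebraD(2)[OF D]
  note p = tensor_map_pure[OF V algebra_mapD(1)[OF f] algebra_mapD(1)[OF g]]
  show "linear_map (tensor A B) (tensor C D) (tensor_map C D f g)"
    by (rule tensor_map_linear[OF V algebra_mapD(1)[OF f] algebra_mapD(1)[OF g]])
qed (simp_all add: tensor_map_pure[OF complex_algebraD(2)[OF A] complex_algebraD(2)[OF B]
       complex_algebraD(2)[OF C] complex_algebraD(2)[OF D] algebra_mapD(1)[OF f] algebra_mapD(1)[OF g]]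
     complex_algebra_simps[OF A] complex_algebra_simps[OF B] algebra_map_simps[OF f] algebra_map_simps[OF g]
     pure_tensor_mult[OF C D] pure_tensor_one[OF C D])

text \<open>
  Multiplicativity need only be checked on pure tensors of three factors. The two stages below
  extend it linearly to all of \<open>A \<otimes> B\<close>, first in the right and then in the
  left argument of the product.
\<close>

lemma tensor_assoc_algebra_map:
  assumes A: "complex_algebra A" and B: "complex_algebra B" and C: "complex_algebra C"
  shows "algebra_map (tensor (tensor A B) C) (tensor A (tensor B C)) (tensor_assoc A B C)"
proof -
  note V = complex_algebraD(2)[OF A] complex_algebraD(2)[OF B] complex_algebraD(2)[OF C]
  note S = complex_algebra_simps[OF A] complex_algebra_simps[OF B] complex_algebra_simps[OF C]
  note AB = tensor_algebra_structure[OF A B] and BC = tensor_algebra_structure[OF B C]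
  note T = tensor_algebra_structure[OF AB C] and T' = tensor_algebra_structure[OF A BC]
  note VT = complex_algebraD(2)[OF T] and VT' = complex_algebraD(2)[OF T']
  note VAB = complex_algebraD(2)[OF AB]
  note assoc_lin = tensor_assoc_linear[OF V]
  note assoc = tensor_assoc_pure[OF V]
  note pt = pure_tensor_mult[OF AB C] pure_tensor_mult[OF A B] pure_tensor_mult[OF A BC] pure_tensor_mult[OF B C]
  note pc = pure_tensor_simps(1)[OF V(1,2)] pure_tensor_simps(1)[OF V(2,3)] pure_tensor_simps(1)[OF VAB V(3)]
  let ?f = "tensor_assoc A B C"
  let ?P = "\<lambda>t c. pure_tensor (tensor A B) C t c"
  have 1: "?f (?P (pure_tensor A B a b \<otimes>\<^bsub>tensor A B\<^esub> t') (c \<otimes>\<^bsub>C\<^esub> c'))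
      = ?f (?P (pure_tensor A B a b) c) \<otimes>\<^bsub>tensor A (tensor B C)\<^esub> ?f (?P t' c')"
    if "a \<in> carrier A" "b \<in> carrier B" and t': "t' \<in> carrier (tensor A B)" and c: "c \<in> carrier C" "c' \<in> carrier C"
    for a b t' c c'
  proof (rule tensor_linear_eq[OF V(1,2) VT' _ _ _ t'])
    show "linear_map (tensor A B) (tensor A (tensor B C)) (\<lambda>t'. ?f (?P (pure_tensor A B a b \<otimes>\<^bsub>tensor A B\<^esub> t') (c \<otimes>\<^bsub>C\<^esub> c')))"
      by (rule linear_map_comp[OF _ assoc_lin], rule linear_map_comp[OF complex_algebra_mult_linear(1)[OF AB]
        bilinear_mapD(2)[OF pure_tensor_bilinear[OF VAB V(3)]]]) (use that in \<open>simp_all add: pc S\<close>)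
    show "linear_map (tensor A B) (tensor A (tensor B C)) (\<lambda>t'. ?f (?P (pure_tensor A B a b) c) \<otimes>\<^bsub>tensor A (tensor B C)\<^esub> ?f (?P t' c'))"
      by (rule linear_map_comp[OF linear_map_comp[OF bilinear_mapD(2)[OF pure_tensor_bilinear[OF VAB V(3)]] assoc_lin]
        complex_algebra_mult_linear(1)[OF T']]) (use that in \<open>simp_all add: pc S linear_mapD(1)[OF assoc_lin]\<close>)
  qed (use that in \<open>simp add: pt assoc pc S\<close>)
  show ?thesis
  proof (rule tensor_algebra_mapI[OF AB C T' assoc_lin])
    fix t c t' c' assume t: "t \<in> carrier (tensor A B)" and c: "c \<in> carrier C"
      and t': "t' \<in> carrier (tensor A B)" and c': "c' \<in> carrier C"
    show "?f (?P (t \<otimes>\<^bsub>tensor A B\<^esub> t') (c \<otimes>\<^bsub>C\<^esub> c')) = ?f (?P t c) \<otimes>\<^bsub>tensor A (tensor B C)\<^esub> ?f (?P t' c')"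
    proof (rule tensor_linear_eq[OF V(1,2) VT' _ _ _ t])
      show "linear_map (tensor A B) (tensor A (tensor B C)) (\<lambda>t. ?f (?P (t \<otimes>\<^bsub>tensor A B\<^esub> t') (c \<otimes>\<^bsub>C\<^esub> c')))"
        by (rule linear_map_comp[OF _ assoc_lin], rule linear_map_comp[OF complex_algebra_mult_linear(2)[OF AB]
          bilinear_mapD(2)[OF pure_tensor_bilinear[OF VAB V(3)]]]) (use t' c c' in \<open>simp_all add: pc S\<close>)
      show "linear_map (tensor A B) (tensor A (tensor B C)) (\<lambda>t. ?f (?P t c) \<otimes>\<^bsub>tensor A (tensor B C)\<^esub> ?f (?P t' c'))"
        by (rule linear_map_comp[OF linear_map_comp[OF bilinear_mapD(2)[OF pure_tensor_bilinear[OF VAB V(3)]] assoc_lin]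
          complex_algebra_mult_linear(2)[OF T']]) (use t' c c' in \<open>simp_all add: pc S linear_mapD(1)[OF assoc_lin]\<close>)
    qed (rule 1[OF _ _ t' c c'])
  next
    show "?f (?P \<one>\<^bsub>tensor A B\<^esub> \<one>\<^bsub>C\<^esub>) = \<one>\<^bsub>tensor A (tensor B C)\<^esub>"
      by (simp add: pure_tensor_one[OF A B] pure_tensor_one[OF A BC] pure_tensor_one[OF B C] assoc S)
  qed
qed

section \<open>Hopf algebras\<close>

text \<open>
  Formulated as the induction principle it is used for: a subalgebra that contains
  \<open>S\<close> is everything.
\<close>

definition algebra_generators :: "(complex, 'a, 'm) module_scheme \<Rightarrow> 'a set \<Rightarrow> bool" where
  "algebra_generators A S \<longleftrightarrow> S \<subseteq> carrier A \<and>
     (\<forall>B. submodule B CC A \<longrightarrow> \<one>\<^bsub>A\<^esub> \<in> B \<longrightarrow> (\<forall>x\<in>B. \<forall>y\<in>B. x \<otimes>\<^bsub>A\<^esub> y \<in> B) \<longrightarrow> S \<subseteq> B \<longrightarrow> carrier A \<subseteq> B)"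

lemma algebra_generatorsD:
  assumes "algebra_generators A S" "submodule B CC A" "\<one>\<^bsub>A\<^esub> \<in> B"
    "\<And>x y. x \<in> B \<Longrightarrow> y \<in> B \<Longrightarrow> x \<otimes>\<^bsub>A\<^esub> y \<in> B" "\<And>x. x \<in> S \<Longrightarrow> x \<in> B" "x \<in> carrier A"
  shows "x \<in> B"
proof -
  have imp: "submodule B CC A \<longrightarrow> \<one>\<^bsub>A\<^esub> \<in> B \<longrightarrow> (\<forall>x\<in>B. \<forall>y\<in>B. x \<otimes>\<^bsub>A\<^esub> y \<in> B) \<longrightarrow> S \<subseteq> B \<longrightarrow> carrier A \<subseteq> B"
    using assms(1) unfolding algebra_generators_def by (elim conjE spec)
  have m: "\<forall>x\<in>B. \<forall>y\<in>B. x \<otimes>\<^bsub>A\<^esub> y \<in> B" by (intro ballI assms(4))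
  have s: "S \<subseteq> B" by (intro subsetI assms(5))
  have "carrier A \<subseteq> B" by (rule imp[THEN mp, THEN mp, THEN mp, THEN mp, OF assms(2,3) m s])
  then show ?thesis using assms(6) by (rule subsetD)
qed

text \<open>The elements on which two homomorphisms agree form a subalgebra.\<close>

lemma algebra_map_eq_on_generators:
  assumes A: "complex_algebra A" and C: "complex_algebra C" and S: "algebra_generators A S"
    and f: "algebra_map A C f" and g: "algebra_map A C g" and eq: "\<And>x. x \<in> S \<Longrightarrow> f x = g x"
    and x: "x \<in> carrier A"
  shows "f x = g x"
proof -
  note V = complex_algebraD(2)[OF A] complex_algebraD(2)[OF C]
  note fs = algebra_map_simps[OF f] and gs = algebra_map_simps[OF g] and s = complex_algebra_simps[OF A]
  have "x \<in> {x \<in> carrier A. f x = g x}"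
  proof (rule algebra_generatorsD[OF S])
    show "submodule {x \<in> carrier A. f x = g x} CC A"
      by (rule subspaceI[OF V(1)])
        (auto simp: fs gs s linear_map_zero[OF V algebra_mapD(1)[OF f]] linear_map_zero[OF V algebra_mapD(1)[OF g]])
    show "x \<in> {x \<in> carrier A. f x = g x}" if "x \<in> S" for x
      using eq[OF that] that S by (auto simp: algebra_generators_def)
  qed (auto simp: fs gs s x)
  then show ?thesis by simp
qed

lemma tensor_linear_eq3:
  assumes U: "module CC U" and V: "module CC V" and W: "module CC W" and Z: "module CC Z"
    and f: "linear_map (tensor (tensor U V) W) Z f" and g: "linear_map (tensor (tensor U V) W) Z g"
    and eq: "\<And>u v w. u \<in> carrier U \<Longrightarrow> v \<in> carrier V \<Longrightarrow> w \<in> carrier W \<Longrightarrow>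
      f (pure_tensor (tensor U V) W (pure_tensor U V u v) w) = g (pure_tensor (tensor U V) W (pure_tensor U V u v) w)"
    and t: "t \<in> carrier (tensor (tensor U V) W)"
  shows "f t = g t"
proof (rule tensor_linear_eq[OF tensor_vector_space[OF U V] W Z f g _ t])
  fix s w assume s: "s \<in> carrier (tensor U V)" and w: "w \<in> carrier W"
  note B = bilinear_mapD(2)[OF pure_tensor_bilinear[OF tensor_vector_space[OF U V] W] w]
  show "f (pure_tensor (tensor U V) W s w) = g (pure_tensor (tensor U V) W s w)"
    by (rule tensor_linear_eq[OF U V Z linear_map_comp[OF B f] linear_map_comp[OF B g] _ s]) (rule eq[OF _ _ w])
qed

lemma hopf_algebraD:
  assumes "hopf_algebra H"
  shows "complex_algebra H" "algebra_map H (tensor H H) (comult H)" "algebra_map H complex_space (counit H)"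
    "linear_map H H (antipode H)"
    "x \<in> carrier H \<Longrightarrow> tensor_assoc H H H (tensor_map (tensor H H) H (comult H) (\<lambda>y. y) (comult H x)) =
        tensor_map H (tensor H H) (\<lambda>y. y) (comult H) (comult H x)"
    "x \<in> carrier H \<Longrightarrow> tensor_lift H (\<lambda>a b. counit H a \<odot>\<^bsub>H\<^esub> b) (comult H x) = x"
    "x \<in> carrier H \<Longrightarrow> tensor_lift H (\<lambda>a b. counit H b \<odot>\<^bsub>H\<^esub> a) (comult H x) = x"
    "x \<in> carrier H \<Longrightarrow> tensor_lift H (\<lambda>a b. antipode H a \<otimes>\<^bsub>H\<^esub> b) (comult H x) = counit H x \<odot>\<^bsub>H\<^esub> \<one>\<^bsub>H\<^esub>"
    "x \<in> carrier H \<Longrightarrow> tensor_lift H (\<lambda>a b. a \<otimes>\<^bsub>H\<^esub> antipode H b) (comult H x) = counit H x \<odot>\<^bsub>H\<^esub> \<one>\<^bsub>H\<^esub>"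
  using assms unfolding hopf_algebra_def by blast+

lemma complex_space_linear:
  assumes A: "complex_algebra A" and x: "x \<in> carrier A"
  shows "linear_map complex_space A (\<lambda>c. c \<odot>\<^bsub>A\<^esub> x)"
proof -
  interpret module CC A using A by (rule complex_algebraD)
  show ?thesis using x smult_l_distr[of _ _ x] by (auto intro!: linear_mapI simp: complex_algebra_simps[OF A])
qed

lemma counit_bilinear:
  assumes A: "complex_algebra A" and e: "linear_map A complex_space e"
  shows "bilinear_map A A A (\<lambda>a b. e a \<odot>\<^bsub>A\<^esub> b)" "bilinear_map A A A (\<lambda>a b. e b \<odot>\<^bsub>A\<^esub> a)"
proof -
  note V = complex_algebraD(2)[OF A]
  note l = linear_map_scale[OF V linear_map_id] and r = linear_map_comp[OF e complex_space_linear[OF A]]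
  show "bilinear_map A A A (\<lambda>a b. e a \<odot>\<^bsub>A\<^esub> b)" by (rule bilinear_mapI2[OF l r])
  show "bilinear_map A A A (\<lambda>a b. e b \<odot>\<^bsub>A\<^esub> a)" by (rule bilinear_mapI2[OF r l])
qed

lemma antipode_bilinear:
  assumes A: "complex_algebra A" and s: "linear_map A A s"
  shows "bilinear_map A A A (\<lambda>a b. s a \<otimes>\<^bsub>A\<^esub> b)" "bilinear_map A A A (\<lambda>a b. a \<otimes>\<^bsub>A\<^esub> s b)"
proof -
  note L = complex_algebra_mult_linear(1)[OF A] and R = complex_algebra_mult_linear(2)[OF A]
  note c = linear_mapD(1)[OF s]
  show "bilinear_map A A A (\<lambda>a b. s a \<otimes>\<^bsub>A\<^esub> b)"
    by (rule bilinear_mapI2[OF L[OF c] linear_map_comp[OF s R]])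
  show "bilinear_map A A A (\<lambda>a b. a \<otimes>\<^bsub>A\<^esub> s b)"
    by (rule bilinear_mapI2[OF linear_map_comp[OF s L] R[OF c]])
qed

text \<open>
  For an antihomomorphism \<open>s\<close> the product of a tensor \<open>\<Sum> a \<otimes>
  b\<close> with \<open>x \<otimes> y\<close> is sent to \<open>s(x) (\<Sum> s(a) b) y\<close>.
  When the inner sum is a scalar it moves to the front. This is why the antipode law for two
  elements implies it for their product.
\<close>

lemma convolution_mult:
  assumes A: "complex_algebra A" and s: "algebra_map A (opposite_algebra A) s"
    and t: "t \<in> carrier (tensor A A)" "t' \<in> carrier (tensor A A)"
  shows "tensor_lift A (\<lambda>a b. s a \<otimes>\<^bsub>A\<^esub> b) t = c \<odot>\<^bsub>A\<^esub> \<one>\<^bsub>A\<^esub> \<Longrightarrow>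
      tensor_lift A (\<lambda>a b. s a \<otimes>\<^bsub>A\<^esub> b) (t \<otimes>\<^bsub>tensor A A\<^esub> t') = c \<odot>\<^bsub>A\<^esub> tensor_lift A (\<lambda>a b. s a \<otimes>\<^bsub>A\<^esub> b) t'"
    and "tensor_lift A (\<lambda>a b. a \<otimes>\<^bsub>A\<^esub> s b) t' = c \<odot>\<^bsub>A\<^esub> \<one>\<^bsub>A\<^esub> \<Longrightarrow>
      tensor_lift A (\<lambda>a b. a \<otimes>\<^bsub>A\<^esub> s b) (t \<otimes>\<^bsub>tensor A A\<^esub> t') = c \<odot>\<^bsub>A\<^esub> tensor_lift A (\<lambda>a b. a \<otimes>\<^bsub>A\<^esub> s b) t"
proof -
  note V = complex_algebraD(2)[OF A] and T = tensor_algebra_structure[OF A A]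
  note S = complex_algebra_simps[OF A]
  have s': "linear_map A A s" using algebra_mapD(1)[OF s] by simp
  note sS = linear_mapD[OF s'] algebra_mapD(2)[OF s, simplified]
  note b = antipode_bilinear[OF A s']
  note L = tensor_lift_linear[OF V V V] and P = tensor_lift_pure[OF V V V]
  note mT = complex_algebra_mult_linear[OF T] and mA = complex_algebra_mult_linear[OF A]
  note pt = pure_tensor_simps(1)[OF V V]
  have 1: "tensor_lift A (\<lambda>a b. s a \<otimes>\<^bsub>A\<^esub> b) (t \<otimes>\<^bsub>tensor A A\<^esub> pure_tensor A A x y)
      = s x \<otimes>\<^bsub>A\<^esub> (tensor_lift A (\<lambda>a b. s a \<otimes>\<^bsub>A\<^esub> b) t \<otimes>\<^bsub>A\<^esub> y)"
    if xy: "x \<in> carrier A" "y \<in> carrier A" for x y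
    by (rule tensor_linear_eq[OF V V V linear_map_comp[OF mT(2)[OF pt[OF xy]] L[OF b(1)]]
          linear_map_comp[OF linear_map_comp[OF L[OF b(1)] mA(2)[OF xy(2)]] mA(1)[OF sS(1)[OF xy(1)]]] _ t(1)])
       (simp add: P[OF b(1)] pure_tensor_mult[OF A A] sS S xy)
  have 2: "tensor_lift A (\<lambda>a b. a \<otimes>\<^bsub>A\<^esub> s b) (pure_tensor A A x y \<otimes>\<^bsub>tensor A A\<^esub> t')
      = (x \<otimes>\<^bsub>A\<^esub> tensor_lift A (\<lambda>a b. a \<otimes>\<^bsub>A\<^esub> s b) t') \<otimes>\<^bsub>A\<^esub> s y"
    if xy: "x \<in> carrier A" "y \<in> carrier A" for x y
    by (rule tensor_linear_eq[OF V V V linear_map_comp[OF mT(1)[OF pt[OF xy]] L[OF b(2)]]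
          linear_map_comp[OF linear_map_comp[OF L[OF b(2)] mA(1)[OF xy(1)]] mA(2)[OF sS(1)[OF xy(2)]]] _ t(2)])
       (simp add: P[OF b(2)] pure_tensor_mult[OF A A] sS S xy)
  show "tensor_lift A (\<lambda>a b. s a \<otimes>\<^bsub>A\<^esub> b) (t \<otimes>\<^bsub>tensor A A\<^esub> t') = c \<odot>\<^bsub>A\<^esub> tensor_lift A (\<lambda>a b. s a \<otimes>\<^bsub>A\<^esub> b) t'"
    if c: "tensor_lift A (\<lambda>a b. s a \<otimes>\<^bsub>A\<^esub> b) t = c \<odot>\<^bsub>A\<^esub> \<one>\<^bsub>A\<^esub>"
    by (rule tensor_linear_eq[OF V V V linear_map_comp[OF mT(1)[OF t(1)] L[OF b(1)]]
          linear_map_scale[OF V L[OF b(1)]] _ t(2)])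
       (simp add: 1 c P[OF b(1)] S sS)
  show "tensor_lift A (\<lambda>a b. a \<otimes>\<^bsub>A\<^esub> s b) (t \<otimes>\<^bsub>tensor A A\<^esub> t') = c \<odot>\<^bsub>A\<^esub> tensor_lift A (\<lambda>a b. a \<otimes>\<^bsub>A\<^esub> s b) t"
    if c: "tensor_lift A (\<lambda>a b. a \<otimes>\<^bsub>A\<^esub> s b) t' = c \<odot>\<^bsub>A\<^esub> \<one>\<^bsub>A\<^esub>"
    by (rule tensor_linear_eq[OF V V V linear_map_comp[OF mT(2)[OF t(2)] L[OF b(2)]]
          linear_map_scale[OF V L[OF b(2)]] _ t(1)])
       (simp add: 2 c P[OF b(2)] S sS)
qed

text \<open>
  Coassociativity and the counit laws are equations between algebra homomorphisms. The antipode
  law is not, since convolution with the identity is not multiplicative, but the elements that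
  satisfy it form a subalgebra by \<open>convolution_mult\<close>.
\<close>

lemma hopf_algebra_from_generators:
  assumes A: "complex_algebra H" and S: "algebra_generators H S"
    and d: "algebra_map H (tensor H H) (comult H)" and e: "algebra_map H complex_space (counit H)"
    and s: "algebra_map H (opposite_algebra H) (antipode H)"
    and coassoc: "\<And>x. x \<in> S \<Longrightarrow> tensor_assoc H H H (tensor_map (tensor H H) H (comult H) (\<lambda>y. y) (comult H x)) =
        tensor_map H (tensor H H) (\<lambda>y. y) (comult H) (comult H x)"
    and counit: "\<And>x. x \<in> S \<Longrightarrow> tensor_lift H (\<lambda>a b. counit H a \<odot>\<^bsub>H\<^esub> b) (comult H x) = x"
      "\<And>x. x \<in> S \<Longrightarrow> tensor_lift H (\<lambda>a b. counit H b \<odot>\<^bsub>H\<^esub> a) (comult H x) = x"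
    and antipode: "\<And>x. x \<in> S \<Longrightarrow>
        tensor_lift H (\<lambda>a b. antipode H a \<otimes>\<^bsub>H\<^esub> b) (comult H x) = counit H x \<odot>\<^bsub>H\<^esub> \<one>\<^bsub>H\<^esub>"
      "\<And>x. x \<in> S \<Longrightarrow>
        tensor_lift H (\<lambda>a b. a \<otimes>\<^bsub>H\<^esub> antipode H b) (comult H x) = counit H x \<odot>\<^bsub>H\<^esub> \<one>\<^bsub>H\<^esub>"
  shows "hopf_algebra H"
proof -
  note V = complex_algebraD(2)[OF A] and T = tensor_algebra_structure[OF A A]
  note VT = complex_algebraD(2)[OF T]
  note cs = complex_algebra_simps[OF A]
  note T1 = tensor_algebra_structure[OF A T] and T2 = tensor_algebra_structure[OF T A]
  have s': "linear_map H H (antipode H)" using algebra_mapD(1)[OF s] by simp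
  note ds = algebra_map_simps[OF d] and es = algebra_map_simps[OF e, simplified]
  note L = tensor_lift_linear[OF V V V] and P = tensor_lift_pure[OF V V V]
  note cb = counit_bilinear[OF A algebra_mapD(1)[OF e]] and ab = antipode_bilinear[OF A s']
  have c1: "algebra_map (tensor H H) H (tensor_lift H (\<lambda>a b. counit H a \<odot>\<^bsub>H\<^esub> b))"
    by (rule tensor_algebra_mapI[OF A A A L[OF cb(1)]]) (simp_all add: P[OF cb(1)] es cs mult.commute)
  have c2: "algebra_map (tensor H H) H (tensor_lift H (\<lambda>a b. counit H b \<odot>\<^bsub>H\<^esub> a))"
    by (rule tensor_algebra_mapI[OF A A A L[OF cb(2)]]) (simp_all add: P[OF cb(2)] es cs mult.commute)
  have co: "tensor_assoc H H H (tensor_map (tensor H H) H (comult H) (\<lambda>y. y) (comult H x)) =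
        tensor_map H (tensor H H) (\<lambda>y. y) (comult H) (comult H x)" if x: "x \<in> carrier H" for x
  proof (rule algebra_map_eq_on_generators[OF A T1 S _ _ coassoc x])
    show "algebra_map H (tensor H (tensor H H))
      (\<lambda>x. tensor_assoc H H H (tensor_map (tensor H H) H (comult H) (\<lambda>y. y) (comult H x)))"
      by (rule algebra_map_comp[OF algebra_map_comp[OF d tensor_map_algebra_map[OF A A T A d algebra_map_id]]
        tensor_assoc_algebra_map[OF A A A]])
    show "algebra_map H (tensor H (tensor H H)) (\<lambda>x. tensor_map H (tensor H H) (\<lambda>y. y) (comult H) (comult H x))"
      by (rule algebra_map_comp[OF d tensor_map_algebra_map[OF A A A T algebra_map_id d]])
  qed
  have cu: "tensor_lift H (\<lambda>a b. counit H a \<odot>\<^bsub>H\<^esub> b) (comult H x) = x"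
    "tensor_lift H (\<lambda>a b. counit H b \<odot>\<^bsub>H\<^esub> a) (comult H x) = x" if x: "x \<in> carrier H" for x
  proof -
    show "tensor_lift H (\<lambda>a b. counit H a \<odot>\<^bsub>H\<^esub> b) (comult H x) = x"
      by (rule algebra_map_eq_on_generators[OF A A S algebra_map_comp[OF d c1] algebra_map_id counit(1) x])
    show "tensor_lift H (\<lambda>a b. counit H b \<odot>\<^bsub>H\<^esub> a) (comult H x) = x"
      by (rule algebra_map_eq_on_generators[OF A A S algebra_map_comp[OF d c2] algebra_map_id counit(2) x])
  qed
  have eta: "linear_map H H (\<lambda>x. counit H x \<odot>\<^bsub>H\<^esub> \<one>\<^bsub>H\<^esub>)"
    by (rule linear_map_comp[OF algebra_mapD(1)[OF e] complex_space_linear[OF A cs(6)]])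
  have an: "x \<in> {x \<in> carrier H. tensor_lift H f (comult H x) = counit H x \<odot>\<^bsub>H\<^esub> \<one>\<^bsub>H\<^esub>}"
    if x: "x \<in> carrier H" and b: "bilinear_map H H H f" and one: "f \<one>\<^bsub>H\<^esub> \<one>\<^bsub>H\<^esub> = \<one>\<^bsub>H\<^esub>"
      and gen: "\<And>x. x \<in> S \<Longrightarrow> tensor_lift H f (comult H x) = counit H x \<odot>\<^bsub>H\<^esub> \<one>\<^bsub>H\<^esub>"
      and m: "\<And>x y. x \<in> carrier H \<Longrightarrow> y \<in> carrier H \<Longrightarrow>
        tensor_lift H f (comult H x) = counit H x \<odot>\<^bsub>H\<^esub> \<one>\<^bsub>H\<^esub> \<Longrightarrow>
        tensor_lift H f (comult H y) = counit H y \<odot>\<^bsub>H\<^esub> \<one>\<^bsub>H\<^esub> \<Longrightarrow>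
        tensor_lift H f (comult H x \<otimes>\<^bsub>tensor H H\<^esub> comult H y) = (counit H x * counit H y) \<odot>\<^bsub>H\<^esub> \<one>\<^bsub>H\<^esub>"
      for f x
  proof (rule algebra_generatorsD[OF S _ _ _ _ x])
    let ?B = "{x \<in> carrier H. tensor_lift H f (comult H x) = counit H x \<odot>\<^bsub>H\<^esub> \<one>\<^bsub>H\<^esub>}"
    have lf: "linear_map H H (\<lambda>x. tensor_lift H f (comult H x))"
      by (rule linear_map_comp[OF algebra_mapD(1)[OF d] L[OF b]])
    show "submodule ?B CC H"
      by (rule subspaceI[OF V])
        (auto simp: linear_mapD[OF lf] linear_mapD[OF eta] linear_map_zero[OF V V lf] linear_map_zero[OF V V eta] cs)
    show "\<one>\<^bsub>H\<^esub> \<in> ?B" by (simp add: cs ds es pure_tensor_one[OF A A] P[OF b] one)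
    show "x \<in> ?B" if "x \<in> S" for x using that gen S by (auto simp: algebra_generators_def)
    show "x \<otimes>\<^bsub>H\<^esub> y \<in> ?B" if "x \<in> ?B" "y \<in> ?B" for x y
      using that m[of x y] by (simp add: ds es cs)
  qed
  have a1: "tensor_lift H (\<lambda>a b. antipode H a \<otimes>\<^bsub>H\<^esub> b) (comult H x) = counit H x \<odot>\<^bsub>H\<^esub> \<one>\<^bsub>H\<^esub>"
    if x: "x \<in> carrier H" for x
    using an[OF x ab(1) _ antipode(1)] algebra_mapD(3)[OF s] convolution_mult(1)[OF A s ds(1) ds(1)]
    by (simp add: cs)
  have a2: "tensor_lift H (\<lambda>a b. a \<otimes>\<^bsub>H\<^esub> antipode H b) (comult H x) = counit H x \<odot>\<^bsub>H\<^esub> \<one>\<^bsub>H\<^esub>"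
    if x: "x \<in> carrier H" for x
    using an[OF x ab(2) _ antipode(2)] algebra_mapD(3)[OF s] convolution_mult(2)[OF A s ds(1) ds(1)]
    by (simp add: cs mult.commute)
  show ?thesis
    unfolding hopf_algebra_def using A d e s' co cu a1 a2 by blast
qed

text \<open>
  Every axiom is a natural equation, so that pushing it forward along the surjection
  \<open>f\<close> gives the axiom for \<open>K\<close>. In this way the quantum enveloping
  algebra will inherit the Hopf axioms.
\<close>

lemma hopf_algebra_image:
  fixes H :: "('a, 'm) hopf_scheme" and K :: "('b, 'n) hopf_scheme"
  assumes H: "hopf_algebra H" and B: "complex_algebra K"
    and f: "algebra_map H K f" and surj: "carrier K = f ` carrier H"
    and d: "\<And>x. x \<in> carrier H \<Longrightarrow> comult K (f x) = tensor_map K K f f (comult H x)"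
    and e: "\<And>x. x \<in> carrier H \<Longrightarrow> counit K (f x) = counit H x"
    and s: "\<And>x. x \<in> carrier H \<Longrightarrow> antipode K (f x) = f (antipode H x)"
  shows "hopf_algebra K"
proof -
  note h = hopf_algebraD[OF H] and A = hopf_algebraD(1)[OF H]
  note V = complex_algebraD(2)[OF A] and VK = complex_algebraD(2)[OF B]
  note T = tensor_algebra_structure[OF A A] and TK = tensor_algebra_structure[OF B B]
  note VT = complex_algebraD(2)[OF T] and VTK = complex_algebraD(2)[OF TK]
  note sH = complex_algebra_simps[OF A] and sK = complex_algebra_simps[OF B]
  note fl = algebra_mapD(1)[OF f] and fs = algebra_map_simps[OF f]
  note ff = tensor_map_algebra_map[OF A A B B f f]
  note ffl = algebra_mapD(1)[OF ff] and ffp = tensor_map_pure[OF V V VK VK fl fl]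
  note hd = algebra_map_simps[OF h(2)] and he = algebra_map_simps[OF h(3), simplified] and hs = linear_mapD[OF h(4)]
  note ffs = algebra_map_simps[OF ff]
  have dK: "algebra_map K (tensor K K) (comult K)"
  proof (intro algebra_mapI linear_mapI)
    show "comult K \<one>\<^bsub>K\<^esub> = \<one>\<^bsub>tensor K K\<^esub>"
      using d[OF sH(6)] by (simp add: fs hd ffs)
  qed (auto simp: surj d hd ffs sH fs(2-4)[symmetric])
  have eK: "algebra_map K complex_space (counit K)"
  proof (intro algebra_mapI linear_mapI)
    show "counit K \<one>\<^bsub>K\<^esub> = \<one>\<^bsub>complex_space\<^esub>" using e[OF sH(6)] by (simp add: fs he)
  qed (auto simp: surj e he sH fs(2-4)[symmetric])
  have sKl: "linear_map K K (antipode K)"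
    by (rule linear_mapI) (auto simp: surj s hs sH fs(2-4)[symmetric])
  have fx: "\<exists>x\<in>carrier H. y = f x" if "y \<in> carrier K" for y using that surj by auto
  note dKl = algebra_mapD(1)[OF dK] and dl = algebra_mapD(1)[OF h(2)]
  note pH = pure_tensor_simps(1)[OF V V] pure_tensor_simps(1)[OF V VT] pure_tensor_simps(1)[OF VT V]
  note pK = pure_tensor_simps(1)[OF VK VK] pure_tensor_simps(1)[OF VK VTK] pure_tensor_simps(1)[OF VTK VK]
  have dc: "comult H x \<in> carrier (tensor H H)" if "x \<in> carrier H" for x using hd that by simp
  note fff1 = tensor_map_linear[OF VT V VTK VK ffl fl] and fff1p = tensor_map_pure[OF VT V VTK VK ffl fl]
  note fff2 = tensor_map_linear[OF V VT VK VTK fl ffl] and fff2p = tensor_map_pure[OF V VT VK VTK fl ffl]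
  note did = tensor_map_linear[OF V V VT V dl linear_map_id] and didp = tensor_map_pure[OF V V VT V dl linear_map_id]
  note idd = tensor_map_linear[OF V V V VT linear_map_id dl] and iddp = tensor_map_pure[OF V V V VT linear_map_id dl]
  note didK = tensor_map_linear[OF VK VK VTK VK dKl linear_map_id]
    and didKp = tensor_map_pure[OF VK VK VTK VK dKl linear_map_id]
  note iddK = tensor_map_linear[OF VK VK VK VTK linear_map_id dKl]
    and iddKp = tensor_map_pure[OF VK VK VK VTK linear_map_id dKl]
  note asH = tensor_assoc_linear[OF V V V] and asK = tensor_assoc_linear[OF VK VK VK]
  have 1: "tensor_map (tensor K K) K (comult K) (\<lambda>y. y) (tensor_map K K f f t)
      = tensor_map (tensor K K) K (tensor_map K K f f) f (tensor_map (tensor H H) H (comult H) (\<lambda>y. y) t)"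
    if t: "t \<in> carrier (tensor H H)" for t
    by (rule tensor_linear_eq[OF V V tensor_vector_space[OF VTK VK] linear_map_comp[OF ffl didK]
          linear_map_comp[OF did fff1] _ t])
       (simp add: ffp didKp didp fff1p fs d dc)
  have 2: "tensor_map K (tensor K K) (\<lambda>y. y) (comult K) (tensor_map K K f f t)
      = tensor_map K (tensor K K) f (tensor_map K K f f) (tensor_map H (tensor H H) (\<lambda>y. y) (comult H) t)"
    if t: "t \<in> carrier (tensor H H)" for t
    by (rule tensor_linear_eq[OF V V tensor_vector_space[OF VK VTK] linear_map_comp[OF ffl iddK]
          linear_map_comp[OF idd fff2] _ t])
       (simp add: ffp iddKp iddp fff2p fs d dc)
  have 3: "tensor_assoc K K K (tensor_map (tensor K K) K (tensor_map K K f f) f t)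
      = tensor_map K (tensor K K) f (tensor_map K K f f) (tensor_assoc H H H t)"
    if t: "t \<in> carrier (tensor (tensor H H) H)" for t
    by (rule tensor_linear_eq3[OF V V V tensor_vector_space[OF VK VTK] linear_map_comp[OF fff1 asK]
          linear_map_comp[OF asH fff2] _ t])
       (simp add: fff1p fff2p pH pK ffp fs tensor_assoc_pure[OF V V V] tensor_assoc_pure[OF VK VK VK])
  note L = tensor_lift_linear[OF V V V] and P = tensor_lift_pure[OF V V V]
  note LK = tensor_lift_linear[OF VK VK VK] and PK = tensor_lift_pure[OF VK VK VK]
  have lift: "tensor_lift K g (tensor_map K K f f t) = f (tensor_lift H g' t)"
    if t: "t \<in> carrier (tensor H H)" and g: "bilinear_map K K K g" and g': "bilinear_map H H H g'"
      and gg: "\<And>a b. a \<in> carrier H \<Longrightarrow> b \<in> carrier H \<Longrightarrow> g (f a) (f b) = f (g' a b)" for g g' t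
    by (rule tensor_linear_eq[OF V V VK linear_map_comp[OF ffl LK[OF g]] linear_map_comp[OF L[OF g'] fl] _ t])
       (simp add: ffp P[OF g'] PK[OF g] fs gg)
  note cH = counit_bilinear[OF A algebra_mapD(1)[OF h(3)]] and cK = counit_bilinear[OF B algebra_mapD(1)[OF eK]]
  note aH = antipode_bilinear[OF A h(4)] and aK = antipode_bilinear[OF B sKl]
  show ?thesis
    unfolding hopf_algebra_def
  proof (intro conjI ballI)
    show "complex_algebra K" "algebra_map K (tensor K K) (comult K)"
      "algebra_map K complex_space (counit K)" "linear_map K K (antipode K)" by fact+
    fix y assume "y \<in> carrier K"
    then obtain x where x: "x \<in> carrier H" and y: "y = f x" using fx by blast
    show "tensor_assoc K K K (tensor_map (tensor K K) K (comult K) (\<lambda>y. y) (comult K y)) =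
        tensor_map K (tensor K K) (\<lambda>y. y) (comult K) (comult K y)"
      unfolding y d[OF x] 1[OF dc[OF x]] 2[OF dc[OF x]] 3[OF linear_mapD(1)[OF did dc[OF x]]] h(5)[OF x] ..
    show "tensor_lift K (\<lambda>a b. counit K a \<odot>\<^bsub>K\<^esub> b) (comult K y) = y"
      unfolding y d[OF x] using lift[OF dc[OF x] cK(1) cH(1)] h(6)[OF x] by (simp add: e fs)
    show "tensor_lift K (\<lambda>a b. counit K b \<odot>\<^bsub>K\<^esub> a) (comult K y) = y"
      unfolding y d[OF x] using lift[OF dc[OF x] cK(2) cH(2)] h(7)[OF x] by (simp add: e fs)
    show "tensor_lift K (\<lambda>a b. antipode K a \<otimes>\<^bsub>K\<^esub> b) (comult K y) = counit K y \<odot>\<^bsub>K\<^esub> \<one>\<^bsub>K\<^esub>"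
      unfolding y d[OF x] e[OF x] using lift[OF dc[OF x] aK(1) aH(1)] h(8)[OF x]
      by (simp add: s fs sH hs)
    show "tensor_lift K (\<lambda>a b. a \<otimes>\<^bsub>K\<^esub> antipode K b) (comult K y) = counit K y \<odot>\<^bsub>K\<^esub> \<one>\<^bsub>K\<^esub>"
      unfolding y d[OF x] e[OF x] using lift[OF dc[OF x] aK(2) aH(2)] h(9)[OF x]
      by (simp add: s fs sH hs)
  qed
qed

section \<open>The first isomorphism theorem for Hopf algebras\<close>

text \<open>
  The tensor product depends only on the algebra fields of a record, so that it is the same before
  and after a Hopf structure has been added.
\<close>

lemma tensor_cong:
  assumes "carrier V = carrier V'" "monoid.mult V = monoid.mult V'" "\<one>\<^bsub>V\<^esub> = \<one>\<^bsub>V'\<^esub>"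
    "ring.add V = ring.add V'" "module.smult V = module.smult V'"
    and "carrier W = carrier W'" "monoid.mult W = monoid.mult W'" "\<one>\<^bsub>W\<^esub> = \<one>\<^bsub>W'\<^esub>"
    "ring.add W = ring.add W'" "module.smult W = module.smult W'"
  shows "tensor V W = tensor V' W'" "pure_tensor V W = pure_tensor V' W'" "tensor_map V W = tensor_map V' W'"
proof -
  have p: "V \<times>\<times> W = V' \<times>\<times> W'" unfolding DirProd_def by (simp add: assms)
  have r: "tensor_relations V W = tensor_relations V' W'" unfolding tensor_relations_def by (simp add: assms)
  show t: "tensor V W = tensor V' W'" unfolding tensor_def p r ..
  show pt: "pure_tensor V W = pure_tensor V' W'" by (intro ext) (simp add: pure_tensor_def p r)
  show "tensor_map V W = tensor_map V' W'" by (intro ext) (simp add: tensor_map_def t pt)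
qed

text \<open>
  Modulo \<open>J = I \<otimes> H + H \<otimes> I\<close> a pure tensor \<open>x \<otimes>
  y\<close> depends only on \<open>f x\<close> and \<open>f y\<close>. Choosing preimages
  therefore defines a map on \<open>U \<otimes> U\<close> through which the quotient map modulo
  \<open>J\<close> factors, so that whatever \<open>f \<otimes> f\<close> kills lies in
  \<open>J\<close>.
\<close>

lemma tensor_map_kernel:
  assumes H: "complex_algebra H" and U: "complex_algebra U" and f: "algebra_map H U f"
    and surj: "carrier U = f ` carrier H"
    and I: "I = {x \<in> carrier H. f x = \<zero>\<^bsub>U\<^esub>}"
    and t: "t \<in> carrier (tensor H H)" "tensor_map U U f f t = \<zero>\<^bsub>tensor U U\<^esub>"
  shows "t \<in> linear_span (tensor H H)
    {pure_tensor H H a b | a b. a \<in> carrier H \<and> b \<in> carrier H \<and> (a \<in> I \<or> b \<in> I)}" (is "t \<in> linear_span _ ?S")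
proof -
  note V = complex_algebraD(2)[OF H] and VU = complex_algebraD(2)[OF U]
  interpret V: module CC H by (rule V)
  interpret U: module CC U by (rule VU)
  note VT = tensor_vector_space[OF V V] and VTU = tensor_vector_space[OF VU VU]
  note fl = algebra_mapD(1)[OF f]
  note fs = linear_mapD[OF fl]
  have S: "?S \<subseteq> carrier (tensor H H)" by (auto simp: pure_tensor_simps[OF V V])
  let ?J = "linear_span (tensor H H) ?S"
  have J: "submodule ?J CC (tensor H H)" by (rule linear_span_subspace[OF VT S])
  let ?Q = "quotient_space (tensor H H) ?J" and ?c = "quotient_class (tensor H H) ?J"
  note VQ = quotient_vector_space[OF VT J] and cl = quotient_class_linear[OF VT J]
  have B: "bilinear_map H H ?Q (\<lambda>x y. ?c (pure_tensor H H x y))"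
    by (rule bilinear_mapI2)
      (rule linear_map_comp[OF _ cl], rule bilinear_mapD[OF pure_tensor_bilinear[OF V V]], assumption)+
  note b = bilinear_simps[OF B]
  have zero: "?c (pure_tensor H H x y) = \<zero>\<^bsub>?Q\<^esub>" if "x \<in> carrier H" "y \<in> carrier H" "x \<in> I \<or> y \<in> I" for x y
  proof -
    have "pure_tensor H H x y \<in> ?J" by (rule subsetD[OF linear_span_superset]) (use that in auto)
    then show ?thesis using quotient_class_eq_zero_iff[OF VT J] subspaceD(1)[OF VT J]
      by (auto simp: quotient_space_simps)
  qed
  \<comment> \<open>Replace \<open>x\<close> by \<open>x'\<close> and then \<open>y\<close> by \<open>y'\<close>; each difference lies in \<open>I\<close>.\<close>
  have eq: "?c (pure_tensor H H x y) = ?c (pure_tensor H H x' y')"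
    if xy: "x \<in> carrier H" "y \<in> carrier H" "x' \<in> carrier H" "y' \<in> carrier H" and e: "f x = f x'" "f y = f y'"
    for x y x' y'
  proof -
    interpret Q: module CC ?Q by (rule VQ)
    have i: "x \<ominus>\<^bsub>H\<^esub> x' \<in> I" "y \<ominus>\<^bsub>H\<^esub> y' \<in> I"
      using xy e linear_map_minus[OF V VU fl] fs(1) unfolding I by (auto simp: a_minus_def U.r_neg)
    have x2: "x = (x \<ominus>\<^bsub>H\<^esub> x') \<oplus>\<^bsub>H\<^esub> x'" "y = (y \<ominus>\<^bsub>H\<^esub> y') \<oplus>\<^bsub>H\<^esub> y'"
      using xy by (simp_all add: a_minus_def V.a_assoc V.l_neg)
    have "?c (pure_tensor H H x y) = ?c (pure_tensor H H (x \<ominus>\<^bsub>H\<^esub> x') y) \<oplus>\<^bsub>?Q\<^esub> ?c (pure_tensor H H x' y)"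
      by (subst x2(1), rule b(4)) (use xy in auto)
    also have "\<dots> = ?c (pure_tensor H H x' y)" using zero[of "x \<ominus>\<^bsub>H\<^esub> x'" y] i xy b(1) by simp
    also have "\<dots> = ?c (pure_tensor H H x' (y \<ominus>\<^bsub>H\<^esub> y')) \<oplus>\<^bsub>?Q\<^esub> ?c (pure_tensor H H x' y')"
      by (subst x2(2), rule b(2)) (use xy in auto)
    also have "\<dots> = ?c (pure_tensor H H x' y')" using zero[of x' "y \<ominus>\<^bsub>H\<^esub> y'"] i xy b(1) by simp
    finally show ?thesis .
  qed
  define g where "g u = (SOME x. x \<in> carrier H \<and> f x = u)" for u
  have g: "g u \<in> carrier H" "f (g u) = u" if "u \<in> carrier U" for u
    using someI_ex[of "\<lambda>x. x \<in> carrier H \<and> f x = u"] that surj unfolding g_def by auto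
  have BU: "bilinear_map U U ?Q (\<lambda>u v. ?c (pure_tensor H H (g u) (g v)))"
  proof (rule bilinear_mapI)
    fix v w w' c assume vw: "v \<in> carrier U" "w \<in> carrier U"
    show "?c (pure_tensor H H (g v) (g w)) \<in> carrier ?Q" using b(1) g vw by simp
    show "?c (pure_tensor H H (g v) (g (c \<odot>\<^bsub>U\<^esub> w))) = c \<odot>\<^bsub>?Q\<^esub> ?c (pure_tensor H H (g v) (g w))"
      using eq[of "g v" "g (c \<odot>\<^bsub>U\<^esub> w)" "g v" "c \<odot>\<^bsub>H\<^esub> g w"] b(3)[of "g v" "g w" c] g vw by (simp add: fs)
    show "?c (pure_tensor H H (g (c \<odot>\<^bsub>U\<^esub> v)) (g w)) = c \<odot>\<^bsub>?Q\<^esub> ?c (pure_tensor H H (g v) (g w))"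
      using eq[of "g (c \<odot>\<^bsub>U\<^esub> v)" "g w" "c \<odot>\<^bsub>H\<^esub> g v" "g w"] b(5)[of "g v" "g w" c] g vw by (simp add: fs)
    assume w': "w' \<in> carrier U"
    show "?c (pure_tensor H H (g v) (g (w \<oplus>\<^bsub>U\<^esub> w'))) = ?c (pure_tensor H H (g v) (g w)) \<oplus>\<^bsub>?Q\<^esub> ?c (pure_tensor H H (g v) (g w'))"
      using eq[of "g v" "g (w \<oplus>\<^bsub>U\<^esub> w')" "g v" "g w \<oplus>\<^bsub>H\<^esub> g w'"] b(2)[of "g v" "g w" "g w'"] g vw w' by (simp add: fs)
    show "?c (pure_tensor H H (g (v \<oplus>\<^bsub>U\<^esub> w')) (g w)) = ?c (pure_tensor H H (g v) (g w)) \<oplus>\<^bsub>?Q\<^esub> ?c (pure_tensor H H (g w') (g w))"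
      using eq[of "g (v \<oplus>\<^bsub>U\<^esub> w')" "g w" "g v \<oplus>\<^bsub>H\<^esub> g w'" "g w"] b(4)[of "g v" "g w'" "g w"] g vw w' by (simp add: fs)
  qed
  let ?h = "tensor_lift ?Q (\<lambda>u v. ?c (pure_tensor H H (g u) (g v)))"
  note hl = tensor_lift_linear[OF VU VU VQ BU]
  have "?h (tensor_map U U f f t) = ?c t"
  proof (rule tensor_linear_eq[OF V V VQ linear_map_comp[OF tensor_map_linear[OF V V VU VU fl fl] hl] cl _ t(1)])
    fix v w assume vw: "v \<in> carrier H" "w \<in> carrier H"
    show "?h (tensor_map U U f f (pure_tensor H H v w)) = ?c (pure_tensor H H v w)"
      using vw eq[of "g (f v)" "g (f w)" v w] g
      by (simp add: tensor_map_pure[OF V V VU VU fl fl] tensor_lift_pure[OF VU VU VQ BU] fs)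
  qed
  then have "?c t = ?J"
    unfolding t(2) linear_map_zero[OF VTU VQ hl] by (simp add: quotient_space_simps)
  then show ?thesis using quotient_class_eq_zero_iff[OF VT J t(1)] by simp
qed

lemma algebra_map_kernel_ideal:
  assumes A: "complex_algebra A" and B: "complex_algebra B" and f: "algebra_map A B f"
  shows "ideal {x \<in> carrier A. f x = \<zero>\<^bsub>B\<^esub>} A"
proof (rule idealI)
  show "ring A" by (rule complex_algebraD(1)[OF A])
  note V = complex_algebraD(2)[OF A] and VB = complex_algebraD(2)[OF B]
  have "submodule {x \<in> carrier A. f x \<in> {\<zero>\<^bsub>B\<^esub>}} CC A"
    by (rule subspace_vimage[OF V VB algebra_mapD(1)[OF f] trivial_subspace[OF VB]])
  then show "subgroup {x \<in> carrier A. f x = \<zero>\<^bsub>B\<^esub>} (add_monoid A)" by (simp add: submodule_def)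
qed (auto simp: complex_algebra_simps[OF A] algebra_map_simps[OF f] ring.ring_simprules[OF complex_algebraD(1)[OF B]])

text \<open>
  The kernel is a coideal by \<open>tensor_map_kernel\<close>, and a Hopf ideal because counit and
  antipode commute with \<open>f\<close>. Both \<open>U\<close> and the quotient are images of
  \<open>H\<close>, hence Hopf algebras, and the isomorphism sends \<open>f x\<close> to the class
  of \<open>x\<close>. That \<open>U\<close> is a Hopf algebra is part of the conclusion.
\<close>

theorem hopf_first_isomorphism:
  fixes H :: "('a, 'm) hopf_scheme" and U :: "('b, 'n) hopf_scheme"
  assumes H: "hopf_algebra H" and U: "complex_algebra U"
    and f: "algebra_map H U f" and surj: "carrier U = f ` carrier H"
    and d: "\<And>x. x \<in> carrier H \<Longrightarrow> comult U (f x) = tensor_map U U f f (comult H x)"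
    and e: "\<And>x. x \<in> carrier H \<Longrightarrow> counit U (f x) = counit H x"
    and s: "\<And>x. x \<in> carrier H \<Longrightarrow> antipode U (f x) = f (antipode H x)"
  defines "I \<equiv> {x \<in> carrier H. f x = \<zero>\<^bsub>U\<^esub>}"
  shows "hopf_ideal I H" "\<exists>g. hopf_isomorphism U (hopf_quotient H I) g"
proof -
  note h = hopf_algebraD[OF H] and A = hopf_algebraD(1)[OF H]
  have hU: "hopf_algebra U" by (rule hopf_algebra_image[OF H U f surj]) (fact d e s)+
  note u = hopf_algebraD[OF hU]
  note V = complex_algebraD(2)[OF A] and VU = complex_algebraD(2)[OF U]
  note T = tensor_algebra_structure[OF A A] and TU = tensor_algebra_structure[OF U U]
  note VT = complex_algebraD(2)[OF T] and VTU = complex_algebraD(2)[OF TU]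
  note sH = complex_algebra_simps[OF A] and sU = complex_algebra_simps[OF U]
  note fl = algebra_mapD(1)[OF f] and fs = algebra_map_simps[OF f]
  note hd = algebra_map_simps[OF h(2)] and he = algebra_map_simps[OF h(3), simplified] and hs = linear_mapD[OF h(4)]
  have ideal: "ideal I H" unfolding I_def by (rule algebra_map_kernel_ideal[OF A U f])
  let ?S = "{pure_tensor H H a b | a b. a \<in> carrier H \<and> b \<in> carrier H \<and> (a \<in> I \<or> b \<in> I)}"
  have dI: "comult H x \<in> linear_span (tensor H H) ?S" if "x \<in> I" for x
  proof (rule tensor_map_kernel[OF A U f surj])
    have x: "x \<in> carrier H" "f x = \<zero>\<^bsub>U\<^esub>" using that by (auto simp: I_def)
    show "comult H x \<in> carrier (tensor H H)" using hd x by simp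
    show "tensor_map U U f f (comult H x) = \<zero>\<^bsub>tensor U U\<^esub>"
      using d[OF x(1)] x(2) linear_map_zero[OF VU VTU algebra_mapD(1)[OF u(2)]] by simp
  qed (simp add: I_def)
  have eI: "counit H x = 0" if "x \<in> I" for x
    using that e[of x] linear_map_zero[OF VU complex_algebraD(2)[OF complex_space_algebra] algebra_mapD(1)[OF u(3)]]
    by (simp add: I_def)
  have sI: "antipode H x \<in> I" if "x \<in> I" for x
    using that s[of x] linear_map_zero[OF VU VU u(4)] hs(1) by (simp add: I_def)
  show "hopf_ideal I H"
    unfolding hopf_ideal_def using ideal dI eI sI by blast
  let ?K = "hopf_quotient H I" and ?Q = "quotient_space H I" and ?p = "quotient_class H I"
  have Ksimps: "carrier ?K = carrier ?Q" "monoid.mult ?K = monoid.mult ?Q" "\<one>\<^bsub>?K\<^esub> = \<one>\<^bsub>?Q\<^esub>"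
    "\<zero>\<^bsub>?K\<^esub> = \<zero>\<^bsub>?Q\<^esub>" "ring.add ?K = ring.add ?Q" "module.smult ?K = module.smult ?Q"
    "comult ?K = (\<lambda>C. tensor_map ?Q ?Q ?p ?p (comult H (SOME x. x \<in> C)))"
    "counit ?K = (\<lambda>C. counit H (SOME x. x \<in> C))" "antipode ?K = (\<lambda>C. ?p (antipode H (SOME x. x \<in> C)))"
    by (simp_all add: hopf_quotient_def module.defs hopf.defs quotient_class_def[abs_def])
  note tc = tensor_cong[OF Ksimps(1-3,5,6) Ksimps(1-3,5,6)]
  note Q = quotient_algebra[OF A ideal]
  have K: "complex_algebra ?K"
    by (rule complex_algebra_image[where h = "\<lambda>x. x", OF Q(1)]) (simp_all add: Ksimps)
  have p: "algebra_map H ?K ?p"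
    using Q(2) by (auto simp: algebra_map_def linear_map_def ring_hom_def Ksimps)
  note VK = complex_algebraD(2)[OF K] and pl = algebra_mapD(1)[OF p]
  note W = ideal_subspace[OF A ideal]
  note VQ = complex_algebraD(2)[OF Q(1)]
  have pI: "?p x = \<zero>\<^bsub>?K\<^esub> \<longleftrightarrow> x \<in> I" if "x \<in> carrier H" for x
    using quotient_class_eq_zero_iff[OF V W that] by (simp add: Ksimps quotient_space_simps)
  note TK = tensor_algebra_structure[OF K K]
  note VTK = complex_algebraD(2)[OF TK]
  note pp = tensor_map_linear[OF V V VK VK pl pl] and ppp = tensor_map_pure[OF V V VK VK pl pl]
  have ppS: "tensor_map ?K ?K ?p ?p t = \<zero>\<^bsub>tensor ?K ?K\<^esub>" if "t \<in> linear_span (tensor H H) ?S" for t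
  proof -
    interpret TK: module CC "tensor ?K ?K" by (rule VTK)
    have z: "pure_tensor ?K ?K \<zero>\<^bsub>?K\<^esub> y = \<zero>\<^bsub>tensor ?K ?K\<^esub>" "pure_tensor ?K ?K y \<zero>\<^bsub>?K\<^esub> = \<zero>\<^bsub>tensor ?K ?K\<^esub>"
      if "y \<in> carrier ?K" for y
      using linear_map_zero[OF VK VTK bilinear_mapD(1)[OF pure_tensor_bilinear[OF VK VK] that]]
        linear_map_zero[OF VK VTK bilinear_mapD(2)[OF pure_tensor_bilinear[OF VK VK] that]] by simp_all
    have "tensor_map ?K ?K ?p ?p t \<in> {\<zero>\<^bsub>tensor ?K ?K\<^esub>}"
    proof (rule linear_map_span[OF VT VTK pp trivial_subspace[OF VTK] _ _ that])
      show "?S \<subseteq> carrier (tensor H H)" by (auto simp: pure_tensor_simps[OF V V])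
      fix t assume "t \<in> ?S"
      then obtain a b where ab: "t = pure_tensor H H a b" "a \<in> carrier H" "b \<in> carrier H" "a \<in> I \<or> b \<in> I" by blast
      have "?p a = \<zero>\<^bsub>?K\<^esub> \<or> ?p b = \<zero>\<^bsub>?K\<^esub>" using ab(4) pI ab(2,3) by auto
      then show "tensor_map ?K ?K ?p ?p t \<in> {\<zero>\<^bsub>tensor ?K ?K\<^esub>}"
        using linear_mapD(1)[OF pl] ab(2,3) z unfolding ab(1) ppp[OF ab(2,3)] by auto
    qed
    then show ?thesis by simp
  qed
  have dK: "comult ?K (?p x) = tensor_map ?K ?K ?p ?p (comult H x)" if "x \<in> carrier H" for x
    unfolding Ksimps(7) tc(3)[symmetric]
    by (rule quotient_value[OF V W VTK linear_map_comp[OF algebra_mapD(1)[OF h(2)] pp] ppS[OF dI] that])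
  have eK: "counit ?K (?p x) = counit H x" if "x \<in> carrier H" for x
    unfolding Ksimps(8)
    by (rule quotient_value[OF V W complex_algebraD(2)[OF complex_space_algebra] algebra_mapD(1)[OF h(3)] _ that])
       (simp add: eI)
  have sK: "antipode ?K (?p x) = ?p (antipode H x)" if "x \<in> carrier H" for x
    unfolding Ksimps(9)
    by (rule quotient_value[OF V W VK linear_map_comp[OF h(4) pl] _ that])
       (use sI pI subspaceD(1)[OF V W] in auto)
  have psurj: "carrier ?K = ?p ` carrier H" by (simp add: Ksimps quotient_space_simps)
  have hK: "hopf_algebra ?K" by (rule hopf_algebra_image[OF H K p psurj]) (fact dK eK sK)+
  define g where "g u = ?p (SOME x. x \<in> carrier H \<and> f x = u)" for u
  have peq: "?p x = ?p y \<longleftrightarrow> f x = f y" if "x \<in> carrier H" "y \<in> carrier H" for x y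
  proof -
    have "f x = f y \<longleftrightarrow> f (x \<ominus>\<^bsub>H\<^esub> y) = \<zero>\<^bsub>U\<^esub>"
      using that fs(1) linear_map_minus[OF V VU fl]
      by (simp add: ring.r_right_minus_eq[OF complex_algebraD(1)[OF U]])
    then show ?thesis using that quotient_class_eq_iff[OF V W] by (simp add: I_def sH)
  qed
  have gf: "g (f x) = ?p x" if x: "x \<in> carrier H" for x
  proof -
    have "(SOME z. z \<in> carrier H \<and> f z = f x) \<in> carrier H \<and> f (SOME z. z \<in> carrier H \<and> f z = f x) = f x"
      by (rule someI[of _ x]) (use x in simp)
    then show ?thesis unfolding g_def using peq[of "SOME z. z \<in> carrier H \<and> f z = f x" x] x by simp
  qed
  have g: "algebra_map U ?K g"
  proof (intro algebra_mapI linear_mapI)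
    show "g \<one>\<^bsub>U\<^esub> = \<one>\<^bsub>?K\<^esub>" using gf[OF sH(6)] fs(5) algebra_mapD(3)[OF p] by simp
  qed (auto simp: surj gf algebra_map_simps[OF p] sH fs(2-4)[symmetric])
  have inj: "inj_on g (carrier U)"
    by (rule inj_onI) (auto simp: surj gf peq)
  have im: "g ` carrier U = carrier ?K" unfolding surj psurj image_image by (rule image_cong) (auto simp: gf)
  have dg: "comult ?K (g y) = tensor_map ?K ?K g g (comult U y)" if "y \<in> carrier U" for y
  proof -
    obtain x where x: "x \<in> carrier H" "y = f x" using \<open>y \<in> carrier U\<close> surj by auto
    note gl = algebra_mapD(1)[OF g]
    have "tensor_map ?K ?K g g (tensor_map U U f f t) = tensor_map ?K ?K ?p ?p t" if t: "t \<in> carrier (tensor H H)" for t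
      by (rule tensor_linear_eq[OF V V VTK linear_map_comp[OF tensor_map_linear[OF V V VU VU fl fl]
            tensor_map_linear[OF VU VU VK VK gl gl]] pp _ t])
         (simp add: ppp tensor_map_pure[OF V V VU VU fl fl] tensor_map_pure[OF VU VU VK VK gl gl] fs gf)
    then show ?thesis using x hd(1) by (simp add: gf dK d)
  qed
  show "\<exists>g. hopf_isomorphism U ?K g"
    unfolding hopf_isomorphism_def
  proof (intro exI[of _ g] conjI ballI)
    show "bij_betw g (carrier U) (carrier ?K)" using inj im by (simp add: bij_betw_def)
    fix y assume y: "y \<in> carrier U"
    then obtain x where x: "x \<in> carrier H" "y = f x" using surj by auto
    show "comult ?K (g y) = tensor_map ?K ?K g g (comult U y)" by (rule dg[OF y])
    show "counit ?K (g y) = counit U y" using x by (simp add: gf eK e)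
    show "antipode ?K (g y) = g (antipode U y)" using x by (simp add: gf sK s hs)
  qed (fact hU hK g)+
qed

section \<open>The tensor algebra of a bimodule\<close>

lemma tensor_words_simps [simp]:
  "carrier (tensor_words R M r) = carrier R \<times> lists (carrier M)" "\<one>\<^bsub>tensor_words R M r\<^esub> = (\<one>\<^bsub>R\<^esub>, [])"
  "(a, []) \<otimes>\<^bsub>tensor_words R M r\<^esub> (b, vs) = (a \<otimes>\<^bsub>R\<^esub> b, vs)"
  "(a, us @ [m]) \<otimes>\<^bsub>tensor_words R M r\<^esub> (b, vs) = (a, us @ [r m b] @ vs)"
  "(a, [m]) \<otimes>\<^bsub>tensor_words R M r\<^esub> (b, vs) = (a, r m b # vs)"
  "(a, us @ [m, m']) \<otimes>\<^bsub>tensor_words R M r\<^esub> (b, vs) = (a, us @ [m, r m' b] @ vs)"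
  by (simp_all add: tensor_words_def butlast_append)

lemma tensor_algebra_relations_members:
  "a \<in> carrier R \<Longrightarrow> b \<in> carrier R \<Longrightarrow> us \<in> lists (carrier M) \<Longrightarrow>
    basis_vector (a \<oplus>\<^bsub>R\<^esub> b, us) - basis_vector (a, us) - basis_vector (b, us) \<in> tensor_algebra_relations R M l r"
  "a \<in> carrier R \<Longrightarrow> us \<in> lists (carrier M) \<Longrightarrow>
    basis_vector (c \<odot>\<^bsub>R\<^esub> a, us) - Poly_Mapping.single (a, us) c \<in> tensor_algebra_relations R M l r"
  "a \<in> carrier R \<Longrightarrow> us \<in> lists (carrier M) \<Longrightarrow> m \<in> carrier M \<Longrightarrow> m' \<in> carrier M \<Longrightarrow> vs \<in> lists (carrier M) \<Longrightarrow>
    basis_vector (a, us @ [m \<oplus>\<^bsub>M\<^esub> m'] @ vs)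
        - basis_vector (a, us @ [m] @ vs) - basis_vector (a, us @ [m'] @ vs) \<in> tensor_algebra_relations R M l r"
  "a \<in> carrier R \<Longrightarrow> us \<in> lists (carrier M) \<Longrightarrow> m \<in> carrier M \<Longrightarrow> vs \<in> lists (carrier M) \<Longrightarrow>
    basis_vector (a, us @ [c \<odot>\<^bsub>M\<^esub> m] @ vs) - Poly_Mapping.single (a, us @ [m] @ vs) c
      \<in> tensor_algebra_relations R M l r"
  "a \<in> carrier R \<Longrightarrow> b \<in> carrier R \<Longrightarrow> m \<in> carrier M \<Longrightarrow> us \<in> lists (carrier M) \<Longrightarrow>
    basis_vector (a \<otimes>\<^bsub>R\<^esub> b, m # us) - basis_vector (a, l b m # us) \<in> tensor_algebra_relations R M l r"
  "a \<in> carrier R \<Longrightarrow> b \<in> carrier R \<Longrightarrow> us \<in> lists (carrier M) \<Longrightarrow> m \<in> carrier M \<Longrightarrow> m' \<in> carrier M \<Longrightarrow>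
    vs \<in> lists (carrier M) \<Longrightarrow>
    basis_vector (a, us @ [r m b, m'] @ vs) - basis_vector (a, us @ [m, l b m'] @ vs)
      \<in> tensor_algebra_relations R M l r"
  unfolding tensor_algebra_relations_def
  subgoal by (rule UnI1, rule UnI1, rule UnI1, rule UnI1, rule UnI1, rule CollectI, intro exI conjI, rule refl, assumption+)
  subgoal by (rule UnI1, rule UnI1, rule UnI1, rule UnI1, rule UnI2, rule CollectI, intro exI conjI, rule refl, assumption+)
  subgoal by (rule UnI1, rule UnI1, rule UnI1, rule UnI2, rule CollectI, intro exI conjI, rule refl, assumption+)
  subgoal by (rule UnI1, rule UnI1, rule UnI2, rule CollectI, intro exI conjI, rule refl, assumption+)
  subgoal by (rule UnI1, rule UnI2, rule CollectI, intro exI conjI, rule refl, assumption+)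
  subgoal by (rule UnI2, rule CollectI, intro exI conjI, rule refl, assumption+)
  done

lemma tensor_algebra_relations_cases:
  assumes "x \<in> tensor_algebra_relations R M l r"
  obtains a b us where "x = basis_vector (a \<oplus>\<^bsub>R\<^esub> b, us) - basis_vector (a, us) - basis_vector (b, us)"
      "a \<in> carrier R" "b \<in> carrier R" "us \<in> lists (carrier M)"
  | a us c where "x = basis_vector (c \<odot>\<^bsub>R\<^esub> a, us) - Poly_Mapping.single (a, us) c"
      "a \<in> carrier R" "us \<in> lists (carrier M)"
  | a us m m' vs where "x = basis_vector (a, us @ [m \<oplus>\<^bsub>M\<^esub> m'] @ vs)
        - basis_vector (a, us @ [m] @ vs) - basis_vector (a, us @ [m'] @ vs)"
      "a \<in> carrier R" "us \<in> lists (carrier M)" "m \<in> carrier M" "m' \<in> carrier M" "vs \<in> lists (carrier M)"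
  | a us m c vs where "x = basis_vector (a, us @ [c \<odot>\<^bsub>M\<^esub> m] @ vs) - Poly_Mapping.single (a, us @ [m] @ vs) c"
      "a \<in> carrier R" "us \<in> lists (carrier M)" "m \<in> carrier M" "vs \<in> lists (carrier M)"
  | a b m us where "x = basis_vector (a \<otimes>\<^bsub>R\<^esub> b, m # us) - basis_vector (a, l b m # us)"
      "a \<in> carrier R" "b \<in> carrier R" "m \<in> carrier M" "us \<in> lists (carrier M)"
  | a b us m m' vs where "x = basis_vector (a, us @ [r m b, m'] @ vs) - basis_vector (a, us @ [m, l b m'] @ vs)"
      "a \<in> carrier R" "b \<in> carrier R" "us \<in> lists (carrier M)" "m \<in> carrier M" "m' \<in> carrier M" "vs \<in> lists (carrier M)"
proof -
  show thesis
    using assms unfolding tensor_algebra_relations_def Un_iff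
    by (elim disjE CollectE exE conjE)
      (rule that(1), assumption+, rule that(2), assumption+, rule that(3), assumption+,
    rule that(4), assumption+, rule that(5), assumption+, rule that(6), assumption+)
qed

context
  fixes R :: "(complex, 'a, 'm) module_scheme" and M :: "(complex, 'b, 'n) module_scheme"
    and l :: "'a \<Rightarrow> 'b \<Rightarrow> 'b" and r :: "'b \<Rightarrow> 'a \<Rightarrow> 'b"
  assumes R: "complex_algebra R" and M: "module CC M" and bim: "bimodule R M l r"
begin

interpretation M: module CC M by (rule M)

lemmas base_simps = complex_algebra_simps[OF R]

lemma bimodule_simps:
  "a \<in> carrier R \<Longrightarrow> m \<in> carrier M \<Longrightarrow> l a m \<in> carrier M"
  "a \<in> carrier R \<Longrightarrow> m \<in> carrier M \<Longrightarrow> r m a \<in> carrier M"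
  "a \<in> carrier R \<Longrightarrow> m \<in> carrier M \<Longrightarrow> m' \<in> carrier M \<Longrightarrow> r (m \<oplus>\<^bsub>M\<^esub> m') a = r m a \<oplus>\<^bsub>M\<^esub> r m' a"
  "a \<in> carrier R \<Longrightarrow> b \<in> carrier R \<Longrightarrow> m \<in> carrier M \<Longrightarrow> r m (a \<oplus>\<^bsub>R\<^esub> b) = r m a \<oplus>\<^bsub>M\<^esub> r m b"
  "a \<in> carrier R \<Longrightarrow> m \<in> carrier M \<Longrightarrow> r (c \<odot>\<^bsub>M\<^esub> m) a = c \<odot>\<^bsub>M\<^esub> r m a"
  "a \<in> carrier R \<Longrightarrow> m \<in> carrier M \<Longrightarrow> r m (c \<odot>\<^bsub>R\<^esub> a) = c \<odot>\<^bsub>M\<^esub> r m a"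
  "m \<in> carrier M \<Longrightarrow> l \<one>\<^bsub>R\<^esub> m = m" "m \<in> carrier M \<Longrightarrow> r m \<one>\<^bsub>R\<^esub> = m"
  "a \<in> carrier R \<Longrightarrow> b \<in> carrier R \<Longrightarrow> m \<in> carrier M \<Longrightarrow> l (a \<otimes>\<^bsub>R\<^esub> b) m = l a (l b m)"
  "a \<in> carrier R \<Longrightarrow> b \<in> carrier R \<Longrightarrow> m \<in> carrier M \<Longrightarrow> r m (a \<otimes>\<^bsub>R\<^esub> b) = r (r m a) b"
  "a \<in> carrier R \<Longrightarrow> b \<in> carrier R \<Longrightarrow> m \<in> carrier M \<Longrightarrow> r (l a m) b = l a (r m b)"
proof -
  have b: "bilinear_map R M M l" "bilinear_map M R M r" using bim by (auto simp: bimodule_def)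
  note s = bilinear_simps[OF b(1)] bilinear_simps[OF b(2)]
  show "a \<in> carrier R \<Longrightarrow> m \<in> carrier M \<Longrightarrow> l a m \<in> carrier M"
    "a \<in> carrier R \<Longrightarrow> m \<in> carrier M \<Longrightarrow> r m a \<in> carrier M"
    "a \<in> carrier R \<Longrightarrow> m \<in> carrier M \<Longrightarrow> m' \<in> carrier M \<Longrightarrow> r (m \<oplus>\<^bsub>M\<^esub> m') a = r m a \<oplus>\<^bsub>M\<^esub> r m' a"
    "a \<in> carrier R \<Longrightarrow> b \<in> carrier R \<Longrightarrow> m \<in> carrier M \<Longrightarrow> r m (a \<oplus>\<^bsub>R\<^esub> b) = r m a \<oplus>\<^bsub>M\<^esub> r m b"
    "a \<in> carrier R \<Longrightarrow> m \<in> carrier M \<Longrightarrow> r (c \<odot>\<^bsub>M\<^esub> m) a = c \<odot>\<^bsub>M\<^esub> r m a"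
    "a \<in> carrier R \<Longrightarrow> m \<in> carrier M \<Longrightarrow> r m (c \<odot>\<^bsub>R\<^esub> a) = c \<odot>\<^bsub>M\<^esub> r m a"
    using s by simp_all
qed (use bim in \<open>auto simp: bimodule_def\<close>)

lemma tensor_words_monoid: "monoid (tensor_words R M r)"
proof (rule monoidI)
  fix x y z assume x: "x \<in> carrier (tensor_words R M r)" and y: "y \<in> carrier (tensor_words R M r)"
    and z: "z \<in> carrier (tensor_words R M r)"
  obtain a us b vs c ws where e: "x = (a, us)" "y = (b, vs)" "z = (c, ws)" by (cases x, cases y, cases z) auto
  show "x \<otimes>\<^bsub>tensor_words R M r\<^esub> y \<in> carrier (tensor_words R M r)"
    using x y e by (cases us rule: rev_cases) (auto simp: base_simps bimodule_simps)
  show "x \<otimes>\<^bsub>tensor_words R M r\<^esub> y \<otimes>\<^bsub>tensor_words R M r\<^esub> z = x \<otimes>\<^bsub>tensor_words R M r\<^esub> (y \<otimes>\<^bsub>tensor_words R M r\<^esub> z)"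
  proof (cases us rule: rev_cases)
    case Nil
    show ?thesis using x y z e Nil by (cases vs rule: rev_cases) (auto simp: base_simps)
  next
    case (snoc us' m)
    show ?thesis
    proof (cases vs rule: rev_cases)
      case Nil
      then show ?thesis using x y z e snoc by (auto simp: bimodule_simps)
    next
      case (snoc vs' m')
      then show ?thesis using e \<open>us = us' @ [m]\<close> tensor_words_simps(4)[of R M r a "us' @ [r m b] @ vs'" m' c ws] by simp
    qed
  qed
  show "\<one>\<^bsub>tensor_words R M r\<^esub> \<otimes>\<^bsub>tensor_words R M r\<^esub> x = x" using x e by (auto simp: base_simps)
  show "x \<otimes>\<^bsub>tensor_words R M r\<^esub> \<one>\<^bsub>tensor_words R M r\<^esub> = x"
    using x e by (cases us rule: rev_cases) (auto simp: base_simps bimodule_simps)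
qed (auto simp: base_simps)

abbreviation "word_algebra \<equiv> monoid_algebra (tensor_words R M r)"

lemma word_algebra: "complex_algebra word_algebra"
  by (rule monoid_algebra_algebra[OF tensor_words_monoid])

lemma tensor_algebra_relations_subset: "tensor_algebra_relations R M l r \<subseteq> carrier word_algebra"
proof
  fix x assume "x \<in> tensor_algebra_relations R M l r"
  then show "x \<in> carrier word_algebra"
    by (cases rule: tensor_algebra_relations_cases)
      (simp_all add: keys_minus_subset base_simps bimodule_simps in_lists_conv_set[symmetric])
qed

text \<open>
  Multiplying a relation by a word gives a relation again. The cases that use the bimodule axioms
  are those in which a coefficient from \<open>R\<close> meets the adjacent letter and is absorbed
  by it; the kind of the relation may then change, for example additivity in the coefficient
  becomes additivity in a letter.
\<close>

lemma tensor_algebra_kernel_ideal: "ideal (tensor_algebra_kernel R M l r) word_algebra"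
proof -
  note K = word_algebra
  let ?T = "tensor_words R M r"
  note mult = complex_algebra_mult_linear[OF K]
  note VK = monoid_algebra_vector_space[of ?T]
  interpret W: monoid ?T by (rule tensor_words_monoid)
  have sc: "Poly_Mapping.single (a, us) c \<in> carrier word_algebra" if "a \<in> carrier R" "us \<in> lists (carrier M)" for a us c
    using that by auto
  note mc = linear_map_diff_basis(2)[OF VK linear_map_id]
  have dl: "z \<otimes>\<^bsub>word_algebra\<^esub> (p - p') = z \<otimes>\<^bsub>word_algebra\<^esub> p - z \<otimes>\<^bsub>word_algebra\<^esub> p'"
    and dr: "(p - p') \<otimes>\<^bsub>word_algebra\<^esub> z = p \<otimes>\<^bsub>word_algebra\<^esub> z - p' \<otimes>\<^bsub>word_algebra\<^esub> z"
    if "p \<in> carrier word_algebra" "p' \<in> carrier word_algebra" "z \<in> carrier word_algebra" for p p' z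
    using linear_map_diff_basis(1)[OF VK mult(1)[OF that(3)] that(1,2)]
      linear_map_diff_basis(1)[OF VK mult(2)[OF that(3)] that(1,2)] that complex_algebra_simps(1)[OF K]
    by (simp_all del: monoid_algebra_simps(1) add: monoid_algebra_minus)
  note sm = dl dr mc sc base_simps bimodule_simps
  have left: "basis_vector x \<otimes>\<^bsub>word_algebra\<^esub> y \<in> tensor_algebra_relations R M l r"
    if x: "x \<in> carrier ?T" and y: "y \<in> tensor_algebra_relations R M l r" for x y
  proof -
    obtain c ws where xc: "x = (c, ws)" "c \<in> carrier R" "ws \<in> lists (carrier M)" using x by auto
    show ?thesis
    proof (cases ws rule: rev_cases)
      case Nil
      from y show ?thesis
      proof (cases rule: tensor_algebra_relations_cases)
        case (5 a b m us)
        then show ?thesis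
          using tensor_algebra_relations_members(5)[of "c \<otimes>\<^bsub>R\<^esub> a" R b m M us l r] xc Nil
          by (simp del: monoid_algebra_simps(1) add: sm)
      qed (simp_all del: monoid_algebra_simps(1) append.simps add: sm xc Nil tensor_algebra_relations_members)
    next
      case (snoc ws' w)
      have w: "w \<in> carrier M" "ws' \<in> lists (carrier M)" using xc snoc by auto
      from y show ?thesis
      proof (cases rule: tensor_algebra_relations_cases)
        case (1 a b us)
        then show ?thesis
          using tensor_algebra_relations_members(3)[of c R ws' M "r w a" "r w b" us l r] w xc snoc
          by (simp del: monoid_algebra_simps(1) add: sm)
      next
        case (2 a us k)
        then show ?thesis
          using tensor_algebra_relations_members(4)[of c R ws' M "r w a" us k l r] w xc snoc
          by (simp del: monoid_algebra_simps(1) add: sm)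
      next
        case (3 a us m m' vs)
        then show ?thesis
          using tensor_algebra_relations_members(3)[of c R "ws' @ [r w a] @ us" M m m' vs l r] w xc snoc
          by (simp del: monoid_algebra_simps(1) add: sm)
      next
        case (4 a us m k vs)
        then show ?thesis
          using tensor_algebra_relations_members(4)[of c R "ws' @ [r w a] @ us" M m vs k l r] w xc snoc
          by (simp del: monoid_algebra_simps(1) add: sm)
      next
        case (5 a b m us)
        then show ?thesis
          using tensor_algebra_relations_members(6)[of c R b ws' M "r w a" m us r l] w xc snoc
          by (simp del: monoid_algebra_simps(1) add: sm)
      next
        case (6 a b us m m' vs)
        then show ?thesis
          using tensor_algebra_relations_members(6)[of c R b "ws' @ [r w a] @ us" M m m' vs r l] w xc snoc
          by (simp del: monoid_algebra_simps(1) add: sm)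
      qed
    qed
  qed
  have right: "y \<otimes>\<^bsub>word_algebra\<^esub> basis_vector x \<in> tensor_algebra_relations R M l r"
    if x: "x \<in> carrier ?T" and y: "y \<in> tensor_algebra_relations R M l r" for x y
  proof -
    obtain c ws where xc: "x = (c, ws)" "c \<in> carrier R" "ws \<in> lists (carrier M)" using x by auto
    have snoc_mult: "(a, us @ vs @ [m]) \<otimes>\<^bsub>?T\<^esub> (c, ws) = (a, us @ vs @ [r m c] @ ws)" for a us vs m
      using tensor_words_simps(4)[of R M r a "us @ vs" m c ws] by simp
    note snoc_mult2 = snoc_mult[of _ "_ # _" _ _, simplified] snoc_mult[of _ _ "_ # _" _, simplified]
      snoc_mult[of _ _ "_ # _ # _" _, simplified] snoc_mult
    note mem = tensor_algebra_relations_members[where l = l and r = r and R = R and M = M]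
    from y show ?thesis
    proof (cases rule: tensor_algebra_relations_cases)
      case (1 a b us)
      show ?thesis
      proof (cases us rule: rev_cases)
        case Nil
        then show ?thesis using 1 mem(1)[of "a \<otimes>\<^bsub>R\<^esub> c" "b \<otimes>\<^bsub>R\<^esub> c" ws] xc
          by (simp del: monoid_algebra_simps(1) add: sm)
      next
        case (snoc us' m)
        then show ?thesis using 1 mem(1)[of a b "us' @ [r m c] @ ws"] xc
          by (simp del: monoid_algebra_simps(1) add: sm)
      qed
    next
      case (2 a us k)
      show ?thesis
      proof (cases us rule: rev_cases)
        case Nil
        then show ?thesis using 2 mem(2)[of "a \<otimes>\<^bsub>R\<^esub> c" ws k] xc
          by (simp del: monoid_algebra_simps(1) add: sm)
      next
        case (snoc us' m)
        then show ?thesis using 2 mem(2)[of a "us' @ [r m c] @ ws" k] xc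
          by (simp del: monoid_algebra_simps(1) add: sm)
      qed
    next
      case (3 a us m m' vs)
      show ?thesis
      proof (cases vs rule: rev_cases)
        case Nil
        then show ?thesis using 3 mem(3)[of a us "r m c" "r m' c" ws] xc
          by (simp del: monoid_algebra_simps(1) add: sm)
      next
        case (snoc vs' w)
        then show ?thesis using 3 mem(3)[of a us m m' "vs' @ [r w c] @ ws"] xc
          by (simp del: monoid_algebra_simps(1) add: sm snoc_mult2)
      qed
    next
      case (4 a us m k vs)
      show ?thesis
      proof (cases vs rule: rev_cases)
        case Nil
        then show ?thesis using 4 mem(4)[of a us "r m c" ws k] xc
          by (simp del: monoid_algebra_simps(1) add: sm)
      next
        case (snoc vs' w)
        then show ?thesis using 4 mem(4)[of a us m "vs' @ [r w c] @ ws" k] xc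
          by (simp del: monoid_algebra_simps(1) add: sm snoc_mult2)
      qed
    next
      case (5 a b m us)
      show ?thesis
      proof (cases us rule: rev_cases)
        case Nil
        then show ?thesis using 5 mem(5)[of a b "r m c" ws] xc
          by (simp del: monoid_algebra_simps(1) add: sm)
      next
        case (snoc us' w)
        then show ?thesis using 5 mem(5)[of a b m "us' @ [r w c] @ ws"] xc
          tensor_words_simps(4)[of R M r _ "_ # us'" w c ws]
          by (simp del: monoid_algebra_simps(1) add: sm)
      qed
    next
      case (6 a b us m m' vs)
      show ?thesis
      proof (cases vs rule: rev_cases)
        case Nil
        then show ?thesis using 6 mem(6)[of a b us m "r m' c" ws] xc
          by (simp del: monoid_algebra_simps(1) add: sm)
      next
        case (snoc vs' w)
        then show ?thesis using 6 mem(6)[of a b us m m' "vs' @ [r w c] @ ws"] xc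
          by (simp del: monoid_algebra_simps(1) add: sm snoc_mult2)
      qed
    qed
  qed
  show ?thesis
    by (rule span_ideal[OF tensor_words_monoid tensor_algebra_relations_subset])
       (rule subsetD[OF linear_span_superset], erule (1) left right)+
qed

lemma tensor_algebra_algebra: "complex_algebra (tensor_algebra R M l r)"
  unfolding tensor_algebra_def by (rule quotient_algebra[OF word_algebra tensor_algebra_kernel_ideal])

lemma tensor_word_class:
  "tensor_word R M l r a us = quotient_class word_algebra (tensor_algebra_kernel R M l r) (basis_vector (a, us))"
  by (simp add: tensor_word_def quotient_class_def)

lemma tensor_class_algebra_map:
  "algebra_map word_algebra (tensor_algebra R M l r) (quotient_class word_algebra (tensor_algebra_kernel R M l r))"
  unfolding tensor_algebra_def by (rule quotient_algebra[OF word_algebra tensor_algebra_kernel_ideal])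

lemma tensor_word_closed:
  "a \<in> carrier R \<Longrightarrow> us \<in> lists (carrier M) \<Longrightarrow> tensor_word R M l r a us \<in> carrier (tensor_algebra R M l r)"
  unfolding tensor_word_class by (rule algebra_map_simps(1)[OF tensor_class_algebra_map]) simp

lemma tensor_word_mult:
  assumes "a \<in> carrier R" "us \<in> lists (carrier M)" "b \<in> carrier R" "vs \<in> lists (carrier M)"
    and "(a, us) \<otimes>\<^bsub>tensor_words R M r\<^esub> (b, vs) = (c, ws)"
  shows "tensor_word R M l r a us \<otimes>\<^bsub>tensor_algebra R M l r\<^esub> tensor_word R M l r b vs = tensor_word R M l r c ws"
  using algebra_mapD(2)[OF tensor_class_algebra_map, of "basis_vector (a, us)" "basis_vector (b, vs)"] assms
  by (simp add: tensor_word_class)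

lemma tensor_word_one: "\<one>\<^bsub>tensor_algebra R M l r\<^esub> = tensor_word R M l r \<one>\<^bsub>R\<^esub> []"
  using algebra_mapD(3)[OF tensor_class_algebra_map] by (simp add: tensor_word_class)

lemma tensor_class_eq_of_relation:
  assumes p: "p \<in> carrier word_algebra" "p' \<in> carrier word_algebra" and d: "p - p' \<in> tensor_algebra_relations R M l r"
  shows "quotient_class word_algebra (tensor_algebra_kernel R M l r) p
    = quotient_class word_algebra (tensor_algebra_kernel R M l r) p'"
  unfolding quotient_class_eq_iff[OF monoid_algebra_vector_space ideal_subspace[OF word_algebra tensor_algebra_kernel_ideal] p]
    monoid_algebra_minus[OF p] by (rule subsetD[OF linear_span_superset d])

lemma tensor_word_base_linear: "linear_map R (tensor_algebra R M l r) (\<lambda>a. tensor_word R M l r a [])"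
proof (rule linear_mapI)
  note C = algebra_map_simps[OF tensor_class_algebra_map]
  have s: "Poly_Mapping.single (a, []) c \<in> carrier word_algebra" if "a \<in> carrier R" for a c using that by simp
  have p: "x + y \<in> carrier word_algebra" if "x \<in> carrier word_algebra" "y \<in> carrier word_algebra" for x y
    using that keys_add[of x y] by auto
  fix a b c assume a: "a \<in> carrier R"
  show "tensor_word R M l r a [] \<in> carrier (tensor_algebra R M l r)" by (simp add: tensor_word_closed a)
  show "tensor_word R M l r (c \<odot>\<^bsub>R\<^esub> a) [] = c \<odot>\<^bsub>tensor_algebra R M l r\<^esub> tensor_word R M l r a []"
    unfolding tensor_word_class C(3)[OF s[OF a], symmetric]
    by (rule tensor_class_eq_of_relation)
      (use a tensor_algebra_relations_members(2)[of a R "[]" M c l r] base_simps in simp_all)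
  assume b: "b \<in> carrier R"
  show "tensor_word R M l r (a \<oplus>\<^bsub>R\<^esub> b) [] = tensor_word R M l r a [] \<oplus>\<^bsub>tensor_algebra R M l r\<^esub> tensor_word R M l r b []"
    unfolding tensor_word_class C(2)[OF s[OF a] s[OF b], symmetric]
    by (rule tensor_class_eq_of_relation)
      (use a b p[OF s[OF a, of 1] s[OF b, of 1]] tensor_algebra_relations_members(1)[of a R b "[]" M l r] base_simps in
        \<open>simp_all add: diff_diff_eq\<close>)
qed

lemma tensor_word_base_algebra_map: "algebra_map R (tensor_algebra R M l r) (\<lambda>a. tensor_word R M l r a [])"
  by (rule algebra_mapI[OF tensor_word_base_linear]) (simp_all add: tensor_word_one tensor_word_mult)

lemma tensor_word_letter_linear: "linear_map M (tensor_algebra R M l r) (\<lambda>m. tensor_word R M l r \<one>\<^bsub>R\<^esub> [m])"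
proof (rule linear_mapI)
  note C = algebra_map_simps[OF tensor_class_algebra_map]
  note one = base_simps(6)
  have s: "Poly_Mapping.single (\<one>\<^bsub>R\<^esub>, [a]) c \<in> carrier word_algebra" if "a \<in> carrier M" for a c using that one by simp
  have p: "x + y \<in> carrier word_algebra" if "x \<in> carrier word_algebra" "y \<in> carrier word_algebra" for x y
    using that keys_add[of x y] by auto
  fix a b c assume a: "a \<in> carrier M"
  show "tensor_word R M l r \<one>\<^bsub>R\<^esub> [a] \<in> carrier (tensor_algebra R M l r)" by (simp add: tensor_word_closed a one)
  show "tensor_word R M l r \<one>\<^bsub>R\<^esub> [c \<odot>\<^bsub>M\<^esub> a] = c \<odot>\<^bsub>tensor_algebra R M l r\<^esub> tensor_word R M l r \<one>\<^bsub>R\<^esub> [a]"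
    unfolding tensor_word_class C(3)[OF s[OF a], symmetric]
    by (rule tensor_class_eq_of_relation)
      (use a one tensor_algebra_relations_members(4)[of "\<one>\<^bsub>R\<^esub>" R "[]" M a "[]" c l r] in simp_all)
  assume b: "b \<in> carrier M"
  show "tensor_word R M l r \<one>\<^bsub>R\<^esub> [a \<oplus>\<^bsub>M\<^esub> b]
      = tensor_word R M l r \<one>\<^bsub>R\<^esub> [a] \<oplus>\<^bsub>tensor_algebra R M l r\<^esub> tensor_word R M l r \<one>\<^bsub>R\<^esub> [b]"
    unfolding tensor_word_class C(2)[OF s[OF a] s[OF b], symmetric]
    by (rule tensor_class_eq_of_relation)
      (use a b one p[OF s[OF a, of 1] s[OF b, of 1]] tensor_algebra_relations_members(3)[of "\<one>\<^bsub>R\<^esub>" R "[]" M a b "[]" l r] in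
        \<open>simp_all add: diff_diff_eq\<close>)
qed

lemma tensor_word_left_action:
  assumes "a \<in> carrier R" "m \<in> carrier M"
  shows "tensor_word R M l r a [] \<otimes>\<^bsub>tensor_algebra R M l r\<^esub> tensor_word R M l r \<one>\<^bsub>R\<^esub> [m]
    = tensor_word R M l r \<one>\<^bsub>R\<^esub> [l a m]"
proof -
  have "tensor_word R M l r a [] \<otimes>\<^bsub>tensor_algebra R M l r\<^esub> tensor_word R M l r \<one>\<^bsub>R\<^esub> [m]
      = tensor_word R M l r (\<one>\<^bsub>R\<^esub> \<otimes>\<^bsub>R\<^esub> a) [m]"
    by (rule tensor_word_mult) (simp_all add: assms base_simps)
  also have "\<dots> = tensor_word R M l r \<one>\<^bsub>R\<^esub> [l a m]"
    unfolding tensor_word_class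
    by (rule tensor_class_eq_of_relation)
      (use assms base_simps(1,6) bimodule_simps(1) tensor_algebra_relations_members(5)[of "\<one>\<^bsub>R\<^esub>" R a m M "[]" l r] in simp_all)
  finally show ?thesis .
qed

lemma tensor_word_right_action:
  assumes "a \<in> carrier R" "m \<in> carrier M"
  shows "tensor_word R M l r \<one>\<^bsub>R\<^esub> [m] \<otimes>\<^bsub>tensor_algebra R M l r\<^esub> tensor_word R M l r a []
    = tensor_word R M l r \<one>\<^bsub>R\<^esub> [r m a]"
  by (rule tensor_word_mult) (simp_all add: assms base_simps)

lemma tensor_word_snoc:
  assumes "a \<in> carrier R" "us \<in> lists (carrier M)" "m \<in> carrier M"
  shows "tensor_word R M l r a (us @ [m])
    = tensor_word R M l r a us \<otimes>\<^bsub>tensor_algebra R M l r\<^esub> tensor_word R M l r \<one>\<^bsub>R\<^esub> [m]"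
  by (rule tensor_word_mult[symmetric], use assms base_simps(6) in simp_all)
     (cases us rule: rev_cases, use assms in \<open>auto simp: bimodule_simps base_simps\<close>)

lemma tensor_algebra_linear_into:
  assumes V: "module CC V" and f: "linear_map (tensor_algebra R M l r) V f" and H: "submodule H CC V"
    and w: "\<And>a us. a \<in> carrier R \<Longrightarrow> us \<in> lists (carrier M) \<Longrightarrow> f (tensor_word R M l r a us) \<in> H"
    and x: "x \<in> carrier (tensor_algebra R M l r)"
  shows "f x \<in> H"
proof -
  let ?c = "quotient_class word_algebra (tensor_algebra_kernel R M l r)"
  obtain p where p: "p \<in> carrier word_algebra" "x = ?c p"
    using x unfolding tensor_algebra_def quotient_space_simps(1) by auto
  show ?thesis unfolding p(2)
    by (rule monoid_algebra_linear_into[OF V linear_map_comp[OF algebra_mapD(1)[OF tensor_class_algebra_map] f] H _ p(1)])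
       (use w in \<open>auto simp: tensor_word_class\<close>)
qed

lemma tensor_algebra_generators:
  "algebra_generators (tensor_algebra R M l r)
     ((\<lambda>a. tensor_word R M l r a []) ` carrier R \<union> (\<lambda>m. tensor_word R M l r \<one>\<^bsub>R\<^esub> [m]) ` carrier M)"
  unfolding algebra_generators_def
proof (intro conjI allI impI)
  show "(\<lambda>a. tensor_word R M l r a []) ` carrier R \<union> (\<lambda>m. tensor_word R M l r \<one>\<^bsub>R\<^esub> [m]) ` carrier M
      \<subseteq> carrier (tensor_algebra R M l r)"
    using base_simps(6) by (auto intro!: tensor_word_closed)
  fix B assume B: "submodule B CC (tensor_algebra R M l r)" and one: "\<one>\<^bsub>tensor_algebra R M l r\<^esub> \<in> B"
    and mult: "\<forall>x\<in>B. \<forall>y\<in>B. x \<otimes>\<^bsub>tensor_algebra R M l r\<^esub> y \<in> B"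
    and gen: "(\<lambda>a. tensor_word R M l r a []) ` carrier R \<union> (\<lambda>m. tensor_word R M l r \<one>\<^bsub>R\<^esub> [m]) ` carrier M \<subseteq> B"
  have w: "tensor_word R M l r a us \<in> B" if a: "a \<in> carrier R" and us: "us \<in> lists (carrier M)" for a us
    using us
  proof (induction us rule: rev_induct)
    case Nil
    show ?case using gen a by auto
  next
    case (snoc m us)
    then show ?case using mult gen a tensor_word_snoc[OF a, of us m] by auto
  qed
  show "carrier (tensor_algebra R M l r) \<subseteq> B"
    using tensor_algebra_linear_into[OF complex_algebraD(2)[OF tensor_algebra_algebra] linear_map_id B w] by blast
qed

text \<open>
  The word with coefficient \<open>a\<close> and letters \<open>m\<^sub>1, ..., m\<^sub>n\<close>
  has to be sent to \<open>f(a) g(m\<^sub>1) ... g(m\<^sub>n)\<close>. The hypotheses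
  \<open>gl\<close> and \<open>gr\<close> on \<open>f\<close> and \<open>g\<close> say that this
  respects the balancing relations.
\<close>

theorem tensor_algebra_universal:
  assumes B: "complex_algebra B" and f: "algebra_map R B f" and g: "linear_map M B g"
    and gl: "\<And>a m. a \<in> carrier R \<Longrightarrow> m \<in> carrier M \<Longrightarrow> g (l a m) = f a \<otimes>\<^bsub>B\<^esub> g m"
    and gr: "\<And>a m. a \<in> carrier R \<Longrightarrow> m \<in> carrier M \<Longrightarrow> g (r m a) = g m \<otimes>\<^bsub>B\<^esub> f a"
  obtains h where "algebra_map (tensor_algebra R M l r) B h"
    "\<And>a. a \<in> carrier R \<Longrightarrow> h (tensor_word R M l r a []) = f a"
    "\<And>m. m \<in> carrier M \<Longrightarrow> h (tensor_word R M l r \<one>\<^bsub>R\<^esub> [m]) = g m"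
proof -
  note VB = complex_algebraD(2)[OF B] and sB = complex_algebra_simps[OF B]
  note fs = algebra_map_simps[OF f] and gs = linear_mapD[OF g]
  note mult = complex_algebra_mult_linear[OF B]
  define P where "P us x = foldl (\<lambda>y m. y \<otimes>\<^bsub>B\<^esub> g m) x us" for us x
  have P_simps: "P [] x = x" "P (m # us) x = P us (x \<otimes>\<^bsub>B\<^esub> g m)" "P (us @ vs) x = P vs (P us x)" for x m us vs
    by (simp_all add: P_def)
  have P_linear: "linear_map B B (P us)" if "us \<in> lists (carrier M)" for us
    using that
  proof (induction us)
    case Nil
    then show ?case by (simp add: P_def linear_map_id)
  next
    case (Cons m us)
    then show ?case
      using linear_map_comp[OF mult(2)[OF gs(1)[of m]] Cons.IH] by (simp add: P_simps(2)[abs_def] Cons)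
  qed
  note Ps = linear_mapD[OF P_linear]
  have P_mult: "P us (y \<otimes>\<^bsub>B\<^esub> z) = y \<otimes>\<^bsub>B\<^esub> P us z"
    if "us \<in> lists (carrier M)" "y \<in> carrier B" "z \<in> carrier B" for us y z
    using that by (induction us arbitrary: z) (auto simp: P_simps sB gs)
  define w where "w = (\<lambda>(a, us). P us (f a))"
  note M = tensor_words_monoid
  have wc: "w x \<in> carrier B" if "x \<in> carrier (tensor_words R M r)" for x
    using that by (auto simp: w_def fs Ps in_lists_conv_set)
  have wm: "w (x \<otimes>\<^bsub>tensor_words R M r\<^esub> y) = w x \<otimes>\<^bsub>B\<^esub> w y"
    if xy: "x \<in> carrier (tensor_words R M r)" "y \<in> carrier (tensor_words R M r)" for x y
  proof -
    obtain a us b vs where e: "x = (a, us)" "y = (b, vs)" by (cases x, cases y) auto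
    show ?thesis
      using xy unfolding e
      by (cases us rule: rev_cases) (auto simp: w_def P_simps P_mult[symmetric] fs gs sB Ps gr)
  qed
  have w1: "w \<one>\<^bsub>tensor_words R M r\<^esub> = \<one>\<^bsub>B\<^esub>" by (simp add: w_def P_simps fs)
  let ?E = "linear_extension B w"
  have E: "algebra_map word_algebra B ?E" by (rule monoid_algebra_lift[OF M B]) (fact wc wm w1)+
  have s: "?E (Poly_Mapping.single (a, us) c) = c \<odot>\<^bsub>B\<^esub> P us (f a)" if "a \<in> carrier R" "us \<in> lists (carrier M)" for a us c
    using linear_extension_basis[OF VB, of w "(a, us)" c] wc[of "(a, us)"] that by (simp add: w_def)
  note d = linear_map_diff_basis[OF VB algebra_mapD(1)[OF E]]
  have sc: "Poly_Mapping.single (a, us) c \<in> carrier word_algebra" if "a \<in> carrier R" "us \<in> lists (carrier M)" for a us c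
    using that by auto
  note z = minus_minus_cancel[OF VB]
  have ker: "?E x = \<zero>\<^bsub>B\<^esub>" if "x \<in> tensor_algebra_kernel R M l r" for x
  proof -
    have "?E x \<in> {\<zero>\<^bsub>B\<^esub>}"
    proof (rule linear_map_span[OF monoid_algebra_vector_space VB algebra_mapD(1)[OF E] trivial_subspace[OF VB]
          tensor_algebra_relations_subset _ that])
      fix x assume "x \<in> tensor_algebra_relations R M l r"
      then show "?E x \<in> {\<zero>\<^bsub>B\<^esub>}"
        by (cases rule: tensor_algebra_relations_cases)
          (simp_all del: monoid_algebra_simps(1) add: d sc s base_simps bimodule_simps P_simps fs gs sB Ps z gl gr)
    qed
    then show ?thesis by simp
  qed
  let ?h = "\<lambda>C. ?E (SOME x. x \<in> C)"
  have h: "algebra_map (tensor_algebra R M l r) B ?h"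
    unfolding tensor_algebra_def
    by (rule quotient_algebra_lift[OF word_algebra tensor_algebra_kernel_ideal B E]) (rule ker)
  have hw: "?h (tensor_word R M l r a us) = P us (f a)" if "a \<in> carrier R" "us \<in> lists (carrier M)" for a us
  proof -
    have "?h (tensor_word R M l r a us) = ?E (basis_vector (a, us))"
      unfolding tensor_word_class
      by (rule quotient_value[OF monoid_algebra_vector_space ideal_subspace[OF word_algebra tensor_algebra_kernel_ideal]
            VB algebra_mapD(1)[OF E] ker]) (use that in simp_all)
    then show ?thesis using s[OF that, of 1] sB(10) Ps(1) fs(1) that by simp
  qed
  show ?thesis
    by (rule that[OF h]) (simp_all add: hw P_simps base_simps fs gs sB)
qed

end

section \<open>Quantum Serre elements as iterated q-commutators\<close>

lemma q_number_add:
  assumes "p \<noteq> 0"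
  shows "q_number p (a + b) = p powi (- int b) * q_number p a + p ^ a * q_number p b"
proof -
  have "p powi int (a + b) - p powi (- int (a + b))
      = p powi (- int b) * (p powi int a - p powi (- int a)) + p ^ a * (p powi int b - p powi (- int b))"
    using assms by (simp add: power_int_minus field_simps power_add del: of_nat_add)
  then show ?thesis unfolding q_number_def by (simp only: add_divide_distrib times_divide_eq_right)
qed

lemma q_number_inverse: "q_number (inverse p) n = q_number p n"
proof -
  have "inverse p powi int n - inverse p powi (- int n) = - (p powi int n - p powi (- int n))"
    by (simp add: power_int_minus power_inverse)
  moreover have "inverse p - inverse (inverse p) = - (p - inverse p)" by simp
  ultimately show ?thesis unfolding q_number_def by (metis minus_divide_divide)
qed

lemma q_binomial_inverse: "q_binomial (inverse p) n m = q_binomial p n m"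
  by (simp add: q_binomial_def q_factorial_def q_number_inverse)

lemma q_number_nonzero:
  assumes p: "p \<noteq> 0" "\<And>m. m > 0 \<Longrightarrow> p ^ m \<noteq> 1" and n: "n > 0"
  shows "q_number p n \<noteq> 0"
proof -
  have "p powi int n - p powi (- int n) \<noteq> 0"
  proof
    assume "p powi int n - p powi (- int n) = 0"
    then have "p ^ n * p ^ n = 1" using p(1) by (simp add: power_int_minus field_simps)
    then show False using p(2)[of "n + n"] n by (simp add: power_add)
  qed
  moreover have "p - inverse p \<noteq> 0"
  proof
    assume "p - inverse p = 0"
    then have "p * p = 1" using p(1) by (simp add: field_simps)
    then show False using p(2)[of 2] by (simp add: power2_eq_square)
  qed
  ultimately show ?thesis by (simp add: q_number_def)
qed

lemma q_factorial_Suc: "q_factorial p (Suc n) = q_factorial p n * q_number p (Suc n)"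
  by (simp add: q_factorial_def)

lemma q_factorial_nonzero:
  assumes "p \<noteq> 0" "\<And>m. m > 0 \<Longrightarrow> p ^ m \<noteq> 1"
  shows "q_factorial p n \<noteq> 0"
  unfolding q_factorial_def using q_number_nonzero[OF assms] by (auto simp: prod_zero_iff)

lemma q_pascal:
  assumes p: "p \<noteq> 0" "\<And>m. m > 0 \<Longrightarrow> p ^ m \<noteq> 1" and k: "k < n"
  shows "q_binomial p (Suc n) (Suc k)
    = p powi (- int (Suc k)) * q_binomial p n (Suc k) + p ^ (n - k) * q_binomial p n k"
proof -
  note nz = q_factorial_nonzero[OF p] q_number_nonzero[OF p]
  obtain a where a: "n - k = Suc a" "n = a + Suc k" using k by (metis Suc_diff_Suc add.commute add_Suc_right le_add_diff_inverse2 less_imp_le_nat add_diff_cancel_right')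
  have num: "q_number p (Suc n) = p powi (- int (Suc k)) * q_number p (Suc a) + p ^ Suc a * q_number p (Suc k)"
    using q_number_add[OF p(1), of "Suc a" "Suc k"] a by simp
  have d: "Suc n - Suc k = Suc a" "n - Suc k = a" "n - k = Suc a" using a by auto
  have eq: "F * N / (G * M * (D * P)) = I * (F / (G * M * D)) + J * (F / (G * (D * P)))"
    if "N = I * P + J * M" "G \<noteq> 0" "M \<noteq> 0" "D \<noteq> 0" "P \<noteq> 0" for F N G M D P I J :: complex
    using that by (simp add: field_simps)
  show ?thesis
    unfolding q_binomial_def q_factorial_Suc d
    by (rule eq[OF num]) (use nz in auto)
qed

lemma q_binomial_0:
  assumes "p \<noteq> 0" "\<And>m. m > 0 \<Longrightarrow> p ^ m \<noteq> 1"
  shows "q_binomial p n 0 = 1" "q_binomial p n n = 1"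
  using q_factorial_nonzero[OF assms] by (simp_all add: q_binomial_def q_factorial_def[of p 0])

text \<open>
  The coefficient of \<open>x^(n-m) y x^m\<close> in the iterated q-commutator below.
\<close>

fun q_commutator_coeff :: "complex \<Rightarrow> complex \<Rightarrow> nat \<Rightarrow> nat \<Rightarrow> complex" where
  "q_commutator_coeff p s 0 m = (if m = 0 then 1 else 0)"
| "q_commutator_coeff p s (Suc n) 0 = q_commutator_coeff p s n 0"
| "q_commutator_coeff p s (Suc n) (Suc m) =
     q_commutator_coeff p s n (Suc m) - p ^ (2 * n) * s * q_commutator_coeff p s n m"

lemma q_commutator_coeff_beyond: "n < m \<Longrightarrow> q_commutator_coeff p s n m = 0"
  by (induction p s n m rule: q_commutator_coeff.induct) auto

text \<open>
  The power of \<open>p\<close> turns the recursion of the coefficients into the q-Pascal rule.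
  For \<open>s = p^(1-n)\<close> it cancels, which leaves the coefficients of the quantum Serre
  relation.
\<close>

lemma q_commutator_coeff_eq:
  assumes p: "p \<noteq> 0" "\<And>m. m > 0 \<Longrightarrow> p ^ m \<noteq> 1" and m: "m \<le> n"
  shows "q_commutator_coeff p s n m = (- s) ^ m * p powi (int m * (int n - 1)) * q_binomial p n m"
  using m
proof (induction n arbitrary: m)
  case 0
  then show ?case by (simp add: q_binomial_0[OF p])
next
  case (Suc n)
  show ?case
  proof (cases m)
    case 0
    then show ?thesis using Suc.IH[of 0] by (simp add: q_binomial_0[OF p])
  next
    case (Suc k)
    show ?thesis
    proof (cases "k < n")
      case True
      have e1: "p powi (int (Suc k) * (int n - 1)) = p powi (int (Suc k) * int n) * p powi (- int (Suc k))"
        using p(1) by (subst power_int_add[symmetric]) (auto simp: algebra_simps)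
      have e2: "p ^ (2 * n) * p powi (int k * (int n - 1)) = p powi (int (Suc k) * int n) * p ^ (n - k)"
      proof -
        have "p ^ (2 * n) * p powi (int k * (int n - 1)) = p powi (int (2 * n) + int k * (int n - 1))"
          using p(1) by (simp add: power_int_add del: of_nat_mult)
        also have "int (2 * n) + int k * (int n - 1) = int (Suc k) * int n + int (n - k)"
          using True by (simp add: algebra_simps of_nat_diff)
        also have "p powi (int (Suc k) * int n + int (n - k)) = p powi (int (Suc k) * int n) * p ^ (n - k)"
          using p(1) by (simp add: power_int_add del: of_nat_mult of_nat_Suc)
        finally show ?thesis .
      qed
      have "q_commutator_coeff p s (Suc n) m
          = (- s) ^ Suc k * p powi (int (Suc k) * (int n - 1)) * q_binomial p n (Suc k)
            + (- s) ^ Suc k * (p ^ (2 * n) * p powi (int k * (int n - 1))) * q_binomial p n k"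
        using Suc.IH[of "Suc k"] Suc.IH[of k] True \<open>m = Suc k\<close> by (simp del: of_nat_Suc)
      also have "\<dots> = (- s) ^ Suc k * p powi (int (Suc k) * int n) * q_binomial p (Suc n) (Suc k)"
      proof -
        have dist: "C * (P * I) * B + C * (P * J) * B' = C * P * (I * B + J * B')" for C P I J B B' :: complex
          by (simp add: algebra_simps)
        have pascal: "q_binomial p (Suc n) (Suc k)
            = p powi (- int (Suc k)) * q_binomial p n (Suc k) + p ^ (n - k) * q_binomial p n k"
          by (rule q_pascal[OF p True])
        show ?thesis unfolding e1 e2 pascal by (rule dist)
      qed
      finally show ?thesis using \<open>m = Suc k\<close> by (simp del: of_nat_Suc) simp
    next
      case False
      then have m: "k = n" "m = Suc n" using Suc.prems \<open>m = Suc k\<close> by auto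
      have "p ^ (2 * n) * p powi (int n * (int n - 1)) = p powi (int (2 * n) + int n * (int n - 1))"
        using p(1) by (simp add: power_int_add del: of_nat_mult)
      also have "int (2 * n) + int n * (int n - 1) = int (Suc n) * (int (Suc n) - 1)"
        by (simp add: algebra_simps)
      finally have e: "p ^ (2 * n) * p powi (int n * (int n - 1)) = p powi (int (Suc n) * (int (Suc n) - 1))" .
      have "q_commutator_coeff p s (Suc n) m = (- s) ^ Suc n * (p ^ (2 * n) * p powi (int n * (int n - 1)))"
        unfolding m(2) using Suc.IH[of n] q_commutator_coeff_beyond[of n "Suc n"] by (simp add: q_binomial_0[OF p])
      moreover have "q_binomial p (Suc n) (Suc n) = 1" by (rule q_binomial_0[OF p])
      ultimately show ?thesis unfolding m(2) e by simp
    qed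
  qed
qed

text \<open>
  The twist \<open>p^(2n) s\<close> is the factor that arises when the \<open>n\<close>-th
  commutator is moved past an element which skew-commutes with \<open>x\<close> by
  \<open>p^2\<close> and with \<open>y\<close> by \<open>s\<close>; see
  \<open>q_commutator_past\<close>.
\<close>

primrec iterated_q_commutator ::
  "(complex, 'a, 'm) module_scheme \<Rightarrow> 'a \<Rightarrow> complex \<Rightarrow> complex \<Rightarrow> 'a \<Rightarrow> nat \<Rightarrow> 'a" where
  "iterated_q_commutator A x p s y 0 = y"
| "iterated_q_commutator A x p s y (Suc n) =
     x \<otimes>\<^bsub>A\<^esub> iterated_q_commutator A x p s y n
     \<oplus>\<^bsub>A\<^esub> (- (p ^ (2 * n) * s)) \<odot>\<^bsub>A\<^esub> (iterated_q_commutator A x p s y n \<otimes>\<^bsub>A\<^esub> x)"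

lemma free_algebra_algebra: "complex_algebra free_algebra"
  unfolding free_algebra_def by (rule monoid_algebra_algebra, rule monoidI) auto

lemma free_algebra_simps [simp]:
  "carrier free_algebra = UNIV" "\<zero>\<^bsub>free_algebra\<^esub> = 0"
  "p \<oplus>\<^bsub>free_algebra\<^esub> p' = p + p'" "c \<odot>\<^bsub>free_algebra\<^esub> p = Poly_Mapping.map (\<lambda>z. c * z) p"
  "\<one>\<^bsub>free_algebra\<^esub> = basis_vector []"
  "Poly_Mapping.single u a \<otimes>\<^bsub>free_algebra\<^esub> Poly_Mapping.single v b = Poly_Mapping.single (u @ v) (a * b)"
  by (simp_all add: free_algebra_def)

lemma free_algebra_mult_sum:
  "p \<otimes>\<^bsub>free_algebra\<^esub> (\<Sum>i\<in>I. f i) = (\<Sum>i\<in>I. p \<otimes>\<^bsub>free_algebra\<^esub> f i)"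
  "(\<Sum>i\<in>I. f i) \<otimes>\<^bsub>free_algebra\<^esub> p = (\<Sum>i\<in>I. f i \<otimes>\<^bsub>free_algebra\<^esub> p)"
proof -
  note s = complex_algebra_simps[OF free_algebra_algebra]
  have z: "p \<otimes>\<^bsub>free_algebra\<^esub> 0 = 0" "0 \<otimes>\<^bsub>free_algebra\<^esub> p = 0"
    using ring.ring_simprules(24,25)[OF complex_algebraD(1)[OF free_algebra_algebra]] by auto
  show "p \<otimes>\<^bsub>free_algebra\<^esub> (\<Sum>i\<in>I. f i) = (\<Sum>i\<in>I. p \<otimes>\<^bsub>free_algebra\<^esub> f i)"
    by (induction I rule: infinite_finite_induct) (auto simp: s(17)[simplified] z)
  show "(\<Sum>i\<in>I. f i) \<otimes>\<^bsub>free_algebra\<^esub> p = (\<Sum>i\<in>I. f i \<otimes>\<^bsub>free_algebra\<^esub> p)"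
    by (induction I rule: infinite_finite_induct) (auto simp: s(16)[simplified] z)
qed

lemma iterated_q_commutator_free:
  "iterated_q_commutator free_algebra (basis_vector [u]) p s (basis_vector [v]) n
   = (\<Sum>m\<le>n. Poly_Mapping.single (replicate (n - m) u @ [v] @ replicate m u) (q_commutator_coeff p s n m))"
proof (induction n)
  case 0
  then show ?case by simp
next
  case (Suc n)
  let ?t = "\<lambda>n m. Poly_Mapping.single (replicate (n - m) u @ [v] @ replicate m u)"
  have 1: "basis_vector [u] \<otimes>\<^bsub>free_algebra\<^esub> (\<Sum>m\<le>n. ?t n m (q_commutator_coeff p s n m))
      = (\<Sum>m\<le>Suc n. ?t (Suc n) m (q_commutator_coeff p s n m))"
    by (simp add: free_algebra_mult_sum q_commutator_coeff_beyond Suc_diff_le)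
  have 2: "Poly_Mapping.map (\<lambda>z. - (p ^ (2 * n) * s) * z)
        ((\<Sum>m\<le>n. ?t n m (q_commutator_coeff p s n m)) \<otimes>\<^bsub>free_algebra\<^esub> basis_vector [u])
      = (\<Sum>m\<le>n. ?t (Suc n) (Suc m) (- (p ^ (2 * n) * s * q_commutator_coeff p s n m)))"
    unfolding free_algebra_mult_sum scale_sum
    by (rule sum.cong) (simp_all add: replicate_append_same)
  have "iterated_q_commutator free_algebra (basis_vector [u]) p s (basis_vector [v]) (Suc n)
      = (\<Sum>m\<le>Suc n. ?t (Suc n) m (q_commutator_coeff p s n m))
        + (\<Sum>m\<le>n. ?t (Suc n) (Suc m) (- (p ^ (2 * n) * s * q_commutator_coeff p s n m)))"
    using Suc.IH 1 2 by (simp del: sum.atMost_Suc)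
  also have "\<dots> = ?t (Suc n) 0 (q_commutator_coeff p s n 0)
      + (\<Sum>m\<le>n. ?t (Suc n) (Suc m) (q_commutator_coeff p s n (Suc m))
          + ?t (Suc n) (Suc m) (- (p ^ (2 * n) * s * q_commutator_coeff p s n m)))"
    unfolding sum.atMost_Suc_shift sum.distrib by (simp add: add.assoc)
  also have "\<dots> = (\<Sum>m\<le>Suc n. ?t (Suc n) m (q_commutator_coeff p s (Suc n) m))"
    unfolding sum.atMost_Suc_shift by (simp add: single_add[symmetric])
  finally show ?case .
qed

text \<open>
  The element of the free algebra whose vanishing is the quantum Serre relation between
  \<open>u\<close> and \<open>v\<close>.
\<close>

definition serre_element :: "complex \<Rightarrow> nat \<Rightarrow> 'x \<Rightarrow> 'x \<Rightarrow> ('x list \<Rightarrow>\<^sub>0 complex)" where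
  "serre_element p N u v = (\<Sum>m=0..N. Poly_Mapping.single (replicate (N - m) u @ [v] @ replicate m u)
     ((-1) ^ m * q_binomial p N m))"

text \<open>
  The second form exists because q-binomial coefficients are invariant under inverting
  \<open>p\<close>. It is needed for antihomomorphisms and for the second summand of a coproduct.
\<close>

lemma serre_element_q_commutator:
  assumes p: "p \<noteq> 0" "\<And>m. m > 0 \<Longrightarrow> p ^ m \<noteq> 1"
  shows "serre_element p N u v
      = iterated_q_commutator free_algebra (basis_vector [u]) p (p powi (1 - int N)) (basis_vector [v]) N"
    and "serre_element p N u v
      = iterated_q_commutator free_algebra (basis_vector [u]) (inverse p) (p powi (int N - 1)) (basis_vector [v]) N"
proof -
  have c: "q_commutator_coeff p (p powi (1 - int N)) N m = (-1) ^ m * q_binomial p N m"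
    if p: "p \<noteq> 0" "\<And>m. m > 0 \<Longrightarrow> p ^ m \<noteq> 1" and m: "m \<le> N" for p m
  proof -
    have "(- (p powi (1 - int N))) ^ m * p powi (int m * (int N - 1))
        = (-1) ^ m * (p powi ((1 - int N) * int m) * p powi (int m * (int N - 1)))"
      by (subst power_minus) (simp add: power_int_mult)
    also have "p powi ((1 - int N) * int m) * p powi (int m * (int N - 1)) = 1"
      using p(1) by (subst power_int_add[symmetric]) (auto simp: algebra_simps)
    finally show ?thesis using q_commutator_coeff_eq[OF p m, of "p powi (1 - int N)"] by simp
  qed
  show "serre_element p N u v
      = iterated_q_commutator free_algebra (basis_vector [u]) p (p powi (1 - int N)) (basis_vector [v]) N"
    unfolding iterated_q_commutator_free serre_element_def
    by (rule sum.cong) (auto simp: c[OF p])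
  have i: "inverse p \<noteq> 0" "m > 0 \<Longrightarrow> inverse p ^ m \<noteq> 1" for m
    using p by (auto simp: power_inverse)
  have s: "p powi (int N - 1) = inverse p powi (1 - int N)"
    using p(1) by (simp add: power_int_inverse power_int_minus[symmetric])
  show "serre_element p N u v
      = iterated_q_commutator free_algebra (basis_vector [u]) (inverse p) (p powi (int N - 1)) (basis_vector [v]) N"
    unfolding iterated_q_commutator_free serre_element_def s
    by (rule sum.cong) (auto simp: c[OF i] q_binomial_inverse)
qed

lemma free_algebra_lift_map:
  assumes A: "complex_algebra A" and f: "\<And>g. f g \<in> carrier A"
  shows "algebra_map free_algebra A (free_algebra_lift A f)"
    and "free_algebra_lift A f (Poly_Mapping.single w c) = c \<odot>\<^bsub>A\<^esub> foldr (\<lambda>g y. f g \<otimes>\<^bsub>A\<^esub> y) w \<one>\<^bsub>A\<^esub>"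
    and "free_algebra_lift A f (basis_vector [g]) = f g"
proof -
  note S = complex_algebra_simps[OF A]
  let ?w = "\<lambda>w. foldr (\<lambda>g y. f g \<otimes>\<^bsub>A\<^esub> y) w \<one>\<^bsub>A\<^esub>"
  have c: "?w w \<in> carrier A" for w by (induction w) (auto simp: S f)
  have m: "?w (v @ w) = ?w v \<otimes>\<^bsub>A\<^esub> ?w w" for v w by (induction v) (auto simp: S f c simp del: foldr_append)
  show "algebra_map free_algebra A (free_algebra_lift A f)"
    unfolding free_algebra_def free_algebra_lift_def
    by (rule monoid_algebra_lift[OF _ A]) (auto intro!: monoidI simp: c m[simplified])
  show s: "free_algebra_lift A f (Poly_Mapping.single w c) = c \<odot>\<^bsub>A\<^esub> ?w w" for w c
    unfolding free_algebra_lift_def by (rule linear_extension_basis[of A ?w w c, OF complex_algebraD(2)[OF A] c])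
  show "free_algebra_lift A f (basis_vector [g]) = f g" by (simp add: s S f)
qed

lemma algebra_map_q_commutator:
  assumes A: "complex_algebra A" and f: "algebra_map A B f" and xy: "x \<in> carrier A" "y \<in> carrier A"
  shows "iterated_q_commutator A x p s y n \<in> carrier A"
    "f (iterated_q_commutator A x p s y n) = iterated_q_commutator B (f x) p s (f y) n"
proof -
  note S = complex_algebra_simps[OF A]
  have c: "iterated_q_commutator A x p s y n \<in> carrier A" for n by (induction n) (auto simp: S xy)
  then show "iterated_q_commutator A x p s y n \<in> carrier A" .
  show "f (iterated_q_commutator A x p s y n) = iterated_q_commutator B (f x) p s (f y) n"
    by (induction n) (auto simp: S xy c algebra_map_simps[OF f])
qed

lemmas q_commutator_closed = algebra_map_q_commutator(1)[OF _ algebra_map_id]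

text \<open>Both sides are images of the same element of the free algebra.\<close>

lemma serre_q_commutator_symmetric:
  assumes p: "p \<noteq> 0" "\<And>m. m > 0 \<Longrightarrow> p ^ m \<noteq> 1" and A: "complex_algebra A" and xy: "x \<in> carrier A" "y \<in> carrier A"
  shows "iterated_q_commutator A x (inverse p) (p powi (int N - 1)) y N
    = iterated_q_commutator A x p (p powi (1 - int N)) y N"
proof -
  let ?f = "\<lambda>b. if b then x else y"
  have f: "?f b \<in> carrier A" for b using xy by simp
  note h = free_algebra_lift_map[of A ?f, OF A f]
  note q = algebra_map_q_commutator(2)[OF free_algebra_algebra h(1), of "basis_vector [True]" "basis_vector [False]"]
  show ?thesis
    using q[of "inverse p" "p powi (int N - 1)" N] q[of p "p powi (1 - int N)" N]
      serre_element_q_commutator[OF p, of N True False] h(3)[of True] h(3)[of False] by simp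
qed

lemma q_commutator_past:
  assumes A: "complex_algebra A" and c: "a \<in> carrier A" "b \<in> carrier A" "y \<in> carrier A"
    and ba: "b \<otimes>\<^bsub>A\<^esub> a = p\<^sup>2 \<odot>\<^bsub>A\<^esub> (a \<otimes>\<^bsub>A\<^esub> b)" and "by": "b \<otimes>\<^bsub>A\<^esub> y = s \<odot>\<^bsub>A\<^esub> (y \<otimes>\<^bsub>A\<^esub> b)"
  shows "b \<otimes>\<^bsub>A\<^esub> iterated_q_commutator A a p s y n = (p ^ (2 * n) * s) \<odot>\<^bsub>A\<^esub> (iterated_q_commutator A a p s y n \<otimes>\<^bsub>A\<^esub> b)"
proof (induction n)
  case 0
  then show ?case using "by" by simp
next
  case (Suc n)
  note S = complex_algebra_simps[OF A]
  let ?z = "iterated_q_commutator A a p s y n"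
  have z: "?z \<in> carrier A" by (rule q_commutator_closed[OF A c(1,3)])
  have 1: "b \<otimes>\<^bsub>A\<^esub> (a \<otimes>\<^bsub>A\<^esub> ?z) = (p ^ (2 * Suc n) * s) \<odot>\<^bsub>A\<^esub> (a \<otimes>\<^bsub>A\<^esub> (?z \<otimes>\<^bsub>A\<^esub> b))"
  proof -
    have "b \<otimes>\<^bsub>A\<^esub> (a \<otimes>\<^bsub>A\<^esub> ?z) = (b \<otimes>\<^bsub>A\<^esub> a) \<otimes>\<^bsub>A\<^esub> ?z" by (simp add: S c z)
    also have "\<dots> = p\<^sup>2 \<odot>\<^bsub>A\<^esub> (a \<otimes>\<^bsub>A\<^esub> (b \<otimes>\<^bsub>A\<^esub> ?z))" unfolding ba by (simp add: S c z)
    also have "\<dots> = (p ^ (2 * Suc n) * s) \<odot>\<^bsub>A\<^esub> (a \<otimes>\<^bsub>A\<^esub> (?z \<otimes>\<^bsub>A\<^esub> b))"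
      unfolding Suc.IH by (simp add: S c z power_add[symmetric] mult.assoc[symmetric] power2_eq_square)
    finally show ?thesis .
  qed
  have 2: "b \<otimes>\<^bsub>A\<^esub> (?z \<otimes>\<^bsub>A\<^esub> a) = (p ^ (2 * Suc n) * s) \<odot>\<^bsub>A\<^esub> (?z \<otimes>\<^bsub>A\<^esub> (a \<otimes>\<^bsub>A\<^esub> b))"
  proof -
    have "b \<otimes>\<^bsub>A\<^esub> (?z \<otimes>\<^bsub>A\<^esub> a) = (b \<otimes>\<^bsub>A\<^esub> ?z) \<otimes>\<^bsub>A\<^esub> a" by (simp add: S c z)
    also have "\<dots> = (p ^ (2 * n) * s) \<odot>\<^bsub>A\<^esub> (?z \<otimes>\<^bsub>A\<^esub> (b \<otimes>\<^bsub>A\<^esub> a))" unfolding Suc.IH by (simp add: S c z)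
    also have "\<dots> = (p ^ (2 * Suc n) * s) \<odot>\<^bsub>A\<^esub> (?z \<otimes>\<^bsub>A\<^esub> (a \<otimes>\<^bsub>A\<^esub> b))"
      unfolding ba by (simp add: S c z power2_eq_square algebra_simps)
    finally show ?thesis .
  qed
  show ?case
    by (simp add: S c z 1[simplified] 2[simplified] mult.commute)
qed

text \<open>
  By \<open>q_commutator_past\<close> the element \<open>b\<close> skew-commutes with the previous
  commutator by exactly the twist, so that its contribution cancels at every step.
\<close>

lemma q_commutator_add_left:
  assumes A: "complex_algebra A" and c: "a \<in> carrier A" "b \<in> carrier A" "y \<in> carrier A"
    and ba: "b \<otimes>\<^bsub>A\<^esub> a = p\<^sup>2 \<odot>\<^bsub>A\<^esub> (a \<otimes>\<^bsub>A\<^esub> b)" and "by": "b \<otimes>\<^bsub>A\<^esub> y = s \<odot>\<^bsub>A\<^esub> (y \<otimes>\<^bsub>A\<^esub> b)"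
  shows "iterated_q_commutator A (a \<oplus>\<^bsub>A\<^esub> b) p s y n = iterated_q_commutator A a p s y n"
proof (induction n)
  case (Suc n)
  note S = complex_algebra_simps[OF A]
  interpret ring A using A by (rule complex_algebraD)
  interpret V: module CC A using A by (rule complex_algebraD)
  let ?z = "iterated_q_commutator A a p s y n" and ?k = "p ^ (2 * n) * s"
  have z: "?z \<in> carrier A" by (rule q_commutator_closed[OF A c(1,3)])
  let ?u = "?z \<otimes>\<^bsub>A\<^esub> b"
  have u: "?u \<in> carrier A" using S c z by simp
  have zero: "?k \<odot>\<^bsub>A\<^esub> ?u \<oplus>\<^bsub>A\<^esub> (- ?k) \<odot>\<^bsub>A\<^esub> ?u = \<zero>\<^bsub>A\<^esub>"
    using V.smult_l_distr[of ?k "- ?k" ?u] u by (simp add: S)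
  have "(a \<oplus>\<^bsub>A\<^esub> b) \<otimes>\<^bsub>A\<^esub> ?z \<oplus>\<^bsub>A\<^esub> (- ?k) \<odot>\<^bsub>A\<^esub> (?z \<otimes>\<^bsub>A\<^esub> (a \<oplus>\<^bsub>A\<^esub> b))
      = (a \<otimes>\<^bsub>A\<^esub> ?z \<oplus>\<^bsub>A\<^esub> ?k \<odot>\<^bsub>A\<^esub> ?u) \<oplus>\<^bsub>A\<^esub> ((- ?k) \<odot>\<^bsub>A\<^esub> (?z \<otimes>\<^bsub>A\<^esub> a) \<oplus>\<^bsub>A\<^esub> (- ?k) \<odot>\<^bsub>A\<^esub> ?u)"
    using q_commutator_past[OF A c ba "by", of n] by (simp only: S c z)
  also have "\<dots> = (a \<otimes>\<^bsub>A\<^esub> ?z \<oplus>\<^bsub>A\<^esub> (- ?k) \<odot>\<^bsub>A\<^esub> (?z \<otimes>\<^bsub>A\<^esub> a)) \<oplus>\<^bsub>A\<^esub> (?k \<odot>\<^bsub>A\<^esub> ?u \<oplus>\<^bsub>A\<^esub> (- ?k) \<odot>\<^bsub>A\<^esub> ?u)"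
    by (rule add.m_assoc[THEN trans], (simp_all only: S c z u)[3], subst (2) add.m_lcomm, (simp_all only: S c z u)[3],
        rule add.m_assoc[symmetric]) (simp_all only: S c z u)
  also have "\<dots> = a \<otimes>\<^bsub>A\<^esub> ?z \<oplus>\<^bsub>A\<^esub> (- ?k) \<odot>\<^bsub>A\<^esub> (?z \<otimes>\<^bsub>A\<^esub> a)"
    unfolding zero using S c z by simp
  finally show ?case using Suc.IH by simp
qed simp

lemma q_commutator_linear:
  assumes A: "complex_algebra A" and x: "x \<in> carrier A"
  shows "linear_map A A (\<lambda>y. iterated_q_commutator A x p s y n)"
proof (induction n)
  case (Suc n)
  note V = complex_algebraD(2)[OF A]
  note m = linear_map_comp[OF Suc.IH complex_algebra_mult_linear(1)[OF A x]]
    linear_map_comp[OF Suc.IH complex_algebra_mult_linear(2)[OF A x]]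
  show ?case using linear_map_add[OF V m(1) linear_map_scale[OF V m(2)]] by simp
qed (simp add: linear_map_id)

text \<open>
  By linearity in the last argument \<open>y\<close> and \<open>z\<close> can be treated
  separately. For \<open>y\<close> the summand \<open>b\<close> drops out by
  \<open>q_commutator_add_left\<close>. For \<open>z\<close> the summand \<open>a\<close> drops
  out in the same way once \<open>p\<close> has been replaced by its inverse, which is possible by
  \<open>serre_q_commutator_symmetric\<close>.
\<close>

lemma serre_q_commutator_add:
  assumes p: "p \<noteq> 0" "\<And>m. m > 0 \<Longrightarrow> p ^ m \<noteq> 1" and A: "complex_algebra A"
    and c: "a \<in> carrier A" "b \<in> carrier A" "y \<in> carrier A" "z \<in> carrier A"
    and ba: "b \<otimes>\<^bsub>A\<^esub> a = p\<^sup>2 \<odot>\<^bsub>A\<^esub> (a \<otimes>\<^bsub>A\<^esub> b)"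
    and "by": "b \<otimes>\<^bsub>A\<^esub> y = p powi (1 - int N) \<odot>\<^bsub>A\<^esub> (y \<otimes>\<^bsub>A\<^esub> b)"
    and za: "z \<otimes>\<^bsub>A\<^esub> a = p powi (1 - int N) \<odot>\<^bsub>A\<^esub> (a \<otimes>\<^bsub>A\<^esub> z)"
  shows "iterated_q_commutator A (a \<oplus>\<^bsub>A\<^esub> b) p (p powi (1 - int N)) (y \<oplus>\<^bsub>A\<^esub> z) N
    = iterated_q_commutator A a p (p powi (1 - int N)) y N \<oplus>\<^bsub>A\<^esub> iterated_q_commutator A b p (p powi (1 - int N)) z N"
proof -
  note S = complex_algebra_simps[OF A]
  interpret ring A using A by (rule complex_algebraD)
  let ?s = "p powi (1 - int N)"
  have s: "p powi (int N - 1) * ?s = 1" using p(1) by (subst power_int_add[symmetric]) auto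
  have ab: "a \<otimes>\<^bsub>A\<^esub> b = (inverse p)\<^sup>2 \<odot>\<^bsub>A\<^esub> (b \<otimes>\<^bsub>A\<^esub> a)"
    unfolding ba using p(1) by (simp add: S c power_mult_distrib[symmetric])
  have az: "a \<otimes>\<^bsub>A\<^esub> z = p powi (int N - 1) \<odot>\<^bsub>A\<^esub> (z \<otimes>\<^bsub>A\<^esub> a)"
    unfolding za using s by (simp add: S c)
  have 1: "iterated_q_commutator A (a \<oplus>\<^bsub>A\<^esub> b) p ?s y N = iterated_q_commutator A a p ?s y N"
    by (rule q_commutator_add_left[OF A c(1-3) ba "by"])
  \<comment> \<open>The roles of \<open>a\<close> and \<open>b\<close> are exchanged, with \<open>inverse p\<close> in place of \<open>p\<close>.\<close>
  have 2: "iterated_q_commutator A (a \<oplus>\<^bsub>A\<^esub> b) p ?s z N = iterated_q_commutator A b p ?s z N"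
    using q_commutator_add_left[OF A c(2,1,4) ab az, of N] c
    by (simp add: serre_q_commutator_symmetric[OF p A] a_comm[of b a])
  show ?thesis
    using linear_mapD(2)[OF q_commutator_linear[OF A, of "a \<oplus>\<^bsub>A\<^esub> b" p ?s N] c(3,4)] c by (simp add: 1 2)
qed

text \<open>
  The second tensor factors are commuting products of \<open>k\<close> and \<open>k'\<close>, so
  that both terms of each commutator carry the same one.
\<close>

lemma q_commutator_pure_left:
  assumes A: "complex_algebra A" and B: "complex_algebra B" and c: "x \<in> carrier A" "y \<in> carrier A"
    "k \<in> carrier B" "k' \<in> carrier B" and kk: "k \<otimes>\<^bsub>B\<^esub> k' = k' \<otimes>\<^bsub>B\<^esub> k"
  shows "\<exists>u\<in>carrier B. u \<otimes>\<^bsub>B\<^esub> k = k \<otimes>\<^bsub>B\<^esub> u \<and>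
    iterated_q_commutator (tensor A B) (pure_tensor A B x k) p s (pure_tensor A B y k') n
    = pure_tensor A B (iterated_q_commutator A x p s y n) u"
proof (induction n)
  case 0
  show ?case by (rule bexI[of _ k']) (use c kk in simp_all)
next
  case (Suc n)
  note S = complex_algebra_simps[OF A] complex_algebra_simps[OF B]
  note P = pure_tensor_simps[OF complex_algebraD(2)[OF A] complex_algebraD(2)[OF B]]
  have z: "iterated_q_commutator A x p s y n \<in> carrier A" by (rule q_commutator_closed[OF A c(1,2)])
  obtain u where u: "u \<in> carrier B" "u \<otimes>\<^bsub>B\<^esub> k = k \<otimes>\<^bsub>B\<^esub> u"
    "iterated_q_commutator (tensor A B) (pure_tensor A B x k) p s (pure_tensor A B y k') n
      = pure_tensor A B (iterated_q_commutator A x p s y n) u" using Suc.IH by blast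
  show ?case
    by (rule bexI[of _ "k \<otimes>\<^bsub>B\<^esub> u"]) (use u c z in \<open>simp_all add: pure_tensor_mult[OF A B] S P\<close>)
qed

lemma q_commutator_pure_right:
  assumes A: "complex_algebra A" and B: "complex_algebra B" and c: "x \<in> carrier B" "y \<in> carrier B"
    "k \<in> carrier A" "k' \<in> carrier A" and kk: "k \<otimes>\<^bsub>A\<^esub> k' = k' \<otimes>\<^bsub>A\<^esub> k"
  shows "\<exists>u\<in>carrier A. u \<otimes>\<^bsub>A\<^esub> k = k \<otimes>\<^bsub>A\<^esub> u \<and>
    iterated_q_commutator (tensor A B) (pure_tensor A B k x) p s (pure_tensor A B k' y) n
    = pure_tensor A B u (iterated_q_commutator B x p s y n)"
proof (induction n)
  case 0
  show ?case by (rule bexI[of _ k']) (use c kk in simp_all)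
next
  case (Suc n)
  note S = complex_algebra_simps[OF A] complex_algebra_simps[OF B]
  note P = pure_tensor_simps[OF complex_algebraD(2)[OF A] complex_algebraD(2)[OF B]]
  have z: "iterated_q_commutator B x p s y n \<in> carrier B" by (rule q_commutator_closed[OF B c(1,2)])
  obtain u where u: "u \<in> carrier A" "u \<otimes>\<^bsub>A\<^esub> k = k \<otimes>\<^bsub>A\<^esub> u"
    "iterated_q_commutator (tensor A B) (pure_tensor A B k x) p s (pure_tensor A B k' y) n
      = pure_tensor A B u (iterated_q_commutator B x p s y n)" using Suc.IH by blast
  show ?case
    by (rule bexI[of _ "k \<otimes>\<^bsub>A\<^esub> u"]) (use u c z in \<open>simp_all add: pure_tensor_mult[OF A B] S P\<close>)
qed

text \<open>
  Reversing the product exchanges the two terms of each commutator. Dividing by the twist restores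
  the shape, with \<open>p\<close> and \<open>s\<close> inverted.
\<close>

lemma q_commutator_opposite:
  assumes A: "complex_algebra A" and c: "x \<in> carrier A" "y \<in> carrier A" and p: "p \<noteq> 0" and s: "s \<noteq> 0"
  shows "\<exists>k. iterated_q_commutator (opposite_algebra A) x p s y n
    = k \<odot>\<^bsub>A\<^esub> iterated_q_commutator A x (inverse p) (inverse s) y n"
proof (induction n)
  case 0
  show ?case by (rule exI[of _ 1]) (simp add: complex_algebra_simps[OF A] c)
next
  case (Suc n)
  note S = complex_algebra_simps[OF A]
  interpret ring A using A by (rule complex_algebraD)
  let ?z = "iterated_q_commutator A x (inverse p) (inverse s) y n"
  have z: "?z \<in> carrier A" by (rule q_commutator_closed[OF A c])
  obtain k where k: "iterated_q_commutator (opposite_algebra A) x p s y n = k \<odot>\<^bsub>A\<^esub> ?z" using Suc.IH by blast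
  let ?K = "- (p ^ (2 * n) * s) * k" and ?k' = "- (inverse p ^ (2 * n) * inverse s)"
  have e: "?K * ?k' = k" using p s by (simp add: field_simps power_inverse)
  have "iterated_q_commutator (opposite_algebra A) x p s y (Suc n)
      = k \<odot>\<^bsub>A\<^esub> (?z \<otimes>\<^bsub>A\<^esub> x) \<oplus>\<^bsub>A\<^esub> ?K \<odot>\<^bsub>A\<^esub> (x \<otimes>\<^bsub>A\<^esub> ?z)"
    by (simp add: k S c z)
  also have "\<dots> = ?K \<odot>\<^bsub>A\<^esub> (x \<otimes>\<^bsub>A\<^esub> ?z) \<oplus>\<^bsub>A\<^esub> (?K * ?k') \<odot>\<^bsub>A\<^esub> (?z \<otimes>\<^bsub>A\<^esub> x)"
    unfolding e by (rule a_comm) (simp_all add: S c z)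
  also have "\<dots> = ?K \<odot>\<^bsub>A\<^esub> iterated_q_commutator A x (inverse p) (inverse s) y (Suc n)"
    by (simp add: S c z)
  finally show ?case by blast
qed

lemma q_commutator_scale:
  assumes A: "complex_algebra A" and c: "x \<in> carrier A" "y \<in> carrier A"
  shows "iterated_q_commutator A (a \<odot>\<^bsub>A\<^esub> x) p s (b \<odot>\<^bsub>A\<^esub> y) n = (a ^ n * b) \<odot>\<^bsub>A\<^esub> iterated_q_commutator A x p s y n"
proof (induction n)
  case 0
  show ?case by simp
next
  case (Suc n)
  note S = complex_algebra_simps[OF A]
  have z: "iterated_q_commutator A x p s y n \<in> carrier A" by (rule q_commutator_closed[OF A c])
  show ?case by (simp add: Suc.IH S c z mult_ac)
qed

section \<open>The quantum enveloping algebra\<close>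

lemma (in ring) minus_minus_eq_zero_iff:
  assumes "a \<in> carrier R" "b \<in> carrier R" "c \<in> carrier R" "e \<in> carrier R"
  shows "a \<ominus> b \<ominus> (c \<ominus> e) = \<zero> \<longleftrightarrow> a \<oplus> e = b \<oplus> c"
proof -
  have "a \<ominus> b \<ominus> (c \<ominus> e) = (a \<oplus> e) \<ominus> (b \<oplus> c)"
    using assms by (simp add: a_minus_def minus_add a_ac)
  then show ?thesis using assms by simp
qed

lemma skew_commute_inverse:
  assumes A: "complex_algebra A" and c: "k \<in> carrier A" "k' \<in> carrier A" "x \<in> carrier A"
    and inv: "k \<otimes>\<^bsub>A\<^esub> k' = \<one>\<^bsub>A\<^esub>" "k' \<otimes>\<^bsub>A\<^esub> k = \<one>\<^bsub>A\<^esub>" and kx: "k \<otimes>\<^bsub>A\<^esub> x = a \<odot>\<^bsub>A\<^esub> (x \<otimes>\<^bsub>A\<^esub> k)" and a: "a \<noteq> 0"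
  shows "k' \<otimes>\<^bsub>A\<^esub> x = inverse a \<odot>\<^bsub>A\<^esub> (x \<otimes>\<^bsub>A\<^esub> k')"
proof -
  note S = complex_algebra_simps[OF A]
  have "x \<otimes>\<^bsub>A\<^esub> k = inverse a \<odot>\<^bsub>A\<^esub> (k \<otimes>\<^bsub>A\<^esub> x)" unfolding kx using a by (simp add: S c)
  then have "k' \<otimes>\<^bsub>A\<^esub> ((x \<otimes>\<^bsub>A\<^esub> k) \<otimes>\<^bsub>A\<^esub> k') = inverse a \<odot>\<^bsub>A\<^esub> ((k' \<otimes>\<^bsub>A\<^esub> k) \<otimes>\<^bsub>A\<^esub> (x \<otimes>\<^bsub>A\<^esub> k'))"
    by (simp add: S c)
  moreover have "k' \<otimes>\<^bsub>A\<^esub> ((x \<otimes>\<^bsub>A\<^esub> k) \<otimes>\<^bsub>A\<^esub> k') = (k' \<otimes>\<^bsub>A\<^esub> x) \<otimes>\<^bsub>A\<^esub> (k \<otimes>\<^bsub>A\<^esub> k')" by (simp add: S c)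
  ultimately show ?thesis unfolding inv by (simp add: S c)
qed

lemma free_algebra_generators: "algebra_generators free_algebra (range (\<lambda>g. basis_vector [g]))"
  unfolding algebra_generators_def
proof (intro conjI allI impI)
  fix B :: "('a list \<Rightarrow>\<^sub>0 complex) set"
  assume B: "submodule B CC free_algebra" and one: "\<one>\<^bsub>free_algebra\<^esub> \<in> B"
    and m: "\<forall>x\<in>B. \<forall>y\<in>B. x \<otimes>\<^bsub>free_algebra\<^esub> y \<in> B" and g: "range (\<lambda>g. basis_vector [g]) \<subseteq> B"
  have w: "basis_vector w \<in> B" for w
  proof (induction w)
    case (Cons a w)
    have "basis_vector [a] \<in> B" using g by auto
    from m[rule_format, OF this Cons] show ?case by simp
  qed (use one in simp)
  show "carrier free_algebra \<subseteq> B"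
    using monoid_algebra_linear_into[OF complex_algebraD(2)[OF free_algebra_algebra, unfolded free_algebra_def]
      linear_map_id B[unfolded free_algebra_def] w]
    by (auto simp: free_algebra_def)
qed simp

text \<open>
  The Serre relations appear as vanishing iterated q-commutators, and the relation between
  \<open>E\<^sub>i\<close> and \<open>F\<^sub>i\<close> is arranged so that no subtraction occurs.
\<close>

definition Uq_relations_hold ::
  "complex \<Rightarrow> ('n \<Rightarrow> 'n \<Rightarrow> int) \<Rightarrow> ('n \<Rightarrow> nat) \<Rightarrow> (complex, 'b, 'm) module_scheme \<Rightarrow> ('n generator \<Rightarrow> 'b) \<Rightarrow> bool" where
  "Uq_relations_hold q A d B f \<longleftrightarrow>
     (\<forall>i. f (K i) \<otimes>\<^bsub>B\<^esub> f (Kinv i) = \<one>\<^bsub>B\<^esub>) \<and> (\<forall>i. f (Kinv i) \<otimes>\<^bsub>B\<^esub> f (K i) = \<one>\<^bsub>B\<^esub>) \<and>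
     (\<forall>i j. f (K i) \<otimes>\<^bsub>B\<^esub> f (K j) = f (K j) \<otimes>\<^bsub>B\<^esub> f (K i)) \<and>
     (\<forall>i j. f (K i) \<otimes>\<^bsub>B\<^esub> f (E j) = (q powi (int (d i) * A i j)) \<odot>\<^bsub>B\<^esub> (f (E j) \<otimes>\<^bsub>B\<^esub> f (K i))) \<and>
     (\<forall>i j. f (K i) \<otimes>\<^bsub>B\<^esub> f (F j) = (q powi (- (int (d i) * A i j))) \<odot>\<^bsub>B\<^esub> (f (F j) \<otimes>\<^bsub>B\<^esub> f (K i))) \<and>
     (\<forall>i j. i \<noteq> j \<longrightarrow> f (E i) \<otimes>\<^bsub>B\<^esub> f (F j) = f (F j) \<otimes>\<^bsub>B\<^esub> f (E i)) \<and>
     (\<forall>i. let c = 1 / (q powi (2 * int (d i)) - q powi (- (2 * int (d i)))) in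
        f (E i) \<otimes>\<^bsub>B\<^esub> f (F i) \<oplus>\<^bsub>B\<^esub> c \<odot>\<^bsub>B\<^esub> (f (Kinv i) \<otimes>\<^bsub>B\<^esub> f (Kinv i))
        = f (F i) \<otimes>\<^bsub>B\<^esub> f (E i) \<oplus>\<^bsub>B\<^esub> c \<odot>\<^bsub>B\<^esub> (f (K i) \<otimes>\<^bsub>B\<^esub> f (K i))) \<and>
     (\<forall>i j. i \<noteq> j \<longrightarrow> (let N = nat (1 - A i j); p = q ^ (2 * d i) in
        iterated_q_commutator B (f (E i)) p (p powi (1 - int N)) (f (E j)) N = \<zero>\<^bsub>B\<^esub>)) \<and>
     (\<forall>i j. i \<noteq> j \<longrightarrow> (let N = nat (1 - A i j); p = q ^ (2 * d i) in
        iterated_q_commutator B (f (F i)) p (p powi (1 - int N)) (f (F j)) N = \<zero>\<^bsub>B\<^esub>))"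

lemma Uq_relations_holdD:
  assumes "Uq_relations_hold q A d B f"
  shows "f (K i) \<otimes>\<^bsub>B\<^esub> f (Kinv i) = \<one>\<^bsub>B\<^esub>" "f (Kinv i) \<otimes>\<^bsub>B\<^esub> f (K i) = \<one>\<^bsub>B\<^esub>"
    "f (K i) \<otimes>\<^bsub>B\<^esub> f (K j) = f (K j) \<otimes>\<^bsub>B\<^esub> f (K i)"
    "f (K i) \<otimes>\<^bsub>B\<^esub> f (E j) = (q powi (int (d i) * A i j)) \<odot>\<^bsub>B\<^esub> (f (E j) \<otimes>\<^bsub>B\<^esub> f (K i))"
    "f (K i) \<otimes>\<^bsub>B\<^esub> f (F j) = (q powi (- (int (d i) * A i j))) \<odot>\<^bsub>B\<^esub> (f (F j) \<otimes>\<^bsub>B\<^esub> f (K i))"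
  using assms unfolding Uq_relations_hold_def by blast+

text \<open>
  The Cartan matrix enters through the symmetry of \<open>d\<^sub>i a\<^sub>i\<^sub>j\<close> and
  through \<open>a\<^sub>i\<^sub>i = 2\<close>.
\<close>

locale quantum_data =
  fixes q :: complex and A :: "'n \<Rightarrow> 'n \<Rightarrow> int" and d :: "'n \<Rightarrow> nat"
  assumes q_nonzero: "q \<noteq> 0" and q_not_root: "\<And>m. m > 0 \<Longrightarrow> q ^ m \<noteq> 1"
    and d_pos: "\<And>i. d i > 0" and symmetric: "\<And>i j. int (d i) * A i j = int (d j) * A j i"
    and diagonal: "\<And>i. A i i = 2"
begin

lemma base_nonzero: "q ^ (2 * d i) \<noteq> 0" using q_nonzero by simp

lemma base_not_root: "m > 0 \<Longrightarrow> (q ^ (2 * d i)) ^ m \<noteq> 1"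
  using q_not_root[of "2 * d i * m"] d_pos[of i] by (simp add: power_mult[symmetric])

lemma serre_symmetric_base:
  assumes "complex_algebra C" "x \<in> carrier C" "y \<in> carrier C"
  shows "iterated_q_commutator C x (inverse (q ^ (2 * d i))) ((q ^ (2 * d i)) powi (int N - 1)) y N
    = iterated_q_commutator C x (q ^ (2 * d i)) ((q ^ (2 * d i)) powi (1 - int N)) y N"
  by (rule serre_q_commutator_symmetric[OF base_nonzero base_not_root assms])

text \<open>
  The translation between relations as elements of the free algebra and as equations in
  \<open>B\<close>; for the Serre relations it rests on \<open>serre_element_q_commutator\<close>.
\<close>

lemma Uq_relations_hold_iff:
  assumes B: "complex_algebra B" and f: "\<And>g. f g \<in> carrier B"
  shows "Uq_relations_hold q A d B f \<longleftrightarrow> (\<forall>r\<in>Uq_relations q A d. free_algebra_lift B f r = \<zero>\<^bsub>B\<^esub>)"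
proof -
  interpret B: ring B using B by (rule complex_algebraD)
  note S = complex_algebra_simps[OF B]
  let ?h = "free_algebra_lift B f"
  note h = free_algebra_lift_map[of B f, OF B f]
  note V = complex_algebraD(2)[OF free_algebra_algebra] and VB = complex_algebraD(2)[OF B]
  have hc: "?h x \<in> carrier B" for x using algebra_map_simps(1)[OF h(1)] by simp
  have minus: "?h (x - y) = ?h x \<ominus>\<^bsub>B\<^esub> ?h y" for x y
    using linear_map_diff_basis(1)[OF VB algebra_mapD(1)[OF h(1), unfolded free_algebra_def]]
    by (simp add: free_algebra_def)
  have m0: "?h (x - y) = \<zero>\<^bsub>B\<^esub> \<longleftrightarrow> ?h x = ?h y" for x y
    unfolding minus using hc by simp
  note w = h(2) S f
  have ball1: "(\<forall>r\<in>{t i |i. P i}. Q r) \<longleftrightarrow> (\<forall>i. P i \<longrightarrow> Q (t i))"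
    for t :: "'n \<Rightarrow> 'n generator list \<Rightarrow>\<^sub>0 complex" and P Q by blast
  have ball2: "(\<forall>r\<in>{t i j |i j. P i j}. Q r) \<longleftrightarrow> (\<forall>i j. P i j \<longrightarrow> Q (t i j))"
    for t :: "'n \<Rightarrow> 'n \<Rightarrow> 'n generator list \<Rightarrow>\<^sub>0 complex" and P Q by blast
  have r1: "(\<forall>r\<in>{basis_vector [K i, Kinv i] - basis_vector [] |i. True}. ?h r = \<zero>\<^bsub>B\<^esub>)
      \<longleftrightarrow> (\<forall>i. f (K i) \<otimes>\<^bsub>B\<^esub> f (Kinv i) = \<one>\<^bsub>B\<^esub>)"
    and r2: "(\<forall>r\<in>{basis_vector [Kinv i, K i] - basis_vector [] |i. True}. ?h r = \<zero>\<^bsub>B\<^esub>)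
      \<longleftrightarrow> (\<forall>i. f (Kinv i) \<otimes>\<^bsub>B\<^esub> f (K i) = \<one>\<^bsub>B\<^esub>)"
    and r3: "(\<forall>r\<in>{basis_vector [K i, K j] - basis_vector [K j, K i] |i j. True}. ?h r = \<zero>\<^bsub>B\<^esub>)
      \<longleftrightarrow> (\<forall>i j. f (K i) \<otimes>\<^bsub>B\<^esub> f (K j) = f (K j) \<otimes>\<^bsub>B\<^esub> f (K i))"
    and r6: "(\<forall>r\<in>{basis_vector [E i, F j] - basis_vector [F j, E i] |i j. i \<noteq> j}. ?h r = \<zero>\<^bsub>B\<^esub>)
      \<longleftrightarrow> (\<forall>i j. i \<noteq> j \<longrightarrow> f (E i) \<otimes>\<^bsub>B\<^esub> f (F j) = f (F j) \<otimes>\<^bsub>B\<^esub> f (E i))"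
    unfolding ball1 ball2 by (simp_all add: m0 w)
  have conj: "k \<otimes>\<^bsub>B\<^esub> (x \<otimes>\<^bsub>B\<^esub> k') = c \<odot>\<^bsub>B\<^esub> x \<longleftrightarrow> k \<otimes>\<^bsub>B\<^esub> x = c \<odot>\<^bsub>B\<^esub> (x \<otimes>\<^bsub>B\<^esub> k)"
    if "k \<otimes>\<^bsub>B\<^esub> k' = \<one>\<^bsub>B\<^esub>" "k' \<otimes>\<^bsub>B\<^esub> k = \<one>\<^bsub>B\<^esub>" and c: "k \<in> carrier B" "k' \<in> carrier B" "x \<in> carrier B" for k k' x c
  proof
    assume e: "k \<otimes>\<^bsub>B\<^esub> (x \<otimes>\<^bsub>B\<^esub> k') = c \<odot>\<^bsub>B\<^esub> x"
    have "k \<otimes>\<^bsub>B\<^esub> x = (k \<otimes>\<^bsub>B\<^esub> (x \<otimes>\<^bsub>B\<^esub> k')) \<otimes>\<^bsub>B\<^esub> k" using that by (simp add: S)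
    then show "k \<otimes>\<^bsub>B\<^esub> x = c \<odot>\<^bsub>B\<^esub> (x \<otimes>\<^bsub>B\<^esub> k)" unfolding e using c by (simp add: S)
  next
    assume e: "k \<otimes>\<^bsub>B\<^esub> x = c \<odot>\<^bsub>B\<^esub> (x \<otimes>\<^bsub>B\<^esub> k)"
    have "k \<otimes>\<^bsub>B\<^esub> (x \<otimes>\<^bsub>B\<^esub> k') = (k \<otimes>\<^bsub>B\<^esub> x) \<otimes>\<^bsub>B\<^esub> k'" using c by (simp add: S)
    then show "k \<otimes>\<^bsub>B\<^esub> (x \<otimes>\<^bsub>B\<^esub> k') = c \<odot>\<^bsub>B\<^esub> x" unfolding e using that by (simp add: S)
  qed
  have r4: "(\<forall>r\<in>{basis_vector [K i, E j, Kinv i] - Poly_Mapping.single [E j] (q powi (int (d i) * A i j)) |i j. True}. ?h r = \<zero>\<^bsub>B\<^esub>)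
      \<longleftrightarrow> (\<forall>i j. f (K i) \<otimes>\<^bsub>B\<^esub> (f (E j) \<otimes>\<^bsub>B\<^esub> f (Kinv i)) = (q powi (int (d i) * A i j)) \<odot>\<^bsub>B\<^esub> f (E j))"
    and r5: "(\<forall>r\<in>{basis_vector [K i, F j, Kinv i] - Poly_Mapping.single [F j] (q powi (- (int (d i) * A i j))) |i j. True}. ?h r = \<zero>\<^bsub>B\<^esub>)
      \<longleftrightarrow> (\<forall>i j. f (K i) \<otimes>\<^bsub>B\<^esub> (f (F j) \<otimes>\<^bsub>B\<^esub> f (Kinv i)) = (q powi (- (int (d i) * A i j))) \<odot>\<^bsub>B\<^esub> f (F j))"
    unfolding ball2 by (simp_all add: m0 w)
  have r7: "(\<forall>r\<in>{basis_vector [E i, F i] - basis_vector [F i, E i]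
        - (let c = 1 / (q powi (2 * int (d i)) - q powi (- (2 * int (d i))))
           in Poly_Mapping.single [K i, K i] c - Poly_Mapping.single [Kinv i, Kinv i] c) | i. True}. ?h r = \<zero>\<^bsub>B\<^esub>)
      \<longleftrightarrow> (\<forall>i. let c = 1 / (q powi (2 * int (d i)) - q powi (- (2 * int (d i)))) in
        f (E i) \<otimes>\<^bsub>B\<^esub> f (F i) \<oplus>\<^bsub>B\<^esub> c \<odot>\<^bsub>B\<^esub> (f (Kinv i) \<otimes>\<^bsub>B\<^esub> f (Kinv i))
        = f (F i) \<otimes>\<^bsub>B\<^esub> f (E i) \<oplus>\<^bsub>B\<^esub> c \<odot>\<^bsub>B\<^esub> (f (K i) \<otimes>\<^bsub>B\<^esub> f (K i)))"
  proof -
    have "?h (basis_vector [E i, F i] - basis_vector [F i, E i]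
        - (Poly_Mapping.single [K i, K i] c - Poly_Mapping.single [Kinv i, Kinv i] c)) = \<zero>\<^bsub>B\<^esub>
      \<longleftrightarrow> f (E i) \<otimes>\<^bsub>B\<^esub> f (F i) \<oplus>\<^bsub>B\<^esub> c \<odot>\<^bsub>B\<^esub> (f (Kinv i) \<otimes>\<^bsub>B\<^esub> f (Kinv i))
        = f (F i) \<otimes>\<^bsub>B\<^esub> f (E i) \<oplus>\<^bsub>B\<^esub> c \<odot>\<^bsub>B\<^esub> (f (K i) \<otimes>\<^bsub>B\<^esub> f (K i))" for i c
      unfolding minus by (subst B.minus_minus_eq_zero_iff) (simp_all add: hc w)
    then show ?thesis unfolding ball1 Let_def by simp
  qed
  have serre: "?h (Uq_serre q A d g i j) = (let N = nat (1 - A i j); p = q ^ (2 * d i) in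
        iterated_q_commutator B (f (g i)) p (p powi (1 - int N)) (f (g j)) N)" for g i j
  proof -
    have "Uq_serre q A d g i j = serre_element (q ^ (2 * d i)) (nat (1 - A i j)) (g i) (g j)"
      by (simp add: Uq_serre_def serre_element_def Let_def)
    then show ?thesis
      unfolding Let_def
      using serre_element_q_commutator(1)[OF base_nonzero base_not_root, of i "nat (1 - A i j)" "g i" "g j"]
        algebra_map_q_commutator(2)[OF free_algebra_algebra h(1)] h(3) by simp
  qed
  have r8: "(\<forall>r\<in>{Uq_serre q A d E i j |i j. i \<noteq> j}. ?h r = \<zero>\<^bsub>B\<^esub>) \<longleftrightarrow> (\<forall>i j. i \<noteq> j \<longrightarrow> (let N = nat (1 - A i j); p = q ^ (2 * d i) in
        iterated_q_commutator B (f (E i)) p (p powi (1 - int N)) (f (E j)) N = \<zero>\<^bsub>B\<^esub>))"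
    and r9: "(\<forall>r\<in>{Uq_serre q A d F i j |i j. i \<noteq> j}. ?h r = \<zero>\<^bsub>B\<^esub>) \<longleftrightarrow> (\<forall>i j. i \<noteq> j \<longrightarrow> (let N = nat (1 - A i j); p = q ^ (2 * d i) in
        iterated_q_commutator B (f (F i)) p (p powi (1 - int N)) (f (F j)) N = \<zero>\<^bsub>B\<^esub>))"
    unfolding ball2 serre Let_def by simp_all
  show ?thesis
    unfolding Uq_relations_def ball_Un r1 r2 r3 r4 r5 r6 r7 r8 r9 Uq_relations_hold_def
    using conj f by (intro iffI conjI; elim conjE; simp)
qed

abbreviation U where "U \<equiv> Uq_algebra q A d"
abbreviation u where "u \<equiv> Uq_gen q A d"

lemma Uq_ideal: "ideal (Uq_ideal q A d) free_algebra"
  by (rule ring.genideal_ideal[OF complex_algebraD(1)[OF free_algebra_algebra]]) simp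

lemma Uq_algebra_algebra: "complex_algebra U"
  unfolding Uq_algebra_def by (rule quotient_algebra[OF free_algebra_algebra Uq_ideal])

lemma Uq_class_algebra_map: "algebra_map free_algebra U (quotient_class free_algebra (Uq_ideal q A d))"
  unfolding Uq_algebra_def by (rule quotient_algebra[OF free_algebra_algebra Uq_ideal])

lemma Uq_gen_class: "u g = quotient_class free_algebra (Uq_ideal q A d) (basis_vector [g])"
  by (simp add: Uq_gen_def quotient_class_def)

lemma Uq_gen_closed: "u g \<in> carrier U"
  unfolding Uq_gen_class by (rule algebra_map_simps(1)[OF Uq_class_algebra_map]) simp

lemma Uq_generators: "algebra_generators U (range u)"
  unfolding algebra_generators_def
proof (intro conjI allI impI)
  let ?c = "quotient_class free_algebra (Uq_ideal q A d)"
  note c = algebra_map_simps[OF Uq_class_algebra_map]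
  show "range u \<subseteq> carrier U" using Uq_gen_closed by auto
  fix B assume B: "submodule B CC U" and one: "\<one>\<^bsub>U\<^esub> \<in> B" and m: "\<forall>x\<in>B. \<forall>y\<in>B. x \<otimes>\<^bsub>U\<^esub> y \<in> B"
    and g: "range u \<subseteq> B"
  have "x \<in> {x \<in> carrier free_algebra. ?c x \<in> B}" for x
  proof (rule algebra_generatorsD[OF free_algebra_generators])
    show "submodule {x \<in> carrier free_algebra. ?c x \<in> B} CC free_algebra"
      by (rule subspace_vimage[OF complex_algebraD(2)[OF free_algebra_algebra] complex_algebraD(2)[OF Uq_algebra_algebra]
        algebra_mapD(1)[OF Uq_class_algebra_map] B])
  qed (use one m g c Uq_gen_class in auto)
  then show "carrier U \<subseteq> B" by (auto simp: Uq_algebra_def quotient_space_simps)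
qed

lemma Uq_gen_relations: "Uq_relations_hold q A d U u"
  unfolding Uq_relations_hold_iff[of U u, OF Uq_algebra_algebra Uq_gen_closed]
proof
  fix r assume r: "r \<in> Uq_relations q A d"
  have "free_algebra_lift U u x = quotient_class free_algebra (Uq_ideal q A d) x" for x
    by (rule algebra_map_eq_on_generators[OF free_algebra_algebra Uq_algebra_algebra free_algebra_generators
        free_algebra_lift_map(1)[of U u, OF Uq_algebra_algebra Uq_gen_closed] Uq_class_algebra_map])
       (auto simp: free_algebra_lift_map(3)[of U u, OF Uq_algebra_algebra Uq_gen_closed] Uq_gen_class)
  moreover have "r \<in> Uq_ideal q A d"
    using ring.genideal_self[OF complex_algebraD(1)[OF free_algebra_algebra], of "Uq_relations q A d"] r by auto
  ultimately show "free_algebra_lift U u r = \<zero>\<^bsub>U\<^esub>"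
    using quotient_class_eq_zero_iff[OF complex_algebraD(2)[OF free_algebra_algebra]
      ideal_subspace[OF free_algebra_algebra Uq_ideal], of r]
    by (simp add: Uq_algebra_def quotient_space_simps)
qed

lemma Uq_algebra_lift:
  assumes B: "complex_algebra B" and f: "\<And>g. f g \<in> carrier B" and rel: "Uq_relations_hold q A d B f"
  shows "algebra_map U B (\<lambda>C. free_algebra_lift B f (SOME p. p \<in> C))"
    and "free_algebra_lift B f (SOME p. p \<in> u g) = f g"
proof -
  note h = free_algebra_lift_map[of B f, OF B f]
  have "Uq_ideal q A d \<subseteq> {x \<in> carrier free_algebra. free_algebra_lift B f x = \<zero>\<^bsub>B\<^esub>}"
    by (rule ring.genideal_minimal[OF complex_algebraD(1)[OF free_algebra_algebra]
          algebra_map_kernel_ideal[OF free_algebra_algebra B h(1)]])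
       (use rel Uq_relations_hold_iff[of B f, OF B f] in auto)
  then have z: "free_algebra_lift B f x = \<zero>\<^bsub>B\<^esub>" if "x \<in> Uq_ideal q A d" for x using that by auto
  show "algebra_map U B (\<lambda>C. free_algebra_lift B f (SOME p. p \<in> C))"
    unfolding Uq_algebra_def by (rule quotient_algebra_lift[OF free_algebra_algebra Uq_ideal B h(1)]) (rule z)
  have "free_algebra_lift B f (SOME p. p \<in> u g) = free_algebra_lift B f (basis_vector [g])"
    unfolding Uq_gen_class
    by (rule quotient_value[OF complex_algebraD(2)[OF free_algebra_algebra] ideal_subspace[OF free_algebra_algebra Uq_ideal]
          complex_algebraD(2)[OF B] algebra_mapD(1)[OF h(1)]]) (simp_all add: z)
  then show "free_algebra_lift B f (SOME p. p \<in> u g) = f g" by (simp add: h(3))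
qed

end

section \<open>Structure maps of the quantum enveloping algebra\<close>

text \<open>
  The commutation rules make \<open>serre_q_commutator_add\<close> applicable to \<open>x
  \<otimes> k' + k \<otimes> x\<close> and \<open>y \<otimes> l' + l \<otimes> y\<close>. The
  Serre expression is therefore the sum of those of \<open>x \<otimes> k'\<close>, \<open>y
  \<otimes> l'\<close> and of \<open>k \<otimes> x\<close>, \<open>l \<otimes> y\<close>. Each of
  these has the Serre expression of \<open>x\<close> and \<open>y\<close> as a tensor factor and
  vanishes.
\<close>

lemma serre_comultiplication:
  assumes p: "p \<noteq> 0" "\<And>m. m > 0 \<Longrightarrow> p ^ m \<noteq> 1" and B: "complex_algebra B"
    and c: "k \<in> carrier B" "k' \<in> carrier B" "l \<in> carrier B" "l' \<in> carrier B" "x \<in> carrier B" "y \<in> carrier B"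
    and kl: "k \<otimes>\<^bsub>B\<^esub> l = l \<otimes>\<^bsub>B\<^esub> k" "k' \<otimes>\<^bsub>B\<^esub> l' = l' \<otimes>\<^bsub>B\<^esub> k'"
    and kx: "k \<otimes>\<^bsub>B\<^esub> x = p \<odot>\<^bsub>B\<^esub> (x \<otimes>\<^bsub>B\<^esub> k)" "k' \<otimes>\<^bsub>B\<^esub> x = inverse p \<odot>\<^bsub>B\<^esub> (x \<otimes>\<^bsub>B\<^esub> k')"
    and ky: "k \<otimes>\<^bsub>B\<^esub> y = e \<odot>\<^bsub>B\<^esub> (y \<otimes>\<^bsub>B\<^esub> k)" "k' \<otimes>\<^bsub>B\<^esub> y = inverse e \<odot>\<^bsub>B\<^esub> (y \<otimes>\<^bsub>B\<^esub> k')"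
    and lx: "l \<otimes>\<^bsub>B\<^esub> x = e \<odot>\<^bsub>B\<^esub> (x \<otimes>\<^bsub>B\<^esub> l)" "l' \<otimes>\<^bsub>B\<^esub> x = inverse e \<odot>\<^bsub>B\<^esub> (x \<otimes>\<^bsub>B\<^esub> l')"
    and e: "e \<noteq> 0" "N > 0 \<Longrightarrow> e * e = p powi (1 - int N)"
    and z: "iterated_q_commutator B x p (p powi (1 - int N)) y N = \<zero>\<^bsub>B\<^esub>"
  shows "iterated_q_commutator (tensor B B) (pure_tensor B B x k' \<oplus>\<^bsub>tensor B B\<^esub> pure_tensor B B k x) p
    (p powi (1 - int N)) (pure_tensor B B y l' \<oplus>\<^bsub>tensor B B\<^esub> pure_tensor B B l y) N = \<zero>\<^bsub>tensor B B\<^esub>"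
proof -
  note T = tensor_algebra_structure[OF B B] and V = complex_algebraD(2)[OF B]
  note S = complex_algebra_simps[OF B] and ST = complex_algebra_simps[OF T]
  note P = pure_tensor_simps[OF V V]
  interpret T: ring "tensor B B" using T by (rule complex_algebraD)
  have pz: "pure_tensor B B v \<zero>\<^bsub>B\<^esub> = \<zero>\<^bsub>tensor B B\<^esub>" "pure_tensor B B \<zero>\<^bsub>B\<^esub> v = \<zero>\<^bsub>tensor B B\<^esub>" if "v \<in> carrier B" for v
    using linear_map_zero[OF V complex_algebraD(2)[OF T] bilinear_mapD(1)[OF pure_tensor_bilinear[OF V V] that]]
      linear_map_zero[OF V complex_algebraD(2)[OF T] bilinear_mapD(2)[OF pure_tensor_bilinear[OF V V] that]] by simp_all
  show ?thesis
  \<comment> \<open>For \<open>N = 0\<close> the expression is the second argument itself, and \<open>e * e\<close> is not tied to \<open>p\<close>.\<close>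
  proof (cases "N = 0")
    case True
    then show ?thesis using z c by (simp add: pz)
  next
    case False
    then have e': "e * e = p powi (1 - int N)" using e by simp
    let ?a = "pure_tensor B B x k'" and ?b = "pure_tensor B B k x"
      and ?y = "pure_tensor B B y l'" and ?z = "pure_tensor B B l y"
    have 1: "iterated_q_commutator (tensor B B) (?a \<oplus>\<^bsub>tensor B B\<^esub> ?b) p (p powi (1 - int N)) (?y \<oplus>\<^bsub>tensor B B\<^esub> ?z) N
        = iterated_q_commutator (tensor B B) ?a p (p powi (1 - int N)) ?y N
          \<oplus>\<^bsub>tensor B B\<^esub> iterated_q_commutator (tensor B B) ?b p (p powi (1 - int N)) ?z N"
    proof (rule serre_q_commutator_add[OF p T])
      have pp: "p * p * inverse p = p" "e * e * inverse e = e" using p(1) e(1) by simp_all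
      show "?b \<otimes>\<^bsub>tensor B B\<^esub> ?a = p\<^sup>2 \<odot>\<^bsub>tensor B B\<^esub> (?a \<otimes>\<^bsub>tensor B B\<^esub> ?b)"
        using p(1) by (simp add: pure_tensor_mult[OF B B] c S ST P kx power2_eq_square pp)
      show "?b \<otimes>\<^bsub>tensor B B\<^esub> ?y = p powi (1 - int N) \<odot>\<^bsub>tensor B B\<^esub> (?y \<otimes>\<^bsub>tensor B B\<^esub> ?b)"
        unfolding e'[symmetric] using e(1) by (simp add: pure_tensor_mult[OF B B] c S ST P ky lx pp)
      show "?z \<otimes>\<^bsub>tensor B B\<^esub> ?a = p powi (1 - int N) \<odot>\<^bsub>tensor B B\<^esub> (?a \<otimes>\<^bsub>tensor B B\<^esub> ?z)"
        unfolding e'[symmetric] using e(1) by (simp add: pure_tensor_mult[OF B B] c S ST P ky lx pp)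
    qed (simp_all add: P c)
    have "iterated_q_commutator (tensor B B) ?a p (p powi (1 - int N)) ?y N = \<zero>\<^bsub>tensor B B\<^esub>"
      using q_commutator_pure_left[OF B B c(5,6,2,4) kl(2), of p "p powi (1 - int N)" N] z pz by auto
    moreover have "iterated_q_commutator (tensor B B) ?b p (p powi (1 - int N)) ?z N = \<zero>\<^bsub>tensor B B\<^esub>"
      using q_commutator_pure_right[OF B B c(5,6,1,3) kl(1), of p "p powi (1 - int N)" N] z pz by auto
    ultimately show ?thesis unfolding 1 by simp
  qed
qed

context quantum_data begin

text \<open>
  In the relation between \<open>E\<^sub>i\<close> and \<open>F\<^sub>i\<close> the mixed terms of
  the coproducts agree on both sides, because the powers of \<open>q\<close> produced by the two
  tensor factors cancel. The Serre relations hold by \<open>serre_comultiplication\<close>, which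
  for the \<open>F\<^sub>i\<close> is applied with \<open>q\<close> replaced by its inverse.
\<close>

lemma Uq_relations_hold_comult:
  fixes B (structure)
  assumes B: "complex_algebra B" and f: "\<And>g. f g \<in> carrier B" and rel: "Uq_relations_hold q A d B f"
  shows "Uq_relations_hold q A d (tensor B B) (\<lambda>g. case g of
        K i \<Rightarrow> pure_tensor B B (f (K i)) (f (K i))
      | Kinv i \<Rightarrow> pure_tensor B B (f (Kinv i)) (f (Kinv i))
      | E i \<Rightarrow> pure_tensor B B (f (E i)) (f (Kinv i)) \<oplus>\<^bsub>tensor B B\<^esub> pure_tensor B B (f (K i)) (f (E i))
      | F i \<Rightarrow> pure_tensor B B (f (F i)) (f (Kinv i)) \<oplus>\<^bsub>tensor B B\<^esub> pure_tensor B B (f (K i)) (f (F i)))"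
proof -
  note T = tensor_algebra_structure[OF B B] and V = complex_algebraD(2)[OF B]
  note S = complex_algebra_simps[OF B] and ST = complex_algebra_simps[OF T]
  note P = pure_tensor_simps[OF V V]
  interpret T: ring "tensor B B" using T by (rule complex_algebraD)
  let ?T = "tensor B B" and ?P = "pure_tensor B B"
  let ?E = "\<lambda>i. ?P (f (E i)) (f (Kinv i)) \<oplus>\<^bsub>?T\<^esub> ?P (f (K i)) (f (E i))"
  let ?F = "\<lambda>i. ?P (f (F i)) (f (Kinv i)) \<oplus>\<^bsub>?T\<^esub> ?P (f (K i)) (f (F i))"
  define c where "c i j = q powi (int (d i) * A i j)" for i j
  have c0: "c i j \<noteq> 0" and cs: "c i j = c j i" and ci: "q powi (- (int (d i) * A i j)) = inverse (c i j)" for i j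
    using q_nonzero symmetric[of i j] by (auto simp: c_def power_int_minus)
  have kk': "f (K i) \<otimes> f (Kinv i) = \<one>" "f (Kinv i) \<otimes> f (K i) = \<one>"
    and kk: "f (K i) \<otimes> f (K j) = f (K j) \<otimes> f (K i)"
    and ke: "f (K i) \<otimes> f (E j) = c i j \<odot> (f (E j) \<otimes> f (K i))"
    and kf: "f (K i) \<otimes> f (F j) = inverse (c i j) \<odot> (f (F j) \<otimes> f (K i))"
    and ef: "i \<noteq> j \<Longrightarrow> f (E i) \<otimes> f (F j) = f (F j) \<otimes> f (E i)" for i j
    using rel unfolding Uq_relations_hold_def c_def[symmetric] ci by blast+
  define b where "b i = 1 / (q powi (2 * int (d i)) - q powi (- (2 * int (d i))))" for i
  have efi: "f (E i) \<otimes> f (F i) \<oplus> b i \<odot> (f (Kinv i) \<otimes> f (Kinv i)) = f (F i) \<otimes> f (E i) \<oplus> b i \<odot> (f (K i) \<otimes> f (K i))" for i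
    using rel unfolding Uq_relations_hold_def Let_def b_def by blast
  have se: "i \<noteq> j \<Longrightarrow> iterated_q_commutator B (f (E i)) (q ^ (2 * d i)) ((q ^ (2 * d i)) powi (1 - int (nat (1 - A i j)))) (f (E j)) (nat (1 - A i j)) = \<zero>"
    and sf: "i \<noteq> j \<Longrightarrow> iterated_q_commutator B (f (F i)) (q ^ (2 * d i)) ((q ^ (2 * d i)) powi (1 - int (nat (1 - A i j)))) (f (F j)) (nat (1 - A i j)) = \<zero>" for i j
    using rel unfolding Uq_relations_hold_def Let_def by blast+
  note si = skew_commute_inverse[OF B f f f kk']
  have k'e: "f (Kinv i) \<otimes> f (E j) = inverse (c i j) \<odot> (f (E j) \<otimes> f (Kinv i))"
    and k'f: "f (Kinv i) \<otimes> f (F j) = c i j \<odot> (f (F j) \<otimes> f (Kinv i))" for i j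
    using si[OF ke c0, of i j] si[OF kf, of i j] c0[of i j] by simp_all
  have k'k: "f (Kinv i) \<otimes> f (K j) = f (K j) \<otimes> f (Kinv i)" for i j
    using si[of i "K j" 1] kk[of i j] by (simp add: S f)
  have k'k': "f (Kinv i) \<otimes> f (Kinv j) = f (Kinv j) \<otimes> f (Kinv i)" for i j
    using skew_commute_inverse[OF B f f f kk', of j "Kinv i" 1] k'k[of i j] by (simp add: S f)
  note ord = ke kf k'e k'f
  note base = pure_tensor_mult[OF B B] f S ST P
  have cii: "c i i = q ^ (2 * d i)" for i
    by (simp add: c_def diagonal mult.commute power_int_def nat_mult_distrib)
  \<comment> \<open>The exponent \<open>a\<^sub>i\<^sub>j\<close> in the action of \<open>K\<^sub>i\<close> matches the length \<open>1 - a\<^sub>i\<^sub>j\<close> of the Serre relation.\<close>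
  have cN: "c i j * c i j = (q ^ (2 * d i)) powi (1 - int (nat (1 - A i j)))" if "nat (1 - A i j) > 0" for i j
  proof -
    have "1 - int (nat (1 - A i j)) = A i j" using that by simp
    moreover have "(q ^ (2 * d i)) powi (A i j) = q powi (int (2 * d i) * A i j)"
      using power_int_mult[of q "int (2 * d i)" "A i j"] by (simp add: del: of_nat_mult)
    moreover have "c i j * c i j = q powi (int (d i) * A i j + int (d i) * A i j)"
      unfolding c_def by (rule power_int_add[symmetric]) (use q_nonzero in simp)
    moreover have "int (2 * d i) * A i j = int (d i) * A i j + int (d i) * A i j" by simp
    ultimately show ?thesis by (simp only:)
  qed
  show ?thesis
    unfolding Uq_relations_hold_def c_def[symmetric] ci Let_def b_def[symmetric]
  proof (intro conjI allI impI; simp only: generator.case)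
    fix i j :: 'n
    show "?P (f (K i)) (f (K i)) \<otimes>\<^bsub>?T\<^esub> ?P (f (Kinv i)) (f (Kinv i)) = \<one>\<^bsub>?T\<^esub>"
      "?P (f (Kinv i)) (f (Kinv i)) \<otimes>\<^bsub>?T\<^esub> ?P (f (K i)) (f (K i)) = \<one>\<^bsub>?T\<^esub>"
      by (simp_all add: base kk' pure_tensor_one[OF B B])
    show "?P (f (K i)) (f (K i)) \<otimes>\<^bsub>?T\<^esub> ?P (f (K j)) (f (K j)) =
        ?P (f (K j)) (f (K j)) \<otimes>\<^bsub>?T\<^esub> ?P (f (K i)) (f (K i))"
      by (simp add: base kk[of i j])
    show "?P (f (K i)) (f (K i)) \<otimes>\<^bsub>?T\<^esub>
          (?E j)
        = c i j \<odot>\<^bsub>?T\<^esub> ((?E j)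
          \<otimes>\<^bsub>?T\<^esub> ?P (f (K i)) (f (K i)))"
      by (simp add: base ord k'k[of j i] kk[of i j])
    show "?P (f (K i)) (f (K i)) \<otimes>\<^bsub>?T\<^esub>
          (?F j)
        = inverse (c i j) \<odot>\<^bsub>?T\<^esub> ((?F j)
          \<otimes>\<^bsub>?T\<^esub> ?P (f (K i)) (f (K i)))"
      by (simp add: base ord k'k[of j i] kk[of i j])
    show "(?E i) \<otimes>\<^bsub>?T\<^esub>
          (?F j)
        = (?F j) \<otimes>\<^bsub>?T\<^esub>
          (?E i)"
      if ij: "i \<noteq> j"
      using c0[of i j] by (simp add: base ord ef[OF ij] kk[of i j] k'k'[of i j] cs[of j i] T.a_ac)
    show "(?E i) \<otimes>\<^bsub>?T\<^esub>
          (?F i)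
          \<oplus>\<^bsub>?T\<^esub> b i \<odot>\<^bsub>?T\<^esub> (?P (f (Kinv i)) (f (Kinv i)) \<otimes>\<^bsub>?T\<^esub> ?P (f (Kinv i)) (f (Kinv i)))
        = (?F i) \<otimes>\<^bsub>?T\<^esub>
          (?E i)
          \<oplus>\<^bsub>?T\<^esub> b i \<odot>\<^bsub>?T\<^esub> (?P (f (K i)) (f (K i)) \<otimes>\<^bsub>?T\<^esub> ?P (f (K i)) (f (K i)))"
      (is "?L = ?R")
    proof -
      let ?k = "f (K i) \<otimes> f (K i)" and ?k' = "f (Kinv i) \<otimes> f (Kinv i)"
      let ?ef = "f (E i) \<otimes> f (F i)" and ?fe = "f (F i) \<otimes> f (E i)"
      let ?M = "c i i \<odot>\<^bsub>?T\<^esub> ?P (f (E i) \<otimes> f (K i)) (f (F i) \<otimes> f (Kinv i))"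
      let ?M' = "inverse (c i i) \<odot>\<^bsub>?T\<^esub> ?P (f (F i) \<otimes> f (K i)) (f (E i) \<otimes> f (Kinv i))"
      have cl: "?k \<in> carrier B" "?k' \<in> carrier B" "?ef \<in> carrier B" "?fe \<in> carrier B" by (simp_all add: S f)
      have Mc: "?M \<in> carrier ?T" "?M' \<in> carrier ?T" by (simp_all add: base)
      note base' = base cl Mc
      have pc: "?P v w \<in> carrier ?T" if "v \<in> carrier B" "w \<in> carrier B" for v w using that by (rule P(1))
      have 1: "?P ?ef ?k' \<oplus>\<^bsub>?T\<^esub> b i \<odot>\<^bsub>?T\<^esub> ?P ?k' ?k' = ?P ?fe ?k' \<oplus>\<^bsub>?T\<^esub> b i \<odot>\<^bsub>?T\<^esub> ?P ?k ?k'"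
        using arg_cong[OF efi[of i], of "\<lambda>v. ?P v ?k'"] by (simp add: P S cl)
      have 2: "?P ?k ?ef \<oplus>\<^bsub>?T\<^esub> b i \<odot>\<^bsub>?T\<^esub> ?P ?k ?k' = ?P ?k ?fe \<oplus>\<^bsub>?T\<^esub> b i \<odot>\<^bsub>?T\<^esub> ?P ?k ?k"
        using arg_cong[OF efi[of i], of "\<lambda>v. ?P ?k v"] by (simp add: P S cl)
      have "?L = (?P ?ef ?k' \<oplus>\<^bsub>?T\<^esub> b i \<odot>\<^bsub>?T\<^esub> ?P ?k' ?k') \<oplus>\<^bsub>?T\<^esub> (?M \<oplus>\<^bsub>?T\<^esub> ?M' \<oplus>\<^bsub>?T\<^esub> ?P ?k ?ef)"
        by (simp add: base ord T.a_ac)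
      also have "\<dots> = ?P ?fe ?k' \<oplus>\<^bsub>?T\<^esub> (?M \<oplus>\<^bsub>?T\<^esub> ?M' \<oplus>\<^bsub>?T\<^esub> (?P ?k ?ef \<oplus>\<^bsub>?T\<^esub> b i \<odot>\<^bsub>?T\<^esub> ?P ?k ?k'))"
        unfolding 1 by (simp only: T.a_ac pc cl Mc ST(2,3))
      also have "\<dots> = ?R" unfolding 2 by (simp add: base ord T.a_ac)
      finally show ?thesis .
    qed
    assume ij: "i \<noteq> j"
    show "iterated_q_commutator ?T (?E i)
        (q ^ (2 * d i)) ((q ^ (2 * d i)) powi (1 - int (nat (1 - A i j))))
        (?E j) (nat (1 - A i j)) = \<zero>\<^bsub>?T\<^esub>"
      by (rule serre_comultiplication[OF base_nonzero base_not_root B f f f f f f kk k'k' _ _ ke k'e _ _ c0 cN se[OF ij]])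
         (simp_all add: ke k'e cii[symmetric] cs[of j i])
    let ?p = "q ^ (2 * d i)" and ?N = "nat (1 - A i j)"
    have p': "inverse ?p \<noteq> 0" "m > 0 \<Longrightarrow> inverse ?p ^ m \<noteq> 1" for m
      using base_nonzero[of i] base_not_root[of m i] by (auto simp: power_inverse)
    have ps: "inverse ?p powi (1 - int ?N) = ?p powi (int ?N - 1)"
      using base_nonzero[of i] by (simp add: power_int_inverse power_int_minus[symmetric])
    have Xc: "?F i \<in> carrier ?T"
      and Yc: "?F j \<in> carrier ?T"
      by (simp_all add: base)
    have "iterated_q_commutator ?T (?F i)
        (inverse ?p) (inverse ?p powi (1 - int ?N))
        (?F j) ?N = \<zero>\<^bsub>?T\<^esub>"
    proof (rule serre_comultiplication[OF p' B f f f f f f kk k'k' _ _ kf])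
      show "inverse (c i j) \<noteq> 0" using c0 by simp
      show "inverse (c i j) * inverse (c i j) = inverse ?p powi (1 - int ?N)" if "?N > 0"
        using cN[OF that] by (simp add: power_int_inverse inverse_mult_distrib[symmetric] del: inverse_mult_distrib)
      show "iterated_q_commutator B (f (F i)) (inverse ?p) (inverse ?p powi (1 - int ?N)) (f (F j)) ?N = \<zero>"
        unfolding ps serre_symmetric_base[OF B f f] by (rule sf[OF ij])
    qed (simp_all add: ord cii[symmetric] cs[of j i])
    then show "iterated_q_commutator ?T (?F i)
        ?p (?p powi (1 - int ?N))
        (?F j) ?N = \<zero>\<^bsub>?T\<^esub>"
      by (simp only: ps serre_symmetric_base[OF T Xc Yc])
  qed
qed

lemma Uq_relations_hold_counit: "Uq_relations_hold q A d complex_space Uq_gen_counit"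
proof -
  have "iterated_q_commutator complex_space 0 p s 0 n = 0" for p s n by (induction n) auto
  then show ?thesis by (simp add: Uq_relations_hold_def Uq_gen_counit_def Let_def)
qed

text \<open>
  The antipode multiplies \<open>E\<^sub>i\<close> and \<open>F\<^sub>i\<close> by scalars and
  inverts \<open>K\<^sub>i\<close>. Up to scalars the relations for the reversed product are thus
  the original ones, the Serre relations by \<open>q_commutator_opposite\<close> and
  \<open>serre_q_commutator_symmetric\<close>.
\<close>

lemma Uq_relations_hold_antipode:
  fixes B (structure)
  assumes B: "complex_algebra B" and f: "\<And>g. f g \<in> carrier B" and rel: "Uq_relations_hold q A d B f"
  shows "Uq_relations_hold q A d (opposite_algebra B) (\<lambda>g. case g of
        K i \<Rightarrow> f (Kinv i)
      | Kinv i \<Rightarrow> f (K i)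
      | E i \<Rightarrow> (- (q powi (- (2 * int (d i))))) \<odot> f (E i)
      | F i \<Rightarrow> (- (q powi (2 * int (d i)))) \<odot> f (F i))"
proof -
  note V = complex_algebraD(2)[OF B] and S = complex_algebra_simps[OF B] and O = opposite_algebra[OF B]
  interpret B: ring B using B by (rule complex_algebraD)
  interpret V: module CC B by (rule V)
  define c where "c i j = q powi (int (d i) * A i j)" for i j
  have c0: "c i j \<noteq> 0" and ci: "q powi (- (int (d i) * A i j)) = inverse (c i j)" for i j
    using q_nonzero by (auto simp: c_def power_int_minus)
  have kk': "f (K i) \<otimes> f (Kinv i) = \<one>" "f (Kinv i) \<otimes> f (K i) = \<one>"
    and kk: "f (K i) \<otimes> f (K j) = f (K j) \<otimes> f (K i)"
    and ke: "f (K i) \<otimes> f (E j) = c i j \<odot> (f (E j) \<otimes> f (K i))"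
    and kf: "f (K i) \<otimes> f (F j) = inverse (c i j) \<odot> (f (F j) \<otimes> f (K i))"
    and ef: "i \<noteq> j \<Longrightarrow> f (E i) \<otimes> f (F j) = f (F j) \<otimes> f (E i)" for i j
    using rel unfolding Uq_relations_hold_def c_def[symmetric] ci by blast+
  define b where "b i = 1 / (q powi (2 * int (d i)) - q powi (- (2 * int (d i))))" for i
  have efi: "f (E i) \<otimes> f (F i) \<oplus> b i \<odot> (f (Kinv i) \<otimes> f (Kinv i)) = f (F i) \<otimes> f (E i) \<oplus> b i \<odot> (f (K i) \<otimes> f (K i))" for i
    using rel unfolding Uq_relations_hold_def Let_def b_def by blast
  have se: "i \<noteq> j \<Longrightarrow> iterated_q_commutator B (f (E i)) (q ^ (2 * d i)) ((q ^ (2 * d i)) powi (1 - int (nat (1 - A i j)))) (f (E j)) (nat (1 - A i j)) = \<zero>"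
    and sf: "i \<noteq> j \<Longrightarrow> iterated_q_commutator B (f (F i)) (q ^ (2 * d i)) ((q ^ (2 * d i)) powi (1 - int (nat (1 - A i j)))) (f (F j)) (nat (1 - A i j)) = \<zero>" for i j
    using rel unfolding Uq_relations_hold_def Let_def by blast+
  note si = skew_commute_inverse[OF B f f f kk']
  have k'e: "f (Kinv i) \<otimes> f (E j) = inverse (c i j) \<odot> (f (E j) \<otimes> f (Kinv i))"
    and k'f: "f (Kinv i) \<otimes> f (F j) = c i j \<odot> (f (F j) \<otimes> f (Kinv i))" for i j
    using si[OF ke c0, of i j] si[OF kf, of i j] c0[of i j] by simp_all
  have k'k: "f (Kinv i) \<otimes> f (K j) = f (K j) \<otimes> f (Kinv i)" for i j
    using si[of i "K j" 1] kk[of i j] by (simp add: S f)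
  have k'k': "f (Kinv i) \<otimes> f (Kinv j) = f (Kinv j) \<otimes> f (Kinv i)" for i j
    using skew_commute_inverse[OF B f f f kk', of j "Kinv i" 1] k'k[of i j] by (simp add: S f)
  have serre: "iterated_q_commutator (opposite_algebra B) (a \<odot> x) p (p powi (1 - int N)) (a' \<odot> y) N = \<zero>"
    if z: "iterated_q_commutator B x p (p powi (1 - int N)) y N = \<zero>" and c: "x \<in> carrier B" "y \<in> carrier B"
      and p: "p \<noteq> 0" "\<And>m. m > 0 \<Longrightarrow> p ^ m \<noteq> 1" for a a' x y p N
  proof -
    have i: "inverse (p powi (1 - int N)) = p powi (int N - 1)"
      using p(1) by (simp add: power_int_minus[symmetric])
    have sym: "iterated_q_commutator B x (inverse p) (p powi (int N - 1)) y N
        = iterated_q_commutator B x p (p powi (1 - int N)) y N"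
      by (rule serre_q_commutator_symmetric[OF p B c])
    obtain k where "iterated_q_commutator (opposite_algebra B) x p (p powi (1 - int N)) y N
        = k \<odot> iterated_q_commutator B x (inverse p) (p powi (int N - 1)) y N"
      using q_commutator_opposite[OF B c p(1), of "p powi (1 - int N)" N] p(1) unfolding i by auto
    then have "iterated_q_commutator (opposite_algebra B) x p (p powi (1 - int N)) y N = \<zero>"
      by (simp add: sym z)
    then show ?thesis using q_commutator_scale[OF O, of x y a p _ a' N] c by simp
  qed
  have e1: "- (q powi (- (2 * int (d i)))) * - (q powi (2 * int (d i))) = 1" for i
    using q_nonzero by (simp add: power_int_minus)
  have e2: "- (q powi (2 * int (d i))) * - (q powi (- (2 * int (d i)))) = 1" for i
    using q_nonzero by (simp add: power_int_minus)
  show ?thesis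
    unfolding Uq_relations_hold_def c_def[symmetric] ci Let_def b_def[symmetric]
  proof (intro conjI allI impI; simp only: generator.case opposite_algebra_simps)
    fix i j :: 'n
    show "f (K i) \<otimes> f (Kinv i) = \<one>" "f (Kinv i) \<otimes> f (K i) = \<one>" by (rule kk')+
    show "f (Kinv j) \<otimes> f (Kinv i) = f (Kinv i) \<otimes> f (Kinv j)" by (rule k'k')
    show "(- (q powi (- (2 * int (d j))))) \<odot> f (E j) \<otimes> f (Kinv i)
        = c i j \<odot> (f (Kinv i) \<otimes> ((- (q powi (- (2 * int (d j))))) \<odot> f (E j)))"
      using c0[of i j] by (simp add: S f k'e field_simps)
    show "(- (q powi (2 * int (d j)))) \<odot> f (F j) \<otimes> f (Kinv i)
        = inverse (c i j) \<odot> (f (Kinv i) \<otimes> ((- (q powi (2 * int (d j)))) \<odot> f (F j)))"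
      using c0[of i j] by (simp add: S f k'f field_simps)
    show "((- (q powi (2 * int (d j)))) \<odot> f (F j)) \<otimes> ((- (q powi (- (2 * int (d i))))) \<odot> f (E i))
        = ((- (q powi (- (2 * int (d i))))) \<odot> f (E i)) \<otimes> ((- (q powi (2 * int (d j)))) \<odot> f (F j))" if "i \<noteq> j"
      by (simp add: S f ef[OF that] mult.commute)
    show "((- (q powi (2 * int (d i)))) \<odot> f (F i)) \<otimes> ((- (q powi (- (2 * int (d i))))) \<odot> f (E i)) \<oplus> b i \<odot> (f (K i) \<otimes> f (K i))
        = ((- (q powi (- (2 * int (d i))))) \<odot> f (E i)) \<otimes> ((- (q powi (2 * int (d i)))) \<odot> f (F i)) \<oplus> b i \<odot> (f (Kinv i) \<otimes> f (Kinv i))"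
      by (simp only: S f e1 e2 efi)
  qed (rule serre, (rule se sf, assumption), (rule f base_nonzero, (rule f base_nonzero)?)+, rule base_not_root, assumption)+
qed

end

section \<open>Bilinear maps on free spaces\<close>

definition bilinear_extension ::
  "(complex, 'b, 'm) module_scheme \<Rightarrow> ('x \<Rightarrow> 'y \<Rightarrow> 'b) \<Rightarrow> ('x \<Rightarrow>\<^sub>0 complex) \<Rightarrow> ('y \<Rightarrow>\<^sub>0 complex) \<Rightarrow> 'b" where
  "bilinear_extension V f p m = linear_extension V (\<lambda>x. linear_extension V (f x) m) p"

lemma bilinear_extension_bilinear:
  assumes V: "module CC V" and f: "\<And>x y. x \<in> S \<Longrightarrow> y \<in> T \<Longrightarrow> f x y \<in> carrier V"
  shows "bilinear_map (free_space S) (free_space T) V (bilinear_extension V f)"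
proof -
  interpret V: module CC V by fact
  have L: "linear_map (free_space T) V (linear_extension V (f x))" if "x \<in> S" for x
    by (rule linear_extension_linear[OF V f[OF that]])
  note Ls = linear_mapD[OF L]
  have P: "linear_map (free_space S) V (\<lambda>p. linear_extension V (\<lambda>x. linear_extension V (f x) m) p)"
    if "m \<in> carrier (free_space T)" for m
    using linear_extension_linear[OF V, of S "\<lambda>x. linear_extension V (f x) m"] Ls(1) that by simp
  have b: "linear_extension V (\<lambda>x. linear_extension V (f x) m) (basis_vector x) = linear_extension V (f x) m"
    if "m \<in> carrier (free_space T)" "x \<in> S" for m x
    by (rule linear_extension_basis_vector[OF V]) (use Ls(1) that in simp)
  interpret FT: module CC "free_space T" by (rule free_space_vector_space)
  show ?thesis
    unfolding bilinear_extension_def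
  proof (rule bilinear_mapI2)
    show "linear_map (free_space S) V (\<lambda>p. linear_extension V (\<lambda>x. linear_extension V (f x) m) p)"
      if "m \<in> carrier (free_space T)" for m by (rule P[OF that])
    fix p assume p: "p \<in> carrier (free_space S)"
    show "linear_map (free_space T) V (\<lambda>m. linear_extension V (\<lambda>x. linear_extension V (f x) m) p)"
    proof (rule linear_mapI)
    fix m m' c assume m: "m \<in> carrier (free_space T)"
    show "linear_extension V (\<lambda>x. linear_extension V (f x) m) p \<in> carrier V" using linear_mapD(1)[OF P[OF m] p] .
    have cm: "c \<odot>\<^bsub>free_space T\<^esub> m \<in> carrier (free_space T)" using FT.smult_closed[of c m] m by (simp del: free_space_simps)
    show "linear_extension V (\<lambda>x. linear_extension V (f x) (c \<odot>\<^bsub>free_space T\<^esub> m)) p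
        = c \<odot>\<^bsub>V\<^esub> linear_extension V (\<lambda>x. linear_extension V (f x) m) p"
      by (rule free_space_linear_eq[OF V P[OF cm] linear_map_scale[OF V P[OF m]] _ p])
         (simp del: free_space_simps add: b[OF cm] b[OF m] Ls(3) m)
    assume m': "m' \<in> carrier (free_space T)"
    have mm: "m \<oplus>\<^bsub>free_space T\<^esub> m' \<in> carrier (free_space T)" using FT.a_closed[OF m m'] .
    show "linear_extension V (\<lambda>x. linear_extension V (f x) (m \<oplus>\<^bsub>free_space T\<^esub> m')) p
        = linear_extension V (\<lambda>x. linear_extension V (f x) m) p \<oplus>\<^bsub>V\<^esub> linear_extension V (\<lambda>x. linear_extension V (f x) m') p"
      by (rule free_space_linear_eq[OF V P[OF mm] linear_map_add[OF V P[OF m] P[OF m']] _ p])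
         (simp del: free_space_simps add: b[OF mm] b[OF m] b[OF m'] Ls(2) m m')
    qed
  qed
qed

lemma bilinear_extension_basis:
  assumes V: "module CC V" and f: "f x y \<in> carrier V"
  shows "bilinear_extension V f (basis_vector x) (basis_vector y) = f x y"
proof -
  have 1: "linear_extension V (f x) (basis_vector y) = f x y"
    by (rule linear_extension_basis_vector[of V "f x" y, OF V f])
  show ?thesis
    unfolding bilinear_extension_def
    using linear_extension_basis_vector[of V "\<lambda>x. linear_extension V (f x) (basis_vector y)" x, OF V] f by (simp add: 1)
qed

lemma bilinear_free_eq:
  assumes V: "module CC V" and f: "bilinear_map (free_space S) (free_space T) V f"
    and g: "bilinear_map (free_space S) (free_space T) V g"
    and eq: "\<And>x y. x \<in> S \<Longrightarrow> y \<in> T \<Longrightarrow> f (basis_vector x) (basis_vector y) = g (basis_vector x) (basis_vector y)"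
    and p: "p \<in> carrier (free_space S)" "p' \<in> carrier (free_space T)"
  shows "f p p' = g p p'"
proof (rule free_space_linear_eq[OF V bilinear_mapD(2)[OF f p(2)] bilinear_mapD(2)[OF g p(2)] _ p(1)])
  fix x assume x: "x \<in> S"
  then have b: "basis_vector x \<in> carrier (free_space S)" by simp
  show "f (basis_vector x) p' = g (basis_vector x) p'"
    by (rule free_space_linear_eq[OF V bilinear_mapD(1)[OF f b] bilinear_mapD(1)[OF g b] eq[OF x] p(2)])
qed

lemma trilinear_free_eq:
  assumes V: "module CC V"
    and f: "\<And>x y z. x \<in> carrier (free_space R) \<Longrightarrow> y \<in> carrier (free_space S) \<Longrightarrow> linear_map (free_space T) V (f x y)"
      "\<And>x z. x \<in> carrier (free_space R) \<Longrightarrow> z \<in> carrier (free_space T) \<Longrightarrow> linear_map (free_space S) V (\<lambda>y. f x y z)"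
      "\<And>y z. y \<in> carrier (free_space S) \<Longrightarrow> z \<in> carrier (free_space T) \<Longrightarrow> linear_map (free_space R) V (\<lambda>x. f x y z)"
    and g: "\<And>x y z. x \<in> carrier (free_space R) \<Longrightarrow> y \<in> carrier (free_space S) \<Longrightarrow> linear_map (free_space T) V (g x y)"
      "\<And>x z. x \<in> carrier (free_space R) \<Longrightarrow> z \<in> carrier (free_space T) \<Longrightarrow> linear_map (free_space S) V (\<lambda>y. g x y z)"
      "\<And>y z. y \<in> carrier (free_space S) \<Longrightarrow> z \<in> carrier (free_space T) \<Longrightarrow> linear_map (free_space R) V (\<lambda>x. g x y z)"
    and eq: "\<And>x y z. x \<in> R \<Longrightarrow> y \<in> S \<Longrightarrow> z \<in> T \<Longrightarrow>
      f (basis_vector x) (basis_vector y) (basis_vector z) = g (basis_vector x) (basis_vector y) (basis_vector z)"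
    and p: "p \<in> carrier (free_space R)" "p' \<in> carrier (free_space S)" "p'' \<in> carrier (free_space T)"
  shows "f p p' p'' = g p p' p''"
proof (rule free_space_linear_eq[OF V f(3)[OF p(2,3)] g(3)[OF p(2,3)] _ p(1)])
  fix x assume x: "x \<in> R"
  then have b: "basis_vector x \<in> carrier (free_space R)" by simp
  show "f (basis_vector x) p' p'' = g (basis_vector x) p' p''"
    by (rule bilinear_free_eq[OF V bilinear_mapI2[OF f(1)[OF b] f(2)[OF b]] bilinear_mapI2[OF g(1)[OF b] g(2)[OF b]]
          eq[OF x] p(2,3)])
qed

lemma bilinear_map_monoid_algebra:
  "bilinear_map (monoid_algebra G) V Z f \<longleftrightarrow> bilinear_map (free_space (carrier G)) V Z f"
  "bilinear_map V' (monoid_algebra G) Z g \<longleftrightarrow> bilinear_map V' (free_space (carrier G)) Z g"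
  by (simp_all add: bilinear_map_def linear_map_def)

lemma tensor_product_action_bilinear:
  assumes B: "module CC B" and C: "module CC C" and D: "module CC D" and D': "module CC D'"
    and V: "module CC V" and W: "module CC W"
    and f: "bilinear_map B D V f" and g: "bilinear_map C D' W g"
  shows "bilinear_map (tensor B C) (tensor D D') (tensor V W) (tensor_product_action V W f g)"
    and "b \<in> carrier B \<Longrightarrow> c \<in> carrier C \<Longrightarrow> x \<in> carrier D \<Longrightarrow> y \<in> carrier D' \<Longrightarrow>
      tensor_product_action V W f g (pure_tensor B C b c) (pure_tensor D D' x y) = pure_tensor V W (f b x) (g c y)"
proof -
  note VW = tensor_vector_space[OF V W] and DE = tensor_vector_space[OF D D']
  interpret DE: module CC "tensor D D'" by (rule DE)
  interpret VW: module CC "tensor V W" by (rule VW)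
  have m: "linear_map (tensor D D') (tensor V W) (tensor_map V W (f b) (g c))"
    and mp: "x \<in> carrier D \<Longrightarrow> y \<in> carrier D' \<Longrightarrow>
      tensor_map V W (f b) (g c) (pure_tensor D D' x y) = pure_tensor V W (f b x) (g c y)"
    if "b \<in> carrier B" "c \<in> carrier C" for b c x y
    using tensor_map_linear[OF D D' V W bilinear_mapD(1)[OF f that(1)] bilinear_mapD(1)[OF g that(2)]]
      tensor_map_pure[OF D D' V W bilinear_mapD(1)[OF f that(1)] bilinear_mapD(1)[OF g that(2)]] by auto
  interpret B: module CC B by (rule B)
  interpret C: module CC C by (rule C)
  note fs = bilinear_simps[OF f] and gs = bilinear_simps[OF g] and P = pure_tensor_simps[OF V W]
  have inner: "bilinear_map B C (tensor V W) (\<lambda>b c. tensor_map V W (f b) (g c) t)" if t: "t \<in> carrier (tensor D D')" for t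
  proof (rule bilinear_mapI)
    fix b b' c c' k assume b: "b \<in> carrier B" and c: "c \<in> carrier C"
    show "tensor_map V W (f b) (g c) t \<in> carrier (tensor V W)" by (rule linear_mapD(1)[OF m[OF b c] t])
    have kb: "k \<odot>\<^bsub>B\<^esub> b \<in> carrier B" and kc: "k \<odot>\<^bsub>C\<^esub> c \<in> carrier C" using b c by auto
    show "tensor_map V W (f b) (g (k \<odot>\<^bsub>C\<^esub> c)) t = k \<odot>\<^bsub>tensor V W\<^esub> tensor_map V W (f b) (g c) t"
      by (rule tensor_linear_eq[OF D D' VW m[OF b kc] linear_map_scale[OF VW m[OF b c]] _ t])
         (simp add: mp b c kc fs gs P)
    show "tensor_map V W (f (k \<odot>\<^bsub>B\<^esub> b)) (g c) t = k \<odot>\<^bsub>tensor V W\<^esub> tensor_map V W (f b) (g c) t"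
      by (rule tensor_linear_eq[OF D D' VW m[OF kb c] linear_map_scale[OF VW m[OF b c]] _ t])
         (simp add: mp b c kb fs gs P)
    show "tensor_map V W (f b) (g (c \<oplus>\<^bsub>C\<^esub> c')) t = tensor_map V W (f b) (g c) t \<oplus>\<^bsub>tensor V W\<^esub> tensor_map V W (f b) (g c') t"
      if c': "c' \<in> carrier C"
      by (rule tensor_linear_eq[OF D D' VW m[OF b C.a_closed[OF c c']] linear_map_add[OF VW m[OF b c] m[OF b c']] _ t])
         (simp add: mp b c c' fs gs P)
    show "tensor_map V W (f (b \<oplus>\<^bsub>B\<^esub> b')) (g c) t = tensor_map V W (f b) (g c) t \<oplus>\<^bsub>tensor V W\<^esub> tensor_map V W (f b') (g c) t"
      if b': "b' \<in> carrier B"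
      by (rule tensor_linear_eq[OF D D' VW m[OF B.a_closed[OF b b'] c] linear_map_add[OF VW m[OF b c] m[OF b' c]] _ t])
         (simp add: mp b b' c fs gs P)
  qed
  note L = tensor_lift_linear[OF B C VW inner] and LP = tensor_lift_pure[OF B C VW inner]
  show "bilinear_map (tensor B C) (tensor D D') (tensor V W) (tensor_product_action V W f g)"
    unfolding tensor_product_action_def
  proof (rule bilinear_mapI2)
    show "linear_map (tensor B C) (tensor V W) (\<lambda>s. tensor_lift (tensor V W) (\<lambda>b c. tensor_map V W (f b) (g c) t) s)"
      if "t \<in> carrier (tensor D D')" for t by (rule L[OF that])
    fix s assume s: "s \<in> carrier (tensor B C)"
    show "linear_map (tensor D D') (tensor V W) (\<lambda>t. tensor_lift (tensor V W) (\<lambda>b c. tensor_map V W (f b) (g c) t) s)"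
    proof (rule linear_mapI)
    fix t k assume t: "t \<in> carrier (tensor D D')"
    show "tensor_lift (tensor V W) (\<lambda>b c. tensor_map V W (f b) (g c) t) s \<in> carrier (tensor V W)"
      by (rule linear_mapD(1)[OF L[OF t] s])
    have kt: "k \<odot>\<^bsub>tensor D D'\<^esub> t \<in> carrier (tensor D D')" using t by simp
    show "tensor_lift (tensor V W) (\<lambda>b c. tensor_map V W (f b) (g c) (k \<odot>\<^bsub>tensor D D'\<^esub> t)) s
        = k \<odot>\<^bsub>tensor V W\<^esub> tensor_lift (tensor V W) (\<lambda>b c. tensor_map V W (f b) (g c) t) s"
      by (rule tensor_linear_eq[OF B C VW L[OF kt] linear_map_scale[OF VW L[OF t]] _ s])
         (simp add: LP kt t linear_mapD(3)[OF m])
    fix t' assume t': "t' \<in> carrier (tensor D D')"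
    show "tensor_lift (tensor V W) (\<lambda>b c. tensor_map V W (f b) (g c) (t \<oplus>\<^bsub>tensor D D'\<^esub> t')) s
        = tensor_lift (tensor V W) (\<lambda>b c. tensor_map V W (f b) (g c) t) s
          \<oplus>\<^bsub>tensor V W\<^esub> tensor_lift (tensor V W) (\<lambda>b c. tensor_map V W (f b) (g c) t') s"
      by (rule tensor_linear_eq[OF B C VW L[OF DE.a_closed[OF t t']] linear_map_add[OF VW L[OF t] L[OF t']] _ s])
         (simp add: LP t t' linear_mapD(2)[OF m])
    qed
  qed
  show "tensor_product_action V W f g (pure_tensor B C b c) (pure_tensor D D' x y) = pure_tensor V W (f b x) (g c y)"
    if "b \<in> carrier B" "c \<in> carrier C" "x \<in> carrier D" "y \<in> carrier D'"
    unfolding tensor_product_action_def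
    using that LP[of "pure_tensor D D' x y" b c] pure_tensor_simps(1)[OF D D'] by (simp add: mp)
qed

section \<open>Arrow Hopf bimodules over abelian groups\<close>

definition additive_group :: "'g::ab_group_add monoid" where
  "additive_group = \<lparr>carrier = UNIV, monoid.mult = (+), one = 0\<rparr>"

lemma additive_group_simps [simp]:
  "carrier additive_group = UNIV" "x \<otimes>\<^bsub>additive_group\<^esub> y = x + y" "\<one>\<^bsub>additive_group\<^esub> = 0"
  by (simp_all add: additive_group_def)

lemma additive_group: "group additive_group"
proof (rule groupI)
  show "\<exists>y\<in>carrier additive_group. y \<otimes>\<^bsub>additive_group\<^esub> x = \<one>\<^bsub>additive_group\<^esub>" for x :: 'a
    by (rule bexI[of _ "- x"]) simp_all
qed (simp_all add: add.assoc)

lemma additive_group_inv [simp]: "inv\<^bsub>additive_group\<^esub> x = - x"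
  by (rule group.inv_equality[OF additive_group]) auto

text \<open>
  As a rewrite rule it would turn the basis vector of the neutral element into the constant 1, to
  which the rules for basis vectors do not apply.
\<close>

declare single_one [simp del]

text \<open>
  An abelian group acts on the arrows of a quiver on its elements such that both ends are
  translated. Then \<open>g a = shift g a\<close> and \<open>a g = w(a, g) shift g a\<close>
  define a bimodule as soon as \<open>w(a, _)\<close> is a character that is constant on orbits.
\<close>

locale character_quiver =
  fixes Q :: "('g::ab_group_add, 'e) pre_digraph" and shift :: "'g \<Rightarrow> 'e \<Rightarrow> 'e" and w :: "'e \<Rightarrow> 'g \<Rightarrow> complex"
  assumes shift_closed: "a \<in> arcs Q \<Longrightarrow> shift g a \<in> arcs Q"
    and shift_zero: "a \<in> arcs Q \<Longrightarrow> shift 0 a = a"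
    and shift_add: "a \<in> arcs Q \<Longrightarrow> shift (g + h) a = shift g (shift h a)"
    and tail_shift: "a \<in> arcs Q \<Longrightarrow> tail Q (shift g a) = g + tail Q a"
    and head_shift: "a \<in> arcs Q \<Longrightarrow> head Q (shift g a) = g + head Q a"
    and w_zero: "a \<in> arcs Q \<Longrightarrow> w a 0 = 1"
    and w_add: "a \<in> arcs Q \<Longrightarrow> w a (g + h) = w a g * w a h"
    and w_shift: "a \<in> arcs Q \<Longrightarrow> w (shift g a) h = w a h"
begin

abbreviation kG :: "(complex, 'g \<Rightarrow>\<^sub>0 complex) module" where "kG \<equiv> monoid_algebra additive_group"
abbreviation M :: "(complex, 'e \<Rightarrow>\<^sub>0 complex) module" where "M \<equiv> arrow_space Q"

definition l :: "('g \<Rightarrow>\<^sub>0 complex) \<Rightarrow> ('e \<Rightarrow>\<^sub>0 complex) \<Rightarrow> ('e \<Rightarrow>\<^sub>0 complex)" where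
  "l = bilinear_extension M (\<lambda>g a. basis_vector (shift g a))"

definition r :: "('e \<Rightarrow>\<^sub>0 complex) \<Rightarrow> ('g \<Rightarrow>\<^sub>0 complex) \<Rightarrow> ('e \<Rightarrow>\<^sub>0 complex)" where
  "r = bilinear_extension M (\<lambda>a g. Poly_Mapping.single (shift g a) (w a g))"

lemma kG: "complex_algebra kG"
  by (rule monoid_algebra_algebra[OF group.is_monoid[OF additive_group]])

lemmas kG_space = complex_algebraD(2)[OF kG] and M_space = free_space_vector_space[of "arcs Q"]

lemma kG_free: "carrier kG = carrier (free_space UNIV)" by simp

lemma l_bilinear: "bilinear_map kG M M l"
  unfolding l_def bilinear_map_monoid_algebra
  by (rule bilinear_extension_bilinear[OF M_space]) (simp add: shift_closed)

lemma r_bilinear: "bilinear_map M kG M r"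
  unfolding r_def bilinear_map_monoid_algebra
  by (rule bilinear_extension_bilinear[OF M_space]) (simp add: shift_closed)

lemma l_basis: "a \<in> arcs Q \<Longrightarrow> l (basis_vector g) (basis_vector a) = basis_vector (shift g a)"
  unfolding l_def by (rule bilinear_extension_basis[OF M_space]) (simp add: shift_closed)

lemma r_basis: "a \<in> arcs Q \<Longrightarrow> r (basis_vector a) (basis_vector g) = w a g \<odot>\<^bsub>M\<^esub> basis_vector (shift g a)"
  unfolding r_def using bilinear_extension_basis[OF M_space, of "\<lambda>a g. Poly_Mapping.single (shift g a) (w a g)" a g]
  by (simp add: shift_closed)

lemma basis_closed: "basis_vector g \<in> carrier kG" "a \<in> arcs Q \<Longrightarrow> basis_vector a \<in> carrier M"
  by simp_all

lemma arrow_bimodule: "bimodule kG M l r"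
proof -
  note L = bilinear_simps[OF l_bilinear] and R = bilinear_simps[OF r_bilinear] and S = complex_algebra_simps[OF kG]
  interpret M: module CC M by (rule M_space)
  interpret kG: module CC kG by (rule kG_space)
  note lin = linear_map_monoid_algebra(1)[of additive_group, simplified additive_group_simps, symmetric]
  note bs = basis_closed l_basis r_basis shift_closed
  have one: "l \<one>\<^bsub>kG\<^esub> m = m" "r m \<one>\<^bsub>kG\<^esub> = m" if m: "m \<in> carrier M" for m
  proof -
    show "l \<one>\<^bsub>kG\<^esub> m = m"
      by (rule free_space_linear_eq[OF M_space bilinear_mapD(1)[OF l_bilinear S(6)] linear_map_id _ m])
         (simp add: l_basis shift_zero)
    show "r m \<one>\<^bsub>kG\<^esub> = m"
      by (rule free_space_linear_eq[OF M_space bilinear_mapD(2)[OF r_bilinear S(6)] linear_map_id _ m])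
         (simp add: r_basis shift_zero w_zero)
  qed
  have mult: "l (x \<otimes>\<^bsub>kG\<^esub> y) m = l x (l y m)" if "x \<in> carrier kG" "y \<in> carrier kG" "m \<in> carrier M" for x y m
    by (rule trilinear_free_eq[OF M_space, of UNIV UNIV "arcs Q" "\<lambda>x y m. l (x \<otimes>\<^bsub>kG\<^esub> y) m" "\<lambda>x y m. l x (l y m)"],
        unfold lin kG_free[symmetric])
       (use that in \<open>auto simp del: free_space_simps monoid_algebra_simps intro!: linear_mapI simp: L S,
          simp add: l_basis shift_closed shift_add\<close>)
  have sm: "a \<odot>\<^bsub>M\<^esub> (b \<odot>\<^bsub>M\<^esub> x) = (a * b) \<odot>\<^bsub>M\<^esub> x" if "x \<in> carrier M" for a b x
    using M.smult_assoc1[of a b x] that by (simp del: free_space_simps)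
  have mult': "r m (x \<otimes>\<^bsub>kG\<^esub> y) = r (r m x) y" if "x \<in> carrier kG" "y \<in> carrier kG" "m \<in> carrier M" for x y m
    by (rule trilinear_free_eq[OF M_space, of UNIV UNIV "arcs Q" "\<lambda>x y m. r m (x \<otimes>\<^bsub>kG\<^esub> y)" "\<lambda>x y m. r (r m x) y"],
        unfold lin kG_free[symmetric])
       (use that in \<open>auto simp del: free_space_simps monoid_algebra_simps intro!: linear_mapI simp: R S r_basis bs
          w_shift w_add sm shift_add[symmetric] add.commute\<close>)
  have comm: "l x (r m y) = r (l x m) y" if "x \<in> carrier kG" "y \<in> carrier kG" "m \<in> carrier M" for x y m
    by (rule trilinear_free_eq[OF M_space, of UNIV UNIV "arcs Q" "\<lambda>x y m. l x (r m y)" "\<lambda>x y m. r (l x m) y"],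
        unfold lin kG_free[symmetric])
       (use that in \<open>auto simp del: free_space_simps monoid_algebra_simps intro!: linear_mapI simp: L R S bs
          w_shift shift_add[symmetric] add.commute\<close>)
  show ?thesis
    unfolding bimodule_def by (intro conjI ballI l_bilinear r_bilinear one mult mult' comm)
qed

lemma group_comult_basis: "group_comult additive_group (basis_vector g) = pure_tensor kG kG (basis_vector g) (basis_vector g)"
  unfolding group_comult_def
  by (rule linear_extension_basis_vector[OF tensor_vector_space[OF kG_space kG_space]])
     (rule pure_tensor_simps(1)[OF kG_space kG_space basis_closed(1) basis_closed(1)])

lemma group_comult_linear: "linear_map kG (tensor kG kG) (group_comult additive_group)"
  unfolding group_comult_def linear_map_monoid_algebra
  by (rule linear_extension_linear[OF tensor_vector_space[OF kG_space kG_space]])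
     (rule pure_tensor_simps(1)[OF kG_space kG_space basis_closed(1) basis_closed(1)])

lemma left_coaction_basis:
  "a \<in> arcs Q \<Longrightarrow> left_coaction additive_group Q (basis_vector a) = pure_tensor kG M (basis_vector (head Q a)) (basis_vector a)"
  unfolding left_coaction_def
  by (rule linear_extension_basis_vector[OF tensor_vector_space[OF kG_space M_space]])
     (rule pure_tensor_simps(1)[OF kG_space M_space basis_closed])

lemma left_coaction_linear: "linear_map M (tensor kG M) (left_coaction additive_group Q)"
  unfolding left_coaction_def
  by (rule linear_extension_linear[OF tensor_vector_space[OF kG_space M_space]])
     (rule pure_tensor_simps(1)[OF kG_space M_space basis_closed])

lemma right_coaction_basis:
  "a \<in> arcs Q \<Longrightarrow> right_coaction additive_group Q (basis_vector a) = pure_tensor M kG (basis_vector a) (basis_vector (tail Q a))"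
  unfolding right_coaction_def
  by (rule linear_extension_basis_vector[OF tensor_vector_space[OF M_space kG_space]])
     (rule pure_tensor_simps(1)[OF M_space kG_space basis_closed(2,1)])

lemma right_coaction_linear: "linear_map M (tensor M kG) (right_coaction additive_group Q)"
  unfolding right_coaction_def
  by (rule linear_extension_linear[OF tensor_vector_space[OF M_space kG_space]])
     (rule pure_tensor_simps(1)[OF M_space kG_space basis_closed(2,1)])

lemma kG_mult_basis: "basis_vector g \<otimes>\<^bsub>kG\<^esub> basis_vector h = basis_vector (g + h)"
  by simp

text \<open>
  On basis vectors the coactions are compatible with the actions because both ends of an arrow are
  translated, and left and right translation agree in an abelian group. The general case follows
  by bilinearity.
\<close>

lemma arrow_hopf_bimodule: "arrow_hopf_bimodule additive_group Q l r"
proof -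
  note mb = complex_algebra_mult_bilinear[OF kG]
  note KM = tensor_vector_space[OF kG_space M_space] and MK = tensor_vector_space[OF M_space kG_space]
  note bl = bilinear_mapD[OF l_bilinear] and br = bilinear_mapD[OF r_bilinear]
  note gc = linear_mapD(1)[OF group_comult_linear] and lc = linear_mapD(1)[OF left_coaction_linear]
    and rc = linear_mapD(1)[OF right_coaction_linear]
  note a1 = tensor_product_action_bilinear[OF kG_space kG_space kG_space M_space kG_space M_space mb l_bilinear]
  note a2 = tensor_product_action_bilinear[OF kG_space M_space kG_space kG_space kG_space M_space mb r_bilinear]
  note a3 = tensor_product_action_bilinear[OF kG_space kG_space M_space kG_space M_space kG_space l_bilinear mb]
  note a4 = tensor_product_action_bilinear[OF M_space kG_space kG_space kG_space M_space kG_space r_bilinear mb]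
  note pKM = pure_tensor_simps[OF kG_space M_space] and pMK = pure_tensor_simps[OF M_space kG_space]
  have comp: "bilinear_map V W Z (\<lambda>x y. b (f x) (g y))"
    if "bilinear_map V' W' Z b" "linear_map V V' f" "linear_map W W' g" for V W Z V' W' b f g
    using bilinear_simps[OF that(1)] linear_mapD[OF that(2)] linear_mapD[OF that(3)]
    by (intro bilinear_mapI) auto
  have post: "bilinear_map V W Z (\<lambda>x y. f (b x y))" if "bilinear_map V W Z' b" "linear_map Z' Z f" for V W Z Z' b f
    using bilinear_simps[OF that(1)] linear_mapD[OF that(2)] by (intro bilinear_mapI) auto
  note bx = l_basis r_basis left_coaction_basis right_coaction_basis group_comult_basis basis_closed shift_closed
    head_shift tail_shift kG_mult_basis
  have u: "UNIV = carrier (additive_group :: 'g monoid)" by simp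
  have 1: "left_coaction additive_group Q (l x m) = tensor_product_action kG M (monoid.mult kG) l (group_comult additive_group x) (left_coaction additive_group Q m)"
    if "x \<in> carrier kG" "m \<in> carrier M" for x m
    by (rule bilinear_free_eq[OF KM post[OF l_bilinear left_coaction_linear, unfolded bilinear_map_monoid_algebra]
          comp[OF a1(1) group_comult_linear left_coaction_linear, unfolded bilinear_map_monoid_algebra]])
       (use that in \<open>simp_all del: monoid_algebra_simps(4) free_space_simps(4) monoid_algebra_mult_single add: bx a1(2)\<close>)
  have 2: "left_coaction additive_group Q (r m x) = tensor_product_action kG M (monoid.mult kG) r (left_coaction additive_group Q m) (group_comult additive_group x)"
    if "x \<in> carrier kG" "m \<in> carrier M" for x m
    by (rule bilinear_free_eq[OF KM post[OF r_bilinear left_coaction_linear, unfolded bilinear_map_monoid_algebra]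
          comp[OF a2(1) left_coaction_linear group_comult_linear, unfolded bilinear_map_monoid_algebra]])
       (use that in \<open>simp_all del: monoid_algebra_simps(4) free_space_simps(4) monoid_algebra_mult_single
          add: bx a2(2) linear_mapD(3)[OF left_coaction_linear] pKM add.commute\<close>)
  have 3: "right_coaction additive_group Q (l x m) = tensor_product_action M kG l (monoid.mult kG) (group_comult additive_group x) (right_coaction additive_group Q m)"
    if "x \<in> carrier kG" "m \<in> carrier M" for x m
    by (rule bilinear_free_eq[OF MK post[OF l_bilinear right_coaction_linear, unfolded bilinear_map_monoid_algebra]
          comp[OF a3(1) group_comult_linear right_coaction_linear, unfolded bilinear_map_monoid_algebra]])
       (use that in \<open>simp_all del: monoid_algebra_simps(4) free_space_simps(4) monoid_algebra_mult_single add: bx a3(2)\<close>)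
  have 4: "right_coaction additive_group Q (r m x) = tensor_product_action M kG r (monoid.mult kG) (right_coaction additive_group Q m) (group_comult additive_group x)"
    if "x \<in> carrier kG" "m \<in> carrier M" for x m
    by (rule bilinear_free_eq[OF MK post[OF r_bilinear right_coaction_linear, unfolded bilinear_map_monoid_algebra]
          comp[OF a4(1) right_coaction_linear group_comult_linear, unfolded bilinear_map_monoid_algebra]])
       (use that in \<open>simp_all del: monoid_algebra_simps(4) free_space_simps(4) monoid_algebra_mult_single
          add: bx a4(2) linear_mapD(3)[OF right_coaction_linear] pMK add.commute\<close>)
  show ?thesis
    unfolding arrow_hopf_bimodule_def Let_def by (intro conjI ballI arrow_bimodule 1 2 3 4)
qed

end

section \<open>Adding a Hopf structure to an algebra\<close>

lemma module_extend_simps [simp]: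
  "carrier (module.extend T h) = carrier T" "monoid.mult (module.extend T h) = monoid.mult T"
  "\<one>\<^bsub>module.extend T h\<^esub> = \<one>\<^bsub>T\<^esub>" "\<zero>\<^bsub>module.extend T h\<^esub> = \<zero>\<^bsub>T\<^esub>" "ring.add (module.extend T h) = ring.add T"
  "module.smult (module.extend T h) = module.smult T"
  by (simp_all add: module.defs)

lemma truncate_extend [simp]: "module.truncate (module.extend T h) = (T :: (complex, 'a) module)"
  by (simp add: module.defs)

lemma hopf_extend_simps [simp]:
  "comult (module.extend T (hopf.fields D e s)) = D"
  "counit (module.extend T (hopf.fields D e s)) = e"
  "antipode (module.extend T (hopf.fields D e s)) = s"
  by (simp_all add: module.defs hopf.defs)

lemma complex_algebra_extend: "complex_algebra T \<Longrightarrow> complex_algebra (module.extend T h)"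
  by (rule complex_algebra_image[where h = "\<lambda>x. x"]) simp_all

lemma algebra_map_extend [simp]:
  "algebra_map (module.extend T h) B f \<longleftrightarrow> algebra_map T B f"
  "algebra_map C (module.extend T h) g \<longleftrightarrow> algebra_map C T g"
  "algebra_map C (opposite_algebra (module.extend T h)) g \<longleftrightarrow> algebra_map C (opposite_algebra T) g"
  by (simp_all add: algebra_map_def linear_map_def ring_hom_def)

lemma algebra_generators_extend:
  assumes T: "complex_algebra T"
  shows "algebra_generators (module.extend T h) S \<longleftrightarrow> algebra_generators T S"
proof -
  note V = complex_algebraD(2)[OF T] and V' = complex_algebraD(2)[OF complex_algebra_extend[OF T, of h]]
  have "submodule B CC (module.extend T h) \<longleftrightarrow> submodule B CC T" for B
  proof
    assume B: "submodule B CC (module.extend T h)"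
    show "submodule B CC T"
      by (rule subspaceI[OF V]) (use subspaceD[OF V' B] in simp_all)
  next
    assume B: "submodule B CC T"
    show "submodule B CC (module.extend T h)"
      by (rule subspaceI[OF V']) (use subspaceD[OF V B] in simp_all)
  qed
  then show ?thesis by (simp add: algebra_generators_def)
qed

lemma tensor_extend:
  "tensor (module.extend T h) (module.extend T' h') = tensor T T'"
  "pure_tensor (module.extend T h) (module.extend T' h') = pure_tensor T T'"
  "tensor_map (module.extend T h) (module.extend T' h') = tensor_map T T'"
  by (rule tensor_cong; simp)+

lemma bilinear_map_span:
  assumes V: "module CC V" and W: "module CC W" and Z: "module CC Z" and f: "bilinear_map V W Z f"
    and H: "submodule H CC Z" and S: "S \<subseteq> carrier V" and S': "S' \<subseteq> carrier W"
    and m: "\<And>x y. x \<in> S \<Longrightarrow> y \<in> S' \<Longrightarrow> f x y \<in> H"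
    and xy: "x \<in> linear_span V S" "y \<in> linear_span W S'"
  shows "f x y \<in> H"
proof -
  have y: "y \<in> carrier W" using xy(2) subspaceD(1)[OF W linear_span_subspace[OF W S']] by auto
  show ?thesis
  proof (rule linear_map_span[OF V Z bilinear_mapD(2)[OF f y] H S _ xy(1)])
    fix x assume x: "x \<in> S"
    then have x': "x \<in> carrier V" using S by auto
    show "f x y \<in> H" by (rule linear_map_span[OF W Z bilinear_mapD(1)[OF f x'] H S' m[OF x] xy(2)])
  qed
qed

context character_quiver begin

section \<open>Semi-path Hopf algebras over abelian groups\<close>

abbreviation "T \<equiv> tensor_algebra kG M l r"

text \<open>
  The generators of the tensor algebra in degrees 0 and 1: the images of the group elements and of
  the arrows.
\<close>

definition \<gamma> :: "'g \<Rightarrow> (('g \<Rightarrow>\<^sub>0 complex) \<times> ('e \<Rightarrow>\<^sub>0 complex) list \<Rightarrow>\<^sub>0 complex) set" where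
  "\<gamma> g = tensor_word kG M l r (basis_vector g) []"

definition \<xi> :: "'e \<Rightarrow> (('g \<Rightarrow>\<^sub>0 complex) \<times> ('e \<Rightarrow>\<^sub>0 complex) list \<Rightarrow>\<^sub>0 complex) set" where
  "\<xi> a = tensor_word kG M l r \<one>\<^bsub>kG\<^esub> [basis_vector a]"

lemmas T_algebra = tensor_algebra_algebra[OF kG M_space arrow_bimodule]
lemmas T_space = complex_algebraD(2)[OF T_algebra]
lemmas base_map = tensor_word_base_algebra_map[OF kG M_space arrow_bimodule]
lemmas letter_map = tensor_word_letter_linear[OF kG M_space arrow_bimodule]

lemma \<gamma>_closed: "\<gamma> g \<in> carrier T"
  unfolding \<gamma>_def by (rule algebra_map_simps(1)[OF base_map basis_closed(1)])

lemma \<xi>_closed: "a \<in> arcs Q \<Longrightarrow> \<xi> a \<in> carrier T"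
  unfolding \<xi>_def by (rule linear_mapD(1)[OF letter_map basis_closed(2)])

lemma \<gamma>_add: "\<gamma> g \<otimes>\<^bsub>T\<^esub> \<gamma> h = \<gamma> (g + h)"
  unfolding \<gamma>_def kG_mult_basis[symmetric] by (rule algebra_mapD(2)[OF base_map basis_closed(1) basis_closed(1), symmetric])

lemma \<gamma>_zero: "\<one>\<^bsub>T\<^esub> = \<gamma> 0"
  using algebra_mapD(3)[OF base_map] by (simp add: \<gamma>_def)

lemma \<gamma>_\<xi>: "a \<in> arcs Q \<Longrightarrow> \<gamma> g \<otimes>\<^bsub>T\<^esub> \<xi> a = \<xi> (shift g a)"
  unfolding \<gamma>_def \<xi>_def
  by (subst tensor_word_left_action[OF kG M_space arrow_bimodule basis_closed]) (simp_all only: l_basis)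

lemma \<xi>_\<gamma>: "a \<in> arcs Q \<Longrightarrow> \<xi> a \<otimes>\<^bsub>T\<^esub> \<gamma> g = w a g \<odot>\<^bsub>T\<^esub> \<xi> (shift g a)"
  unfolding \<gamma>_def \<xi>_def
  by (subst tensor_word_right_action[OF kG M_space arrow_bimodule basis_closed])
    (simp_all only: r_basis linear_mapD(3)[OF letter_map basis_closed(2)[OF shift_closed]])

lemma base_into:
  assumes "module CC V" "linear_map kG V f" "submodule H CC V" "\<And>g. f (basis_vector g) \<in> H" "x \<in> carrier kG"
  shows "f x \<in> H"
  using monoid_algebra_linear_into[OF assms(1-3) _ assms(5)] assms(4) by blast

lemma semi_path_generators: "algebra_generators T (range \<gamma> \<union> \<xi> ` arcs Q)"
  unfolding algebra_generators_def
proof (intro conjI allI impI)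
  show "range \<gamma> \<union> \<xi> ` arcs Q \<subseteq> carrier T" using \<gamma>_closed \<xi>_closed by auto
  fix B assume B: "submodule B CC T" and one: "\<one>\<^bsub>T\<^esub> \<in> B" and m: "\<forall>x\<in>B. \<forall>y\<in>B. x \<otimes>\<^bsub>T\<^esub> y \<in> B"
    and g: "range \<gamma> \<union> \<xi> ` arcs Q \<subseteq> B"
  have 1: "tensor_word kG M l r a [] \<in> B" if "a \<in> carrier kG" for a
    by (rule base_into[OF T_space algebra_mapD(1)[OF base_map] B _ that]) (use g in \<open>auto simp: \<gamma>_def\<close>)
  have 2: "tensor_word kG M l r \<one>\<^bsub>kG\<^esub> [x] \<in> B" if "x \<in> carrier M" for x
    by (rule free_space_linear_into[OF T_space letter_map B _ that]) (use g in \<open>auto simp: \<xi>_def\<close>)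
  show "carrier T \<subseteq> B"
  proof
    fix x assume x: "x \<in> carrier T"
    show "x \<in> B"
      by (rule algebra_generatorsD[OF tensor_algebra_generators[OF kG M_space arrow_bimodule] B one _ _ x])
         (use m 1 2 in blast)+
  qed
qed

text \<open>The universal property of the tensor algebra, read off on basis vectors.\<close>

theorem semi_path_universal:
  assumes B: "complex_algebra B" and c: "\<And>g. \<phi> g \<in> carrier B" "\<And>a. a \<in> arcs Q \<Longrightarrow> \<psi> a \<in> carrier B"
    and zero: "\<phi> 0 = \<one>\<^bsub>B\<^esub>" and add: "\<And>g h. \<phi> (g + h) = \<phi> g \<otimes>\<^bsub>B\<^esub> \<phi> h"
    and left: "\<And>g a. a \<in> arcs Q \<Longrightarrow> \<psi> (shift g a) = \<phi> g \<otimes>\<^bsub>B\<^esub> \<psi> a"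
    and right: "\<And>g a. a \<in> arcs Q \<Longrightarrow> w a g \<odot>\<^bsub>B\<^esub> \<psi> (shift g a) = \<psi> a \<otimes>\<^bsub>B\<^esub> \<phi> g"
  obtains h where "algebra_map T B h" "\<And>g. h (\<gamma> g) = \<phi> g" "\<And>a. a \<in> arcs Q \<Longrightarrow> h (\<xi> a) = \<psi> a"
proof -
  note VB = complex_algebraD(2)[OF B]
  let ?f = "linear_extension B \<phi>" and ?g = "linear_extension B \<psi>"
  have f: "algebra_map kG B ?f"
    by (rule monoid_algebra_lift[OF group.is_monoid[OF additive_group] B]) (simp_all add: c zero add)
  have g: "linear_map M B ?g" by (rule linear_extension_linear[OF VB c(2)])
  have fb: "?f (basis_vector x) = \<phi> x" for x
    by (rule linear_extension_basis_vector[of B \<phi> x, OF VB c(1)])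
  have gb: "?g (basis_vector x) = \<psi> x" if "x \<in> arcs Q" for x
    by (rule linear_extension_basis_vector[of B \<psi> x, OF VB c(2)[OF that]])
  note fl = algebra_mapD(1)[OF f] and mb = complex_algebra_mult_bilinear[OF B]
  have bl: "bilinear_map kG M B (\<lambda>x m. ?g (l x m))" "bilinear_map kG M B (\<lambda>x m. ?f x \<otimes>\<^bsub>B\<^esub> ?g m)"
    using bilinear_simps[OF l_bilinear] linear_mapD[OF g] linear_mapD[OF fl] bilinear_simps[OF mb]
    by (auto intro!: bilinear_mapI simp del: monoid_algebra_simps free_space_simps)
  have br: "bilinear_map M kG B (\<lambda>m x. ?g (r m x))" "bilinear_map M kG B (\<lambda>m x. ?g m \<otimes>\<^bsub>B\<^esub> ?f x)"
    using bilinear_simps[OF r_bilinear] linear_mapD[OF g] linear_mapD[OF fl] bilinear_simps[OF mb]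
    by (auto intro!: bilinear_mapI simp del: monoid_algebra_simps free_space_simps)
  have gl: "?g (l x m) = ?f x \<otimes>\<^bsub>B\<^esub> ?g m" if "x \<in> carrier kG" "m \<in> carrier M" for x m
    by (rule bilinear_free_eq[OF VB bl[unfolded bilinear_map_monoid_algebra]])
       (use that in \<open>simp_all del: monoid_algebra_simps(4) free_space_simps(4) add: l_basis fb gb left shift_closed\<close>)
  have gr: "?g (r m x) = ?g m \<otimes>\<^bsub>B\<^esub> ?f x" if "x \<in> carrier kG" "m \<in> carrier M" for x m
  proof (rule bilinear_free_eq[OF VB br[unfolded bilinear_map_monoid_algebra]])
    fix a g assume a: "a \<in> arcs Q"
    show "?g (r (basis_vector a) (basis_vector g)) = ?g (basis_vector a) \<otimes>\<^bsub>B\<^esub> ?f (basis_vector g)"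
      by (simp only: r_basis[OF a] linear_mapD(3)[OF g basis_closed(2)[OF shift_closed[OF a]]]
          gb[OF a] gb[OF shift_closed[OF a]] fb right[OF a])
  qed (use that in simp_all)
  show ?thesis
  proof (rule tensor_algebra_universal[of kG M l r B ?f ?g, OF kG M_space arrow_bimodule B f g])
    show "?g (l x m) = ?f x \<otimes>\<^bsub>B\<^esub> ?g m" if "x \<in> carrier kG" "m \<in> carrier M" for x m using that by (rule gl)
    show "?g (r m x) = ?g m \<otimes>\<^bsub>B\<^esub> ?f x" if "x \<in> carrier kG" "m \<in> carrier M" for x m using that by (rule gr)
    fix h assume h: "algebra_map T B h" "\<And>a. a \<in> carrier kG \<Longrightarrow> h (tensor_word kG M l r a []) = ?f a"
      "\<And>m. m \<in> carrier M \<Longrightarrow> h (tensor_word kG M l r \<one>\<^bsub>kG\<^esub> [m]) = ?g m"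
    show thesis
      by (rule that[OF h(1)]) (simp_all only: \<gamma>_def \<xi>_def h(2)[OF basis_closed(1)] h(3)[OF basis_closed(2)] fb gb)
  qed
qed

abbreviation "degree_part \<equiv> tensor_algebra_degree kG M l r"

abbreviation degree_words where
  "degree_words n \<equiv> {tensor_word kG M l r a us | a us. a \<in> carrier kG \<and> us \<in> lists (carrier M) \<and> length us = n}"

lemma degree_words_subset: "degree_words n \<subseteq> carrier T"
  by (auto simp del: monoid_algebra_simps free_space_simps intro!: tensor_word_closed[OF kG M_space arrow_bimodule])

lemma degree_part_subspace: "submodule (degree_part n) CC T"
  unfolding tensor_algebra_degree_def by (rule linear_span_subspace[OF T_space degree_words_subset])

lemma degree_part_word:
  "a \<in> carrier kG \<Longrightarrow> us \<in> lists (carrier M) \<Longrightarrow> length us = n \<Longrightarrow> tensor_word kG M l r a us \<in> degree_part n"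
  unfolding tensor_algebra_degree_def by (rule subsetD[OF linear_span_superset]) blast

lemma degree_part_\<gamma>: "\<gamma> g \<in> degree_part 0"
  unfolding \<gamma>_def by (rule degree_part_word) simp_all

lemma degree_part_\<xi>: "a \<in> arcs Q \<Longrightarrow> \<xi> a \<in> degree_part 1"
  unfolding \<xi>_def by (rule degree_part_word) simp_all

lemma degree_part_mult:
  assumes "x \<in> degree_part i" "y \<in> degree_part j"
  shows "x \<otimes>\<^bsub>T\<^esub> y \<in> degree_part (i + j)"
proof (rule bilinear_map_span[OF T_space T_space T_space complex_algebra_mult_bilinear[OF T_algebra] degree_part_subspace
      degree_words_subset degree_words_subset _ assms[unfolded tensor_algebra_degree_def]])
  fix x y assume "x \<in> degree_words i" "y \<in> degree_words j"
  then obtain a us b vs where xy: "x = tensor_word kG M l r a us" "y = tensor_word kG M l r b vs"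
    and a: "a \<in> carrier kG" and us: "us \<in> lists (carrier M)" "length us = i"
    and b: "b \<in> carrier kG" and vs: "vs \<in> lists (carrier M)" "length vs = j" by blast
  obtain c ws where cw: "(a, us) \<otimes>\<^bsub>tensor_words kG M r\<^esub> (b, vs) = (c, ws)" by fastforce
  have W: "(c, ws) \<in> carrier (tensor_words kG M r)"
    using monoid.m_closed[OF tensor_words_monoid[OF kG M_space arrow_bimodule], of "(a, us)" "(b, vs)"]
      cw a b us vs by (simp del: monoid_algebra_simps free_space_simps)
  have "length ws = i + j" using cw us(2) vs(2) by (cases us rule: rev_cases) auto
  then show "x \<otimes>\<^bsub>T\<^esub> y \<in> degree_part (i + j)"
    unfolding xy tensor_word_mult[OF kG M_space arrow_bimodule a us(1) b vs(1) cw]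
    using W by (intro degree_part_word) (simp_all del: monoid_algebra_simps free_space_simps)
qed

text \<open>
  Words are products of their letters, so that a homomorphism which respects degrees on the
  generators respects them everywhere. This applies to comultiplication, counit and antipode
  alike.
\<close>

lemma graded_algebra_map:
  assumes B: "complex_algebra B" and h: "algebra_map T B h" and D: "\<And>n. submodule (D n) CC B"
    and m: "\<And>i j u v. u \<in> D i \<Longrightarrow> v \<in> D j \<Longrightarrow> u \<otimes>\<^bsub>B\<^esub> v \<in> D (i + j)"
    and g: "\<And>g. h (\<gamma> g) \<in> D 0" and x: "\<And>a. a \<in> arcs Q \<Longrightarrow> h (\<xi> a) \<in> D 1"
    and y: "y \<in> degree_part n"
  shows "h y \<in> D n"
proof -
  note VB = complex_algebraD(2)[OF B]
  have 1: "h (tensor_word kG M l r a []) \<in> D 0" if "a \<in> carrier kG" for a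
    by (rule base_into[OF VB linear_map_comp[OF algebra_mapD(1)[OF base_map] algebra_mapD(1)[OF h]] D _ that])
       (use g in \<open>simp add: \<gamma>_def\<close>)
  have 2: "h (tensor_word kG M l r \<one>\<^bsub>kG\<^esub> [u]) \<in> D 1" if "u \<in> carrier M" for u
    by (rule free_space_linear_into[OF VB linear_map_comp[OF letter_map algebra_mapD(1)[OF h]] D _ that])
       (use x in \<open>simp add: \<xi>_def\<close>)
  have w: "h (tensor_word kG M l r a us) \<in> D (length us)" if a: "a \<in> carrier kG" and us: "us \<in> lists (carrier M)" for a us
    using us
  proof (induction us rule: rev_induct)
    case Nil
    show ?case using 1[OF a] by simp
  next
    case (snoc u us)
    then have u: "u \<in> carrier M" "us \<in> lists (carrier M)" by auto
    have "h (tensor_word kG M l r a (us @ [u])) = h (tensor_word kG M l r a us) \<otimes>\<^bsub>B\<^esub> h (tensor_word kG M l r \<one>\<^bsub>kG\<^esub> [u])"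
      unfolding tensor_word_snoc[OF kG M_space arrow_bimodule a u(2,1)]
      by (rule algebra_mapD(2)[OF h])
         (use a u complex_algebra_simps(6)[OF kG] in
           \<open>auto simp del: monoid_algebra_simps free_space_simps intro!: tensor_word_closed[OF kG M_space arrow_bimodule]\<close>)
    then show ?case using m[OF snoc.IH[OF u(2)] 2[OF u(1)]] by simp
  qed
  show ?thesis
    by (rule linear_map_span[OF T_space VB algebra_mapD(1)[OF h] D degree_words_subset _ y[unfolded tensor_algebra_degree_def]])
       (use w in blast)
qed

text \<open>
  All three structure maps come from \<open>semi_path_universal\<close>, and the Hopf axioms are
  verified on generators. The comultiplication makes an arrow \<open>a\<close> from
  \<open>x\<close> to \<open>y\<close> skew primitive, which forces its antipode to be \<open>-
  \<gamma>(-y) \<xi>(a) \<gamma>(-x)\<close>; the value stated here is this product in normal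
  form.
\<close>

theorem semi_path_hopf_algebra_exists:
  obtains D e s where "semi_path_hopf_algebra additive_group Q l r (module.extend T (hopf.fields D e s))"
    and "hopf_algebra (module.extend T (hopf.fields D e s))"
    and "algebra_map T (tensor T T) D" "algebra_map T complex_space e" "algebra_map T (opposite_algebra T) s"
    and "\<And>g. D (\<gamma> g) = pure_tensor T T (\<gamma> g) (\<gamma> g)"
    and "\<And>a. a \<in> arcs Q \<Longrightarrow> D (\<xi> a) = pure_tensor T T (\<gamma> (head Q a)) (\<xi> a) \<oplus>\<^bsub>tensor T T\<^esub> pure_tensor T T (\<xi> a) (\<gamma> (tail Q a))"
    and "\<And>g. e (\<gamma> g) = 1" "\<And>a. a \<in> arcs Q \<Longrightarrow> e (\<xi> a) = 0"
    and "\<And>g. s (\<gamma> g) = \<gamma> (- g)"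
    and "\<And>a. a \<in> arcs Q \<Longrightarrow> s (\<xi> a) = (- w a (- tail Q a)) \<odot>\<^bsub>T\<^esub> \<xi> (shift (- head Q a - tail Q a) a)"
proof -
  note S = complex_algebra_simps[OF T_algebra] and V = T_space
  note TT = tensor_algebra_structure[OF T_algebra T_algebra]
  note ST = complex_algebra_simps[OF TT]
  note P = pure_tensor_simps[OF V V]
  interpret TT: ring "tensor T T" using TT by (rule complex_algebraD)
  interpret V: module CC T by (rule V)
  note base = pure_tensor_mult[OF T_algebra T_algebra] \<gamma>_closed \<xi>_closed \<gamma>_add \<gamma>_\<xi> \<xi>_\<gamma> P ST S shift_closed
  note TM = pure_tensor_mult[OF T_algebra T_algebra]
  let ?D = "\<lambda>a. pure_tensor T T (\<gamma> (head Q a)) (\<xi> a) \<oplus>\<^bsub>tensor T T\<^esub> pure_tensor T T (\<xi> a) (\<gamma> (tail Q a))"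
  obtain D where D: "algebra_map T (tensor T T) D" and D\<gamma>: "\<And>g. D (\<gamma> g) = pure_tensor T T (\<gamma> g) (\<gamma> g)"
    and D\<xi>: "\<And>a. a \<in> arcs Q \<Longrightarrow> D (\<xi> a) = ?D a"
  proof (rule semi_path_universal[OF TT, of "\<lambda>g. pure_tensor T T (\<gamma> g) (\<gamma> g)" ?D])
    show "pure_tensor T T (\<gamma> g) (\<gamma> g) \<in> carrier (tensor T T)" for g by (intro P(1) \<gamma>_closed)
    show c: "?D a \<in> carrier (tensor T T)" if "a \<in> arcs Q" for a
      by (intro ST(2) P(1) \<gamma>_closed \<xi>_closed that)
    show "pure_tensor T T (\<gamma> 0) (\<gamma> 0) = \<one>\<^bsub>tensor T T\<^esub>"
      by (simp only: pure_tensor_one[OF T_algebra T_algebra] \<gamma>_zero)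
    show "pure_tensor T T (\<gamma> (g + h)) (\<gamma> (g + h)) = pure_tensor T T (\<gamma> g) (\<gamma> g) \<otimes>\<^bsub>tensor T T\<^esub> pure_tensor T T (\<gamma> h) (\<gamma> h)" for g h
      by (simp only: TM \<gamma>_closed \<gamma>_add)
    show "?D (shift g a) = pure_tensor T T (\<gamma> g) (\<gamma> g) \<otimes>\<^bsub>tensor T T\<^esub> ?D a" if a: "a \<in> arcs Q" for g a
      using a by (simp only: TT.r_distr P(1) TM \<gamma>_closed \<xi>_closed \<gamma>_add \<gamma>_\<xi> head_shift tail_shift)
    show "w a g \<odot>\<^bsub>tensor T T\<^esub> ?D (shift g a) = ?D a \<otimes>\<^bsub>tensor T T\<^esub> pure_tensor T T (\<gamma> g) (\<gamma> g)" if a: "a \<in> arcs Q" for g a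
    proof -
      have "pure_tensor T T (\<gamma> (head Q a)) (\<xi> a) \<otimes>\<^bsub>tensor T T\<^esub> pure_tensor T T (\<gamma> g) (\<gamma> g)
          = w a g \<odot>\<^bsub>tensor T T\<^esub> pure_tensor T T (\<gamma> (g + head Q a)) (\<xi> (shift g a))"
        using a by (simp only: TM \<gamma>_closed \<xi>_closed \<gamma>_add \<xi>_\<gamma> P shift_closed add.commute[of "head Q a" g])
      moreover have "pure_tensor T T (\<xi> a) (\<gamma> (tail Q a)) \<otimes>\<^bsub>tensor T T\<^esub> pure_tensor T T (\<gamma> g) (\<gamma> g)
          = w a g \<odot>\<^bsub>tensor T T\<^esub> pure_tensor T T (\<xi> (shift g a)) (\<gamma> (g + tail Q a))"
        using a by (simp only: TM \<gamma>_closed \<xi>_closed \<gamma>_add \<xi>_\<gamma> P shift_closed add.commute[of "tail Q a" g])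
      ultimately show ?thesis
        using a by (simp only: TT.l_distr P(1) \<gamma>_closed \<xi>_closed shift_closed head_shift tail_shift
            module.smult_r_distr[OF complex_algebraD(2)[OF TT]] CC_simps UNIV_I)
    qed
  qed (rule that)
  obtain e where e: "algebra_map T complex_space e" and e\<gamma>: "\<And>g. e (\<gamma> g) = 1" and e\<xi>: "\<And>a. a \<in> arcs Q \<Longrightarrow> e (\<xi> a) = 0"
    by (rule semi_path_universal[OF complex_space_algebra, of "\<lambda>_. 1" "\<lambda>_. 0"]) simp_all
  let ?s = "\<lambda>a. (- w a (- tail Q a)) \<odot>\<^bsub>T\<^esub> \<xi> (shift (- head Q a - tail Q a) a)"
  obtain s where s: "algebra_map T (opposite_algebra T) s" and s\<gamma>: "\<And>g. s (\<gamma> g) = \<gamma> (- g)"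
    and s\<xi>: "\<And>a. a \<in> arcs Q \<Longrightarrow> s (\<xi> a) = ?s a"
  proof (rule semi_path_universal[OF opposite_algebra[OF T_algebra], of "\<lambda>g. \<gamma> (- g)" ?s])
    show "\<gamma> (- g) \<in> carrier (opposite_algebra T)" for g by (simp only: opposite_algebra_simps \<gamma>_closed)
    show "?s a \<in> carrier (opposite_algebra T)" if "a \<in> arcs Q" for a
      unfolding opposite_algebra_simps by (intro S(3) \<xi>_closed shift_closed that)
    show "\<gamma> (- 0) = \<one>\<^bsub>opposite_algebra T\<^esub>" by (simp only: opposite_algebra_simps \<gamma>_zero minus_zero)
    show "\<gamma> (- (g + h)) = \<gamma> (- g) \<otimes>\<^bsub>opposite_algebra T\<^esub> \<gamma> (- h)" for g h
      by (simp only: opposite_algebra_simps \<gamma>_add minus_add)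
    fix g a assume a: "a \<in> arcs Q"
    let ?b = "shift (- head Q a - tail Q a) a"
    have 1: "shift (- head Q (shift g a) - tail Q (shift g a)) (shift g a) = shift (- g) ?b"
    proof -
      have "- (g + head Q a) - (g + tail Q a) + g = - g + (- head Q a - tail Q a)" by (simp add: algebra_simps)
      then show ?thesis by (simp only: head_shift[OF a] tail_shift[OF a] shift_add[OF a, symmetric])
    qed
    have 2: "- w (shift g a) (- tail Q (shift g a)) = w a (- g) * (- w a (- tail Q a))"
      using w_add[OF a, of "- g" "- tail Q a"] by (simp add: tail_shift[OF a] w_shift[OF a] algebra_simps)
    have 3: "w a g * w a (- g) = 1" using w_add[OF a, of g "- g"] by (simp add: w_zero[OF a])
    have b: "?b \<in> arcs Q" using a by (rule shift_closed)
    have 4: "w ?b h = w a h" for h using a by (rule w_shift)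
    show "?s (shift g a) = \<gamma> (- g) \<otimes>\<^bsub>opposite_algebra T\<^esub> ?s a"
      unfolding 1 2 opposite_algebra_simps
      by (simp only: S(12,13) \<gamma>_closed \<xi>_closed b \<xi>_\<gamma>[OF b] 4 shift_closed mult.commute)
    have "w a g * (w a (- g) * (- w a (- tail Q a))) = - w a (- tail Q a)"
      using 3 by (metis mult.assoc mult_1)
    then show "w a g \<odot>\<^bsub>opposite_algebra T\<^esub> ?s (shift g a) = ?s a \<otimes>\<^bsub>opposite_algebra T\<^esub> \<gamma> (- g)"
      unfolding 1 2 opposite_algebra_simps
      by (simp only: S(12,14) \<gamma>_closed \<xi>_closed b \<gamma>_\<xi>[OF b] shift_closed)
  qed (rule that)
  let ?H = "module.extend T (hopf.fields D e s)"
  note H = complex_algebra_extend[OF T_algebra, of "hopf.fields D e s"]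
  note VH = complex_algebraD(2)[OF H] and SH = complex_algebra_simps[OF H]
  note tH = tensor_extend[of T "hopf.fields D e s" T "hopf.fields D e s"]
  have VHH: "module CC (tensor ?H ?H)" by (rule tensor_vector_space[OF VH VH])
  have Dl: "linear_map ?H (tensor ?H ?H) D"
    using algebra_mapD(1)[OF D] by (simp add: tH linear_map_def)
  have sl: "linear_map ?H ?H s" using algebra_mapD(1)[OF s] by (simp add: linear_map_def)
  have el: "linear_map ?H complex_space e" using algebra_mapD(1)[OF e] by (simp add: linear_map_def)
  have D\<xi>': "D (\<xi> a) = pure_tensor ?H ?H (\<gamma> (head Q a)) (\<xi> a) \<oplus>\<^bsub>tensor ?H ?H\<^esub> pure_tensor ?H ?H (\<xi> a) (\<gamma> (tail Q a))"
    if "a \<in> arcs Q" for a using D\<xi>[OF that] by (simp only: tH)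
  have D\<gamma>': "D (\<gamma> g) = pure_tensor ?H ?H (\<gamma> g) (\<gamma> g)" for g using D\<gamma> by (simp only: tH)
  have cH: "\<gamma> g \<in> carrier ?H" "a \<in> arcs Q \<Longrightarrow> \<xi> a \<in> carrier ?H" for g a using \<gamma>_closed \<xi>_closed by simp_all
  note pH = pure_tensor_simps[OF VH VH] pure_tensor_simps[OF VH VHH] pure_tensor_simps[OF VHH VH]
  note t1 = tensor_map_linear[OF VH VH VHH VH Dl linear_map_id] tensor_map_pure[OF VH VH VHH VH Dl linear_map_id]
  note t2 = tensor_map_linear[OF VH VH VH VHH linear_map_id Dl] tensor_map_pure[OF VH VH VH VHH linear_map_id Dl]
  note as = tensor_assoc_linear[OF VH VH VH] tensor_assoc_pure[OF VH VH VH]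
  note cb = counit_bilinear[OF H el] and ab = antipode_bilinear[OF H sl]
  note LH = tensor_lift_linear[OF VH VH VH] and LP = tensor_lift_pure[OF VH VH VH]
  interpret HHH: module CC "tensor ?H (tensor ?H ?H)" by (rule tensor_vector_space[OF VH VHH])
  interpret HHH': module CC "tensor (tensor ?H ?H) ?H" by (rule tensor_vector_space[OF VHH VH])
  have hopf: "hopf_algebra ?H"
  proof (rule hopf_algebra_from_generators[OF H])
    show "algebra_generators ?H (range \<gamma> \<union> \<xi> ` arcs Q)"
      unfolding algebra_generators_extend[OF T_algebra] by (rule semi_path_generators)
    show "algebra_map ?H (tensor ?H ?H) (comult ?H)" using D by (simp add: tH)
    show "algebra_map ?H complex_space (counit ?H)" using e by simp
    show "algebra_map ?H (opposite_algebra ?H) (antipode ?H)" using s by simp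
    fix x assume x: "x \<in> range \<gamma> \<union> \<xi> ` arcs Q"
    show "tensor_assoc ?H ?H ?H (tensor_map (tensor ?H ?H) ?H (comult ?H) (\<lambda>y. y) (comult ?H x))
        = tensor_map ?H (tensor ?H ?H) (\<lambda>y. y) (comult ?H) (comult ?H x)"
    proof (cases "x \<in> range \<gamma>")
      case True
      then show ?thesis unfolding hopf_extend_simps
        by (elim imageE) (simp del: module_extend_simps add: D\<gamma>' cH t1(2) t2(2) as(2) pH)
    next
      case False
      then obtain a where a: "a \<in> arcs Q" "x = \<xi> a" using x by auto
      show ?thesis unfolding hopf_extend_simps a(2)
        by (simp only: D\<gamma>' D\<xi>'[OF a(1)] cH cH(2)[OF a(1)] t1(2) t2(2) linear_mapD[OF t1(1)] linear_mapD[OF t2(1)]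
            as(2) linear_mapD[OF as(1)] pH HHH.a_assoc HHH'.a_closed)
    qed
    have one: "\<gamma> 0 = \<one>\<^bsub>?H\<^esub>" by (simp add: \<gamma>_zero)
    have z: "0 \<odot>\<^bsub>?H\<^esub> v = \<zero>\<^bsub>?H\<^esub>" "\<zero>\<^bsub>?H\<^esub> \<oplus>\<^bsub>?H\<^esub> v = v" "v \<oplus>\<^bsub>?H\<^esub> \<zero>\<^bsub>?H\<^esub> = v" if "v \<in> carrier ?H" for v
      using that by (simp_all add: S)
    show "tensor_lift ?H (\<lambda>a b. counit ?H a \<odot>\<^bsub>?H\<^esub> b) (comult ?H x) = x"
      using cb(1) LP[OF cb(1)] linear_mapD[OF LH[OF cb(1)]] x unfolding hopf_extend_simps
      by (elim UnE imageE) (simp_all del: module_extend_simps add: D\<gamma>' D\<xi>' cH pH e\<gamma> e\<xi> z SH)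
    show "tensor_lift ?H (\<lambda>a b. counit ?H b \<odot>\<^bsub>?H\<^esub> a) (comult ?H x) = x"
      using cb(2) LP[OF cb(2)] linear_mapD[OF LH[OF cb(2)]] x unfolding hopf_extend_simps
      by (elim UnE imageE) (simp_all del: module_extend_simps add: D\<gamma>' D\<xi>' cH pH e\<gamma> e\<xi> z SH)
    have neg: "w a (- tail Q a) * w a (tail Q a) = 1" if "a \<in> arcs Q" for a
      using w_add[OF that, of "- tail Q a" "tail Q a"] by (simp add: w_zero that)
    have cancel: "(- c) \<odot>\<^bsub>T\<^esub> v \<oplus>\<^bsub>T\<^esub> c \<odot>\<^bsub>T\<^esub> v = \<zero>\<^bsub>T\<^esub>" "c \<odot>\<^bsub>T\<^esub> v \<oplus>\<^bsub>T\<^esub> (- c) \<odot>\<^bsub>T\<^esub> v = \<zero>\<^bsub>T\<^esub>" if "v \<in> carrier T" for c v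
      using that V.smult_l_distr[of "- c" c v] V.smult_l_distr[of c "- c" v] by (simp_all add: S)
    show "tensor_lift ?H (\<lambda>a b. antipode ?H a \<otimes>\<^bsub>?H\<^esub> b) (comult ?H x) = counit ?H x \<odot>\<^bsub>?H\<^esub> \<one>\<^bsub>?H\<^esub>"
    proof (cases "x \<in> range \<gamma>")
      case True
      then obtain g where g: "x = \<gamma> g" by auto
      show ?thesis using LP[OF ab(1), of "\<gamma> g" "\<gamma> g"] unfolding hopf_extend_simps g
        by (simp add: D\<gamma> tH[symmetric] s\<gamma> base e\<gamma> \<gamma>_zero cH)
    next
      case False
      then obtain a where a: "a \<in> arcs Q" "x = \<xi> a" using x by auto
      have "tensor_lift ?H (\<lambda>a b. s a \<otimes>\<^bsub>?H\<^esub> b) (D (\<xi> a)) = s (\<gamma> (head Q a)) \<otimes>\<^bsub>?H\<^esub> \<xi> a \<oplus>\<^bsub>?H\<^esub> s (\<xi> a) \<otimes>\<^bsub>?H\<^esub> \<gamma> (tail Q a)"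
        unfolding D\<xi>'[OF a(1)]
        using a by (simp del: module_extend_simps add: linear_mapD[OF LH[OF ab(1)]] LP[OF ab(1)] cH pH)
      also have "\<dots> = \<zero>\<^bsub>T\<^esub>"
        using a neg[OF a(1)] cancel(2)[of "\<xi> (shift (- head Q a) a)" 1]
        by (simp add: s\<gamma> s\<xi> base shift_add[symmetric] w_shift add.commute)
      finally show ?thesis unfolding hopf_extend_simps a(2) using a by (simp add: e\<xi> S)
    qed
    show "tensor_lift ?H (\<lambda>a b. a \<otimes>\<^bsub>?H\<^esub> antipode ?H b) (comult ?H x) = counit ?H x \<odot>\<^bsub>?H\<^esub> \<one>\<^bsub>?H\<^esub>"
    proof (cases "x \<in> range \<gamma>")
      case True
      then obtain g where g: "x = \<gamma> g" by auto
      show ?thesis using LP[OF ab(2), of "\<gamma> g" "\<gamma> g"] unfolding hopf_extend_simps g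
        by (simp add: D\<gamma> tH[symmetric] s\<gamma> base e\<gamma> \<gamma>_zero cH)
    next
      case False
      then obtain a where a: "a \<in> arcs Q" "x = \<xi> a" using x by auto
      have "tensor_lift ?H (\<lambda>a b. a \<otimes>\<^bsub>?H\<^esub> s b) (D (\<xi> a)) = \<gamma> (head Q a) \<otimes>\<^bsub>?H\<^esub> s (\<xi> a) \<oplus>\<^bsub>?H\<^esub> \<xi> a \<otimes>\<^bsub>?H\<^esub> s (\<gamma> (tail Q a))"
        unfolding D\<xi>'[OF a(1)]
        using a by (simp del: module_extend_simps add: linear_mapD[OF LH[OF ab(2)]] LP[OF ab(2)] cH pH)
      also have "\<dots> = \<zero>\<^bsub>T\<^esub>"
        using a cancel(1)[of "\<xi> (shift (- tail Q a) a)" "w a (- tail Q a)"]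
        by (simp add: s\<gamma> s\<xi> base shift_add[symmetric] add.commute)
      finally show ?thesis unfolding hopf_extend_simps a(2) using a by (simp add: e\<xi> S)
    qed
  qed
  let ?G = "\<lambda>n. {pure_tensor T T y z | y z i j. i + j = n \<and> y \<in> degree_part i \<and> z \<in> degree_part j}"
  have dc: "y \<in> carrier T" if "y \<in> degree_part i" for y i using subspaceD(1)[OF V degree_part_subspace] that by auto
  have G: "?G n \<subseteq> carrier (tensor T T)" for n by (auto intro!: P(1) dc)
  have graded: "graded_hopf_algebra ?H degree_part"
    unfolding graded_hopf_algebra_def
  proof (intro conjI allI ballI impI hopf)
    fix n x assume x: "x \<in> degree_part n"
    have "D x \<in> linear_span (tensor T T) (?G n)"
    proof (rule graded_algebra_map[OF TT D, of "\<lambda>n. linear_span (tensor T T) (?G n)"])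
      show "submodule (linear_span (tensor T T) (?G n)) CC (tensor T T)" for n
        by (rule linear_span_subspace[OF complex_algebraD(2)[OF TT] G])
      show "D (\<gamma> g) \<in> linear_span (tensor T T) (?G 0)" for g
        unfolding D\<gamma> by (rule subsetD[OF linear_span_superset]) (use degree_part_\<gamma> in auto)
      show "D (\<xi> a) \<in> linear_span (tensor T T) (?G 1)" if a: "a \<in> arcs Q" for a
      proof -
        note sub = linear_span_subspace[OF complex_algebraD(2)[OF TT] G, of 1]
        have "pure_tensor T T (\<gamma> (head Q a)) (\<xi> a) \<in> ?G 1" "pure_tensor T T (\<xi> a) (\<gamma> (tail Q a)) \<in> ?G 1"
          using degree_part_\<gamma> degree_part_\<xi>[OF a] by (force, force)
        then show ?thesis unfolding D\<xi>[OF a]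
          by (intro subspaceD(3)[OF complex_algebraD(2)[OF TT] sub] subsetD[OF linear_span_superset])
      qed
      show "u \<otimes>\<^bsub>tensor T T\<^esub> v \<in> linear_span (tensor T T) (?G (i + j))"
        if "u \<in> linear_span (tensor T T) (?G i)" "v \<in> linear_span (tensor T T) (?G j)" for u v i j
      proof (rule bilinear_map_span[OF complex_algebraD(2)[OF TT] complex_algebraD(2)[OF TT] complex_algebraD(2)[OF TT]
            complex_algebra_mult_bilinear[OF TT] linear_span_subspace[OF complex_algebraD(2)[OF TT] G] G G _ that])
        fix u v assume "u \<in> ?G i" "v \<in> ?G j"
        then obtain y z i1 i2 y' z' j1 j2 where uv: "u = pure_tensor T T y z" "v = pure_tensor T T y' z'"
          "i1 + i2 = i" "j1 + j2 = j" and d: "y \<in> degree_part i1" "z \<in> degree_part i2" "y' \<in> degree_part j1" "z' \<in> degree_part j2"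
          by blast
        have "u \<otimes>\<^bsub>tensor T T\<^esub> v = pure_tensor T T (y \<otimes>\<^bsub>T\<^esub> y') (z \<otimes>\<^bsub>T\<^esub> z')"
          unfolding uv by (rule pure_tensor_mult[OF T_algebra T_algebra]) (use d dc in auto)
        moreover have "(i1 + j1) + (i2 + j2) = i + j" using uv by simp
        ultimately have "u \<otimes>\<^bsub>tensor T T\<^esub> v \<in> ?G (i + j)"
          using degree_part_mult[OF d(1,3)] degree_part_mult[OF d(2,4)] by blast
        then show "u \<otimes>\<^bsub>tensor T T\<^esub> v \<in> linear_span (tensor T T) (?G (i + j))"
          by (rule subsetD[OF linear_span_superset])
      qed
    qed (rule x)
    then show "comult ?H x \<in> linear_span (tensor ?H ?H)
        {pure_tensor ?H ?H y z | y z i j. i + j = n \<and> y \<in> degree_part i \<and> z \<in> degree_part j}"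
      by (simp only: hopf_extend_simps tH)
    have "e x \<in> (if n = 0 then UNIV else {0})"
    proof (rule graded_algebra_map[OF complex_space_algebra e, of "\<lambda>n. if n = 0 then UNIV else {0}"])
      show "submodule (if n = 0 then UNIV else {0}) CC complex_space" for n :: nat
        by (rule subspaceI[OF complex_algebraD(2)[OF complex_space_algebra]]) auto
    qed (use x e\<xi> in \<open>auto split: if_splits\<close>)
    then show "counit ?H x = 0" if "n > 0" using that by simp
    have "s x \<in> degree_part n"
    proof (rule graded_algebra_map[OF opposite_algebra[OF T_algebra] s, of degree_part])
      show "submodule (degree_part n) CC (opposite_algebra T)" for n
        by (rule subspaceI[OF complex_algebraD(2)[OF opposite_algebra[OF T_algebra]]])
           (use subspaceD[OF V degree_part_subspace] in simp_all)
      show "u \<otimes>\<^bsub>opposite_algebra T\<^esub> v \<in> degree_part (i + j)" if "u \<in> degree_part i" "v \<in> degree_part j" for u v i j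
        using degree_part_mult[OF that(2,1)] by (simp add: add.commute)
      show "s (\<gamma> g) \<in> degree_part 0" for g unfolding s\<gamma> by (rule degree_part_\<gamma>)
      show "s (\<xi> a) \<in> degree_part 1" if "a \<in> arcs Q" for a
        unfolding s\<xi>[OF that] by (rule subspaceD(4)[OF V degree_part_subspace degree_part_\<xi>[OF shift_closed[OF that]]])
    qed (rule x)
    then show "antipode ?H x \<in> degree_part n" by simp
  qed
  let ?i0 = "\<lambda>x. tensor_word kG M l r x []" and ?i1 = "\<lambda>m. tensor_word kG M l r \<one>\<^bsub>kG\<^esub> [m]"
  note i0 = algebra_mapD(1)[OF base_map] and i1 = letter_map
  note VTT = complex_algebraD(2)[OF TT] and Dl' = algebra_mapD(1)[OF D]
  have c0: "D (?i0 x) = tensor_map T T ?i0 ?i0 (group_comult additive_group x)" if "x \<in> carrier kG" for x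
    by (rule monoid_algebra_linear_eq[OF VTT linear_map_comp[OF i0 Dl']
          linear_map_comp[OF group_comult_linear tensor_map_linear[OF kG_space kG_space V V i0 i0]] _ that])
       (simp only: group_comult_basis tensor_map_pure[OF kG_space kG_space V V i0 i0 basis_closed(1) basis_closed(1)]
          \<gamma>_def[symmetric] D\<gamma>)
  have c1: "D (?i1 m) = tensor_map T T ?i0 ?i1 (left_coaction additive_group Q m)
      \<oplus>\<^bsub>tensor T T\<^esub> tensor_map T T ?i1 ?i0 (right_coaction additive_group Q m)" if "m \<in> carrier M" for m
    by (rule free_space_linear_eq[OF VTT linear_map_comp[OF i1 Dl']
          linear_map_add[OF VTT linear_map_comp[OF left_coaction_linear tensor_map_linear[OF kG_space M_space V V i0 i1]]
            linear_map_comp[OF right_coaction_linear tensor_map_linear[OF M_space kG_space V V i1 i0]]] _ that])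
       (simp only: left_coaction_basis right_coaction_basis tensor_map_pure[OF kG_space M_space V V i0 i1 basis_closed]
          tensor_map_pure[OF M_space kG_space V V i1 i0 basis_closed(2,1)] \<gamma>_def[symmetric] \<xi>_def[symmetric] D\<xi>)
  have "semi_path_hopf_algebra additive_group Q l r ?H"
    unfolding semi_path_hopf_algebra_def Let_def hopf_extend_simps tH
    by (intro conjI ballI truncate_extend graded c0 c1)
  then show thesis
    by (rule that[OF _ hopf D e s D\<gamma> D\<xi> e\<gamma> e\<xi> s\<gamma> s\<xi>])
qed

end

section \<open>The lattice of integer vectors\<close>

definition unit_vector :: "'n \<Rightarrow> 'n \<Rightarrow> int" where
  "unit_vector i = (\<lambda>j. if j = i then 1 else 0)"

text \<open>Induction on the sum of the absolute values of the entries.\<close>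

lemma lattice_induct [case_names zero plus minus]:
  fixes g :: "'n::finite \<Rightarrow> int"
  assumes zero: "P 0" and plus: "\<And>g i. P g \<Longrightarrow> P (g + unit_vector i)" and minus: "\<And>g i. P g \<Longrightarrow> P (g - unit_vector i)"
  shows "P g"
proof (induction "\<Sum>i\<in>UNIV. nat \<bar>g i\<bar>" arbitrary: g rule: less_induct)
  case less
  have less': "P h" if "\<And>j. nat \<bar>h j\<bar> \<le> nat \<bar>g j\<bar>" "nat \<bar>h i\<bar> < nat \<bar>g i\<bar>" for h i
    by (rule less, rule sum_strict_mono_ex1) (use that in auto)
  show ?case
  proof (cases "g = 0")
    case True
    then show ?thesis using zero by simp
  next
    case False
    then obtain i where i: "g i \<noteq> 0" by (auto simp: fun_eq_iff)
    show ?thesis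
    proof (cases "g i > 0")
      case True
      have "P (g - unit_vector i)" by (rule less'[of _ i]) (use True in \<open>auto simp: unit_vector_def\<close>)
      then show ?thesis using plus[of "g - unit_vector i" i] by simp
    next
      case False
      have "P (g + unit_vector i)" by (rule less'[of _ i]) (use False i in \<open>auto simp: unit_vector_def\<close>)
      then show ?thesis using minus[of "g + unit_vector i" i] by simp
    qed
  qed
qed

text \<open>
  The product of the powers \<open>\<kappa> i [^] g i\<close> along a list of all indices. It is
  additive in \<open>g\<close> because the \<open>\<kappa> i\<close> commute.
\<close>

lemma lattice_hom:
  fixes U (structure) and \<kappa> :: "'n::finite \<Rightarrow> 'a"
  assumes U: "monoid U" and \<kappa>: "\<And>i. \<kappa> i \<in> Units U" and comm: "\<And>i j. \<kappa> i \<otimes> \<kappa> j = \<kappa> j \<otimes> \<kappa> i"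
  obtains P where "\<And>g. P g \<in> Units U" "P 0 = \<one>" "\<And>g i. P (g + unit_vector i) = P g \<otimes> \<kappa> i"
proof -
  interpret U: monoid U by (rule U)
  interpret G: group "units_of U" by (rule U.units_group)
  define p where "p i z = \<kappa> i [^]\<^bsub>units_of U\<^esub> z" for i and z :: int
  have \<kappa>': "\<kappa> i \<in> carrier (units_of U)" for i using \<kappa> by (simp add: units_of_carrier)
  have p: "p i z \<in> Units U" for i z
    using G.int_pow_closed[OF \<kappa>', of i z] by (simp add: p_def units_of_carrier)
  have p1: "p i (z + 1) = p i z \<otimes> \<kappa> i" for i z
    using G.int_pow_mult[OF \<kappa>', of i z 1] \<kappa>' by (simp add: p_def units_of_mult)
  have c: "\<kappa> i \<in> carrier U" "p i z \<in> carrier U" for i z using \<kappa> p by auto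
  have pc: "\<kappa> i \<otimes> p j z = p j z \<otimes> \<kappa> i" for i j z
  proof (induction z rule: int_induct[where k = 0])
    case base
    show ?case using c by (simp add: p_def units_of_one)
  next
    case (step1 z)
    then show ?case using c by (simp add: p1 U.m_assoc[symmetric]) (simp add: U.m_assoc comm)
  next
    case (step2 z)
    have "p j z = p j (z - 1) \<otimes> \<kappa> j" using p1[of j "z - 1"] by simp
    then have "(\<kappa> i \<otimes> p j (z - 1)) \<otimes> \<kappa> j = (p j (z - 1) \<otimes> \<kappa> i) \<otimes> \<kappa> j"
      using step2 c by (simp add: U.m_assoc comm[of i j])
    then show ?case
      using G.right_cancel[of "\<kappa> j" "\<kappa> i \<otimes> p j (z - 1)" "p j (z - 1) \<otimes> \<kappa> i"] \<kappa> p
      by (simp add: units_of_mult units_of_carrier)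
  qed
  define P where "P xs g = foldr (\<lambda>i y. p i (g i) \<otimes> y) xs \<one>" for xs and g :: "'n \<Rightarrow> int"
  have P: "P xs g \<in> Units U" for xs g by (induction xs) (simp_all add: P_def p)
  have Pc: "\<kappa> i \<otimes> P xs g = P xs g \<otimes> \<kappa> i" for i xs g
  proof (induction xs)
    case Nil
    show ?case using c by (simp add: P_def)
  next
    case (Cons j xs)
    have "P xs g \<in> carrier U" using P by auto
    moreover have "P (j # xs) g = p j (g j) \<otimes> P xs g" by (simp add: P_def)
    ultimately show ?case using Cons pc[of i j "g j"] c by (metis U.m_assoc)
  qed
  have P1: "P xs (g + unit_vector i) = (if i \<in> set xs then P xs g \<otimes> \<kappa> i else P xs g)" if "distinct xs" for xs g i
    using that
  proof (induction xs)
    case Nil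
    show ?case by (simp add: P_def)
  next
    case (Cons j xs)
    have P': "P xs g \<in> carrier U" for g using P by auto
    have e: "P (j # xs) g = p j (g j) \<otimes> P xs g" for g by (simp add: P_def)
    show ?case
    proof (cases "i = j")
      case True
      have "p j (g j + 1) \<otimes> P xs g = p j (g j) \<otimes> P xs g \<otimes> \<kappa> j"
        using c P' Pc by (simp add: p1 U.m_assoc)
      then show ?thesis using Cons True by (simp add: e unit_vector_def)
    next
      case False
      then show ?thesis using Cons c P' by (simp add: e unit_vector_def U.m_assoc)
    qed
  qed
  obtain xs where xs: "set xs = (UNIV :: 'n set)" "distinct xs" using finite_distinct_list[of "UNIV :: 'n set"] by auto
  have "P ys 0 = \<one>" for ys by (induction ys) (simp_all add: P_def p_def units_of_one)
  then show thesis using that[of "P xs"] P P1[OF xs(2)] xs(1) by simp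
qed

section \<open>The Hopf quiver on the lattice\<close>

text \<open>
  Number 0 is the arrow for \<open>E\<^sub>i\<close> and number 1 the one for
  \<open>F\<^sub>i\<close>. The step is twice the unit vector since these elements are skew
  primitive between the inverse of \<open>K\<^sub>i\<close> and \<open>K\<^sub>i\<close>.
\<close>

definition lattice_quiver :: "('n \<Rightarrow> int, ('n \<Rightarrow> int) \<times> ('n \<Rightarrow> int) \<times> nat) pre_digraph" where
  "lattice_quiver = \<lparr>verts = UNIV, arcs = {(x, x + unit_vector i + unit_vector i, k) | x i k. k < 2},
     tail = fst, head = (\<lambda>a. fst (snd a))\<rparr>"

lemma lattice_quiver_simps [simp]:
  "verts lattice_quiver = UNIV" "tail lattice_quiver = fst" "head lattice_quiver = (\<lambda>a. fst (snd a))"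
  "(x, y, k) \<in> arcs lattice_quiver \<longleftrightarrow> k < 2 \<and> (\<exists>i. y = x + unit_vector i + unit_vector i)"
  by (auto simp: lattice_quiver_def)

text \<open>
  The conjugacy classes of an abelian group are singletons. The class of twice a unit vector has
  ramification 2, all others 0.
\<close>

lemma hopf_quiver_lattice:
  "hopf_quiver additive_group (\<lambda>C. card_of {k::nat. k < 2 \<and> (\<exists>i. unit_vector i + unit_vector i \<in> C)})
     (lattice_quiver :: ('n \<Rightarrow> int, _) pre_digraph)"
  unfolding hopf_quiver_def
proof (intro conjI ballI impI)
  show "wf_digraph (lattice_quiver :: ('n \<Rightarrow> int, _) pre_digraph)" by unfold_locales simp_all
  fix x y :: "'n \<Rightarrow> int" and C :: "('n \<Rightarrow> int) set"
  assume "C \<in> conjugacy_classes additive_group" and y: "inv\<^bsub>additive_group\<^esub> x \<otimes>\<^bsub>additive_group\<^esub> y \<in> C"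
  then have C: "C = {- x + y}" by (auto simp: conjugacy_classes_def)
  have "unit_vector i + unit_vector i \<in> C \<longleftrightarrow> y = x + unit_vector i + unit_vector i" for i :: 'n
    unfolding C by (auto simp: algebra_simps)
  then have "bij_betw (\<lambda>a. snd (snd a)) {a \<in> arcs lattice_quiver. tail lattice_quiver a = x \<and> head lattice_quiver a = y}
      {k::nat. k < 2 \<and> (\<exists>i. unit_vector i + unit_vector i \<in> C)}"
    by (intro bij_betw_byWitness[where f' = "\<lambda>k. (x, y, k)"]) auto
  then show "(card_of {a \<in> arcs lattice_quiver. tail lattice_quiver a = x \<and> head lattice_quiver a = y},
      card_of {k::nat. k < 2 \<and> (\<exists>i. unit_vector i + unit_vector i \<in> C)}) \<in> ordIso"
    by (rule card_of_ordIsoI)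
qed (simp_all add: additive_group card_of_Card_order)

definition translate :: "('n \<Rightarrow> int) \<Rightarrow> ('n \<Rightarrow> int) \<times> ('n \<Rightarrow> int) \<times> nat \<Rightarrow> ('n \<Rightarrow> int) \<times> ('n \<Rightarrow> int) \<times> nat" where
  "translate g = (\<lambda>(x, y, k). (g + x, g + y, k))"

lemma double_unit_vector_inj: "unit_vector i + unit_vector i = unit_vector j + unit_vector j \<longleftrightarrow> i = j"
proof
  assume "unit_vector i + unit_vector i = unit_vector j + unit_vector j"
  from fun_cong[OF this, of i] show "i = j" by (simp add: unit_vector_def split: if_splits)
qed simp

definition direction :: "('n \<Rightarrow> int) \<times> ('n \<Rightarrow> int) \<times> nat \<Rightarrow> 'n" where
  "direction a = (THE i. fst (snd a) - fst a = unit_vector i + unit_vector i)"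

lemma direction [simp]: "direction (x, x + unit_vector i + unit_vector i, k) = i"
proof -
  have "x + unit_vector i + unit_vector i - x = unit_vector i + unit_vector i" by (simp only: add.assoc add_diff_cancel_left')
  then show ?thesis unfolding direction_def by (intro the_equality) (simp_all only: fst_conv snd_conv double_unit_vector_inj)
qed

lemma direction_translate [simp]: "direction (translate g a) = direction a"
  by (simp add: direction_def translate_def split: prod.split)

section \<open>The projection onto the quantum enveloping algebra\<close>

locale finite_quantum_data = quantum_data q A d
  for q and A :: "'n::finite \<Rightarrow> 'n \<Rightarrow> int" and d
begin

text \<open>
  With \<open>K^g\<close> the product of the \<open>K\<^sub>i^(g i)\<close>, this is the exponent
  in \<open>K^g E\<^sub>j = q^(pairing j g) E\<^sub>j K^g\<close>.
\<close>

definition pairing :: "'n \<Rightarrow> ('n \<Rightarrow> int) \<Rightarrow> int" where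
  "pairing j g = (\<Sum>i\<in>UNIV. g i * (int (d i) * A i j))"

lemma pairing_simps:
  "pairing j 0 = 0" "pairing j (g + h) = pairing j g + pairing j h" "pairing j (- g) = - pairing j g"
  "pairing j (g - h) = pairing j g - pairing j h" "pairing j (unit_vector i) = int (d i) * A i j"
proof -
  show add: "pairing j (g + h) = pairing j g + pairing j h" for g h
    by (simp add: pairing_def sum.distrib distrib_right)
  show zero: "pairing j 0 = 0" by (simp add: pairing_def)
  show neg: "pairing j (- g) = - pairing j g" for g using add[of g "- g"] zero by simp
  show "pairing j (g - h) = pairing j g - pairing j h" using add[of g "- h"] neg by simp
  have "pairing j (unit_vector i) = (\<Sum>k\<in>UNIV. if k = i then int (d k) * A k j else 0)"
    unfolding pairing_def by (rule sum.cong) (simp_all add: unit_vector_def)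
  then show "pairing j (unit_vector i) = int (d i) * A i j" by simp
qed

text \<open>
  The arrow from \<open>x\<close> to \<open>x + 2 e\<^sub>j\<close> is going to represent
  \<open>K^(x + e\<^sub>j) E\<^sub>j\<close> or \<open>K^(x + e\<^sub>j) F\<^sub>j\<close>. The
  weight is the scalar that arises when \<open>K^g\<close> is moved from the right to the left of
  this element.
\<close>

definition weight :: "('n \<Rightarrow> int) \<times> ('n \<Rightarrow> int) \<times> nat \<Rightarrow> ('n \<Rightarrow> int) \<Rightarrow> complex" where
  "weight a g = q powi (if snd (snd a) = 0 then - pairing (direction a) g else pairing (direction a) g)"

sublocale Q: character_quiver lattice_quiver translate weight
proof
  show "translate g a \<in> arcs lattice_quiver" if "a \<in> arcs lattice_quiver" for g :: "'n \<Rightarrow> int" and a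
    using that by (cases a) (auto simp: translate_def algebra_simps)
  have k: "snd (snd (translate g a)) = snd (snd a)" for g :: "'n \<Rightarrow> int" and a by (simp add: translate_def split: prod.split)
  show "weight (translate g a) h = weight a h" for g h a by (simp add: weight_def k)
  show "weight a (g + h) = weight a g * weight a h" for a g h
    using q_nonzero by (simp add: weight_def pairing_simps power_int_add[symmetric] add.commute)
qed (auto simp: translate_def weight_def pairing_simps add.assoc split: prod.split)

text \<open>
  The arrows that represent \<open>E\<^sub>i\<close> and \<open>F\<^sub>i\<close> themselves.
\<close>

definition base_arc :: "'n \<Rightarrow> nat \<Rightarrow> ('n \<Rightarrow> int) \<times> ('n \<Rightarrow> int) \<times> nat" where
  "base_arc i k = (- unit_vector i, unit_vector i, k)"

lemma base_arc: "base_arc i k = (- unit_vector i, - unit_vector i + unit_vector i + unit_vector i, k)"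
  by (simp add: base_arc_def)

lemma base_arc_in: "k < 2 \<Longrightarrow> base_arc i k \<in> arcs lattice_quiver"
  unfolding base_arc by auto

lemma direction_base_arc [simp]: "direction (base_arc i k) = i"
  unfolding base_arc by (rule direction)

text \<open>
  Every arrow is a translate of a base arc, and the lattice is generated by the unit vectors.
\<close>

lemma lattice_generators:
  "algebra_generators Q.T ({Q.\<gamma> (unit_vector i) | i. True} \<union> {Q.\<gamma> (- unit_vector i) | i. True}
     \<union> {Q.\<xi> (base_arc i k) | i k. k < 2})"
  unfolding algebra_generators_def
proof (intro conjI allI impI)
  show "{Q.\<gamma> (unit_vector i) | i. True} \<union> {Q.\<gamma> (- unit_vector i) | i. True} \<union> {Q.\<xi> (base_arc i k) | i k. k < 2} \<subseteq> carrier Q.T"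
    using Q.\<gamma>_closed Q.\<xi>_closed[OF base_arc_in] by blast
  fix B assume B: "submodule B CC Q.T" and one: "\<one>\<^bsub>Q.T\<^esub> \<in> B" and m: "\<forall>x\<in>B. \<forall>y\<in>B. x \<otimes>\<^bsub>Q.T\<^esub> y \<in> B"
    and g: "{Q.\<gamma> (unit_vector i) | i. True} \<union> {Q.\<gamma> (- unit_vector i) | i. True} \<union> {Q.\<xi> (base_arc i k) | i k. k < 2} \<subseteq> B"
  have g1: "Q.\<gamma> (unit_vector i) \<in> B" "Q.\<gamma> (- unit_vector i) \<in> B" "k < 2 \<Longrightarrow> Q.\<xi> (base_arc i k) \<in> B" for i k
    using g by blast+
  have 1: "Q.\<gamma> x \<in> B" for x
  proof (induction x rule: lattice_induct)
    case zero
    show ?case using one by (simp only: Q.\<gamma>_zero)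
  next
    case (plus x i)
    then show ?case using m g1(1)[of i] by (metis Q.\<gamma>_add)
  next
    case (minus x i)
    then show ?case using m g1(2)[of i] by (metis Q.\<gamma>_add diff_conv_add_uminus)
  qed
  have 2: "Q.\<xi> a \<in> B" if a: "a \<in> arcs lattice_quiver" for a
  proof -
    obtain x i k where x: "a = (x, x + unit_vector i + unit_vector i, k)" "k < 2" using a by (cases a) auto
    then have "a = translate (x + unit_vector i) (base_arc i k)" by (simp add: translate_def base_arc_def)
    then have "Q.\<xi> a = Q.\<gamma> (x + unit_vector i) \<otimes>\<^bsub>Q.T\<^esub> Q.\<xi> (base_arc i k)"
      using Q.\<gamma>_\<xi>[OF base_arc_in[OF x(2)]] by simp
    then show ?thesis using m 1 g1(3)[OF x(2)] by metis
  qed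
  show "carrier Q.T \<subseteq> B"
    using Q.semi_path_generators B one m 1 2 unfolding algebra_generators_def by auto
qed

text \<open>
  The commuting units \<open>K\<^sub>i\<close> extend to a homomorphism on the lattice by
  \<open>lattice_hom\<close>. The commutation rules with \<open>E\<^sub>j\<close> and
  \<open>F\<^sub>j\<close> follow by induction along unit vectors.
\<close>

lemma Uq_lattice:
  obtains P where "\<And>g. P g \<in> carrier U" "P 0 = \<one>\<^bsub>U\<^esub>" "\<And>g h. P (g + h) = P g \<otimes>\<^bsub>U\<^esub> P h"
    "\<And>i. P (unit_vector i) = u (K i)" "\<And>i. P (- unit_vector i) = u (Kinv i)"
    "\<And>g j. P g \<otimes>\<^bsub>U\<^esub> u (E j) = (q powi pairing j g) \<odot>\<^bsub>U\<^esub> (u (E j) \<otimes>\<^bsub>U\<^esub> P g)"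
    "\<And>g j. P g \<otimes>\<^bsub>U\<^esub> u (F j) = (q powi (- pairing j g)) \<odot>\<^bsub>U\<^esub> (u (F j) \<otimes>\<^bsub>U\<^esub> P g)"
proof -
  note S = complex_algebra_simps[OF Uq_algebra_algebra]
  interpret U: ring U using Uq_algebra_algebra by (rule complex_algebraD)
  note uc = Uq_gen_closed
  have inv: "u (K i) \<otimes>\<^bsub>U\<^esub> u (Kinv i) = \<one>\<^bsub>U\<^esub>" "u (Kinv i) \<otimes>\<^bsub>U\<^esub> u (K i) = \<one>\<^bsub>U\<^esub>"
    and comm: "u (K i) \<otimes>\<^bsub>U\<^esub> u (K j) = u (K j) \<otimes>\<^bsub>U\<^esub> u (K i)"
    and KE: "u (K i) \<otimes>\<^bsub>U\<^esub> u (E j) = (q powi (int (d i) * A i j)) \<odot>\<^bsub>U\<^esub> (u (E j) \<otimes>\<^bsub>U\<^esub> u (K i))"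
    and KF: "u (K i) \<otimes>\<^bsub>U\<^esub> u (F j) = (q powi (- (int (d i) * A i j))) \<odot>\<^bsub>U\<^esub> (u (F j) \<otimes>\<^bsub>U\<^esub> u (K i))" for i j
    by (fact Uq_relations_holdD[OF Uq_gen_relations])+
  have unit: "u (K i) \<in> Units U" for i
    unfolding Units_def using inv uc by blast
  obtain P where P: "\<And>g. P g \<in> Units U" "P 0 = \<one>\<^bsub>U\<^esub>" "\<And>g i. P (g + unit_vector i) = P g \<otimes>\<^bsub>U\<^esub> u (K i)"
    using lattice_hom[of U "\<lambda>i. u (K i)", OF U.monoid_axioms unit comm] by metis
  have c: "P g \<in> carrier U" for g using P(1) by auto
  have Pminus: "P (g - unit_vector i) = P g \<otimes>\<^bsub>U\<^esub> u (Kinv i)" for g i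
  proof -
    have "P g = P (g - unit_vector i) \<otimes>\<^bsub>U\<^esub> u (K i)" using P(3)[of "g - unit_vector i" i] by simp
    then show ?thesis using c uc inv by (simp add: U.m_assoc)
  qed
  have add: "P (g + h) = P g \<otimes>\<^bsub>U\<^esub> P h" for g h
  proof (induction h rule: lattice_induct)
    case zero
    show ?case using c by (simp only: add_0_right P(2) U.r_one)
  next
    case (plus h i)
    then show ?case by (simp only: add.assoc[symmetric] P(3) U.m_assoc c uc)
  next
    case (minus h i)
    then show ?case by (simp only: add_diff_eq Pminus U.m_assoc c uc)
  qed
  have skew: "P g \<otimes>\<^bsub>U\<^esub> x = (q powi (s * pairing j g)) \<odot>\<^bsub>U\<^esub> (x \<otimes>\<^bsub>U\<^esub> P g)"
    if x: "x \<in> carrier U" and Kx: "\<And>i. u (K i) \<otimes>\<^bsub>U\<^esub> x = (q powi (s * (int (d i) * A i j))) \<odot>\<^bsub>U\<^esub> (x \<otimes>\<^bsub>U\<^esub> u (K i))"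
    for x j s g
  proof -
    have step: "a \<otimes>\<^bsub>U\<^esub> b \<otimes>\<^bsub>U\<^esub> x = (y * z) \<odot>\<^bsub>U\<^esub> (x \<otimes>\<^bsub>U\<^esub> (a \<otimes>\<^bsub>U\<^esub> b))"
      if "a \<otimes>\<^bsub>U\<^esub> x = y \<odot>\<^bsub>U\<^esub> (x \<otimes>\<^bsub>U\<^esub> a)" "b \<otimes>\<^bsub>U\<^esub> x = z \<odot>\<^bsub>U\<^esub> (x \<otimes>\<^bsub>U\<^esub> b)" "a \<in> carrier U" "b \<in> carrier U" for a b y z
    proof -
      have "a \<otimes>\<^bsub>U\<^esub> b \<otimes>\<^bsub>U\<^esub> x = z \<odot>\<^bsub>U\<^esub> ((a \<otimes>\<^bsub>U\<^esub> x) \<otimes>\<^bsub>U\<^esub> b)"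
        using that(3,4) x by (simp only: U.m_assoc that(2) S)
      also have "\<dots> = (y * z) \<odot>\<^bsub>U\<^esub> (x \<otimes>\<^bsub>U\<^esub> (a \<otimes>\<^bsub>U\<^esub> b))"
        unfolding that(1) using that(3,4) x by (simp only: U.m_assoc S mult.commute)
      finally show ?thesis .
    qed
    \<comment> \<open>Conjugate the relation for \<open>K\<^sub>i\<close> by its inverse.\<close>
    have Kx': "u (Kinv i) \<otimes>\<^bsub>U\<^esub> x = (q powi (- (s * (int (d i) * A i j)))) \<odot>\<^bsub>U\<^esub> (x \<otimes>\<^bsub>U\<^esub> u (Kinv i))" for i
    proof -
      let ?c = "q powi (s * (int (d i) * A i j))"
      have "x \<otimes>\<^bsub>U\<^esub> u (Kinv i) = u (Kinv i) \<otimes>\<^bsub>U\<^esub> (u (K i) \<otimes>\<^bsub>U\<^esub> x) \<otimes>\<^bsub>U\<^esub> u (Kinv i)"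
        using x uc inv by (simp add: U.m_assoc[symmetric])
      also have "\<dots> = ?c \<odot>\<^bsub>U\<^esub> (u (Kinv i) \<otimes>\<^bsub>U\<^esub> x)"
        unfolding Kx using x uc inv by (simp add: S U.m_assoc)
      finally show ?thesis using x uc q_nonzero by (simp add: S power_int_minus)
    qed
    show ?thesis
    proof (induction g rule: lattice_induct)
      case zero
      show ?case using x by (simp only: P(2) pairing_simps S mult_zero_right power_int_0_right)
    next
      case (plus g i)
      show ?case
        unfolding P(3) step[OF plus Kx c uc] pairing_simps distrib_left using q_nonzero
        by (simp only: power_int_add simp_thms)
    next
      case (minus g i)
      show ?case
        unfolding Pminus step[OF minus Kx' c uc] pairing_simps right_diff_distrib using q_nonzero
        by (simp only: diff_conv_add_uminus power_int_add simp_thms)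
    qed
  qed
  show thesis
  proof (rule that[OF c P(2) add])
    show "P (unit_vector i) = u (K i)" for i using P(3)[of 0 i] uc by (simp add: P(2))
    show "P (- unit_vector i) = u (Kinv i)" for i using Pminus[of 0 i] uc by (simp add: P(2))
    show "P g \<otimes>\<^bsub>U\<^esub> u (E j) = (q powi pairing j g) \<odot>\<^bsub>U\<^esub> (u (E j) \<otimes>\<^bsub>U\<^esub> P g)" for g j
      using skew[of "u (E j)" 1 j g, OF uc] KE by simp
    show "P g \<otimes>\<^bsub>U\<^esub> u (F j) = (q powi (- pairing j g)) \<odot>\<^bsub>U\<^esub> (u (F j) \<otimes>\<^bsub>U\<^esub> P g)" for g j
      using skew[of "u (F j)" "- 1" j g, OF uc] KF by simp
  qed
qed

abbreviation root_generator :: "nat \<Rightarrow> 'n \<Rightarrow> 'n generator" where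
  "root_generator k i \<equiv> (if k = 0 then E i else F i)"

text \<open>
  Sending an arrow to the element \<open>K^(x + e\<^sub>j) E\<^sub>j\<close> or \<open>K^(x +
  e\<^sub>j) F\<^sub>j\<close> that it represents is compatible with the two actions, by the
  choice of the weights. The image contains all generators of \<open>U\<close>.
\<close>

lemma projection_exists:
  obtains \<phi> where "algebra_map Q.T U \<phi>" "carrier U = \<phi> ` carrier Q.T"
    "\<And>i. \<phi> (Q.\<gamma> (unit_vector i)) = u (K i)" "\<And>i. \<phi> (Q.\<gamma> (- unit_vector i)) = u (Kinv i)"
    "\<And>i k. k < 2 \<Longrightarrow> \<phi> (Q.\<xi> (base_arc i k)) = u (root_generator k i)"
proof -
  obtain P where P: "\<And>g. P g \<in> carrier U" "P 0 = \<one>\<^bsub>U\<^esub>" "\<And>g h. P (g + h) = P g \<otimes>\<^bsub>U\<^esub> P h"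
    "\<And>i. P (unit_vector i) = u (K i)" "\<And>i. P (- unit_vector i) = u (Kinv i)"
    and PE: "\<And>g j. P g \<otimes>\<^bsub>U\<^esub> u (E j) = (q powi pairing j g) \<odot>\<^bsub>U\<^esub> (u (E j) \<otimes>\<^bsub>U\<^esub> P g)"
    and PF: "\<And>g j. P g \<otimes>\<^bsub>U\<^esub> u (F j) = (q powi (- pairing j g)) \<odot>\<^bsub>U\<^esub> (u (F j) \<otimes>\<^bsub>U\<^esub> P g)"
    by (rule Uq_lattice) (rule that)
  note S = complex_algebra_simps[OF Uq_algebra_algebra] and uc = Uq_gen_closed
  interpret U: ring U using Uq_algebra_algebra by (rule complex_algebraD)
  define Y where "Y a = u (root_generator (snd (snd a)) (direction a))" for a :: "('n \<Rightarrow> int) \<times> ('n \<Rightarrow> int) \<times> nat"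
  define \<psi> where "\<psi> a = P (fst a + unit_vector (direction a)) \<otimes>\<^bsub>U\<^esub> Y a" for a
  have Y: "Y a \<in> carrier U" for a unfolding Y_def by (rule uc)
  have YP: "Y a \<otimes>\<^bsub>U\<^esub> P g = weight a g \<odot>\<^bsub>U\<^esub> (P g \<otimes>\<^bsub>U\<^esub> Y a)" for a g
    unfolding Y_def weight_def using PE PF q_nonzero P(1) uc by (simp add: S power_int_minus)
  obtain \<phi> where \<phi>: "algebra_map Q.T U \<phi>" "\<And>g. \<phi> (Q.\<gamma> g) = P g"
    "\<And>a. a \<in> arcs lattice_quiver \<Longrightarrow> \<phi> (Q.\<xi> a) = \<psi> a"
  proof (rule Q.semi_path_universal[OF Uq_algebra_algebra, of P \<psi>])
    show "\<psi> a \<in> carrier U" for a unfolding \<psi>_def using P(1) Y by simp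
    fix g and a :: "('n \<Rightarrow> int) \<times> ('n \<Rightarrow> int) \<times> nat"
    have t: "Y (translate g a) = Y a" "fst (translate g a) = g + fst a"
      by (simp_all add: Y_def) (simp_all add: translate_def split: prod.split)
    have tr: "\<psi> (translate g a) = P g \<otimes>\<^bsub>U\<^esub> \<psi> a"
      unfolding \<psi>_def t direction_translate using P(1) Y by (simp add: P(3) U.m_assoc)
    then show "\<psi> (translate g a) = P g \<otimes>\<^bsub>U\<^esub> \<psi> a" .
    have "\<psi> a \<otimes>\<^bsub>U\<^esub> P g = weight a g \<odot>\<^bsub>U\<^esub> (P (fst a + unit_vector (direction a)) \<otimes>\<^bsub>U\<^esub> P g \<otimes>\<^bsub>U\<^esub> Y a)"
      unfolding \<psi>_def using P(1) Y YP by (simp add: U.m_assoc S)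
    also have "P (fst a + unit_vector (direction a)) \<otimes>\<^bsub>U\<^esub> P g \<otimes>\<^bsub>U\<^esub> Y a = \<psi> (translate g a)"
      unfolding \<psi>_def t direction_translate P(3)[symmetric] by (simp add: algebra_simps)
    finally show "weight a g \<odot>\<^bsub>U\<^esub> \<psi> (translate g a) = \<psi> a \<otimes>\<^bsub>U\<^esub> P g" by simp
  qed (use P in auto)
  have v: "\<phi> (Q.\<gamma> (unit_vector i)) = u (K i)" "\<phi> (Q.\<gamma> (- unit_vector i)) = u (Kinv i)" for i
    by (simp_all add: \<phi> P)
  have vx: "\<phi> (Q.\<xi> (base_arc i k)) = u (root_generator k i)" if "k < 2" for i k
  proof -
    have "\<psi> (base_arc i k) = P (- unit_vector i + unit_vector i) \<otimes>\<^bsub>U\<^esub> u (root_generator k i)"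
      unfolding \<psi>_def Y_def direction_base_arc by (simp add: base_arc_def)
    then show ?thesis using \<phi>(3)[OF base_arc_in[OF that]] uc by (simp add: P(2))
  qed
  note V = complex_algebraD(2)[OF Uq_algebra_algebra] and f = algebra_map_simps[OF \<phi>(1)]
  note T = complex_algebra_simps[OF Q.T_algebra]
  have sub: "submodule (\<phi> ` carrier Q.T) CC U"
  proof (rule subspaceI[OF V])
    show "\<phi> ` carrier Q.T \<subseteq> carrier U" using f(1) by blast
    show "\<zero>\<^bsub>U\<^esub> \<in> \<phi> ` carrier Q.T" using T(7) algebra_map_simps[OF \<phi>(1)] by (metis imageI linear_map_zero[OF Q.T_space V algebra_mapD(1)[OF \<phi>(1)]])
    show "x \<oplus>\<^bsub>U\<^esub> y \<in> \<phi> ` carrier Q.T" if "x \<in> \<phi> ` carrier Q.T" "y \<in> \<phi> ` carrier Q.T" for x y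
      using that by (elim imageE) (simp only: linear_mapD(2)[OF algebra_mapD(1)[OF \<phi>(1)], symmetric] T(2) imageI)
    show "c \<odot>\<^bsub>U\<^esub> x \<in> \<phi> ` carrier Q.T" if "x \<in> \<phi> ` carrier Q.T" for c x
      using that by (elim imageE) (simp only: linear_mapD(3)[OF algebra_mapD(1)[OF \<phi>(1)], symmetric] T(3) imageI)
  qed
  have mult: "x \<otimes>\<^bsub>U\<^esub> y \<in> \<phi> ` carrier Q.T" if "x \<in> \<phi> ` carrier Q.T" "y \<in> \<phi> ` carrier Q.T" for x y
    using that by (elim imageE) (simp only: algebra_mapD(2)[OF \<phi>(1), symmetric] T(1) imageI)
  have one: "\<one>\<^bsub>U\<^esub> \<in> \<phi> ` carrier Q.T" unfolding algebra_mapD(3)[OF \<phi>(1), symmetric] using T(6) by (rule imageI)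
  have gen: "u g \<in> \<phi> ` carrier Q.T" for g
  proof (cases g)
    case K: (K i) show ?thesis unfolding K v(1)[of i, symmetric] by (intro imageI Q.\<gamma>_closed)
  next
    case K: (Kinv i) show ?thesis unfolding K v(2)[of i, symmetric] by (intro imageI Q.\<gamma>_closed)
  next
    case K: (E i)
    have "u (E i) = \<phi> (Q.\<xi> (base_arc i 0))" using vx[of 0 i] by simp
    then show ?thesis unfolding K using Q.\<xi>_closed[OF base_arc_in[of 0 i]] by simp
  next
    case K: (F i)
    have "u (F i) = \<phi> (Q.\<xi> (base_arc i 1))" using vx[of 1 i] by simp
    then show ?thesis unfolding K using Q.\<xi>_closed[OF base_arc_in[of 1 i]] by simp
  qed
  have "carrier U \<subseteq> \<phi> ` carrier Q.T"
  proof
    fix x assume x: "x \<in> carrier U"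
    show "x \<in> \<phi> ` carrier Q.T"
      by (rule algebra_generatorsD[OF Uq_generators sub one mult _ x]) (use gen in auto)
  qed
  then have "carrier U = \<phi> ` carrier Q.T" using f(1) by blast
  then show thesis by (rule that[OF \<phi>(1) _ v vx])
qed

text \<open>
  The projection commutes with comultiplication, counit and antipode because both composites are
  homomorphisms, into the opposite algebra for the antipode, that agree on the generators from
  \<open>lattice_generators\<close>. The scalars in the antipodes of \<open>E\<^sub>i\<close> and
  \<open>F\<^sub>i\<close> are the weights of the base arcs at the \<open>i\<close>-th unit vector
  up to sign, that is \<open>q^(-2 d\<^sub>i)\<close> and \<open>q^(2 d\<^sub>i)\<close>, since
  \<open>a\<^sub>i\<^sub>i = 2\<close>.
\<close>

theorem Uq_quotient_of_semi_path_hopf_algebra: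
  "\<exists>kQs I f. semi_path_hopf_algebra additive_group lattice_quiver Q.l Q.r kQs \<and> hopf_ideal I kQs \<and>
     hopf_isomorphism (Uq q A d) (hopf_quotient kQs I) f"
proof -
  obtain D e s where kQs: "semi_path_hopf_algebra additive_group lattice_quiver Q.l Q.r (module.extend Q.T (hopf.fields D e s))"
    and H: "hopf_algebra (module.extend Q.T (hopf.fields D e s))"
    and D: "algebra_map Q.T (tensor Q.T Q.T) D" and e: "algebra_map Q.T complex_space e"
    and s: "algebra_map Q.T (opposite_algebra Q.T) s"
    and D\<gamma>: "\<And>g. D (Q.\<gamma> g) = pure_tensor Q.T Q.T (Q.\<gamma> g) (Q.\<gamma> g)"
    and D\<xi>: "\<And>a. a \<in> arcs lattice_quiver \<Longrightarrow> D (Q.\<xi> a) = pure_tensor Q.T Q.T (Q.\<gamma> (head lattice_quiver a)) (Q.\<xi> a)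
        \<oplus>\<^bsub>tensor Q.T Q.T\<^esub> pure_tensor Q.T Q.T (Q.\<xi> a) (Q.\<gamma> (tail lattice_quiver a))"
    and e\<gamma>: "\<And>g. e (Q.\<gamma> g) = 1" and e\<xi>: "\<And>a. a \<in> arcs lattice_quiver \<Longrightarrow> e (Q.\<xi> a) = 0"
    and s\<gamma>: "\<And>g. s (Q.\<gamma> g) = Q.\<gamma> (- g)"
    and s\<xi>: "\<And>a. a \<in> arcs lattice_quiver \<Longrightarrow> s (Q.\<xi> a) = (- weight a (- tail lattice_quiver a)) \<odot>\<^bsub>Q.T\<^esub>
        Q.\<xi> (translate (- head lattice_quiver a - tail lattice_quiver a) a)"
    by (rule Q.semi_path_hopf_algebra_exists) (rule that)
  let ?H = "module.extend Q.T (hopf.fields D e s)"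
  obtain \<phi> where \<phi>: "algebra_map Q.T U \<phi>" and surj: "carrier U = \<phi> ` carrier Q.T"
    and v: "\<And>i. \<phi> (Q.\<gamma> (unit_vector i)) = u (K i)" "\<And>i. \<phi> (Q.\<gamma> (- unit_vector i)) = u (Kinv i)"
    and vx: "\<And>i k. k < 2 \<Longrightarrow> \<phi> (Q.\<xi> (base_arc i k)) = u (root_generator k i)"
    by (rule projection_exists) (rule that)
  note T = Q.T_algebra and A = Uq_algebra_algebra and V = Q.T_space and W = complex_algebraD(2)[OF Uq_algebra_algebra]
  note TT = tensor_algebra_structure[OF T T] and AA = tensor_algebra_structure[OF A A]
  note uc = Uq_gen_closed and l = algebra_mapD(1)[OF \<phi>] and ft = linear_mapD[OF algebra_mapD(1)[OF \<phi>]]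
  let ?D = "\<lambda>C. free_algebra_lift (tensor U U) (Uq_gen_comult q A d) (SOME p. p \<in> C)"
  let ?e = "\<lambda>C. free_algebra_lift complex_space Uq_gen_counit (SOME p. p \<in> C)"
  let ?s = "\<lambda>C. free_algebra_antilift U (Uq_gen_antipode q A d) (SOME p. p \<in> C)"
  have Uq: "Uq q A d = module.extend U (hopf.fields ?D ?e ?s)" by (simp only: Uq_def Let_def)

  have cf: "Uq_gen_comult q A d g \<in> carrier (tensor U U)" for g
    using uc complex_algebra_simps[OF AA] pure_tensor_simps[OF W W] by (simp add: Uq_gen_comult_def Let_def split: generator.split)
  have crel: "Uq_relations_hold q A d (tensor U U) (Uq_gen_comult q A d)"
    using Uq_relations_hold_comult[of U u, OF A uc Uq_gen_relations]
    by (simp only: Uq_gen_comult_def[abs_def] Let_def)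
  note c = Uq_algebra_lift[of "tensor U U" "Uq_gen_comult q A d", OF AA cf crel]
  have ccf: "Uq_gen_counit g \<in> carrier complex_space" for g by simp
  note cc = Uq_algebra_lift[of complex_space Uq_gen_counit, OF complex_space_algebra ccf Uq_relations_hold_counit]
  have saf: "Uq_gen_antipode q A d g \<in> carrier (opposite_algebra U)" for g
    using uc complex_algebra_simps[OF A] by (simp add: Uq_gen_antipode_def Let_def split: generator.split)
  have arel: "Uq_relations_hold q A d (opposite_algebra U) (Uq_gen_antipode q A d)"
    using Uq_relations_hold_antipode[of U u, OF A uc Uq_gen_relations]
    by (simp only: Uq_gen_antipode_def[abs_def] Let_def)
  have anti: "free_algebra_antilift U f = free_algebra_lift (opposite_algebra U) f" for f :: "'n generator \<Rightarrow> _"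
    by (simp add: free_algebra_antilift_def free_algebra_lift_def linear_extension_def[abs_def] finsum_def opposite_algebra_def)
  note sa = Uq_algebra_lift[of "opposite_algebra U" "Uq_gen_antipode q A d", OF opposite_algebra[OF A] saf arel, folded anti]

  have gens: thesis if "x \<in> {Q.\<gamma> (unit_vector i) | i. True} \<union> {Q.\<gamma> (- unit_vector i) | i. True} \<union> {Q.\<xi> (base_arc i k) | i k. k < 2}"
    "\<And>i. x = Q.\<gamma> (unit_vector i) \<Longrightarrow> thesis" "\<And>i. x = Q.\<gamma> (- unit_vector i) \<Longrightarrow> thesis"
    "\<And>i. x = Q.\<xi> (base_arc i 0) \<Longrightarrow> thesis" "\<And>i. x = Q.\<xi> (base_arc i 1) \<Longrightarrow> thesis" for x thesis
    using that by (auto dest!: less_2_cases)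
  have arc: "base_arc i 0 \<in> arcs lattice_quiver" "base_arc i 1 \<in> arcs lattice_quiver" for i
    by (rule base_arc_in, simp)+
  have vE: "\<phi> (Q.\<xi> (base_arc i 0)) = u (E i)" and vF: "\<phi> (Q.\<xi> (base_arc i 1)) = u (F i)" for i using vx[of 0] vx[of 1] by simp_all
  note cl = Q.\<gamma>_closed Q.\<xi>_closed[OF arc(1)] Q.\<xi>_closed[OF arc(2)]

  have comult: "?D (\<phi> x) = tensor_map U U \<phi> \<phi> (D x)" if x: "x \<in> carrier Q.T" for x
  proof (rule algebra_map_eq_on_generators[OF T AA lattice_generators algebra_map_comp[OF \<phi> c(1)]
        algebra_map_comp[OF D tensor_map_algebra_map[OF T T A A \<phi> \<phi>]] _ x])
    note tl = linear_mapD[OF tensor_map_linear[OF V V W W l l]] and tp = tensor_map_pure[OF V V W W l l]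
    note P = pure_tensor_simps[OF V V] and PU = pure_tensor_simps[OF W W]
    interpret UU: ring "tensor U U" using AA by (rule complex_algebraD)
    have b: "fst (base_arc i k) = - unit_vector i" "fst (snd (base_arc i k)) = unit_vector i" for i k by (simp_all add: base_arc_def)
    fix x assume "x \<in> {Q.\<gamma> (unit_vector i) | i. True} \<union> {Q.\<gamma> (- unit_vector i) | i. True} \<union> {Q.\<xi> (base_arc i k) | i k. k < 2}"
    then show "?D (\<phi> x) = tensor_map U U \<phi> \<phi> (D x)"
    proof (rule gens)
      fix i
      show ?thesis if "x = Q.\<gamma> (unit_vector i)"
        unfolding that v c(2) D\<gamma> tp[OF cl(1) cl(1)] by (simp only: Uq_gen_comult_def Let_def generator.case)
      show ?thesis if "x = Q.\<gamma> (- unit_vector i)"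
        unfolding that v c(2) D\<gamma> tp[OF cl(1) cl(1)] by (simp only: Uq_gen_comult_def Let_def generator.case)
      show ?thesis if "x = Q.\<xi> (base_arc i 0)"
        unfolding that vE c(2) D\<xi>[OF arc(1)] lattice_quiver_simps b
        by (simp only: tl(2) tp cl P(1) v vE Uq_gen_comult_def Let_def generator.case UU.a_comm PU(1) uc)
      show ?thesis if "x = Q.\<xi> (base_arc i 1)"
        unfolding that vF c(2) D\<xi>[OF arc(2)] lattice_quiver_simps b
        by (simp only: tl(2) tp cl P(1) v vF Uq_gen_comult_def Let_def generator.case UU.a_comm PU(1) uc)
    qed
  qed
  have counit: "?e (\<phi> x) = e x" if x: "x \<in> carrier Q.T" for x
  proof (rule algebra_map_eq_on_generators[OF T complex_space_algebra lattice_generators algebra_map_comp[OF \<phi> cc(1)] e _ x])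
    fix x assume "x \<in> {Q.\<gamma> (unit_vector i) | i. True} \<union> {Q.\<gamma> (- unit_vector i) | i. True} \<union> {Q.\<xi> (base_arc i k) | i k. k < 2}"
    then show "?e (\<phi> x) = e x"
      by (rule gens) (simp_all only: v vE vF cc(2) e\<gamma> e\<xi> arc Uq_gen_counit_def generator.case)
  qed
  have antipode: "?s (\<phi> x) = \<phi> (s x)" if x: "x \<in> carrier Q.T" for x
  proof (rule algebra_map_eq_on_generators[OF T opposite_algebra[OF A] lattice_generators algebra_map_comp[OF \<phi> sa(1)] _ _ x])
    have "algebra_map (opposite_algebra Q.T) (opposite_algebra U) \<phi>"
      using \<phi> by (simp add: algebra_map_def linear_map_def ring_hom_def)
    then show "algebra_map Q.T (opposite_algebra U) (\<lambda>x. \<phi> (s x))" by (rule algebra_map_comp[OF s])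
    have t: "translate (- head lattice_quiver (base_arc i k) - tail lattice_quiver (base_arc i k)) (base_arc i k) = base_arc i k" for i k
      by (simp add: base_arc_def translate_def)
    have w: "weight (base_arc i 0) (- tail lattice_quiver (base_arc i 0)) = q powi (- (2 * int (d i)))"
      "weight (base_arc i 1) (- tail lattice_quiver (base_arc i 1)) = q powi (2 * int (d i))" for i
      unfolding weight_def direction_base_arc by (simp_all add: base_arc_def pairing_simps diagonal mult.commute)
    fix x assume "x \<in> {Q.\<gamma> (unit_vector i) | i. True} \<union> {Q.\<gamma> (- unit_vector i) | i. True} \<union> {Q.\<xi> (base_arc i k) | i k. k < 2}"
    then show "?s (\<phi> x) = \<phi> (s x)"
      by (rule gens) (simp_all only: v vE vF sa(2) s\<gamma> s\<xi> arc t w ft(3) cl Uq_gen_antipode_def Let_def generator.case minus_minus)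
  qed

  have U': "complex_algebra (Uq q A d)" unfolding Uq by (rule complex_algebra_extend[OF A])
  have \<phi>': "algebra_map ?H (Uq q A d) \<phi>" unfolding Uq using \<phi> by simp
  have "hopf_ideal {x \<in> carrier ?H. \<phi> x = \<zero>\<^bsub>Uq q A d\<^esub>} ?H"
    and "\<exists>g. hopf_isomorphism (Uq q A d) (hopf_quotient ?H {x \<in> carrier ?H. \<phi> x = \<zero>\<^bsub>Uq q A d\<^esub>}) g"
    by (rule hopf_first_isomorphism[OF H U' \<phi>'];
        simp add: Uq surj comult counit antipode tensor_extend)+
  then show ?thesis using kQs by blast
qed

end

theorem corollary3p10:
  fixes scale :: "complex \<Rightarrow> 'l::ab_group_add \<Rightarrow> 'l"
    and bracket :: "'l \<Rightarrow> 'l \<Rightarrow> 'l"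
    and A :: "'n::finite \<Rightarrow> 'n \<Rightarrow> int"
    and d :: "'n \<Rightarrow> nat"
    and q :: complex
  assumes "complex_semisimple_lie_algebra scale bracket"
    and "complex_lie_algebra.is_cartan_matrix scale bracket A"
    and "\<forall>i. d i \<in> {1, 2, 3}"
    and "\<forall>i j. int (d i) * A i j = int (d j) * A j i"
    and "q \<noteq> 0"
    and "\<forall>m::nat. m > 0 \<longrightarrow> q ^ m \<noteq> 1"
  shows "\<exists>(G :: ('n \<Rightarrow> int) monoid) (\<rho> :: ('n \<Rightarrow> int) set \<Rightarrow> nat rel)
          (Q :: ('n \<Rightarrow> int, ('n \<Rightarrow> int) \<times> ('n \<Rightarrow> int) \<times> nat) pre_digraph) l r kQs I f.
          hopf_quiver G \<rho> Q \<and>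
          arrow_hopf_bimodule G Q l r \<and>
          semi_path_hopf_algebra G Q l r kQs \<and>
          hopf_ideal I kQs \<and>
          hopf_isomorphism (Uq q A d) (hopf_quotient kQs I) f"
proof -
  interpret L: complex_semisimple_lie_algebra scale bracket by (rule assms(1))
  obtain \<alpha> :: "'n \<Rightarrow> 'l \<Rightarrow> complex" and t :: "'n \<Rightarrow> 'l" and H
    where "\<forall>i. L.is_coroot H (\<alpha> i) (t i)" "\<forall>i j. of_int (A i j) = \<alpha> j (t i)"
    using assms(2) unfolding L.is_cartan_matrix_def by blast
  \<comment> \<open>The diagonal entry is the value of a root at its coroot.\<close>
  then have "of_int (A i i) = (2 :: complex)" for i unfolding L.is_coroot_def by metis
  then have "A i i = 2" for i using of_int_eq_numeral_iff by blast
  moreover have "d i > 0" for i using assms(3)[rule_format, of i] by auto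
  ultimately interpret finite_quantum_data q A d using assms(4-6) by unfold_locales auto
  show ?thesis using hopf_quiver_lattice Q.arrow_hopf_bimodule Uq_quotient_of_semi_path_hopf_algebra by blast
qed

end
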